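(* Let $\mathcal G$ be an $S^1$-bundle gerbe $P\rightrightarrows X$ over a smooth manifold $M$ with connection $\gamma$, curving $B$, and resulting 3-curvature $\chi\in\Omega^3(M)$. Let $\mathsf F:\mathbb X(\mathcal G,\gamma)\dashrightarrow\mathbb L(C_\chi)$ and $\mathsf G:\mathbb X(\mathcal G)\dashrightarrow\mathbb A(M,\chi)$ be the invertible butterflies determined by $\gamma$ and $B$, let $\mathsf u:\mathbb X(\mathcal G,\gamma)\to\mathbb X(\mathcal G)$ be the forgetful morphism, and let $\psi:\mathbb L(C_\chi)\to\mathbb A(M,\chi)$ be the Fiorenza–Rogers–Schreiber morphism (all described in the context). Then the square formed by these morphisms 2-commutes: there is an isomorphism of butterflies between $\psi\circ\mathsf F$ and $\mathsf G\circ\mathsf u$.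
   Context: **Lie 2-algebras.** A Lie 2-algebra $V$ consists of a linear map $\partial:V_1\to V_0$ of real vector spaces, a skew bilinear bracket $V_0\times V_0\to V_0$, a bilinear bracket $V_0\times V_1\to V_1$ (with $[a,x]:=-[x,a]$), and an alternating trilinear Jacobiator $J:V_0^3\to V_1$, such that $\partial[x,a]=[x,\partial a]$, $[\partial a,b]=[a,\partial b]$, $\partial J(x,y,z)=[x,[y,z]]+[y,[z,x]]+[z,[x,y]]$, $J(x,y,\partial a)=[x,[y,a]]+[y,[a,x]]+[a,[x,y]]$, and $\sum_i(-1)^{i+1}[x_i,J(\dots\widehat{x_i}\dots)]+\sum_{i<j}(-1)^{i+j}J([x_i,x_j],\dots\widehat{x_i}\dots\widehat{x_j}\dots)=0$ for $x_1,\dots,x_4\in V_0$. It is strict if $J=0$. **Morphisms.** A morphism $f:V\to W$ is a chain map $(f_0,f_1)$ with a skew bilinear $f_2:V_0\times V_0\to W_1$ (chain homotopy) such that $\partial f_2(x,y)=f_0[x,y]-[f_0x,f_0y]$, $f_2(x,\partial a)=f_1[x,a]-[f_0x,f_1a]$, and $f_1J_V(x,y,z)-J_W(f_0x,f_0y,f_0z)=\sum_{\rm cyc}\big([f_0x,f_2(y,z)]+f_2(x,[y,z])\big)$. It is strict if $f_2=0$. **Butterflies.** A butterfly $V\dashrightarrow W$ is a vector space $E$ with a skew bilinear bracket and linear maps $\kappa:V_1\to E$, $\lambda:W_1\to E$, $\sigma:E\to V_0$, $\rho:E\to W_0$ such that $\sigma\kappa=\partial_V$, $\rho\lambda=\partial_W$,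 $\rho\kappa=0$, $\sigma\lambda=0$; the sequence $0\to W_1\xrightarrow{\lambda}E\xrightarrow{\sigma}V_0\to0$ is exact; $\sigma$ and $\rho$ preserve brackets; $[e,\lambda(w)]=\lambda[\rho(e),w]$ and $[e,\kappa(v)]=\kappa[\sigma(e),v]$; and $[e_1,[e_2,e_3]]+[e_2,[e_3,e_1]]+[e_3,[e_1,e_2]]=\lambda J_W(\rho e_1,\rho e_2,\rho e_3)+\kappa J_V(\sigma e_1,\sigma e_2,\sigma e_3)$. It is invertible if also $0\to V_1\xrightarrow{\kappa}E\xrightarrow{\rho}W_0\to0$ is exact. An isomorphism (2-morphism) of butterflies $E\Rightarrow E'$ is a bracket-preserving linear isomorphism commuting with all structure maps. The composite of $E:V\dashrightarrow W$ and $E':W\dashrightarrow U$ is $E'\circ E=(E\times_{W_0}E')/\{(\lambda_E(w),\kappa_{E'}(w)):w\in W_1\}$ (fibre product of $\rho_E$ and $\sigma_{E'}$), with componentwise bracket, $\kappa(v)=(\kappa_E(v),0)$, $\lambda(u)=(0,\lambda_{E'}(u))$, $\sigma=\sigma_E$, $\rho=\rho_{E'}$. A morphism $f:V\to W$ is regarded as the butterfly $W_1\oplus V_0$ with $\kappa(v)=(-f_1(v),\partial v)$, $\lambda(w)=(w,0)$, $\sigma(w,x)=x$, $\rho(w,x)=\partial w+f_0(x)$, and bracket $[(w,x),(w',x')]=([f_0x,w']-[f_0x',w]+[\partial w,w']-f_2(x,x'),[x,x'])$. **Bundle gerbes.** An $S^1$-bundle gerbe $\mathcal G$ over $M$ consists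 of a surjective submersion $\pi:X\to M$, a Lie groupoid $P\rightrightarrows X$ (source $s$, target $t$; product $p\cdot q$ defined when $s(p)=t(q)$; unit map $\epsilon:X\to P$), a morphism of Lie groupoids over $\mathrm{id}_X$ from $P$ to the submersion groupoid $X\times_MX\rightrightarrows X$, and a left $S^1$-action on $P$ making $P\to X\times_MX$ a principal $S^1$-bundle with $(zp)\cdot(wq)=(zw)(p\cdot q)$. The simplicial differential is $\delta\omega=s^*\omega-t^*\omega$ for $\omega\in\Omega^\bullet(X)$ and $\delta\omega=\mathrm{pr}_1^*\omega-m^*\omega+\mathrm{pr}_2^*\omega$ for $\omega\in\Omega^\bullet(P)$, $m$ the multiplication. A connection on $\mathcal G$ is a principal connection 1-form $\gamma\in\Omega^1(P)$ (real-valued) with $\delta\gamma=0$. A curving for $\gamma$ is $B\in\Omega^2(X)$ with $\delta B=d\gamma$. The 3-curvature is the $\chi\in\Omega^3(M)$ with $\pi^*\chi=dB$. **Multiplicative vector fields.** A multiplicative vector field on $P\rightrightarrows X$ is a pair $(\mathbf x,\mathbf p)\in\mathfrak X(X)\times\mathfrak X(P)$ forming a functor from $P\rightrightarrows X$ to $TP\rightrightarrows TX$; such an $\mathbf x$ projects to a vector field $x$ on $M$. Let $A_P=\ker ds|_X$ be the Lie algebroid. For $a\in\Gamma(A_P)$ put $\mathbf a=dt(a)$, $\overrightarrow a(p)=dR_p(a(t(p)))$, $\overleftarrow a(p)=d(L_p\circ i)(a(s(p)))$ ($i$ = inversion), $\bar{\mathbf a}=\overrightarrow a+\overleftarrow a$,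 and $\mathsf v_a=\epsilon^*(\iota_{\overrightarrow a}\gamma)$. $\mathbb X(\mathcal G)$ is the strict Lie 2-algebra with degree-1 part $\Gamma(A_P)$, degree-0 part $\mathbb X(\mathcal G)_0$ the multiplicative vector fields, differential $a\mapsto(\mathbf a,\bar{\mathbf a})$, componentwise Lie bracket in degree 0, and $[(\mathbf x,\mathbf p),a]=[\mathbf p,\overrightarrow a]|_X$. $\mathbb X(\mathcal G,\gamma)$ is the strict Lie 2-algebra with degree-1 part $\Gamma(A_P)$, degree-0 part $\mathbb X(\mathcal G,\gamma)_0=\{(\mathbf x,\mathbf p,\alpha): (\mathbf x,\mathbf p)\text{ multiplicative},\ \alpha\in\Omega^1(X),\ L_{\mathbf p}\gamma=\delta\alpha\}$, differential $\mathsf d a=(\mathbf a,\bar{\mathbf a},\iota_{\mathbf a}B-d\mathsf v_a)$, brackets $[(\mathbf x,\mathbf p,\alpha),(\mathbf z,\mathbf r,\beta)]=([\mathbf x,\mathbf z],[\mathbf p,\mathbf r],L_{\mathbf x}\beta-L_{\mathbf z}\alpha)$ and $[(\mathbf x,\mathbf p,\alpha),a]=[\mathbf p,\overrightarrow a]|_X$. The forgetful morphism $\mathsf u$ is strict: $(\mathbf x,\mathbf p,\alpha)\mapsto(\mathbf x,\mathbf p)$ in degree 0, identity in degree 1. **Lie 2-algebras attached to $\chi$.** $\mathbb L(C_\chi)$: complex $C^\infty(M)\to\Gamma(TM\oplus T^*M)$, $\mathsf d f=(0,df)$, brackets $[(u,\alpha),(v,\beta)]=([u,v],L_u\beta-L_v\alpha-\frac12d(\iota_u\beta-\iota_v\alpha)-\iota_v\iota_u\chi)$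 and $[(u,\alpha),f]=\frac12\iota_udf$, Jacobiator $-\frac16(\langle[e_1,e_2],e_3\rangle^++\text{cyc.})$ with $\langle(u,\alpha),(v,\beta)\rangle^+=\iota_u\beta+\iota_v\alpha$. $\mathbb A(M,\chi)$: complex $C^\infty(M)\to\mathfrak X(M)$ with zero differential, Lie bracket of vector fields in degree 0, $[x,f]=L_xf$, Jacobiator $-\iota_{x_3}\iota_{x_2}\iota_{x_1}\chi$. **The morphism $\psi$**: $\psi_0(u,\alpha)=u$, $\psi_1=\mathrm{id}$, $\psi_2((u,\alpha),(v,\beta))=-\frac12(\iota_u\beta-\iota_v\alpha)$. **The butterfly $\mathsf F$**: $F=\{(\mathbf x,\mathbf p,\alpha;g)\in\mathbb X(\mathcal G,\gamma)_0\times C^\infty(X):\delta g=\iota_{\mathbf p}\gamma\}$, with bracket of $(\mathbf x,\mathbf p,\alpha;g)$ and $(\mathbf z,\mathbf r,\beta;h)$ having first part that of $\mathbb X(\mathcal G,\gamma)_0$ and function part $\frac12(\iota_{\mathbf x}(\beta+dh)-\iota_{\mathbf z}(\alpha+dg))$; $\sigma$ is the projection to $\mathbb X(\mathcal G,\gamma)_0$; $\rho(\mathbf x,\mathbf p,\alpha;g)=(x,-\varepsilon)$ with $\pi^*\varepsilon=\alpha-\iota_{\mathbf x}B-dg$; $\lambda(f)=(0,0,0;\pi^*f)$; $\kappa(a)=(\mathsf d a;-\mathsf v_a)$. **The butterfly $\mathsf G$**: $G=\{(\mathbf x,\mathbf p,g)\in\mathbb X(\mathcal G)_0\times C^\infty(X):\delta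 g=\iota_{\mathbf p}\gamma\}$, bracket $[(\mathbf x,\mathbf p,g),(\mathbf z,\mathbf r,h)]=([\mathbf x,\mathbf z],[\mathbf p,\mathbf r],L_{\mathbf x}h-L_{\mathbf z}g-\iota_{\mathbf z}\iota_{\mathbf x}B)$; $\sigma(\mathbf x,\mathbf p,g)=(\mathbf x,\mathbf p)$; $\rho(\mathbf x,\mathbf p,g)=x$; $\lambda(f)=(0,0,\pi^*f)$; $\kappa(a)=(\mathbf a,\bar{\mathbf a},-\mathsf v_a)$. *)

theory Defs
  imports "HOL-Analysis.Analysis" "HOL-Library.Function_Algebras"
begin

section \<open>Pointwise real vector space structure on functions\<close>

instantiation "fun" :: (type, scaleR) scaleR
begin
definition scaleR_fun_def: "r *\<^sub>R f = (\<lambda>x. r *\<^sub>R f x)"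
instance ..
end

lemma scaleR_fun_apply [simp]: "(r *\<^sub>R f) x = r *\<^sub>R f x"
  by (simp add: scaleR_fun_def)

instance "fun" :: (type, real_vector) real_vector
  by standard (simp_all add: fun_eq_iff scaleR_add_right scaleR_add_left)


section \<open>Smooth manifolds\<close>

text \<open>
  Coordinates live in the library's \<open>Euclidean_space n\<close>, i.e. functions \<open>nat \<Rightarrow> real\<close>
  vanishing at all indices \<open>\<ge> n\<close>.  This keeps the dimension an ordinary natural number
  (including 0), which is needed to speak about fibre products.
\<close>

definition partial :: "nat \<Rightarrow> ((nat \<Rightarrow> real) \<Rightarrow> real) \<Rightarrow> (nat \<Rightarrow> real) \<Rightarrow> real" where
  "partial i f x = deriv (\<lambda>t. f (x(i := t))) (x i)"

fun Ck_on :: "nat \<Rightarrow> nat \<Rightarrow> (nat \<Rightarrow> real) set \<Rightarrow> ((nat \<Rightarrow> real) \<Rightarrow> real) \<Rightarrow> bool" where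
  "Ck_on n 0 W f \<longleftrightarrow> continuous_map (subtopology (Euclidean_space n) W) euclideanreal f"
| "Ck_on n (Suc k) W f \<longleftrightarrow>
     continuous_map (subtopology (Euclidean_space n) W) euclideanreal f \<and>
     (\<forall>i<n. (\<forall>x\<in>W. (\<lambda>t. f (x(i := t))) differentiable (at (x i))) \<and> Ck_on n k W (partial i f))"

text \<open>Only meant for \<open>W\<close> open in \<open>Euclidean_space n\<close>.\<close>
definition smooth_on :: "nat \<Rightarrow> (nat \<Rightarrow> real) set \<Rightarrow> ((nat \<Rightarrow> real) \<Rightarrow> real) \<Rightarrow> bool" where
  "smooth_on n W f \<longleftrightarrow> (\<forall>k. Ck_on n k W f)"

type_synonym 'a chart = "'a set \<times> ('a \<Rightarrow> nat \<Rightarrow> real)"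

record 'a mfd =
  mtop :: "'a topology"
  mdim :: nat
  atlas :: "'a chart set"

abbreviation pts :: "'a mfd \<Rightarrow> 'a set" where
  "pts M \<equiv> topspace (mtop M)"

definition is_chart :: "nat \<Rightarrow> 'a topology \<Rightarrow> 'a chart \<Rightarrow> bool" where
  "is_chart n T = (\<lambda>(U, \<phi>). openin T U \<and> openin (Euclidean_space n) (\<phi> ` U) \<and>
     homeomorphic_map (subtopology T U) (subtopology (Euclidean_space n) (\<phi> ` U)) \<phi>)"

definition transition_smooth :: "nat \<Rightarrow> 'a chart \<Rightarrow> 'a chart \<Rightarrow> bool" where
  "transition_smooth n = (\<lambda>(U, \<phi>) (V, \<psi>).
     \<forall>i<n. smooth_on n (\<phi> ` (U \<inter> V)) (\<lambda>x. \<psi> (inv_into U \<phi> x) i))"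

definition smooth_manifold :: "'a mfd \<Rightarrow> bool" where
  "smooth_manifold M \<longleftrightarrow>
     Hausdorff_space (mtop M) \<and> second_countable (mtop M) \<and>
     (\<forall>c\<in>atlas M. is_chart (mdim M) (mtop M) c) \<and>
     (\<Union>c\<in>atlas M. fst c) = pts M \<and>
     (\<forall>c\<in>atlas M. \<forall>d\<in>atlas M. transition_smooth (mdim M) c d)"

definition max_atlas :: "'a mfd \<Rightarrow> 'a chart set" where
  "max_atlas M = {c. is_chart (mdim M) (mtop M) c \<and>
     (\<forall>d\<in>atlas M. transition_smooth (mdim M) c d \<and> transition_smooth (mdim M) d c)}"

definition smooth_map :: "'a mfd \<Rightarrow> 'b mfd \<Rightarrow> ('a \<Rightarrow> 'b) \<Rightarrow> bool" where
  "smooth_map M N F \<longleftrightarrow> continuous_map (mtop M) (mtop N) F \<and>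
     (\<forall>(U, \<phi>)\<in>atlas M. \<forall>(V, \<psi>)\<in>atlas N. \<forall>i<mdim N.
        smooth_on (mdim M) (\<phi> ` {p \<in> U. F p \<in> V}) (\<lambda>x. \<psi> (F (inv_into U \<phi> x)) i))"

definition diffeomorphism :: "'a mfd \<Rightarrow> 'b mfd \<Rightarrow> ('a \<Rightarrow> 'b) \<Rightarrow> bool" where
  "diffeomorphism M N F \<longleftrightarrow> smooth_map M N F \<and>
     (\<exists>H. smooth_map N M H \<and> (\<forall>p\<in>pts M. H (F p) = p) \<and> (\<forall>q\<in>pts N. F (H q) = q))"

definition prod_mfd :: "'a mfd \<Rightarrow> 'b mfd \<Rightarrow> ('a \<times> 'b) mfd" where
  "prod_mfd M N =
     \<lparr>mtop = prod_topology (mtop M) (mtop N), mdim = mdim M + mdim N,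
      atlas = {(U \<times> V, \<lambda>(p, q) i. if i < mdim M then \<phi> p i else \<psi> q (i - mdim M)) | U \<phi> V \<psi>.
                 (U, \<phi>) \<in> atlas M \<and> (V, \<psi>) \<in> atlas N}\<rparr>"

text \<open>
  The structure induced on an embedded submanifold \<open>S\<close> of dimension \<open>k\<close>: restrictions of all slice
  charts, i.e. charts straightening \<open>S\<close> to the coordinate subspace \<open>Euclidean_space k\<close>.
  With \<open>k = mdim M\<close> and \<open>S\<close> open this is the open submanifold.
\<close>
definition submfd :: "'a mfd \<Rightarrow> nat \<Rightarrow> 'a set \<Rightarrow> 'a mfd" where
  "submfd M k S =
     \<lparr>mtop = subtopology (mtop M) S, mdim = k,
      atlas = {(U \<inter> S, \<phi>) | U \<phi>. (U, \<phi>) \<in> max_atlas M \<and>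
                 \<phi> ` (U \<inter> S) = \<phi> ` U \<inter> {x. \<forall>i\<ge>k. x i = 0}}\<rparr>"

definition complex_mfd :: "complex mfd" where
  "complex_mfd = \<lparr>mtop = euclidean, mdim = 2,
     atlas = {(UNIV, \<lambda>z i. if i = 0 then Re z else if i = 1 then Im z else 0)}\<rparr>"

definition circle :: "complex mfd" where
  "circle = submfd complex_mfd 1 (sphere 0 1)"


section \<open>Tangent vectors, vector fields and differential forms\<close>

text \<open>
  Functions, vector fields, forms etc. are total functions that are zero outside their domain of
  definition, so that equality is ordinary equality and the linear structure is pointwise.
\<close>

definition Cinf :: "'a mfd \<Rightarrow> ('a \<Rightarrow> real) set" where
  "Cinf M = {f. (\<forall>p. p \<notin> pts M \<longrightarrow> f p = 0) \<and>
     (\<forall>(U, \<phi>)\<in>atlas M. smooth_on (mdim M) (\<phi> ` U) (\<lambda>x. f (inv_into U \<phi> x)))}"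

text \<open>Pullback of functions.\<close>
definition pull0 :: "'a mfd \<Rightarrow> ('a \<Rightarrow> 'b) \<Rightarrow> ('b \<Rightarrow> real) \<Rightarrow> 'a \<Rightarrow> real" where
  "pull0 M F h = (\<lambda>p. if p \<in> pts M then h (F p) else 0)"

type_synonym 'a tvec = "('a \<Rightarrow> real) \<Rightarrow> real"
type_synonym 'a vfield = "'a \<Rightarrow> 'a tvec"
type_synonym 'a form1 = "'a \<Rightarrow> 'a tvec \<Rightarrow> real"
type_synonym 'a form2 = "'a \<Rightarrow> 'a tvec \<Rightarrow> 'a tvec \<Rightarrow> real"
type_synonym 'a form3 = "'a \<Rightarrow> 'a tvec \<Rightarrow> 'a tvec \<Rightarrow> 'a tvec \<Rightarrow> real"

text \<open>Tangent vectors at \<open>p\<close> are the derivations of the algebra of smooth functions at \<open>p\<close>.\<close>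
definition tangent :: "'a mfd \<Rightarrow> 'a \<Rightarrow> 'a tvec set" where
  "tangent M p = {v. (\<forall>f. f \<notin> Cinf M \<longrightarrow> v f = 0) \<and>
     (\<forall>f\<in>Cinf M. \<forall>g\<in>Cinf M. v (f + g) = v f + v g) \<and>
     (\<forall>f\<in>Cinf M. \<forall>c. v (c *\<^sub>R f) = c * v f) \<and>
     (\<forall>f\<in>Cinf M. \<forall>g\<in>Cinf M. v (f * g) = v f * g p + f p * v g)}"

text \<open>The differential of a smooth map \<open>F : M \<rightarrow> N\<close>, applied to a tangent vector of \<open>M\<close>.\<close>
definition push :: "'a mfd \<Rightarrow> 'b mfd \<Rightarrow> ('a \<Rightarrow> 'b) \<Rightarrow> 'a tvec \<Rightarrow> 'b tvec" where
  "push M N F v = (\<lambda>h. if h \<in> Cinf N then v (pull0 M F h) else 0)"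

definition vfields :: "'a mfd \<Rightarrow> 'a vfield set" where
  "vfields M = {X. (\<forall>p\<in>pts M. X p \<in> tangent M p) \<and> (\<forall>p. p \<notin> pts M \<longrightarrow> X p = 0) \<and>
     (\<forall>f\<in>Cinf M. (\<lambda>p. X p f) \<in> Cinf M)}"

definition lie_vf :: "'a vfield \<Rightarrow> 'a vfield \<Rightarrow> 'a vfield" where
  "lie_vf X Y = (\<lambda>p f. X p (\<lambda>q. Y q f) - Y p (\<lambda>q. X q f))"

definition vf_fun :: "'a vfield \<Rightarrow> ('a \<Rightarrow> real) \<Rightarrow> 'a \<Rightarrow> real" where
  "vf_fun X f = (\<lambda>p. X p f)"

text \<open>Interior product, for forms of any positive degree.\<close>
definition contract :: "'a vfield \<Rightarrow> ('a \<Rightarrow> 'a tvec \<Rightarrow> 'r) \<Rightarrow> 'a \<Rightarrow> 'r" where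
  "contract X \<omega> = (\<lambda>p. \<omega> p (X p))"

definition lin_at :: "'a mfd \<Rightarrow> 'a \<Rightarrow> ('a tvec \<Rightarrow> real) \<Rightarrow> bool" where
  "lin_at M p l \<longleftrightarrow> (\<forall>v\<in>tangent M p. \<forall>w\<in>tangent M p. l (v + w) = l v + l w) \<and>
     (\<forall>v\<in>tangent M p. \<forall>c. l (c *\<^sub>R v) = c * l v)"

definition forms1 :: "'a mfd \<Rightarrow> 'a form1 set" where
  "forms1 M = {\<omega>.
     (\<forall>p v. p \<notin> pts M \<or> v \<notin> tangent M p \<longrightarrow> \<omega> p v = 0) \<and>
     (\<forall>p\<in>pts M. lin_at M p (\<omega> p)) \<and>
     (\<forall>X\<in>vfields M. (\<lambda>p. \<omega> p (X p)) \<in> Cinf M)}"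

definition forms2 :: "'a mfd \<Rightarrow> 'a form2 set" where
  "forms2 M = {\<omega>.
     (\<forall>p v w. p \<notin> pts M \<or> v \<notin> tangent M p \<or> w \<notin> tangent M p \<longrightarrow> \<omega> p v w = 0) \<and>
     (\<forall>p\<in>pts M. \<forall>v\<in>tangent M p. lin_at M p (\<omega> p v)) \<and>
     (\<forall>p v w. \<omega> p v w = - \<omega> p w v) \<and>
     (\<forall>X\<in>vfields M. \<forall>Y\<in>vfields M. (\<lambda>p. \<omega> p (X p) (Y p)) \<in> Cinf M)}"

definition forms3 :: "'a mfd \<Rightarrow> 'a form3 set" where
  "forms3 M = {\<omega>.
     (\<forall>p u v w. p \<notin> pts M \<or> u \<notin> tangent M p \<or> v \<notin> tangent M p \<or> w \<notin> tangent M p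
        \<longrightarrow> \<omega> p u v w = 0) \<and>
     (\<forall>p\<in>pts M. \<forall>u\<in>tangent M p. \<forall>v\<in>tangent M p. lin_at M p (\<omega> p u v)) \<and>
     (\<forall>p u v w. \<omega> p u v w = - \<omega> p v u w \<and> \<omega> p u v w = - \<omega> p u w v) \<and>
     (\<forall>X\<in>vfields M. \<forall>Y\<in>vfields M. \<forall>Z\<in>vfields M.
        (\<lambda>p. \<omega> p (X p) (Y p) (Z p)) \<in> Cinf M)}"

definition pull1 :: "'a mfd \<Rightarrow> 'b mfd \<Rightarrow> ('a \<Rightarrow> 'b) \<Rightarrow> 'b form1 \<Rightarrow> 'a form1" where
  "pull1 M N F \<omega> = (\<lambda>p v. if p \<in> pts M \<and> v \<in> tangent M p then \<omega> (F p) (push M N F v) else 0)"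

definition pull2 :: "'a mfd \<Rightarrow> 'b mfd \<Rightarrow> ('a \<Rightarrow> 'b) \<Rightarrow> 'b form2 \<Rightarrow> 'a form2" where
  "pull2 M N F \<omega> = (\<lambda>p v w. if p \<in> pts M \<and> v \<in> tangent M p \<and> w \<in> tangent M p
     then \<omega> (F p) (push M N F v) (push M N F w) else 0)"

definition pull3 :: "'a mfd \<Rightarrow> 'b mfd \<Rightarrow> ('a \<Rightarrow> 'b) \<Rightarrow> 'b form3 \<Rightarrow> 'a form3" where
  "pull3 M N F \<omega> =
     (\<lambda>p u v w. if p \<in> pts M \<and> u \<in> tangent M p \<and> v \<in> tangent M p \<and> w \<in> tangent M p
      then \<omega> (F p) (push M N F u) (push M N F v) (push M N F w) else 0)"

text \<open>
  Exterior derivatives, given by the invariant (Koszul) formula in the normalisation without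
  numerical factors, so that \<open>L\<^sub>X = d \<iota>\<^sub>X + \<iota>\<^sub>X d\<close>.
\<close>

definition d0 :: "'a mfd \<Rightarrow> ('a \<Rightarrow> real) \<Rightarrow> 'a form1" where
  "d0 M f = (\<lambda>p v. if p \<in> pts M \<and> v \<in> tangent M p then v f else 0)"

definition d1 :: "'a mfd \<Rightarrow> 'a form1 \<Rightarrow> 'a form2" where
  "d1 M \<alpha> = (THE \<eta>. \<eta> \<in> forms2 M \<and> (\<forall>X\<in>vfields M. \<forall>Y\<in>vfields M. \<forall>p\<in>pts M.
     \<eta> p (X p) (Y p) =
       X p (contract Y \<alpha>) - Y p (contract X \<alpha>) - \<alpha> p (lie_vf X Y p)))"

definition d2 :: "'a mfd \<Rightarrow> 'a form2 \<Rightarrow> 'a form3" where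
  "d2 M \<omega> = (THE \<eta>. \<eta> \<in> forms3 M \<and>
     (\<forall>X\<in>vfields M. \<forall>Y\<in>vfields M. \<forall>Z\<in>vfields M. \<forall>p\<in>pts M.
     \<eta> p (X p) (Y p) (Z p) =
       X p (contract Z (contract Y \<omega>)) - Y p (contract Z (contract X \<omega>))
       + Z p (contract Y (contract X \<omega>))
       - \<omega> p (lie_vf X Y p) (Z p) + \<omega> p (lie_vf X Z p) (Y p) - \<omega> p (lie_vf Y Z p) (X p)))"

text \<open>Lie derivative of 1-forms, by Cartan's formula.\<close>
definition lie1 :: "'a mfd \<Rightarrow> 'a vfield \<Rightarrow> 'a form1 \<Rightarrow> 'a form1" where
  "lie1 M X \<alpha> = d0 M (contract X \<alpha>) + contract X (d1 M \<alpha>)"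

definition surjective_submersion :: "'a mfd \<Rightarrow> 'b mfd \<Rightarrow> ('a \<Rightarrow> 'b) \<Rightarrow> bool" where
  "surjective_submersion M N F \<longleftrightarrow> smooth_map M N F \<and> F ` pts M = pts N \<and>
     (\<forall>p\<in>pts M. push M N F ` tangent M p = tangent N (F p))"


section \<open>Lie 2-algebras and butterflies\<close>

text \<open>
  The two spaces of a Lie 2-algebra are linear subspaces of ambient real vector spaces.
  The records below carry the data of Lie 2-algebras, morphisms and butterflies.
\<close>

record ('v0, 'v1) lie2 =
  deg0 :: "'v0 set"
  deg1 :: "'v1 set"
  bdry :: "'v1 \<Rightarrow> 'v0"
  br00 :: "'v0 \<Rightarrow> 'v0 \<Rightarrow> 'v0"
  br01 :: "'v0 \<Rightarrow> 'v1 \<Rightarrow> 'v1"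
  jac :: "'v0 \<Rightarrow> 'v0 \<Rightarrow> 'v0 \<Rightarrow> 'v1"

record ('v0, 'v1, 'w0, 'w1) lie2_mor =
  mor0 :: "'v0 \<Rightarrow> 'w0"
  mor1 :: "'v1 \<Rightarrow> 'w1"
  mor2 :: "'v0 \<Rightarrow> 'v0 \<Rightarrow> 'w1"

text \<open>
  The vector space underlying a butterfly carries explicit operations, because
  composition of butterflies produces quotient spaces, whose elements are cosets.
\<close>

record 'e rvs =
  vcar :: "'e set"
  vadd :: "'e \<Rightarrow> 'e \<Rightarrow> 'e"
  vzero :: 'e
  vscale :: "real \<Rightarrow> 'e \<Rightarrow> 'e"

definition subspace_rvs :: "'e::real_vector set \<Rightarrow> 'e rvs" where
  "subspace_rvs S = \<lparr>vcar = S, vadd = (+), vzero = 0, vscale = (*\<^sub>R)\<rparr>"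

definition linear_iso :: "'e rvs \<Rightarrow> 'f rvs \<Rightarrow> ('e \<Rightarrow> 'f) \<Rightarrow> bool" where
  "linear_iso E E' \<Phi> \<longleftrightarrow> bij_betw \<Phi> (vcar E) (vcar E') \<and>
     (\<forall>x\<in>vcar E. \<forall>y\<in>vcar E. \<Phi> (vadd E x y) = vadd E' (\<Phi> x) (\<Phi> y)) \<and>
     (\<forall>c. \<forall>x\<in>vcar E. \<Phi> (vscale E c x) = vscale E' c (\<Phi> x))"

record ('e, 'v0, 'v1, 'w0, 'w1) butterfly =
  space :: "'e rvs"
  brk :: "'e \<Rightarrow> 'e \<Rightarrow> 'e"
  kap :: "'v1 \<Rightarrow> 'e"
  lam :: "'w1 \<Rightarrow> 'e"
  sig :: "'e \<Rightarrow> 'v0"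
  rho :: "'e \<Rightarrow> 'w0"

definition butterfly_iso ::
  "('v0, 'v1) lie2 \<Rightarrow> ('w0, 'w1) lie2 \<Rightarrow> ('e, 'v0, 'v1, 'w0, 'w1) butterfly \<Rightarrow>
   ('f, 'v0, 'v1, 'w0, 'w1) butterfly \<Rightarrow> ('e \<Rightarrow> 'f) \<Rightarrow> bool" where
  "butterfly_iso V W E E' \<Phi> \<longleftrightarrow>
     linear_iso (space E) (space E') \<Phi> \<and>
     (\<forall>x\<in>vcar (space E). \<forall>y\<in>vcar (space E). \<Phi> (brk E x y) = brk E' (\<Phi> x) (\<Phi> y)) \<and>
     (\<forall>v\<in>deg1 V. \<Phi> (kap E v) = kap E' v) \<and>
     (\<forall>w\<in>deg1 W. \<Phi> (lam E w) = lam E' w) \<and>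
     (\<forall>x\<in>vcar (space E). sig E' (\<Phi> x) = sig E x) \<and>
     (\<forall>x\<in>vcar (space E). rho E' (\<Phi> x) = rho E x)"

text \<open>The butterfly \<open>W\<^sub>1 \<oplus> V\<^sub>0\<close> of a morphism \<open>V \<rightarrow> W\<close>.\<close>
definition mor_butterfly ::
  "('v0::real_vector, 'v1::real_vector) lie2 \<Rightarrow> ('w0::real_vector, 'w1::real_vector) lie2 \<Rightarrow>
   ('v0, 'v1, 'w0, 'w1) lie2_mor \<Rightarrow> ('w1 \<times> 'v0, 'v0, 'v1, 'w0, 'w1) butterfly" where
  "mor_butterfly V W f =
     \<lparr>space = subspace_rvs (deg1 W \<times> deg0 V),
      brk = (\<lambda>(w, x) (w', x').
        (br01 W (mor0 f x) w' - br01 W (mor0 f x') w + br01 W (bdry W w) w' - mor2 f x x',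
         br00 V x x')),
      kap = (\<lambda>v. (- mor1 f v, bdry V v)),
      lam = (\<lambda>w. (w, 0)),
      sig = (\<lambda>(w, x). x),
      rho = (\<lambda>(w, x). bdry W w + mor0 f x)\<rparr>"

text \<open>
  The composite \<open>E' \<circ> E\<close> of \<open>E : V \<dashrightarrow> W\<close> and \<open>E' : W \<dashrightarrow> U\<close>; elements are cosets in the fibre
  product.  Operations on cosets are unions of the cosets obtained from all representatives, and
  maps out of the quotient take the common value on all representatives.
\<close>
definition comp_coset ::
  "('w0, 'w1) lie2 \<Rightarrow> ('f, 'w0, 'w1, 'u0, 'u1) butterfly \<Rightarrow> ('e, 'v0, 'v1, 'w0, 'w1) butterfly \<Rightarrow>
   'e \<times> 'f \<Rightarrow> ('e \<times> 'f) set" where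
  "comp_coset W E' E = (\<lambda>(x, y).
     {(vadd (space E) x (lam E w), vadd (space E') y (kap E' w)) | w. w \<in> deg1 W})"

definition comp_butterfly ::
  "('w0, 'w1) lie2 \<Rightarrow> ('f, 'w0, 'w1, 'u0, 'u1) butterfly \<Rightarrow> ('e, 'v0, 'v1, 'w0, 'w1) butterfly \<Rightarrow>
   (('e \<times> 'f) set, 'v0, 'v1, 'u0, 'u1) butterfly" where
  "comp_butterfly W E' E =
     (let cos = comp_coset W E' E in
     \<lparr>space =
       \<lparr>vcar = cos ` {(x, y). x \<in> vcar (space E) \<and> y \<in> vcar (space E') \<and> rho E x = sig E' y},
        vadd = (\<lambda>C D. \<Union>(x, y)\<in>C. \<Union>(x', y')\<in>D.
                  cos (vadd (space E) x x', vadd (space E') y y')),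
        vzero = cos (vzero (space E), vzero (space E')),
        vscale = (\<lambda>c C. \<Union>(x, y)\<in>C. cos (vscale (space E) c x, vscale (space E') c y))\<rparr>,
      brk = (\<lambda>C D. \<Union>(x, y)\<in>C. \<Union>(x', y')\<in>D. cos (brk E x x', brk E' y y')),
      kap = (\<lambda>v. cos (kap E v, vzero (space E'))),
      lam = (\<lambda>u. cos (vzero (space E), lam E' u)),
      sig = (\<lambda>C. the_elem ((\<lambda>(x, y). sig E x) ` C)),
      rho = (\<lambda>C. the_elem ((\<lambda>(x, y). rho E' y) ` C))\<rparr>)"


section \<open>Bundle gerbes\<close>

record ('m, 'x, 'p) gerbe =
  gM :: "'m mfd"
  gX :: "'x mfd"
  gP :: "'p mfd"
  gproj :: "'x \<Rightarrow> 'm"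
  gs :: "'p \<Rightarrow> 'x"
  gt :: "'p \<Rightarrow> 'x"
  gmult :: "'p \<Rightarrow> 'p \<Rightarrow> 'p"
  gunit :: "'x \<Rightarrow> 'p"
  ginv :: "'p \<Rightarrow> 'p"
  gact :: "complex \<Rightarrow> 'p \<Rightarrow> 'p"

text \<open>The manifolds \<open>X \<times>\<^sub>M X\<close> and \<open>P \<times>\<^sub>X P\<close> (composable pairs \<open>(p, q)\<close>, \<open>s p = t q\<close>).\<close>

definition XX :: "('m, 'x, 'p) gerbe \<Rightarrow> ('x \<times> 'x) mfd" where
  "XX G = submfd (prod_mfd (gX G) (gX G)) (2 * mdim (gX G) - mdim (gM G))
     {(x, y). x \<in> pts (gX G) \<and> y \<in> pts (gX G) \<and> gproj G x = gproj G y}"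

definition PP :: "('m, 'x, 'p) gerbe \<Rightarrow> ('p \<times> 'p) mfd" where
  "PP G = submfd (prod_mfd (gP G) (gP G)) (2 * mdim (gP G) - mdim (gX G))
     {(p, q). p \<in> pts (gP G) \<and> q \<in> pts (gP G) \<and> gs G p = gt G q}"

abbreviation gm :: "('m, 'x, 'p) gerbe \<Rightarrow> 'p \<times> 'p \<Rightarrow> 'p" where
  "gm G \<equiv> (\<lambda>(p, q). gmult G p q)"

definition lie_groupoid :: "('m, 'x, 'p) gerbe \<Rightarrow> bool" where
  "lie_groupoid G \<longleftrightarrow>
     smooth_manifold (gX G) \<and> smooth_manifold (gP G) \<and>
     surjective_submersion (gP G) (gX G) (gs G) \<and>
     surjective_submersion (gP G) (gX G) (gt G) \<and>
     smooth_map (PP G) (gP G) (gm G) \<and>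
     smooth_map (gX G) (gP G) (gunit G) \<and>
     smooth_map (gP G) (gP G) (ginv G) \<and>
     (\<forall>(p, q)\<in>pts (PP G). gs G (gmult G p q) = gs G q \<and> gt G (gmult G p q) = gt G p) \<and>
     (\<forall>p\<in>pts (gP G). \<forall>q\<in>pts (gP G). \<forall>r\<in>pts (gP G). gs G p = gt G q \<and> gs G q = gt G r \<longrightarrow>
        gmult G (gmult G p q) r = gmult G p (gmult G q r)) \<and>
     (\<forall>x\<in>pts (gX G). gs G (gunit G x) = x \<and> gt G (gunit G x) = x) \<and>
     (\<forall>p\<in>pts (gP G). gmult G (gunit G (gt G p)) p = p \<and> gmult G p (gunit G (gs G p)) = p) \<and>
     (\<forall>p\<in>pts (gP G). gs G (ginv G p) = gt G p \<and> gt G (ginv G p) = gs G p \<and>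
        gmult G (ginv G p) p = gunit G (gs G p) \<and> gmult G p (ginv G p) = gunit G (gt G p))"

text \<open>A (smooth, locally trivial) principal circle bundle \<open>q : P \<rightarrow> N\<close> with left action \<open>A\<close>.\<close>
definition principal_circle_bundle ::
  "'p mfd \<Rightarrow> 'n mfd \<Rightarrow> ('p \<Rightarrow> 'n) \<Rightarrow> (complex \<Rightarrow> 'p \<Rightarrow> 'p) \<Rightarrow> bool" where
  "principal_circle_bundle P N q A \<longleftrightarrow>
     smooth_map P N q \<and>
     smooth_map (prod_mfd circle P) P (\<lambda>(z, p). A z p) \<and>
     (\<forall>p\<in>pts P. A 1 p = p) \<and>
     (\<forall>z\<in>sphere 0 1. \<forall>w\<in>sphere 0 1. \<forall>p\<in>pts P. A z (A w p) = A (z * w) p) \<and>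
     (\<forall>z\<in>sphere 0 1. \<forall>p\<in>pts P. q (A z p) = q p) \<and>
     (\<forall>n\<in>pts N. \<exists>U \<Psi>. openin (mtop N) U \<and> n \<in> U \<and>
        diffeomorphism (prod_mfd (submfd N (mdim N) U) circle)
          (submfd P (mdim P) {p \<in> pts P. q p \<in> U}) \<Psi> \<and>
        (\<forall>u\<in>U. \<forall>z\<in>sphere 0 1. q (\<Psi> (u, z)) = u \<and>
           (\<forall>w\<in>sphere 0 1. \<Psi> (u, w * z) = A w (\<Psi> (u, z)))))"

text \<open>
  A groupoid morphism over \<open>id\<^sub>X\<close> into \<open>X \<times>\<^sub>M X\<close> is determined by sources and targets, so it is
  \<open>p \<mapsto> (t p, s p)\<close>, where the first component of a pair is its target; it exists iff
  \<open>\<pi> \<circ> s = \<pi> \<circ> t\<close>, and then multiplicativity is automatic.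
\<close>
definition bundle_gerbe :: "('m, 'x, 'p) gerbe \<Rightarrow> bool" where
  "bundle_gerbe G \<longleftrightarrow>
     smooth_manifold (gM G) \<and> smooth_manifold (gX G) \<and>
     surjective_submersion (gX G) (gM G) (gproj G) \<and>
     lie_groupoid G \<and>
     (\<forall>p\<in>pts (gP G). gproj G (gs G p) = gproj G (gt G p)) \<and>
     principal_circle_bundle (gP G) (XX G) (\<lambda>p. (gt G p, gs G p)) (gact G) \<and>
     (\<forall>(p, q)\<in>pts (PP G). \<forall>z\<in>sphere 0 1. \<forall>w\<in>sphere 0 1.
        gmult G (gact G z p) (gact G w q) = gact G (z * w) (gmult G p q))"

text \<open>The simplicial differential on functions, 1-forms, 2-forms on \<open>X\<close>, and on 1-forms on \<open>P\<close>.\<close>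

definition delta0 :: "('m, 'x, 'p) gerbe \<Rightarrow> ('x \<Rightarrow> real) \<Rightarrow> 'p \<Rightarrow> real" where
  "delta0 G g = pull0 (gP G) (gs G) g - pull0 (gP G) (gt G) g"

definition delta1 :: "('m, 'x, 'p) gerbe \<Rightarrow> 'x form1 \<Rightarrow> 'p form1" where
  "delta1 G \<alpha> = pull1 (gP G) (gX G) (gs G) \<alpha> - pull1 (gP G) (gX G) (gt G) \<alpha>"

definition delta2 :: "('m, 'x, 'p) gerbe \<Rightarrow> 'x form2 \<Rightarrow> 'p form2" where
  "delta2 G B = pull2 (gP G) (gX G) (gs G) B - pull2 (gP G) (gX G) (gt G) B"

definition deltaP1 :: "('m, 'x, 'p) gerbe \<Rightarrow> 'p form1 \<Rightarrow> ('p \<times> 'p) form1" where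
  "deltaP1 G \<gamma> = pull1 (PP G) (gP G) fst \<gamma> - pull1 (PP G) (gP G) (gm G) \<gamma>
     + pull1 (PP G) (gP G) snd \<gamma>"

text \<open>
  The generator of the circle action.  The Lie algebra of the circle is identified with the reals
  by letting \<open>1\<close> generate \<open>t \<mapsto> exp (\<i> t)\<close>.
\<close>
definition fundamental :: "('m, 'x, 'p) gerbe \<Rightarrow> 'p vfield" where
  "fundamental G = (\<lambda>p f. if p \<in> pts (gP G) \<and> f \<in> Cinf (gP G)
     then deriv (\<lambda>t. f (gact G (cis t) p)) 0 else 0)"

definition gerbe_connection :: "('m, 'x, 'p) gerbe \<Rightarrow> 'p form1 \<Rightarrow> bool" where
  "gerbe_connection G \<gamma> \<longleftrightarrow> \<gamma> \<in> forms1 (gP G) \<and>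
     (\<forall>p\<in>pts (gP G). \<gamma> p (fundamental G p) = 1) \<and>
     (\<forall>z\<in>sphere 0 1. pull1 (gP G) (gP G) (gact G z) \<gamma> = \<gamma>) \<and>
     deltaP1 G \<gamma> = 0"

definition curving :: "('m, 'x, 'p) gerbe \<Rightarrow> 'p form1 \<Rightarrow> 'x form2 \<Rightarrow> bool" where
  "curving G \<gamma> B \<longleftrightarrow> B \<in> forms2 (gX G) \<and> delta2 G B = d1 (gP G) \<gamma>"

definition three_curvature :: "('m, 'x, 'p) gerbe \<Rightarrow> 'x form2 \<Rightarrow> 'm form3 \<Rightarrow> bool" where
  "three_curvature G B H \<longleftrightarrow> H \<in> forms3 (gM G) \<and>
     pull3 (gX G) (gM G) (gproj G) H = d2 (gX G) B"


section \<open>Multiplicative vector fields\<close>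

text \<open>
  The product of \<open>TP \<rightrightarrows> TX\<close>: the differential of the multiplication at \<open>(p, q)\<close>, applied to
  the tangent vector of \<open>P \<times>\<^sub>X P\<close> with components \<open>v\<close> and \<open>w\<close>.
\<close>
definition tmult :: "('m, 'x, 'p) gerbe \<Rightarrow> 'p \<Rightarrow> 'p \<Rightarrow> 'p tvec \<Rightarrow> 'p tvec \<Rightarrow> 'p tvec" where
  "tmult G p q v w = push (PP G) (gP G) (gm G)
     (THE u. u \<in> tangent (PP G) (p, q) \<and>
        push (PP G) (gP G) fst u = v \<and> push (PP G) (gP G) snd u = w)"

definition mult_vf :: "('m, 'x, 'p) gerbe \<Rightarrow> ('x vfield \<times> 'p vfield) set" where
  "mult_vf G = {(x, p). x \<in> vfields (gX G) \<and> p \<in> vfields (gP G) \<and>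
     (\<forall>q\<in>pts (gP G). push (gP G) (gX G) (gs G) (p q) = x (gs G q)) \<and>
     (\<forall>q\<in>pts (gP G). push (gP G) (gX G) (gt G) (p q) = x (gt G q)) \<and>
     (\<forall>y\<in>pts (gX G). p (gunit G y) = push (gX G) (gP G) (gunit G) (x y)) \<and>
     (\<forall>(q, r)\<in>pts (PP G). p (gmult G q r) = tmult G q r (p q) (p r))}"

text \<open>The vector field on \<open>M\<close> to which a vector field on \<open>X\<close> projects.\<close>
definition proj_vf :: "('m, 'x, 'p) gerbe \<Rightarrow> 'x vfield \<Rightarrow> 'm vfield" where
  "proj_vf G x = (THE u. u \<in> vfields (gM G) \<and>
     (\<forall>y\<in>pts (gX G). u (gproj G y) = push (gX G) (gM G) (gproj G) (x y)))"

text \<open>Smooth sections of the Lie algebroid \<open>A\<^sub>P = ker ds|\<^sub>X\<close>.\<close>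
definition algd :: "('m, 'x, 'p) gerbe \<Rightarrow> ('x \<Rightarrow> 'p tvec) set" where
  "algd G = {a.
     (\<forall>y\<in>pts (gX G). a y \<in> tangent (gP G) (gunit G y) \<and> push (gP G) (gX G) (gs G) (a y) = 0) \<and>
     (\<forall>y. y \<notin> pts (gX G) \<longrightarrow> a y = 0) \<and>
     (\<forall>f\<in>Cinf (gP G). (\<lambda>y. a y f) \<in> Cinf (gX G))}"

text \<open>
  Right translation by \<open>p\<close> is defined on the source fibre over \<open>t p\<close>, and \<open>q \<mapsto> p \<cdot> q\<^sup>-\<^sup>1\<close> on the
  source fibre over \<open>s p\<close>.  Elements of \<open>ker ds\<close> are tangent vectors of \<open>P\<close> and have to be regarded as
  tangent vectors of the source fibre first.
\<close>

definition sfib :: "('m, 'x, 'p) gerbe \<Rightarrow> 'x \<Rightarrow> 'p mfd" where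
  "sfib G y = submfd (gP G) (mdim (gP G) - mdim (gX G)) {q \<in> pts (gP G). gs G q = y}"

definition vert :: "('m, 'x, 'p) gerbe \<Rightarrow> ('x \<Rightarrow> 'p tvec) \<Rightarrow> 'x \<Rightarrow> 'p tvec" where
  "vert G a y = (THE u. u \<in> tangent (sfib G y) (gunit G y) \<and> push (sfib G y) (gP G) id u = a y)"

definition right_vf :: "('m, 'x, 'p) gerbe \<Rightarrow> ('x \<Rightarrow> 'p tvec) \<Rightarrow> 'p vfield" where
  "right_vf G a = (\<lambda>p. if p \<in> pts (gP G)
     then push (sfib G (gt G p)) (gP G) (\<lambda>q. gmult G q p) (vert G a (gt G p)) else 0)"

definition left_vf :: "('m, 'x, 'p) gerbe \<Rightarrow> ('x \<Rightarrow> 'p tvec) \<Rightarrow> 'p vfield" where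
  "left_vf G a = (\<lambda>p. if p \<in> pts (gP G)
     then push (sfib G (gs G p)) (gP G) (\<lambda>q. gmult G p (ginv G q)) (vert G a (gs G p)) else 0)"

definition anchor :: "('m, 'x, 'p) gerbe \<Rightarrow> ('x \<Rightarrow> 'p tvec) \<Rightarrow> 'x vfield" where
  "anchor G a = (\<lambda>y. push (gP G) (gX G) (gt G) (a y))"

definition bar_vf :: "('m, 'x, 'p) gerbe \<Rightarrow> ('x \<Rightarrow> 'p tvec) \<Rightarrow> 'p vfield" where
  "bar_vf G a = right_vf G a + left_vf G a"

definition v_fun :: "('m, 'x, 'p) gerbe \<Rightarrow> 'p form1 \<Rightarrow> ('x \<Rightarrow> 'p tvec) \<Rightarrow> 'x \<Rightarrow> real" where
  "v_fun G \<gamma> a = pull0 (gX G) (gunit G) (contract (right_vf G a) \<gamma>)"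

text \<open>\<open>[p, \<rightarrow>a]|\<^sub>X\<close>\<close>
definition mvf_act ::
  "('m, 'x, 'p) gerbe \<Rightarrow> 'p vfield \<Rightarrow> ('x \<Rightarrow> 'p tvec) \<Rightarrow> 'x \<Rightarrow> 'p tvec" where
  "mvf_act G p a = (\<lambda>y. if y \<in> pts (gX G) then lie_vf p (right_vf G a) (gunit G y) else 0)"

definition XG :: "('m, 'x, 'p) gerbe \<Rightarrow> ('x vfield \<times> 'p vfield, 'x \<Rightarrow> 'p tvec) lie2" where
  "XG G =
     \<lparr>deg0 = mult_vf G, deg1 = algd G,
      bdry = (\<lambda>a. (anchor G a, bar_vf G a)),
      br00 = (\<lambda>(x, p) (z, r). (lie_vf x z, lie_vf p r)),
      br01 = (\<lambda>(x, p) a. mvf_act G p a),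
      jac = (\<lambda>_ _ _. 0)\<rparr>"

definition XGgamma ::
  "('m, 'x, 'p) gerbe \<Rightarrow> 'p form1 \<Rightarrow> 'x form2 \<Rightarrow>
   ('x vfield \<times> 'p vfield \<times> 'x form1, 'x \<Rightarrow> 'p tvec) lie2" where
  "XGgamma G \<gamma> B =
     \<lparr>deg0 = {(x, p, \<alpha>). (x, p) \<in> mult_vf G \<and> \<alpha> \<in> forms1 (gX G) \<and>
                lie1 (gP G) p \<gamma> = delta1 G \<alpha>},
      deg1 = algd G,
      bdry = (\<lambda>a. (anchor G a, bar_vf G a, contract (anchor G a) B - d0 (gX G) (v_fun G \<gamma> a))),
      br00 = (\<lambda>(x, p, \<alpha>) (z, r, \<beta>).
                (lie_vf x z, lie_vf p r, lie1 (gX G) x \<beta> - lie1 (gX G) z \<alpha>)),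
      br01 = (\<lambda>(x, p, \<alpha>) a. mvf_act G p a),
      jac = (\<lambda>_ _ _. 0)\<rparr>"

definition forget_mor ::
  "('x vfield \<times> 'p vfield \<times> 'x form1, 'x \<Rightarrow> 'p tvec, 'x vfield \<times> 'p vfield, 'x \<Rightarrow> 'p tvec) lie2_mor"
  where
  "forget_mor = \<lparr>mor0 = (\<lambda>(x, p, \<alpha>). (x, p)), mor1 = id, mor2 = (\<lambda>_ _. 0)\<rparr>"


section \<open>The Lie 2-algebras attached to a 3-form\<close>

text \<open>
  \<open>LC M H\<close> comes from the exact Courant algebroid \<open>TM \<oplus> T\<^sup>*M\<close> twisted by the closed 3-form \<open>H\<close>;
  \<open>AM M H\<close> from the Atiyah-type complex \<open>C\<^sup>\<infinity>(M) \<rightarrow> vector fields (M)\<close> with zero differential.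
\<close>

definition LC :: "'m mfd \<Rightarrow> 'm form3 \<Rightarrow> ('m vfield \<times> 'm form1, 'm \<Rightarrow> real) lie2" where
  "LC M H =
     (let br = (\<lambda>(u, \<alpha>) (v, \<beta>).
            (lie_vf u v,
             lie1 M u \<beta> - lie1 M v \<alpha> - (1/2) *\<^sub>R d0 M (contract u \<beta> - contract v \<alpha>)
             - contract v (contract u H)));
          pair = (\<lambda>(u, \<alpha>) (v, \<beta>). contract u \<beta> + contract v \<alpha>)
      in
     \<lparr>deg0 = vfields M \<times> forms1 M, deg1 = Cinf M,
      bdry = (\<lambda>f. (0, d0 M f)),
      br00 = br,
      br01 = (\<lambda>(u, \<alpha>) f. (1/2) *\<^sub>R contract u (d0 M f)),
      jac = (\<lambda>e1 e2 e3. - (1/6) *\<^sub>R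
               (pair (br e1 e2) e3 + pair (br e2 e3) e1 + pair (br e3 e1) e2))\<rparr>)"

definition AM :: "'m mfd \<Rightarrow> 'm form3 \<Rightarrow> ('m vfield, 'm \<Rightarrow> real) lie2" where
  "AM M H =
     \<lparr>deg0 = vfields M, deg1 = Cinf M,
      bdry = (\<lambda>f. 0),
      br00 = lie_vf,
      br01 = vf_fun,
      jac = (\<lambda>x1 x2 x3. - contract x3 (contract x2 (contract x1 H)))\<rparr>"

definition psi_mor :: "('m vfield \<times> 'm form1, 'm \<Rightarrow> real, 'm vfield, 'm \<Rightarrow> real) lie2_mor" where
  "psi_mor = \<lparr>mor0 = (\<lambda>(u, \<alpha>). u), mor1 = id,
     mor2 = (\<lambda>(u, \<alpha>) (v, \<beta>). - (1/2) *\<^sub>R (contract u \<beta> - contract v \<alpha>))\<rparr>"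


section \<open>The butterflies determined by a connection and curving\<close>

definition F_butterfly ::
  "('m, 'x, 'p) gerbe \<Rightarrow> 'p form1 \<Rightarrow> 'x form2 \<Rightarrow>
   (('x vfield \<times> 'p vfield \<times> 'x form1) \<times> ('x \<Rightarrow> real),
    'x vfield \<times> 'p vfield \<times> 'x form1, 'x \<Rightarrow> 'p tvec, 'm vfield \<times> 'm form1, 'm \<Rightarrow> real) butterfly"
  where
  "F_butterfly G \<gamma> B =
     \<lparr>space = subspace_rvs {((x, p, \<alpha>), g). (x, p, \<alpha>) \<in> deg0 (XGgamma G \<gamma> B) \<and>
                g \<in> Cinf (gX G) \<and> delta0 G g = contract p \<gamma>},
      brk = (\<lambda>((x, p, \<alpha>), g) ((z, r, \<beta>), h).
                (br00 (XGgamma G \<gamma> B) (x, p, \<alpha>) (z, r, \<beta>),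
                 (1/2) *\<^sub>R (contract x (\<beta> + d0 (gX G) h) - contract z (\<alpha> + d0 (gX G) g)))),
      kap = (\<lambda>a. (bdry (XGgamma G \<gamma> B) a, - v_fun G \<gamma> a)),
      lam = (\<lambda>f. ((0, 0, 0), pull0 (gX G) (gproj G) f)),
      sig = fst,
      rho = (\<lambda>((x, p, \<alpha>), g). (proj_vf G x,
                - (THE \<epsilon>. \<epsilon> \<in> forms1 (gM G) \<and>
                     pull1 (gX G) (gM G) (gproj G) \<epsilon> = \<alpha> - contract x B - d0 (gX G) g)))\<rparr>"

definition G_butterfly ::
  "('m, 'x, 'p) gerbe \<Rightarrow> 'p form1 \<Rightarrow> 'x form2 \<Rightarrow>
   ('x vfield \<times> 'p vfield \<times> ('x \<Rightarrow> real),
    'x vfield \<times> 'p vfield, 'x \<Rightarrow> 'p tvec, 'm vfield, 'm \<Rightarrow> real) butterfly"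
  where
  "G_butterfly G \<gamma> B =
     \<lparr>space = subspace_rvs {(x, p, g). (x, p) \<in> deg0 (XG G) \<and>
                g \<in> Cinf (gX G) \<and> delta0 G g = contract p \<gamma>},
      brk = (\<lambda>(x, p, g) (z, r, h).
                (lie_vf x z, lie_vf p r,
                 vf_fun x h - vf_fun z g - contract z (contract x B))),
      kap = (\<lambda>a. (anchor G a, bar_vf G a, - v_fun G \<gamma> a)),
      lam = (\<lambda>f. (0, 0, pull0 (gX G) (gproj G) f)),
      sig = (\<lambda>(x, p, g). (x, p)),
      rho = (\<lambda>(x, p, g). proj_vf G x)\<rparr>"

end

theory Submission
  imports Defs "HOL-Homology.Invariance_of_Domain" "HOL-Computational_Algebra.Polynomial"
begin

text \<open>
  A representative of a coset in \<open>\<psi> \<circ> \<F>\<close> carries a function \<open>g\<close> on \<open>X\<close> and a function \<open>w\<close> on \<open>M\<close>, and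
  \<open>k = g + \<pi>\<^sup>*w\<close> does not depend on the representative.  A coset in \<open>\<G> \<circ> \<u>\<close> has a unique
  representative whose component in \<open>\<Gamma>(A\<^sub>P)\<close> is zero.  The isomorphism sends the coset of
  \<open>((x, p, \<alpha>; g), w)\<close> to the one with normal form \<open>((x, p, \<alpha>), (x, p, k))\<close>.

  It preserves brackets because the 1-form \<open>\<epsilon>\<close> in \<open>\<rho>\<close> is determined by \<open>\<pi>\<^sup>*\<epsilon> = \<alpha> - \<iota>\<^sub>x B - dg\<close>, which turns
  the symmetrised bracket of \<open>\<F>\<close> into \<open>L\<^sub>x h - L\<^sub>z g - \<iota>\<^sub>z \<iota>\<^sub>x B\<close>.  That brackets in \<open>\<G> \<circ> \<u>\<close> may be
  computed on normal forms rests on the identity \<open>v\<^sub>c = L\<^sub>x v\<^sub>a + L\<^sub>a g + \<iota>\<^sub>a \<iota>\<^sub>x B\<close> for \<open>c = [p, a]\<close>, obtained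
  by evaluating \<open>\<delta>B = d\<gamma>\<close> on \<open>p\<close> and the right-invariant vector field of \<open>a\<close> along the units.
\<close>

section \<open>Calculus on coordinate spaces\<close>

abbreviation En :: "nat \<Rightarrow> (nat \<Rightarrow> real) set" where
  "En n \<equiv> topspace (Euclidean_space n)"

lemma En_iff: "x \<in> En n \<longleftrightarrow> (\<forall>i\<ge>n. x i = 0)"
  by (simp add: topspace_Euclidean_space)

lemma En_upd: "x \<in> En n \<Longrightarrow> i < n \<Longrightarrow> x(i := t) \<in> En n"
  by (auto simp: En_iff)

lemma openin_En_sub: "openin (Euclidean_space n) W \<Longrightarrow> W \<subseteq> En n"
  by (rule openin_subset)

lemma cm_iff_cont:
  assumes "W \<subseteq> En n"
  shows "continuous_map (subtopology (Euclidean_space n) W) euclideanreal f \<longleftrightarrow> continuous_on W f"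
proof -
  have "subtopology (Euclidean_space n) W = top_of_set W"
    unfolding Euclidean_space_def using assms
    by (simp add: subtopology_subtopology euclidean_product_topology topspace_Euclidean_space Int_absorb1)
  then show ?thesis by simp
qed

lemma openin_En_alt: "openin (Euclidean_space n) W \<longleftrightarrow> openin (top_of_set (En n)) W"
  by (simp add: Euclidean_space_def euclidean_product_topology)

definition cube :: "nat \<Rightarrow> (nat \<Rightarrow> real) \<Rightarrow> real \<Rightarrow> (nat \<Rightarrow> real) set" where
  "cube n p r = {y \<in> En n. \<forall>i<n. \<bar>y i - p i\<bar> < r}"

lemma openin_cube: "openin (Euclidean_space n) (cube n p r)"
proof -
  have "open {y::nat\<Rightarrow>real. \<bar>y i - p i\<bar> < r}" for i
    by (intro open_Collect_less continuous_intros)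
       (auto intro: continuous_on_product_then_coordinatewise)
  then have "open (\<Inter>i\<in>{..<n}. {y::nat\<Rightarrow>real. \<bar>y i - p i\<bar> < r})"
    by (intro open_INT) auto
  moreover have "cube n p r = En n \<inter> (\<Inter>i\<in>{..<n}. {y. \<bar>y i - p i\<bar> < r})"
    by (auto simp: cube_def)
  ultimately show ?thesis
    unfolding openin_En_alt openin_open by blast
qed

lemma openin_E_cube:
  assumes "openin (Euclidean_space n) W" "x \<in> W"
  shows "\<exists>r>0. cube n x r \<subseteq> W"
proof -
  obtain T where T: "open T" "W = En n \<inter> T"
    using assms(1) unfolding openin_En_alt openin_open by blast
  have T': "openin (product_topology (\<lambda>i. euclidean) UNIV) T" using T(1) by (simp add: euclidean_product_topology)
  then obtain X where X: "x \<in> Pi\<^sub>E UNIV X" "\<And>i. open (X i)" "finite {i. X i \<noteq> UNIV}" "Pi\<^sub>E UNIV X \<subseteq> T"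
    using product_topology_open_contains_basis[OF T', of x] assms(2) T(2) by auto
  have "\<exists>e>0. \<forall>y. \<bar>y - x i\<bar> < e \<longrightarrow> y \<in> X i" for i
  proof -
    have "x i \<in> X i" using X(1) by auto
    then show ?thesis using X(2)[of i] unfolding open_dist by (force simp: dist_real_def)
  qed
  then obtain e where e: "\<And>i. e i > 0" "\<And>i y. \<bar>y - x i\<bar> < e i \<Longrightarrow> y \<in> X i" by metis
  define r where "r = Min (insert 1 (e ` {..<n}))"
  have "r > 0" unfolding r_def using e(1) by (subst Min_gr_iff) auto
  moreover have re: "r \<le> e i" if "i < n" for i unfolding r_def using that by (intro Min_le) auto
  have "cube n x r \<subseteq> W"
  proof
    fix y assume y: "y \<in> cube n x r"
    have "y i \<in> X i" for i
    proof (cases "i < n")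
      case True
      then have "\<bar>y i - x i\<bar> < e i" using y re[OF True] by (auto simp: cube_def)
      then show ?thesis using e(2) by auto
    next
      case False
      then have "y i = x i" using y assms T by (auto simp: cube_def En_iff)
      then show ?thesis using e by simp
    qed
    then show "y \<in> W" using X(4) T y by (auto simp: cube_def)
  qed
  ultimately show ?thesis by blast
qed

lemma openin_E_I:
  assumes "W \<subseteq> En n" "\<And>x. x \<in> W \<Longrightarrow> \<exists>r>0. cube n x r \<subseteq> W"
  shows "openin (Euclidean_space n) W"
proof (subst openin_subopen, intro ballI)
  fix x assume x: "x \<in> W"
  then obtain r where "r > 0" "cube n x r \<subseteq> W" using assms by blast
  moreover have "x \<in> cube n x r" using x assms(1) \<open>r>0\<close> by (auto simp: cube_def)
  ultimately show "\<exists>T. openin (Euclidean_space n) T \<and> x \<in> T \<and> T \<subseteq> W" using openin_cube by blast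
qed

lemma in_cube: "x \<in> En n \<Longrightarrow> r > 0 \<Longrightarrow> x \<in> cube n x r"
  by (auto simp: cube_def)

lemma eventually_line:
  assumes "openin (Euclidean_space n) W" "x \<in> W" "i < n"
  shows "\<forall>\<^sub>F t in nhds (x i). x(i := t) \<in> W"
proof -
  obtain r where r: "r > 0" "cube n x r \<subseteq> W" using openin_E_cube[OF assms(1,2)] by blast
  have "\<forall>\<^sub>F t in nhds (x i). \<bar>t - x i\<bar> < r"
    using r(1) by (auto simp: eventually_nhds_metric dist_real_def)
  then show ?thesis
  proof eventually_elim
    case (elim t)
    have "x(i:=t) \<in> En n" using assms openin_subset by (metis En_upd subsetD)
    then have "x(i:=t) \<in> cube n x r" using elim r(1) by (auto simp: cube_def)
    then show ?case using r by auto
  qed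
qed

lemma partial_cong:
  assumes "openin (Euclidean_space n) W" "x \<in> W" "i < n" "\<And>y. y \<in> W \<Longrightarrow> f y = g y"
  shows "partial i f x = partial i g x"
  unfolding partial_def
  by (rule deriv_cong_ev[OF eventually_mono[OF eventually_line[OF assms(1-3)]]]) (auto simp: assms)

lemma line_differentiable_cong:
  fixes f g :: "(nat \<Rightarrow> real) \<Rightarrow> real"
  assumes "openin (Euclidean_space n) W" "x \<in> W" "i < n" "\<And>y. y \<in> W \<Longrightarrow> f y = g y"
    "(\<lambda>t. f (x(i := t))) differentiable (at (x i))"
  shows "(\<lambda>t. g (x(i := t))) differentiable (at (x i))"
proof -
  obtain D where "((\<lambda>t. f (x(i := t))) has_real_derivative D) (at (x i))"
    using assms(5) real_differentiable_def by blast
  moreover have "\<forall>\<^sub>F t in nhds (x i). f (x(i:=t)) = g (x(i:=t))"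
    by (rule eventually_mono[OF eventually_line[OF assms(1-3)]]) (auto simp: assms)
  ultimately have "((\<lambda>t. g (x(i := t))) has_real_derivative D) (at (x i))"
    by (subst (asm) DERIV_cong_ev[OF refl _ refl])
  then show ?thesis using real_differentiable_def by blast
qed

lemma Ck_on_subset: "Ck_on n k W f \<Longrightarrow> W' \<subseteq> W \<Longrightarrow> Ck_on n k W' f"
proof (induction k arbitrary: f)
  case 0 then show ?case
    by (auto intro: continuous_map_from_subtopology_mono)
next
  case (Suc k) then show ?case
    by (auto intro: continuous_map_from_subtopology_mono)
qed

lemma Ck0: "W \<subseteq> En n \<Longrightarrow> Ck_on n 0 W f \<longleftrightarrow> continuous_on W f"
  by (simp add: cm_iff_cont)

lemma CkS: "W \<subseteq> En n \<Longrightarrow> Ck_on n (Suc k) W f \<longleftrightarrow> continuous_on W f \<and>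
     (\<forall>i<n. (\<forall>x\<in>W. (\<lambda>t. f (x(i := t))) differentiable (at (x i))) \<and> Ck_on n k W (partial i f))"
  by (simp add: cm_iff_cont)

lemma Ck_on_SucD: "Ck_on n (Suc k) W f \<Longrightarrow> Ck_on n k W f"
  by (induction k arbitrary: f) auto

lemma Ck_on_partial: "Ck_on n (Suc k) W f \<Longrightarrow> i < n \<Longrightarrow> Ck_on n k W (partial i f)"
  by simp

lemma Ck_on_line: "Ck_on n (Suc k) W f \<Longrightarrow> i < n \<Longrightarrow> x \<in> W \<Longrightarrow> (\<lambda>t. f (x(i := t))) differentiable (at (x i))"
  by simp

declare Ck_on.simps [simp del]

lemma Ck_on_le: "Ck_on n k W f \<Longrightarrow> l \<le> k \<Longrightarrow> Ck_on n l W f"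
  by (induction k) (auto simp: le_Suc_eq dest: Ck_on_SucD)

lemma Ck_on_cont: "Ck_on n k W f \<Longrightarrow> W \<subseteq> En n \<Longrightarrow> continuous_on W f"
  by (cases k) (simp_all add: Ck0 CkS)

lemma Ck_on_cong:
  assumes W: "openin (Euclidean_space n) W"
  shows "(\<And>x. x \<in> W \<Longrightarrow> f x = g x) \<Longrightarrow> Ck_on n k W f \<Longrightarrow> Ck_on n k W g"
proof (induction k arbitrary: f g)
  case 0
  then show ?case using Ck0[OF openin_En_sub[OF W]] continuous_on_cong[of W W f g] by simp
next
  case (Suc k)
  have "continuous_on W g"
    using Ck_on_cont[OF Suc.prems(2) openin_En_sub[OF W]] Suc.prems(1) continuous_on_cong[of W W f g] by simp
  moreover have "(\<lambda>t. g (x(i := t))) differentiable (at (x i))" if "x \<in> W" "i < n" for x i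
    using line_differentiable_cong[OF W that Suc.prems(1) Ck_on_line[OF Suc.prems(2) that(2,1)]] by blast
  moreover have "Ck_on n k W (partial i g)" if "i < n" for i
    by (rule Suc.IH[OF _ Ck_on_partial[OF Suc.prems(2) that]]) (rule partial_cong[OF W _ that Suc.prems(1)])
  ultimately show ?case by (simp add: CkS[OF openin_En_sub[OF W]])
qed

lemma continuous_on_local:
  assumes "W \<subseteq> En n"
    "\<And>x. x \<in> W \<Longrightarrow> \<exists>W'. openin (Euclidean_space n) W' \<and> x \<in> W' \<and> continuous_on (W' \<inter> W) f"
  shows "continuous_on W f"
  unfolding continuous_on_eq_continuous_within
proof
  fix x assume x: "x \<in> W"
  obtain W' where W': "openin (Euclidean_space n) W'" "x \<in> W'" "continuous_on (W' \<inter> W) f"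
    using assms(2)[OF x] by blast
  obtain T where T: "open T" "W' = En n \<inter> T" using W'(1) unfolding openin_En_alt openin_open by blast
  have "at x within W = at x within (W' \<inter> W)"
    by (rule at_within_nhd[of _ T]) (use T W' assms x in auto)
  moreover have "continuous (at x within (W' \<inter> W)) f"
    using W' x by (simp add: continuous_on_eq_continuous_within)
  ultimately show "continuous (at x within W) f" by simp
qed

lemma Ck_on_local:
  assumes W: "W \<subseteq> En n"
  shows "(\<And>x. x \<in> W \<Longrightarrow> \<exists>W'. openin (Euclidean_space n) W' \<and> x \<in> W' \<and> Ck_on n k (W' \<inter> W) f)
    \<Longrightarrow> Ck_on n k W f"
proof (induction k arbitrary: f)
  case 0
  have "continuous_on W f"
    by (rule continuous_on_local[OF W]) (meson "0.prems" Ck_on_cont W le_infI2)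
  then show ?case using Ck0[OF W] by simp
next
  case (Suc k)
  have "continuous_on W f"
    by (rule continuous_on_local[OF W]) (meson "Suc.prems" Ck_on_cont W le_infI2)
  moreover have "(\<lambda>t. f (x(i := t))) differentiable (at (x i))" if "x \<in> W" "i < n" for x i
  proof -
    obtain W' where "x \<in> W'" "Ck_on n (Suc k) (W' \<inter> W) f" using Suc.prems[of x] \<open>x \<in> W\<close> by blast
    then show ?thesis using Ck_on_line that by blast
  qed
  moreover have "Ck_on n k W (partial i f)" if "i < n" for i
  proof (rule Suc.IH)
    fix x assume "x \<in> W"
    then obtain W' where "openin (Euclidean_space n) W'" "x \<in> W'" "Ck_on n (Suc k) (W' \<inter> W) f" using Suc.prems[of x] by blast
    then show "\<exists>W'. openin (Euclidean_space n) W' \<and> x \<in> W' \<and> Ck_on n k (W' \<inter> W) (partial i f)"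
      using Ck_on_partial[OF _ that] by blast
  qed
  ultimately show ?case by (simp add: CkS[OF W])
qed

lemma Ck_on_has_partial:
  assumes "Ck_on n (Suc k) W f" "x \<in> W" "i < n"
  shows "((\<lambda>t. f (x(i := t))) has_real_derivative partial i f x) (at (x i))"
  using Ck_on_line[OF assms(1,3,2)] unfolding partial_def by (simp add: DERIV_deriv_iff_real_differentiable)

lemma Ck_on_SucI:
  assumes W: "openin (Euclidean_space n) W" and "continuous_on W f"
    "\<And>x i. x \<in> W \<Longrightarrow> i < n \<Longrightarrow> ((\<lambda>t. f (x(i := t))) has_real_derivative D i x) (at (x i))"
    "\<And>i. i < n \<Longrightarrow> Ck_on n k W (D i)"
  shows "Ck_on n (Suc k) W f" "\<And>x i. x \<in> W \<Longrightarrow> i < n \<Longrightarrow> partial i f x = D i x"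
proof -
  show *: "partial i f x = D i x" if "x \<in> W" "i < n" for x i
    using assms(3)[OF that] by (auto simp: partial_def DERIV_imp_deriv)
  have "Ck_on n k W (partial i f)" if "i < n" for i
    by (rule Ck_on_cong[OF W _ assms(4)[OF that]]) (simp add: * that)
  then show "Ck_on n (Suc k) W f"
    using assms(2,3) unfolding CkS[OF openin_En_sub[OF W]] real_differentiable_def by blast
qed

lemma partial_const [simp]: "partial i (\<lambda>_. c) = (\<lambda>_. 0)"
  by (auto simp: partial_def fun_eq_iff)

lemma Ck_const: "openin (Euclidean_space n) W \<Longrightarrow> Ck_on n k W (\<lambda>_. c)"
  by (induction k arbitrary: c) (simp_all add: Ck0 CkS openin_En_sub)

lemma Ck_coord:
  assumes W: "openin (Euclidean_space n) W"
  shows "Ck_on n k W (\<lambda>x. x j)"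
proof (cases k)
  case 0
  then show ?thesis
    by (auto simp: Ck0[OF openin_En_sub[OF W]] intro: continuous_on_product_then_coordinatewise)
next
  case (Suc l)
  have "Ck_on n (Suc l) W (\<lambda>x. x j)"
  proof (rule Ck_on_SucI(1)[OF W])
    show "((\<lambda>t. (x(i := t)) j) has_real_derivative (if i = j then 1 else 0)) (at (x i))" for x :: "nat \<Rightarrow> real" and i
      by (auto intro: derivative_eq_intros)
  qed (auto intro: continuous_on_product_then_coordinatewise Ck_const[OF W])
  then show ?thesis using Suc by simp
qed

lemma partial_coord: "partial i (\<lambda>x. x j) x = (if i = j then 1 else 0)"
  by (auto simp: partial_def intro!: DERIV_imp_deriv derivative_eq_intros)

lemma Ck_add:
  assumes W: "openin (Euclidean_space n) W"
  shows "Ck_on n k W f \<Longrightarrow> Ck_on n k W g \<Longrightarrow> Ck_on n k W (\<lambda>x. f x + g x)"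
proof (induction k arbitrary: f g)
  case 0 then show ?case by (auto simp: Ck0[OF openin_En_sub[OF W]] intro: continuous_on_add)
next
  case (Suc k)
  show ?case
  proof (rule Ck_on_SucI(1)[OF W, where D="\<lambda>i x. partial i f x + partial i g x"])
    show "continuous_on W (\<lambda>x. f x + g x)"
      using Suc.prems Ck_on_cont[OF _ openin_En_sub[OF W]] by (blast intro: continuous_on_add)
    show "((\<lambda>t. f (x(i := t)) + g (x(i := t))) has_real_derivative partial i f x + partial i g x) (at (x i))"
      if "x \<in> W" "i < n" for x i
      by (rule DERIV_add[OF Ck_on_has_partial[OF Suc.prems(1) that] Ck_on_has_partial[OF Suc.prems(2) that]])
    show "Ck_on n k W (\<lambda>x. partial i f x + partial i g x)" if "i < n" for i
      using Suc.prems that by (blast intro: Suc.IH Ck_on_partial)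
  qed
qed

lemma Ck_mult:
  assumes W: "openin (Euclidean_space n) W"
  shows "Ck_on n k W f \<Longrightarrow> Ck_on n k W g \<Longrightarrow> Ck_on n k W (\<lambda>x. f x * g x)"
proof (induction k arbitrary: f g)
  case 0 then show ?case by (auto simp: Ck0[OF openin_En_sub[OF W]] intro: continuous_on_mult)
next
  case (Suc k)
  show ?case
  proof (rule Ck_on_SucI(1)[OF W, where D="\<lambda>i x. partial i f x * g x + partial i g x * f x"])
    show "continuous_on W (\<lambda>x. f x * g x)"
      using Suc.prems Ck_on_cont[OF _ openin_En_sub[OF W]] by (blast intro: continuous_on_mult)
    show "((\<lambda>t. f (x(i := t)) * g (x(i := t))) has_real_derivative partial i f x * g x + partial i g x * f x) (at (x i))"
      if "x \<in> W" "i < n" for x i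
      by (rule DERIV_cong[OF DERIV_mult[OF Ck_on_has_partial[OF Suc.prems(1) that] Ck_on_has_partial[OF Suc.prems(2) that]]])
        simp
    show "Ck_on n k W (\<lambda>x. partial i f x * g x + partial i g x * f x)" if "i < n" for i
      by (intro Ck_add[OF W] Suc.IH[OF Ck_on_partial[OF Suc.prems(1) that] Ck_on_SucD[OF Suc.prems(2)]]
        Suc.IH[OF Ck_on_partial[OF Suc.prems(2) that] Ck_on_SucD[OF Suc.prems(1)]])
  qed
qed

lemma Ck_sum:
  assumes W: "openin (Euclidean_space n) W"
  shows "(\<And>j. j \<in> J \<Longrightarrow> Ck_on n k W (f j)) \<Longrightarrow> Ck_on n k W (\<lambda>x. \<Sum>j\<in>J. f j x)"
  by (induction J rule: infinite_finite_induct) (auto intro: Ck_const[OF W] Ck_add[OF W])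

lemma MVT_any:
  fixes a b :: real
  assumes "a \<noteq> b"
    and der: "\<And>s. min a b \<le> s \<Longrightarrow> s \<le> max a b \<Longrightarrow> (h has_real_derivative h' s) (at s)"
  shows "\<exists>z. min a b < z \<and> z < max a b \<and> h a - h b = (a - b) * h' z"
proof (cases "a < b")
  case True
  then obtain z where "a < z" "z < b" "h b - h a = (b - a) * h' z"
    using MVT2[of a b h h'] der by auto
  then show ?thesis using True by (intro exI[of _ z]) (auto simp: algebra_simps)
next
  case False
  then have "b < a" using assms by simp
  then obtain z where "b < z" "z < a" "h a - h b = (a - b) * h' z"
    using MVT2[of b a h h'] der by auto
  then show ?thesis using \<open>b < a\<close> by (intro exI[of _ z]) auto
qed

lemma mvt_quot:
  assumes V: "openin (Euclidean_space m) V" and g: "Ck_on m (Suc 0) V g" and y: "y \<in> V" and j: "j < m"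
    and ab: "\<And>t. a t = (b t)(j := a t j)"
    and b: "\<forall>\<^sub>F t in F. b t \<in> En m"
    and la: "\<And>i. i < m \<Longrightarrow> ((\<lambda>t. a t i) \<longlongrightarrow> y i) F" and lb: "\<And>i. i < m \<Longrightarrow> ((\<lambda>t. b t i) \<longlongrightarrow> y i) F"
  shows "\<exists>q. (\<forall>\<^sub>F t in F. g (a t) - g (b t) = (a t j - b t j) * q t) \<and> (q \<longlongrightarrow> partial j g y) F"
proof -
  define q where "q t = (if a t j = b t j then partial j g y else (g (a t) - g (b t)) / (a t j - b t j))" for t
  have 1: "g (a t) - g (b t) = (a t j - b t j) * q t" for t
  proof (cases "a t j = b t j")
    case True
    then have "a t = b t" using ab[of t] by (metis fun_upd_triv)
    then show ?thesis by simp
  qed (simp add: q_def)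
  have cont: "continuous_on V (partial j g)" using Ck_on_cont[OF Ck_on_partial[OF g j] openin_En_sub[OF V]] .
  have "(q \<longlongrightarrow> partial j g y) F"
  proof (rule tendstoI)
    fix e :: real assume e: "e > 0"
    obtain T where T: "openin (top_of_set V) T" "y \<in> T" "\<And>z. z \<in> T \<Longrightarrow> dist (partial j g z) (partial j g y) < e"
    proof -
      have "openin (top_of_set V) (V \<inter> partial j g -` ball (partial j g y) e)"
        using cont by (simp add: continuous_openin_preimage_gen)
      then show ?thesis using that y e by (force simp: dist_commute)
    qed
    have "openin (Euclidean_space m) T"
      using T(1) V unfolding openin_En_alt by (metis openin_trans)
    then obtain r where r: "r > 0" "cube m y r \<subseteq> T" using openin_E_cube T(2) by blast
    have TV: "T \<subseteq> V" using T(1) by (metis openin_imp_subset)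
    have "\<forall>\<^sub>F t in F. \<forall>i\<in>{..<m}. \<bar>a t i - y i\<bar> < r \<and> \<bar>b t i - y i\<bar> < r"
    proof (intro eventually_ball_finite ballI eventually_conj)
      fix i assume "i \<in> {..<m}"
      then show "\<forall>\<^sub>F t in F. \<bar>a t i - y i\<bar> < r" "\<forall>\<^sub>F t in F. \<bar>b t i - y i\<bar> < r"
        using tendstoD[OF la r(1)] tendstoD[OF lb r(1)] by (auto simp: dist_real_def)
    qed simp
    then show "\<forall>\<^sub>F t in F. dist (q t) (partial j g y) < e" using b
    proof eventually_elim
      case (elim t)
      show ?case
      proof (cases "a t j = b t j")
        case True then show ?thesis using e by (simp add: q_def)
      next
        case False
        define h where "h s = g ((b t)(j := s))" for s
        have inT: "(b t)(j := s) \<in> T" if "min (a t j) (b t j) \<le> s" "s \<le> max (a t j) (b t j)" for s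
        proof -
          have "\<bar>s - y j\<bar> < r" using bspec[OF elim(1), of j] j that by (auto simp: min_def max_def split: if_splits)
          then have "(b t)(j := s) \<in> cube m y r" using elim j by (auto simp: cube_def intro: En_upd)
          then show ?thesis using r by auto
        qed
        have der: "(h has_real_derivative partial j g ((b t)(j := s))) (at s)"
          if "min (a t j) (b t j) \<le> s" "s \<le> max (a t j) (b t j)" for s
          using Ck_on_has_partial[OF g, of "(b t)(j:=s)" j] inT[OF that] TV j by (auto simp: h_def[abs_def])
        obtain z where z: "min (a t j) (b t j) < z" "z < max (a t j) (b t j)"
           "h (a t j) - h (b t j) = (a t j - b t j) * partial j g ((b t)(j := z))"
          using MVT_any[OF False der] by blast
        have "h (a t j) = g (a t)" "h (b t j) = g (b t)" using ab[of t] by (simp_all add: h_def)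
        then have "g (a t) - g (b t) = (a t j - b t j) * partial j g ((b t)(j := z))"
          using z(3) by simp
        then have "q t = partial j g ((b t)(j := z))" using False by (simp add: q_def)
        then show ?thesis using T(3)[OF inT[of z]] z by simp
      qed
    qed
  qed
  then show ?thesis using 1 by (intro exI[of _ q]) (simp add: always_eventually)
qed

lemma C1_chain:
  assumes V: "openin (Euclidean_space m) V" and g: "Ck_on m (Suc 0) V g" and y: "c t0 \<in> V"
    and d: "\<And>j. j < m \<Longrightarrow> ((\<lambda>t. c t j) has_real_derivative d j) (at t0)"
    and c: "\<forall>\<^sub>F t in nhds t0. c t \<in> En m"
  shows "((\<lambda>t. g (c t)) has_real_derivative (\<Sum>j<m. partial j g (c t0) * d j)) (at t0)"
proof -
  define h where "h k t = (\<lambda>i. if i < k then c t i else c t0 i)" for k t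
  have c0: "c t0 \<in> En m" using openin_En_sub[OF V] y by auto
  have lim: "((\<lambda>t. c t i) \<longlongrightarrow> c t0 i) (at t0)" if "i < m" for i
    using DERIV_isCont[OF d[OF that]] by (simp add: isCont_def)
  have limh: "((\<lambda>t. h k t i) \<longlongrightarrow> c t0 i) (at t0)" if "i < m" for i k
    using lim[OF that] by (cases "i < k") (auto simp: h_def)
  have main: "k \<le> m \<Longrightarrow> ((\<lambda>t. g (h k t)) has_real_derivative (\<Sum>j<k. partial j g (c t0) * d j)) (at t0)" for k
  proof (induction k)
    case 0
    have "h 0 t = c t0" for t by (simp add: h_def)
    then show ?case by simp
  next
    case (Suc k)
    have upd: "h (Suc k) t = (h k t)(k := h (Suc k) t k)" for t
      by (auto simp: h_def fun_eq_iff less_Suc_eq)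
    have "\<forall>\<^sub>F t in at t0. c t \<in> En m" using c eventually_nhds_conv_at by blast
    then have "\<forall>\<^sub>F t in at t0. h k t \<in> En m"
      by eventually_elim (use c0 in \<open>auto simp: h_def En_iff\<close>)
    then obtain q where q: "\<forall>\<^sub>F t in at t0. g (h (Suc k) t) - g (h k t) = (h (Suc k) t k - h k t k) * q t"
       "(q \<longlongrightarrow> partial k g (c t0)) (at t0)"
      using mvt_quot[where F="at t0" and a="h (Suc k)" and b="h k", OF V g y _ upd] limh Suc.prems by auto
    have D: "((\<lambda>t. (c t k - c t0 k) / (t - t0) * q t) \<longlongrightarrow> d k * partial k g (c t0)) (at t0)"
    proof (rule tendsto_mult[OF _ q(2)])
      show "((\<lambda>t. (c t k - c t0 k) / (t - t0)) \<longlongrightarrow> d k) (at t0)"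
        using d[of k] Suc.prems unfolding has_field_derivative_iff by simp
    qed
    have "((\<lambda>t. g (h (Suc k) t) - g (h k t)) has_real_derivative d k * partial k g (c t0)) (at t0)"
      unfolding has_field_derivative_iff
    proof (rule Lim_transform_eventually[OF D])
      show "\<forall>\<^sub>F t in at t0. (c t k - c t0 k) / (t - t0) * q t =
        (g (h (Suc k) t) - g (h k t) - (g (h (Suc k) t0) - g (h k t0))) / (t - t0)"
        using q(1)
      proof eventually_elim
        case (elim t)
        have "h (Suc k) t0 = h k t0" by (auto simp: h_def)
        then show ?case using elim by (simp add: h_def)
      qed
    qed
    from DERIV_add[OF Suc.IH this] Suc.prems show ?case by (simp add: mult.commute)
  qed
  have hm: "c t \<in> En m \<Longrightarrow> h m t = c t" for t
    using c0 by (auto simp: h_def fun_eq_iff En_iff)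
  have "\<forall>\<^sub>F t in nhds t0. g (h m t) = g (c t)" using c by eventually_elim (simp add: hm)
  from DERIV_cong_ev[OF refl this refl] main[OF order_refl] show ?thesis by blast
qed

lemma continuous_on_E:
  assumes "\<And>j. j < m \<Longrightarrow> continuous_on W (\<lambda>x. F x j)" "F ` W \<subseteq> En m"
  shows "continuous_on W F"
proof (rule continuous_on_coordinatewise_then_product)
  fix i show "continuous_on W (\<lambda>x. F x i)"
  proof (cases "i < m")
    case False
    then have "F x i = 0" if "x \<in> W" for x using assms(2) that by (auto simp: En_iff)
    then have "continuous_on W (\<lambda>x. F x i) \<longleftrightarrow> continuous_on W (\<lambda>x. 0::real)"
      by (intro continuous_on_cong) auto
    then show ?thesis by simp
  qed (use assms in auto)
qed

lemma Ck_comp_partial: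
  assumes V: "openin (Euclidean_space m) V" and W: "openin (Euclidean_space n) W"
  shows "Ck_on m k V g \<Longrightarrow> (\<And>j. j < m \<Longrightarrow> Ck_on n k W (\<lambda>x. F x j)) \<Longrightarrow> F ` W \<subseteq> V
     \<Longrightarrow> Ck_on n k W (\<lambda>x. g (F x)) \<and> (k > 0 \<longrightarrow> (\<forall>x\<in>W. \<forall>i<n.
        ((\<lambda>t. g (F (x(i:=t)))) has_real_derivative (\<Sum>j<m. partial j g (F x) * partial i (\<lambda>x. F x j) x)) (at (x i))))"
proof (induction k arbitrary: g)
  case 0
  have "continuous_on W F"
    using 0 Ck_on_cont[OF _ openin_En_sub[OF W], of 0] openin_En_sub[OF V] by (intro continuous_on_E[of m]) blast+
  moreover have "continuous_on V g" using Ck_on_cont[OF 0(1) openin_En_sub[OF V]] .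
  ultimately have "continuous_on W (\<lambda>x. g (F x))" using 0(3) continuous_on_compose2 by blast
  then show ?case using Ck0[OF openin_En_sub[OF W]] by simp
next
  case (Suc k)
  have FE: "F ` W \<subseteq> En m" using Suc.prems(3) openin_En_sub[OF V] by blast
  have "continuous_on W F"
    using Suc.prems(2) FE Ck_on_cont[OF _ openin_En_sub[OF W], of "Suc k"] by (intro continuous_on_E[of m]) blast+
  moreover have "continuous_on V g" using Ck_on_cont[OF Suc.prems(1) openin_En_sub[OF V]] .
  ultimately have cont: "continuous_on W (\<lambda>x. g (F x))" using Suc.prems(3) continuous_on_compose2 by blast
  have der: "((\<lambda>t. g (F (x(i:=t)))) has_real_derivative (\<Sum>j<m. partial j g (F x) * partial i (\<lambda>x. F x j) x)) (at (x i))"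
    if xi: "x \<in> W" "i < n" for x i
  proof -
    have "((\<lambda>t. g (F (x(i:=t)))) has_real_derivative (\<Sum>j<m. partial j g (F (x(i:=x i))) * partial i (\<lambda>x. F x j) x)) (at (x i))"
    proof (rule C1_chain[OF V])
      show "Ck_on m (Suc 0) V g" using Suc.prems(1) Ck_on_le[of m "Suc k" V g "Suc 0"] by simp
      show "\<forall>\<^sub>F t in nhds (x i). F (x(i:=t)) \<in> En m"
        using eventually_line[OF W xi] by eventually_elim (use FE in auto)
    qed (use Suc.prems xi Ck_on_has_partial[OF Suc.prems(2)] in auto)
    then show ?thesis by simp
  qed
  have "Ck_on n (Suc k) W (\<lambda>x. g (F x))"
  proof (rule Ck_on_SucI(1)[OF W cont der])
    fix i assume i: "i < n"
    have "Ck_on n k W (\<lambda>x. partial j g (F x))" if "j < m" for j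
      using Suc.IH[OF Ck_on_partial[OF Suc.prems(1) that] Ck_on_SucD[OF Suc.prems(2)] Suc.prems(3)] by blast
    then show "Ck_on n k W (\<lambda>x. \<Sum>j<m. partial j g (F x) * partial i (\<lambda>x. F x j) x)"
      using Suc.prems(2) i by (intro Ck_sum[OF W] Ck_mult[OF W]) (auto intro: Ck_on_partial)
  qed auto
  then show ?case using der by blast
qed

lemma Ck_comp:
  assumes "openin (Euclidean_space m) V" "openin (Euclidean_space n) W"
    "Ck_on m k V g" "\<And>j. j < m \<Longrightarrow> Ck_on n k W (\<lambda>x. F x j)" "F ` W \<subseteq> V"
  shows "Ck_on n k W (\<lambda>x. g (F x))"
  using Ck_comp_partial[OF assms(1,2), of k g F] assms(3-5) by blast

lemma Ck_real_comp:
  assumes W: "openin (Euclidean_space n) W"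
    and HH: "\<And>h. h \<in> HH \<Longrightarrow> \<exists>h'\<in>HH. \<forall>u\<in>Dm. (h has_real_derivative h' u) (at u)"
  shows "h \<in> HH \<Longrightarrow> Ck_on n k W f \<Longrightarrow> f ` W \<subseteq> Dm \<Longrightarrow> Ck_on n k W (\<lambda>x. h (f x))"
proof (induction k arbitrary: h)
  case 0
  obtain h' where h': "\<And>u. u \<in> Dm \<Longrightarrow> (h has_real_derivative h' u) (at u)" using HH[OF 0(1)] by blast
  have "continuous_on Dm h" using DERIV_isCont[OF h'] by (simp add: continuous_at_imp_continuous_on)
  moreover have "continuous_on W f" using Ck_on_cont[OF 0(2) openin_En_sub[OF W]] .
  ultimately have "continuous_on W (\<lambda>x. h (f x))" using 0(3) continuous_on_compose2 by blast
  then show ?case using Ck0[OF openin_En_sub[OF W]] by simp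
next
  case (Suc k)
  obtain h' where h': "h' \<in> HH" "\<And>u. u \<in> Dm \<Longrightarrow> (h has_real_derivative h' u) (at u)" using HH Suc.prems by blast
  have "continuous_on Dm h" using DERIV_isCont[OF h'(2)] by (simp add: continuous_at_imp_continuous_on)
  moreover have "continuous_on W f" using Ck_on_cont[OF Suc.prems(2) openin_En_sub[OF W]] .
  ultimately have cont: "continuous_on W (\<lambda>x. h (f x))" using Suc.prems(3) continuous_on_compose2 by blast
  show ?case
  proof (rule Ck_on_SucI(1)[OF W cont, where D="\<lambda>i x. h' (f x) * partial i f x"])
    show "((\<lambda>t. h (f (x(i := t)))) has_real_derivative h' (f x) * partial i f x) (at (x i))" if "x \<in> W" "i < n" for x i
      by (rule DERIV_chain2[OF _ Ck_on_has_partial[OF Suc.prems(2) that]]) (use h'(2) Suc.prems(3) that in auto)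
    show "Ck_on n k W (\<lambda>x. h' (f x) * partial i f x)" if "i < n" for i
      by (intro Ck_mult[OF W] Suc.IH[OF h'(1) Ck_on_SucD[OF Suc.prems(2)] Suc.prems(3)] Ck_on_partial[OF Suc.prems(2) that])
  qed
qed

lemma Ck_inverse:
  assumes W: "openin (Euclidean_space n) W" and f: "Ck_on n k W f" "\<And>x. x \<in> W \<Longrightarrow> f x \<noteq> 0"
  shows "Ck_on n k W (\<lambda>x. inverse (f x))"
proof -
  define HH where "HH = {h. \<exists>c m. h = (\<lambda>u::real. c * inverse u ^ m)}"
  have inv: "inverse \<in> HH" unfolding HH_def by (rule CollectI, rule exI[of _ 1], rule exI[of _ 1]) auto
  have *: "\<exists>h'\<in>HH. \<forall>u\<in>-{0}. (h has_real_derivative h' u) (at u)" if hHH: "h \<in> HH" for h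
  proof -
    obtain c m where h: "h = (\<lambda>u::real. c * inverse u ^ m)" using hHH by (auto simp: HH_def)
    have "(h has_real_derivative (- c * m) * inverse u ^ (Suc m)) (at u)" if "u \<in> -{0}" for u
    proof (cases m)
      case (Suc l)
      show ?thesis unfolding h Suc
        by (rule DERIV_cong[OF DERIV_cmult[OF DERIV_power_Suc[OF DERIV_inverse]]]) (use that in \<open>auto simp: algebra_simps\<close>)
    qed (simp add: h)
    moreover have "(\<lambda>u. (- c * m) * inverse u ^ (Suc m)) \<in> HH"
      unfolding HH_def by (rule CollectI, rule exI, rule exI, rule refl)
    ultimately show ?thesis by (intro bexI ballI)
  qed
  show ?thesis by (rule Ck_real_comp[OF W * inv f(1)]) (use f(2) in auto)
qed

lemma smooth_on_subset: "smooth_on n W f \<Longrightarrow> W' \<subseteq> W \<Longrightarrow> smooth_on n W' f"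
  unfolding smooth_on_def by (blast intro: Ck_on_subset)

lemma smooth_on_cong:
  assumes "openin (Euclidean_space n) W" "smooth_on n W f" "\<And>x. x \<in> W \<Longrightarrow> f x = g x"
  shows "smooth_on n W g"
  unfolding smooth_on_def
proof
  fix k show "Ck_on n k W g"
    by (rule Ck_on_cong[OF assms(1), of f]) (use assms(2,3) in \<open>simp_all add: smooth_on_def\<close>)
qed

lemma smooth_on_local:
  assumes "W \<subseteq> En n"
    "\<And>x. x \<in> W \<Longrightarrow> \<exists>W'. openin (Euclidean_space n) W' \<and> x \<in> W' \<and> smooth_on n (W' \<inter> W) f"
  shows "smooth_on n W f"
  unfolding smooth_on_def
proof
  fix k show "Ck_on n k W f"
    by (rule Ck_on_local[OF assms(1)]) (use assms(2) in \<open>unfold smooth_on_def, blast\<close>)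
qed

lemma smooth_on_const: "openin (Euclidean_space n) W \<Longrightarrow> smooth_on n W (\<lambda>_. c)"
  by (simp add: smooth_on_def Ck_const)

lemma smooth_on_coord: "openin (Euclidean_space n) W \<Longrightarrow> smooth_on n W (\<lambda>x. x j)"
  by (simp add: smooth_on_def Ck_coord)

lemma smooth_on_add:
  "openin (Euclidean_space n) W \<Longrightarrow> smooth_on n W f \<Longrightarrow> smooth_on n W g \<Longrightarrow> smooth_on n W (\<lambda>x. f x + g x)"
  by (simp add: smooth_on_def Ck_add)

lemma smooth_on_mult:
  "openin (Euclidean_space n) W \<Longrightarrow> smooth_on n W f \<Longrightarrow> smooth_on n W g \<Longrightarrow> smooth_on n W (\<lambda>x. f x * g x)"
  by (simp add: smooth_on_def Ck_mult)

lemma smooth_on_diff: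
  assumes "openin (Euclidean_space n) W" "smooth_on n W f" "smooth_on n W g"
  shows "smooth_on n W (\<lambda>x. f x - g x)"
  using smooth_on_add[OF assms(1,2) smooth_on_mult[OF assms(1) smooth_on_const[OF assms(1), of "-1"] assms(3)]] by simp

lemma smooth_on_sum:
  assumes "openin (Euclidean_space n) W" "\<And>j. j \<in> J \<Longrightarrow> smooth_on n W (f j)"
  shows "smooth_on n W (\<lambda>x. \<Sum>j\<in>J. f j x)"
  using assms unfolding smooth_on_def by (simp add: Ck_sum)

lemma smooth_on_inverse:
  "openin (Euclidean_space n) W \<Longrightarrow> smooth_on n W f \<Longrightarrow> (\<And>x. x \<in> W \<Longrightarrow> f x \<noteq> 0)
    \<Longrightarrow> smooth_on n W (\<lambda>x. inverse (f x))"
  by (simp add: smooth_on_def Ck_inverse)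

lemma smooth_on_comp:
  assumes "openin (Euclidean_space m) V" "openin (Euclidean_space n) W"
    "smooth_on m V g" "\<And>j. j < m \<Longrightarrow> smooth_on n W (\<lambda>x. F x j)" "F ` W \<subseteq> V"
  shows "smooth_on n W (\<lambda>x. g (F x))"
  unfolding smooth_on_def
  by (rule allI, rule Ck_comp[OF assms(1,2) _ _ assms(5)]) (use assms(3,4) in \<open>simp_all add: smooth_on_def\<close>)

lemma smooth_on_partial:
  assumes "smooth_on n W f" "i < n" shows "smooth_on n W (partial i f)"
  using assms Ck_on_partial unfolding smooth_on_def by blast

lemma smooth_on_has_partial:
  assumes "smooth_on n W f" "x \<in> W" "i < n"
  shows "((\<lambda>t. f (x(i := t))) has_real_derivative partial i f x) (at (x i))"
  using Ck_on_has_partial[of n 0 W f x i] assms unfolding smooth_on_def by blast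

lemma smooth_on_cont: "smooth_on n W f \<Longrightarrow> W \<subseteq> En n \<Longrightarrow> continuous_on W f"
  unfolding smooth_on_def using Ck_on_cont by blast

lemma partial_add:
  assumes "smooth_on n W f" "smooth_on n W g" "x \<in> W" "i < n"
  shows "partial i (\<lambda>x. f x + g x) x = partial i f x + partial i g x"
  unfolding partial_def[of i "\<lambda>x. f x + g x"]
  by (rule DERIV_imp_deriv, rule DERIV_add[OF smooth_on_has_partial[OF assms(1,3,4)] smooth_on_has_partial[OF assms(2,3,4)]])

lemma partial_mult:
  assumes "smooth_on n W f" "smooth_on n W g" "x \<in> W" "i < n"
  shows "partial i (\<lambda>x. f x * g x) x = partial i f x * g x + f x * partial i g x"
  unfolding partial_def[of i "\<lambda>x. f x * g x"]
  by (rule DERIV_imp_deriv, rule DERIV_cong[OF DERIV_mult[OF smooth_on_has_partial[OF assms(1,3,4)] smooth_on_has_partial[OF assms(2,3,4)]]])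
     simp

lemma smooth_on_lower:
  assumes "k \<le> n"
  shows "smooth_on n W f \<Longrightarrow> smooth_on k (W \<inter> En k) f"
proof -
  have "Ck_on n l W f \<Longrightarrow> W \<subseteq> En n \<Longrightarrow> Ck_on k l (W \<inter> En k) f" for l f W
  proof (induction l arbitrary: f)
    case 0 then show ?case by (simp add: Ck0 continuous_on_subset)
  next
    case (Suc l)
    then show ?case using assms by (simp add: CkS) (meson Int_lower1 continuous_on_subset order_less_le_trans)
  qed
  note * = this
  assume "smooth_on n W f"
  then have "smooth_on n (W \<inter> En n) f" by (rule smooth_on_subset) auto
  then have "smooth_on k (W \<inter> En n \<inter> En k) f" using * unfolding smooth_on_def by blast
  moreover have "W \<inter> En n \<inter> En k = W \<inter> En k" using subset_Euclidean_space[of k n] assms by blast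
  ultimately show ?thesis by simp
qed

definition trunc :: "nat \<Rightarrow> (nat \<Rightarrow> real) \<Rightarrow> nat \<Rightarrow> real" where
  "trunc k x = (\<lambda>i. if i < k then x i else 0)"

lemma trunc_En [simp]: "trunc k x \<in> En k" by (simp add: trunc_def En_iff)
lemma trunc_id: "x \<in> En k \<Longrightarrow> trunc k x = x" by (auto simp: trunc_def En_iff fun_eq_iff)

lemma openin_preimage_E:
  assumes W: "openin (Euclidean_space n) W" and V: "openin (Euclidean_space m) V"
    and F: "\<And>j. j < m \<Longrightarrow> continuous_on W (\<lambda>x. F x j)" "F ` W \<subseteq> En m"
  shows "openin (Euclidean_space n) {x \<in> W. F x \<in> V}"
proof -
  have "continuous_on W F" by (rule continuous_on_E[OF F])
  then have "openin (top_of_set W) (W \<inter> F -` V)"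
    using continuous_openin_preimage[of W F "En m" V] F(2) V unfolding openin_En_alt by blast
  moreover have "W \<inter> F -` V = {x \<in> W. F x \<in> V}" by auto
  ultimately show ?thesis using W unfolding openin_En_alt by (metis openin_trans)
qed

lemma openin_trunc:
  assumes "openin (Euclidean_space k) W"
  shows "openin (Euclidean_space n) {x \<in> En n. trunc k x \<in> W}"
  by (rule openin_preimage_E[OF _ assms])
     (auto simp: trunc_def En_iff openin_En_alt intro: continuous_on_product_then_coordinatewise)

lemma smooth_on_trunc:
  assumes "openin (Euclidean_space k) W" "smooth_on k W f"
  shows "smooth_on n {x \<in> En n. trunc k x \<in> W} (\<lambda>x. f (trunc k x))"
proof (rule smooth_on_comp[OF assms(1) openin_trunc[OF assms(1)] assms(2)])
  show "smooth_on n {x \<in> En n. trunc k x \<in> W} (\<lambda>x. trunc k x j)" if "j < k" for j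
    using that smooth_on_coord[OF openin_trunc[OF assms(1)]] by (simp add: trunc_def)
qed auto

lemma poly_exp_tendsto_0: "((\<lambda>x. poly P x * exp (- x)) \<longlongrightarrow> 0) (at_top :: real filter)"
proof -
  have "((\<lambda>x. \<Sum>i\<le>degree P. Polynomial.coeff P i * (x ^ i / exp x)) \<longlongrightarrow> (\<Sum>i\<le>degree P. Polynomial.coeff P i * 0)) (at_top :: real filter)"
    by (intro tendsto_intros tendsto_power_div_exp_0)
  then show ?thesis by (simp add: poly_altdef sum_distrib_right sum_divide_distrib exp_minus field_simps)
qed

definition flat :: "real poly \<Rightarrow> real \<Rightarrow> real" where
  "flat P u = (if u > 0 then poly P (inverse u) * exp (- inverse u) else 0)"

lemma DERIV_flat: "(flat P has_real_derivative flat ((P - pderiv P) * [:0, 0, 1:]) u) (at u)"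
proof -
  consider "u > 0" | "u < 0" | "u = 0" by linarith
  then show ?thesis
  proof cases
    case 1
    have "((\<lambda>u. poly P (inverse u) * exp (- inverse u)) has_real_derivative flat ((P - pderiv P) * [:0, 0, 1:]) u) (at u)"
      using 1 by (auto intro!: derivative_eq_intros DERIV_chain2[OF poly_DERIV] simp: flat_def power2_eq_square algebra_simps)
    moreover have "\<forall>\<^sub>F v in nhds u. flat P v = poly P (inverse v) * exp (- inverse v)"
      using eventually_nhds_in_open[of "{0<..}" u] 1 by (auto elim!: eventually_mono simp: flat_def)
    ultimately show ?thesis using DERIV_cong_ev[OF refl _ refl] by fast
  next
    case 2
    have "((\<lambda>u. 0) has_real_derivative flat ((P - pderiv P) * [:0, 0, 1:]) u) (at u)"
      using 2 by (auto simp: flat_def)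
    moreover have "\<forall>\<^sub>F v in nhds u. flat P v = 0"
      using eventually_nhds_in_open[of "{..<0}" u] 2 by (auto elim!: eventually_mono simp: flat_def)
    ultimately show ?thesis using DERIV_cong_ev[OF refl _ refl] by fast
  next
    case 3
    have "((\<lambda>t. flat P t / t) \<longlongrightarrow> 0) (at_right 0)"
    proof (rule Lim_transform_eventually)
      show "((\<lambda>t. poly ([:0, 1:] * P) (inverse t) * exp (- inverse t)) \<longlongrightarrow> 0) (at_right (0::real))"
        by (rule filterlim_compose[OF poly_exp_tendsto_0 filterlim_inverse_at_top_right])
      show "\<forall>\<^sub>F t in at_right 0. poly ([:0, 1:] * P) (inverse t) * exp (- inverse t) = flat P t / t"
        using eventually_at_right_less[of "0::real"] by eventually_elim (simp add: flat_def field_simps)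
    qed
    moreover have "((\<lambda>t. flat P t / t) \<longlongrightarrow> 0) (at_left 0)"
    proof (rule Lim_transform_eventually[OF tendsto_const])
      show "\<forall>\<^sub>F t in at_left 0. 0 = flat P t / t"
        unfolding eventually_at_filter by (rule always_eventually) (simp add: flat_def)
    qed
    ultimately have "((\<lambda>t. flat P t / t) \<longlongrightarrow> 0) (at 0)"
      by (simp add: filterlim_split_at)
    then show ?thesis using 3 by (simp add: has_field_derivative_iff flat_def)
  qed
qed

lemma smooth_on_flat:
  assumes "openin (Euclidean_space n) W" "smooth_on n W f"
  shows "smooth_on n W (\<lambda>x. flat P (f x))"
  unfolding smooth_on_def
proof
  fix k
  show "Ck_on n k W (\<lambda>x. flat P (f x))"
    by (rule Ck_real_comp[OF assms(1), of "range flat" UNIV])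
       (use assms(2) DERIV_flat in \<open>auto simp: smooth_on_def\<close>)
qed

lemma bump_E:
  assumes W: "openin (Euclidean_space n) W" and p: "p \<in> W"
  shows "\<exists>bmp K r. smooth_on n (En n) bmp \<and> compactin (Euclidean_space n) K \<and> K \<subseteq> W \<and>
    (\<forall>x\<in>En n - K. bmp x = 0) \<and> r > 0 \<and> (\<forall>x\<in>cube n p r. bmp x = 1) \<and> cube n p r \<subseteq> K"
proof -
  obtain s where s: "s > 0" "cube n p s \<subseteq> W" using openin_E_cube[OF W p] by blast
  have pE: "p \<in> En n" using p openin_En_sub[OF W] by auto
  define N where "N x = (\<Sum>i<n. (x i - p i)^2)" for x
  define r where "r = s / 2"
  have r: "r > 0" using s by (simp add: r_def)
  define K where "K = {x \<in> En n. \<forall>i<n. \<bar>x i - p i\<bar> \<le> r}"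
  define e where "e = flat 1"
  define bmp where "bmp x = e (r^2 - N x) * inverse (e (r^2 - N x) + e (N x - r^2/4))" for x
  have e_pos: "e u > 0 \<longleftrightarrow> u > 0" "e u \<ge> 0" "e u = 0 \<longleftrightarrow> u \<le> 0" for u by (auto simp: e_def flat_def)
  have oE: "openin (Euclidean_space n) (En n)" by simp
  have sN: "smooth_on n (En n) N"
    unfolding N_def power2_eq_square
    by (intro smooth_on_sum smooth_on_mult smooth_on_diff smooth_on_coord smooth_on_const oE)
  have sbmp: "smooth_on n (En n) bmp"
    unfolding bmp_def
  proof (intro smooth_on_mult smooth_on_inverse smooth_on_add oE)
    show "smooth_on n (En n) (\<lambda>x. e (r^2 - N x))" "smooth_on n (En n) (\<lambda>x. e (N x - r^2/4))"
      unfolding e_def by (intro smooth_on_flat smooth_on_diff smooth_on_const sN oE)+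
    then show "smooth_on n (En n) (\<lambda>x. e (r^2 - N x))" by simp
    fix x :: "nat \<Rightarrow> real"
    have "r^2 > 0" using r by simp
    then have "r^2 - N x > 0 \<or> N x - r^2/4 > 0" by linarith
    then show "e (r^2 - N x) + e (N x - r^2/4) \<noteq> 0"
      using e_pos(1,2)[of "r^2 - N x"] e_pos(1,2)[of "N x - r^2/4"] by linarith
  qed
  have "compactin (Euclidean_space n) K"
  proof -
    define X where "X i = (if i < n then {p i - r..p i + r} else {0::real})" for i
    have "compactin (powertop_real UNIV) (PiE UNIV X)"
      by (auto simp: compactin_PiE X_def)
    moreover have "PiE UNIV X = K"
      by (auto simp: K_def X_def PiE_iff En_iff abs_le_iff split: if_splits) (smt (verit) atLeastAtMost_iff singletonD)+
    moreover have "K \<subseteq> {x. \<forall>i\<ge>n. x i = 0}" by (auto simp: K_def En_iff)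
    ultimately show ?thesis unfolding Euclidean_space_def compactin_subtopology by simp
  qed
  moreover have "K \<subseteq> W" using s r by (force simp: K_def cube_def r_def)
  moreover have "bmp x = 0" if "x \<in> En n - K" for x
  proof -
    obtain i where i: "i < n" "\<bar>x i - p i\<bar> > r" using \<open>x \<in> En n - K\<close> by (auto simp: K_def not_le)
    have "r^2 \<le> \<bar>x i - p i\<bar>^2" using i r by (intro power_mono) auto
    also have "\<dots> \<le> N x" unfolding N_def using i member_le_sum[of i "{..<n}" "\<lambda>i. (x i - p i)^2"] by simp
    finally show ?thesis using e_pos(3)[of "r^2 - N x"] by (simp add: bmp_def)
  qed
  moreover define q where "q = r / (2 * (1 + real n))"
  have q: "q > 0" "q \<le> r" using r by (auto simp: q_def field_simps)
  moreover have "bmp x = 1" if x: "x \<in> cube n p q" for x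
  proof -
    have "(x i - p i)^2 \<le> q^2" if "i < n" for i
      using that x power_mono[of "\<bar>x i - p i\<bar>" q 2] by (auto simp: cube_def)
    then have "N x \<le> real n * q^2" unfolding N_def using sum_bounded_above[of "{..<n}" "\<lambda>i. (x i - p i)^2" "q^2"] by auto
    also have "\<dots> \<le> (1 + real n)^2 * q^2"
      by (intro mult_right_mono) (auto simp: power2_eq_square algebra_simps)
    also have "\<dots> = ((1 + real n) * q)^2" by (simp add: power_mult_distrib)
    also have "(1 + real n) * q = r / 2" by (simp add: q_def field_simps)
    also have "(r / 2)^2 = r^2 / 4" by (simp add: power_divide)
    finally have *: "N x \<le> r^2/4" .
    moreover have "r^2 > 0" using r by simp
    ultimately have "N x - r^2/4 \<le> 0" "\<not> r^2 - N x \<le> 0" by linarith+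
    then have "e (N x - r^2/4) = 0" "e (r^2 - N x) \<noteq> 0" using e_pos(3) by auto
    then show ?thesis by (simp add: bmp_def)
  qed
  moreover have "cube n p q \<subseteq> K" using q by (force simp: cube_def K_def)
  ultimately show ?thesis using sbmp q(1) by blast
qed

lemma cont_line:
  assumes "openin (Euclidean_space n) V" "y \<in> V" "j < n" "continuous_on V f"
  shows "((\<lambda>t. f (y(j := t))) \<longlongrightarrow> f y) (at (y j))"
proof -
  have "continuous_on UNIV (\<lambda>t. (y(j := t)) i)" for i by (cases "i = j") auto
  then have "continuous_on UNIV (\<lambda>t. y(j := t))" by (rule continuous_on_coordinatewise_then_product)
  then have "isCont (\<lambda>t. y(j := t)) (y j)" by (simp add: continuous_on_eq_continuous_at)
  then have "((\<lambda>t. y(j := t)) \<longlongrightarrow> y) (at (y j))" unfolding isCont_def by simp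
  moreover have "\<forall>\<^sub>F t in at (y j). y(j := t) \<in> V"
    using eventually_line[OF assms(1-3)] eventually_nhds_conv_at by blast
  ultimately show ?thesis using continuous_on_tendsto_compose[OF assms(4) _ assms(2)] by blast
qed

lemma Hadamard_Ck:
  assumes r: "r > 0" and p: "p \<in> En n" and f: "Ck_on n k (cube n p r) f"
  shows "Ck_on n k (cube n p r) (\<lambda>x. integral {0..1} (\<lambda>t. t ^ m * f (\<lambda>i. p i + t * (x i - p i))))"
proof -
  define seg where "seg x t = (\<lambda>i. p i + t * (x i - p i))" for x and t :: real
  have seg: "seg x t \<in> cube n p r" if "x \<in> cube n p r" "t \<in> {0..1}" for x t
  proof -
    have "\<bar>t * (x i - p i)\<bar> < r" if "i < n" for i
    proof -
      have "\<bar>t * (x i - p i)\<bar> \<le> 1 * \<bar>x i - p i\<bar>" unfolding abs_mult using \<open>t \<in> _\<close> by (intro mult_right_mono) auto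
      then show ?thesis using \<open>x \<in> cube n p r\<close> that by (auto simp: cube_def)
    qed
    then show ?thesis using that p by (auto simp: cube_def seg_def En_iff)
  qed
  note W = openin_cube[of n p r]
  have cont2: "continuous_on (cube n p r \<times> {0..1}) (\<lambda>(x, t). t ^ m * f (seg x t))"
    if "continuous_on (cube n p r) f" for f m
  proof -
    have "continuous_on (cube n p r \<times> {0..1}) (\<lambda>z. seg (fst z) (snd z))"
      unfolding seg_def
      by (intro continuous_on_coordinatewise_then_product continuous_intros
          continuous_on_compose2[OF continuous_on_product_coordinates continuous_on_fst]) auto
    then have "continuous_on (cube n p r \<times> {0..1}) (\<lambda>z. f (seg (fst z) (snd z)))"
      by (rule continuous_on_compose2[OF that]) (use seg in auto)
    then show ?thesis unfolding split_beta by (intro continuous_intros)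
  qed
  have contI: "continuous_on (cube n p r) (\<lambda>x. integral {0..1} (\<lambda>t. t ^ m * f (seg x t)))"
    if "continuous_on (cube n p r) f" for f m
    using integral_continuous_on_param[of "cube n p r" 0 1 "\<lambda>x t. t ^ m * f (seg x t)"] cont2[OF that, of m] by simp
  have main: "Ck_on n k (cube n p r) f \<Longrightarrow> Ck_on n k (cube n p r) (\<lambda>x. integral {0..1} (\<lambda>t. t ^ m * f (seg x t)))" for f m
  proof (induction k arbitrary: f m)
    case 0
    then show ?case using contI by (simp add: Ck0[OF openin_En_sub[OF W]])
  next
    case (Suc k)
    have der: "((\<lambda>u. integral {0..1} (\<lambda>t. t ^ m * f (seg (x(i := u)) t))) has_real_derivative
         integral {0..1} (\<lambda>t. t ^ Suc m * partial i f (seg x t))) (at (x i))"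
      if xi: "x \<in> cube n p r" "i < n" for x i
    proof -
      define U where "U = {u. \<bar>u - p i\<bar> < r}"
      have U: "x(i := u) \<in> cube n p r" if "u \<in> U" for u
        using xi that by (auto simp: cube_def U_def intro: En_upd)
      have oU: "open U" "convex U" "x i \<in> U"
      proof -
        have "U = ball (p i) r" by (auto simp: U_def dist_real_def)
        then show "open U" "convex U" by auto
        show "x i \<in> U" using xi by (auto simp: U_def cube_def)
      qed
      have contf: "continuous_on (cube n p r) f" by (rule Ck_on_cont[OF Suc.prems openin_En_sub[OF W]])
      have contp: "continuous_on (cube n p r) (partial i f)"
        by (rule Ck_on_cont[OF Ck_on_partial[OF Suc.prems xi(2)] openin_En_sub[OF W]])
      have c1: "continuous_on (U \<times> {0..1::real}) (\<lambda>z. x(i := fst z))"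
      proof (rule continuous_on_coordinatewise_then_product)
        fix j show "continuous_on (U \<times> {0..1::real}) (\<lambda>z. (x(i := fst z)) j)"
          by (cases "i = j") (auto intro!: continuous_intros)
      qed
      have cu: "continuous_on (U \<times> {0..1::real}) (\<lambda>z. (x(i := fst z), snd z))"
        by (rule continuous_on_Pair[OF c1]) (intro continuous_intros)
      have "((\<lambda>u. integral (cbox 0 1) (\<lambda>t. t ^ m * f (seg (x(i := u)) t))) has_field_derivative
         integral (cbox 0 1) (\<lambda>t. t ^ Suc m * partial i f (seg (x(i := x i)) t))) (at (x i) within U)"
      proof (rule leibniz_rule_field_derivative[where f="\<lambda>u t. t ^ m * f (seg (x(i := u)) t)"
            and fx="\<lambda>u t. t ^ Suc m * partial i f (seg (x(i := u)) t)", OF _ _ _ oU(3,2)])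
        fix u and t :: real assume u: "u \<in> U" and "t \<in> cbox 0 1"
        then have t: "t \<in> {0..1}" by simp
        have eq: "seg (x(i := v)) t = (seg x t)(i := p i + t * (v - p i))" for v by (auto simp: seg_def)
        have "((\<lambda>v. f ((seg x t)(i := v))) has_real_derivative partial i f (seg (x(i:=u)) t)) (at (p i + t * (u - p i)))"
        proof -
          have e1: "(seg (x(i := u)) t)(i := v) = (seg x t)(i := v)" for v by (simp add: eq)
          have e2: "seg (x(i := u)) t i = p i + t * (u - p i)" by (simp add: seg_def)
          show ?thesis using Ck_on_has_partial[OF Suc.prems seg[OF U[OF u] t] xi(2)] unfolding e1 e2 .
        qed
        then have "((\<lambda>v. f ((seg x t)(i := p i + t * (v - p i)))) has_real_derivative partial i f (seg (x(i:=u)) t) * t) (at u)"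
          by (rule DERIV_chain2) (auto intro!: derivative_eq_intros)
        then have "((\<lambda>v. t ^ m * f (seg (x(i := v)) t)) has_real_derivative t ^ m * (partial i f (seg (x(i:=u)) t) * t)) (at u)"
          unfolding eq by (rule DERIV_cmult)
        then show "((\<lambda>v. t ^ m * f (seg (x(i := v)) t)) has_field_derivative t ^ Suc m * partial i f (seg (x(i := u)) t)) (at u within U)"
          by (rule has_field_derivative_at_within[OF DERIV_cong]) (simp add: mult_ac)
      next
        fix u assume "u \<in> U"
        have "continuous_on {0..1} (\<lambda>t. t ^ m * f (seg (x(i := u)) t))"
        proof -
          have c: "continuous_on {0..1::real} (\<lambda>t. (x(i := u), t))"
            by (rule continuous_on_Pair[OF continuous_on_const continuous_on_id])
          have s: "(\<lambda>t. (x(i := u), t)) ` {0..1} \<subseteq> cube n p r \<times> {0..1::real}"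
            using U[OF \<open>u \<in> U\<close>] by auto
          from continuous_on_compose2[OF cont2[OF contf, of m] c s]
          show ?thesis by (simp only: prod.case)
        qed
        then show "(\<lambda>t. t ^ m * f (seg (x(i := u)) t)) integrable_on cbox 0 1"
          by (simp add: integrable_continuous_real)
      next
        show "continuous_on (U \<times> cbox 0 1) (\<lambda>(u, t). t ^ Suc m * partial i f (seg (x(i := u)) t))"
        proof -
          have "(\<lambda>z. (x(i := fst z), snd z)) ` (U \<times> {0..1}) \<subseteq> cube n p r \<times> {0..1::real}"
            using U by auto
          from continuous_on_compose2[OF cont2[OF contp, of "Suc m"] cu this]
          show ?thesis by (simp only: prod.case split_beta' cbox_interval fst_conv snd_conv)
        qed
      qed
      then show ?thesis using at_within_open[OF oU(3,1)] by simp
    qed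
    have "continuous_on (cube n p r) (\<lambda>x. integral {0..1} (\<lambda>t. t ^ m * f (seg x t)))"
      by (rule contI[OF Ck_on_cont[OF Suc.prems openin_En_sub[OF W]]])
    then have "Ck_on n (Suc k) (cube n p r) (\<lambda>x. integral {0..1} (\<lambda>t. t ^ m * f (seg x t)))"
    proof (rule Ck_on_SucI(1)[OF W _ der])
      fix i assume "i < n"
      show "Ck_on n k (cube n p r) (\<lambda>x. integral {0..1} (\<lambda>t. t ^ Suc m * partial i f (seg x t)))"
        using Suc.IH[OF Ck_on_partial[OF Suc.prems \<open>i < n\<close>], of "Suc m"] .
    qed
    then show ?case .
  qed
  from main[OF f] show ?thesis unfolding seg_def .
qed

lemma Hadamard:
  assumes r: "r > 0" and p: "p \<in> En n" and f: "smooth_on n (cube n p r) f"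
  shows "\<exists>g. (\<forall>i<n. smooth_on n (cube n p r) (g i) \<and> g i p = partial i f p) \<and>
    (\<forall>x\<in>cube n p r. f x = f p + (\<Sum>i<n. (x i - p i) * g i x))"
proof -
  define seg where "seg x t = (\<lambda>i. p i + t * (x i - p i))" for x and t :: real
  define g where "g i x = integral {0..1} (\<lambda>t. t ^ 0 * partial i f (\<lambda>i. p i + t * (x i - p i)))" for i x
  have "smooth_on n (cube n p r) (g i)" if "i < n" for i
    unfolding smooth_on_def g_def
    using Hadamard_Ck[OF r p] smooth_on_partial[OF f that] unfolding smooth_on_def by blast
  moreover have "g i p = partial i f p" for i by (simp add: g_def)
  moreover have "f x = f p + (\<Sum>i<n. (x i - p i) * g i x)" if x: "x \<in> cube n p r" for x
  proof -
    have seg: "seg x t \<in> cube n p r" if "t \<in> {0..1}" for t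
    proof -
      have "\<bar>t * (x i - p i)\<bar> < r" if "i < n" for i
      proof -
        have "\<bar>t * (x i - p i)\<bar> \<le> 1 * \<bar>x i - p i\<bar>" unfolding abs_mult using \<open>t \<in> _\<close> by (intro mult_right_mono) auto
        then show ?thesis using x that by (auto simp: cube_def)
      qed
      then show ?thesis using x p by (auto simp: cube_def seg_def En_iff)
    qed
    have segE: "seg x t \<in> En n" for t using x p by (auto simp: cube_def seg_def En_iff)
    have cseg: "continuous_on {0..1} (seg x)"
      unfolding seg_def by (intro continuous_on_coordinatewise_then_product continuous_intros)
    have cont: "continuous_on {0..1} (\<lambda>t. partial i f (seg x t))" if "i < n" for i
      by (rule continuous_on_compose2[OF smooth_on_cont[OF smooth_on_partial[OF f that] openin_En_sub[OF openin_cube]] cseg])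
         (use seg in blast)
    have "((\<lambda>t. f (seg x t)) has_real_derivative (\<Sum>i<n. partial i f (seg x t) * (x i - p i))) (at t)" if "t \<in> {0..1}" for t
    proof (rule C1_chain[where m=n and V="cube n p r" and g=f and c="seg x" and d="\<lambda>j. x j - p j"])
      show "seg x t \<in> cube n p r" by (rule seg[OF that])
      show "Ck_on n (Suc 0) (cube n p r) f" using f by (simp add: smooth_on_def)
      show "((\<lambda>t. seg x t j) has_real_derivative x j - p j) (at t)" for j
        unfolding seg_def by (auto intro!: derivative_eq_intros)
    qed (simp_all add: segE openin_cube)
    then have "((\<lambda>t. \<Sum>i<n. partial i f (seg x t) * (x i - p i)) has_integral f (seg x 1) - f (seg x 0)) {0..1}"
      by (intro fundamental_theorem_of_calculus)
         (auto simp: has_real_derivative_iff_has_vector_derivative[symmetric] intro: has_field_derivative_at_within)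
    then have "f (seg x 1) - f (seg x 0) = integral {0..1} (\<lambda>t. \<Sum>i<n. partial i f (seg x t) * (x i - p i))"
      by (simp add: integral_unique)
    also have "\<dots> = (\<Sum>i<n. integral {0..1} (\<lambda>t. partial i f (seg x t) * (x i - p i)))"
      using cont by (intro integral_sum integrable_continuous_real continuous_intros) auto
    also have "\<dots> = (\<Sum>i<n. (x i - p i) * g i x)"
    proof (rule sum.cong[OF refl])
      fix i
      have "g i x = integral {0..1} (\<lambda>t. partial i f (seg x t))" by (simp add: g_def seg_def)
      then show "integral {0..1} (\<lambda>t. partial i f (seg x t) * (x i - p i)) = (x i - p i) * g i x"
        by (simp add: mult.commute)
    qed
    finally show ?thesis by (simp add: seg_def)
  qed
  ultimately show ?thesis by blast
qed

lemma exchange_E: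
  assumes W: "openin (Euclidean_space n) W" and p: "p \<in> W" and i: "i < n" and g: "smooth_on n W g"
    and nz: "partial i g p \<noteq> 0"
  shows "\<exists>r>0. cube n p r \<subseteq> W \<and> inj_on (\<lambda>x. x(i := g x)) (cube n p r) \<and>
    (\<forall>j<n. smooth_on n ((\<lambda>x. x(i := g x)) ` cube n p r) (\<lambda>y. inv_into (cube n p r) (\<lambda>x. x(i := g x)) y j))"
proof -
  have "continuous_on W (partial i g)" using smooth_on_cont[OF smooth_on_partial[OF g i] openin_En_sub[OF W]] .
  then have "openin (top_of_set W) (W \<inter> partial i g -` (-{0}))"
    by (intro continuous_openin_preimage_gen) auto
  then have "openin (Euclidean_space n) (W \<inter> partial i g -` (-{0}))"
    using W unfolding openin_En_alt by (metis openin_trans)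
  then obtain r where r: "r > 0" "cube n p r \<subseteq> W \<inter> partial i g -` (-{0})"
    using openin_E_cube[of n _ p] p nz by (metis ComplI IntI singletonD vimageI)
  define C where "C = cube n p r"
  have C: "openin (Euclidean_space n) C" unfolding C_def by (rule openin_cube)
  have CW: "C \<subseteq> W" and nzC: "\<And>x. x \<in> C \<Longrightarrow> partial i g x \<noteq> 0" using r by (auto simp: C_def)
  have gC: "smooth_on n C g" using smooth_on_subset[OF g CW] .
  define G where "G x = x(i := g x)" for x
  have inj: "inj_on G C"
  proof (rule inj_onI, rule ccontr)
    fix x y assume x: "x \<in> C" and y: "y \<in> C" and eq: "G x = G y" and ne: "x \<noteq> y"
    have y_eq: "y = x(i := y i)" using eq unfolding G_def by (metis fun_upd_triv fun_upd_upd)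
    then have nei: "x i \<noteq> y i" using ne by (metis fun_upd_triv)
    have line: "x(i := s) \<in> C" if "min (x i) (y i) \<le> s" "s \<le> max (x i) (y i)" for s
    proof -
      have "\<bar>x i - p i\<bar> < r" "\<bar>y i - p i\<bar> < r" using x y i by (auto simp: C_def cube_def)
      then have "\<bar>s - p i\<bar> < r" using that by (auto simp: min_def max_def split: if_splits)
      then show ?thesis using x i by (auto simp: C_def cube_def intro: En_upd)
    qed
    have "\<exists>z. min (x i) (y i) < z \<and> z < max (x i) (y i) \<and> g (x(i := x i)) - g (x(i := y i)) = (x i - y i) * partial i g (x(i := z))"
    proof (rule MVT_any[OF nei])
      fix s assume "min (x i) (y i) \<le> s" "s \<le> max (x i) (y i)"
      from smooth_on_has_partial[OF gC line[OF this] i]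
      show "((\<lambda>s. g (x(i := s))) has_real_derivative partial i g (x(i := s))) (at s)" by simp
    qed
    then obtain z where z: "min (x i) (y i) < z" "z < max (x i) (y i)" "g x - g y = (x i - y i) * partial i g (x(i := z))"
      using y_eq by auto
    have "g x = g y" using eq unfolding G_def by (metis fun_upd_same)
    then show False using z nei nzC[OF line[of z]] by simp
  qed
  define V where "V = G ` C"
  define K where "K = inv_into C G"
  have GE: "G ` C \<subseteq> En n" using openin_En_sub[OF C] i by (auto simp: G_def intro: En_upd)
  have contG: "continuous_map (subtopology (Euclidean_space n) T) (Euclidean_space n) G" if "T \<subseteq> C" for T
  proof -
    have "continuous_on C (\<lambda>x. G x j)" for j
      using smooth_on_cont[OF gC openin_En_sub[OF C]]
      by (cases "j = i") (auto simp: G_def intro: continuous_on_product_then_coordinatewise)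
    then have "continuous_on C G" by (rule continuous_on_coordinatewise_then_product)
    then show ?thesis unfolding cm_Euclidean_space_iff_continuous_on
      using that GE by (auto intro: continuous_on_subset)
  qed
  have openG: "openin (Euclidean_space n) (G ` T)" if "openin (Euclidean_space n) T" "T \<subseteq> C" for T
    by (rule invariance_of_domain_Euclidean_space[OF that(1) contG[OF that(2)] inj_on_subset[OF inj that(2)]])
  have V: "openin (Euclidean_space n) V" unfolding V_def by (rule openG[OF C]) simp
  have KV: "K y \<in> C" "G (K y) = y" if "y \<in> V" for y
    using inv_into_into[of y G C] f_inv_into_f[of y G C] that unfolding K_def V_def by blast+
  have KG: "K (G x) = x" if "x \<in> C" for x using inv_into_f_f[OF inj that] by (simp add: K_def)
  have Kj: "K y j = y j" if "y \<in> V" "j \<noteq> i" for y j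
    using KV(2)[OF that(1)] that(2) by (metis G_def fun_upd_other)
  have gK: "g (K y) = y i" if "y \<in> V" for y using KV(2)[OF that] by (metis G_def fun_upd_same)
  have contK: "continuous_on V (\<lambda>y. K y j)" for j
  proof -
    have "continuous_map (subtopology (Euclidean_space n) V) (subtopology (Euclidean_space n) C) K"
      unfolding continuous_map_def
    proof (intro conjI allI impI)
      show "K \<in> topspace (subtopology (Euclidean_space n) V) \<rightarrow> topspace (subtopology (Euclidean_space n) C)"
        using KV(1) openin_En_sub[OF C] by auto
      fix T assume "openin (subtopology (Euclidean_space n) C) T"
      then have T: "openin (Euclidean_space n) T" "T \<subseteq> C" using C by (auto simp: openin_open_subtopology)
      have "{x \<in> topspace (subtopology (Euclidean_space n) V). K x \<in> T} = G ` T"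
      proof (intro Set.set_eqI iffI)
        fix y assume "y \<in> {x \<in> topspace (subtopology (Euclidean_space n) V). K x \<in> T}"
        then have "y \<in> V" "K y \<in> T" by auto
        then show "y \<in> G ` T" using KV(2)[of y] by (metis imageI)
      next
        fix y assume "y \<in> G ` T"
        then obtain x where x: "x \<in> T" "y = G x" by blast
        then have "x \<in> C" using T(2) by blast
        then have "y \<in> V" "K y = x" using KG x(2) by (auto simp: V_def)
        then show "y \<in> {x \<in> topspace (subtopology (Euclidean_space n) V). K x \<in> T}"
          using x(1) openin_En_sub[OF V] by auto
      qed
      then show "openin (subtopology (Euclidean_space n) V) {x \<in> topspace (subtopology (Euclidean_space n) V). K x \<in> T}"
        using openG[OF T] image_mono[OF T(2), of G] openin_open_subtopology[OF V] by (simp add: V_def)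
    qed
    then have "continuous_map (subtopology (Euclidean_space n) V) (Euclidean_space n) K"
      using continuous_map_in_subtopology by blast
    then have "continuous_on V K" unfolding cm_Euclidean_space_iff_continuous_on
      using openin_En_sub[OF V] by (simp add: Int_absorb1)
    then show ?thesis by (rule continuous_on_product_then_coordinatewise)
  qed
  define D where "D j y = (if j = i then inverse (partial i g (K y)) else - partial j g (K y) * inverse (partial i g (K y)))" for j y
  have der: "((\<lambda>t. K (y(j := t)) i) has_real_derivative D j y) (at (y j))" if y: "y \<in> V" and j: "j < n" for y j
  proof -
    define x where "x = K y"
    define \<kappa> where "\<kappa> t = K (y(j := t)) i" for t
    have xC: "x \<in> C" using KV(1)[OF y] by (simp add: x_def)
    have xE: "x \<in> En n" using xC openin_En_sub[OF C] by auto
    have lk: "(\<kappa> \<longlongrightarrow> x i) (at (y j))"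
      using cont_line[OF V y j contK[of i]] by (simp add: \<kappa>_def[abs_def] x_def)
    have evV: "\<forall>\<^sub>F t in at (y j). y(j := t) \<in> V"
      using eventually_line[OF V y j] eventually_nhds_conv_at by blast
    have g1: "Ck_on n (Suc 0) C g" using gC by (simp add: smooth_on_def)
    have lim_id: "((\<lambda>t. t) \<longlongrightarrow> y j) (at (y j))" by (rule tendsto_ident_at)
    show ?thesis
    proof (cases "j = i")
      case True
      define a where "a t = x(i := \<kappa> t)" for t
      have "\<exists>q. (\<forall>\<^sub>F t in at (y j). g (a t) - g x = (a t i - x i) * q t) \<and> (q \<longlongrightarrow> partial i g x) (at (y j))"
      proof (rule mvt_quot[OF C g1 xC i])
        show "((\<lambda>t. a t l) \<longlongrightarrow> x l) (at (y j))" for l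
          using lk by (cases "l = i") (auto simp: a_def)
      qed (use xE in \<open>auto simp: a_def\<close>)
      then obtain q where q: "\<forall>\<^sub>F t in at (y j). g (a t) - g x = (a t i - x i) * q t"
        "(q \<longlongrightarrow> partial i g x) (at (y j))" by blast
      have "((\<lambda>t. inverse (q t)) \<longlongrightarrow> inverse (partial i g x)) (at (y j))"
        using tendsto_inverse[OF q(2) nzC[OF xC]] .
      moreover have "\<forall>\<^sub>F t in at (y j). q t \<noteq> 0" using tendsto_imp_eventually_ne[OF q(2) nzC[OF xC]] .
      then have "\<forall>\<^sub>F t in at (y j). inverse (q t) = (\<kappa> t - \<kappa> (y j)) / (t - y j)"
        using q(1) evV eventually_neq_at_within[of "y j"]
      proof eventually_elim
        case (elim t)
        have "K (y(j := t)) = a t"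
          using Kj[OF elim(3)] Kj[OF y] True by (auto simp: a_def \<kappa>_def x_def fun_eq_iff)
        then have "g (a t) = t" using gK[OF elim(3)] True by simp
        moreover have "g x = y j" using gK[OF y] True by (simp add: x_def)
        moreover have "\<kappa> (y j) = x i" by (simp add: \<kappa>_def x_def)
        ultimately have "t - y j = (\<kappa> t - \<kappa> (y j)) * q t" using elim(2) by (simp add: a_def)
        then show ?case using elim(1,4) by (simp add: field_simps)
      qed
      ultimately have "((\<lambda>t. (\<kappa> t - \<kappa> (y j)) / (t - y j)) \<longlongrightarrow> inverse (partial i g x)) (at (y j))"
        by (rule Lim_transform_eventually)
      then show ?thesis unfolding has_field_derivative_iff using True by (simp add: \<kappa>_def D_def x_def)
    next
      case False
      define b where "b t = x(j := t)" for t
      define a where "a t = (b t)(i := \<kappa> t)" for t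
      have xj: "x j = y j" using Kj[OF y False] by (simp add: x_def)
      have bE: "b t \<in> En n" for t using En_upd[OF xE j] by (simp add: b_def)
      have lb: "((\<lambda>t. b t l) \<longlongrightarrow> x l) (at (y j))" for l
        using lim_id xj by (cases "l = j") (auto simp: b_def)
      have la: "((\<lambda>t. a t l) \<longlongrightarrow> x l) (at (y j))" for l
        using lb lk by (cases "l = i") (auto simp: a_def)
      have "\<exists>q. (\<forall>\<^sub>F t in at (y j). g (a t) - g (b t) = (a t i - b t i) * q t) \<and> (q \<longlongrightarrow> partial i g x) (at (y j))"
        by (rule mvt_quot[OF C g1 xC i]) (use bE la lb in \<open>auto simp: a_def\<close>)
      then obtain q where q: "\<forall>\<^sub>F t in at (y j). g (a t) - g (b t) = (a t i - b t i) * q t"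
        "(q \<longlongrightarrow> partial i g x) (at (y j))" by blast
      have "\<exists>q. (\<forall>\<^sub>F t in at (y j). g (b t) - g x = (b t j - x j) * q t) \<and> (q \<longlongrightarrow> partial j g x) (at (y j))"
        by (rule mvt_quot[OF C g1 xC j]) (use xE lb in \<open>auto simp: b_def\<close>)
      then obtain q' where q': "\<forall>\<^sub>F t in at (y j). g (b t) - g x = (b t j - x j) * q' t"
        "(q' \<longlongrightarrow> partial j g x) (at (y j))" by blast
      have "((\<lambda>t. - q' t * inverse (q t)) \<longlongrightarrow> - partial j g x * inverse (partial i g x)) (at (y j))"
        by (intro tendsto_mult tendsto_minus tendsto_inverse q(2) q'(2) nzC[OF xC])
      moreover have "\<forall>\<^sub>F t in at (y j). q t \<noteq> 0" using tendsto_imp_eventually_ne[OF q(2) nzC[OF xC]] .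
      then have "\<forall>\<^sub>F t in at (y j). - q' t * inverse (q t) = (\<kappa> t - \<kappa> (y j)) / (t - y j)"
        using q(1) q'(1) evV eventually_neq_at_within[of "y j"]
      proof eventually_elim
        case (elim t)
        have "K (y(j := t)) l = a t l" for l
          using Kj[OF elim(4), of l] Kj[OF y, of l] by (cases "l = i") (auto simp: a_def b_def \<kappa>_def x_def)
        then have "K (y(j := t)) = a t" by blast
        then have "g (a t) = y i" using gK[OF elim(4)] False by auto
        moreover have "g x = y i" using gK[OF y] by (simp add: x_def)
        moreover have "\<kappa> (y j) = x i" by (simp add: \<kappa>_def x_def)
        ultimately have "(\<kappa> t - \<kappa> (y j)) * q t + (t - y j) * q' t = 0"
          using elim(2,3) False xj by (simp add: a_def b_def)
        then have "(\<kappa> t - \<kappa> (y j)) * q t = - q' t * (t - y j)" by (simp add: algebra_simps add_eq_0_iff)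
        then show ?case using elim(1,5) by (simp add: field_simps)
      qed
      ultimately have "((\<lambda>t. (\<kappa> t - \<kappa> (y j)) / (t - y j)) \<longlongrightarrow> - partial j g x * inverse (partial i g x)) (at (y j))"
        by (rule Lim_transform_eventually)
      then show ?thesis unfolding has_field_derivative_iff using False by (simp add: \<kappa>_def D_def x_def)
    qed
  qed
  have Ckj: "Ck_on n k V (\<lambda>y. K y j)" if "j \<noteq> i" for k j
    by (rule Ck_on_cong[OF V _ Ck_coord[OF V, of k j]]) (simp add: Kj that)
  have "Ck_on n k V (\<lambda>y. K y i)" for k
  proof (induction k)
    case 0 then show ?case using contK Ck0[OF openin_En_sub[OF V]] by simp
  next
    case (Suc k)
    have all: "Ck_on n k V (\<lambda>y. K y j)" for j using Suc Ckj by (cases "j = i") auto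
    have comp: "Ck_on n k V (\<lambda>y. partial j g (K y))" if "j < n" for j
      by (rule Ck_comp[OF C V _ all]) (use smooth_on_partial[OF gC that] KV(1) in \<open>auto simp: smooth_on_def\<close>)
    have inv: "Ck_on n k V (\<lambda>y. inverse (partial i g (K y)))"
      by (rule Ck_inverse[OF V comp[OF i]]) (use nzC KV in auto)
    show ?case
    proof (rule Ck_on_SucI(1)[OF V contK der])
      fix j assume j: "j < n"
      show "Ck_on n k V (D j)"
      proof (cases "j = i")
        case True then show ?thesis using inv by (simp add: D_def[abs_def])
      next
        case False
        have "Ck_on n k V (\<lambda>y. (-1) * partial j g (K y) * inverse (partial i g (K y)))"
          by (intro Ck_mult[OF V] Ck_const[OF V] comp j inv)
        then show ?thesis using False by (simp add: D_def[abs_def])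
      qed
    qed
  qed
  then have "smooth_on n V (\<lambda>y. K y j)" for j using Ckj unfolding smooth_on_def by (cases "j = i") auto
  then show ?thesis using r(1) CW inj unfolding V_def K_def G_def C_def by blast
qed

section \<open>Smooth functions and tangent vectors on manifolds\<close>

definition mfd_ok :: "'a mfd \<Rightarrow> bool" where
  "mfd_ok M \<longleftrightarrow> Hausdorff_space (mtop M) \<and>
     (\<forall>c\<in>atlas M. is_chart (mdim M) (mtop M) c) \<and>
     (\<Union>c\<in>atlas M. fst c) = pts M \<and>
     (\<forall>c\<in>atlas M. \<forall>d\<in>atlas M. transition_smooth (mdim M) c d)"

lemma smooth_manifold_imp_mfd_ok: "smooth_manifold M \<Longrightarrow> mfd_ok M"
  by (simp add: smooth_manifold_def mfd_ok_def)

lemma is_chartD: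
  assumes "is_chart n T (U, \<phi>)"
  shows "openin T U" "inj_on \<phi> U" "openin (Euclidean_space n) (\<phi> ` U)"
    "\<And>S. openin T S \<Longrightarrow> S \<subseteq> U \<Longrightarrow> openin (Euclidean_space n) (\<phi> ` S)"
    "\<And>W. openin (Euclidean_space n) W \<Longrightarrow> openin T {p \<in> U. \<phi> p \<in> W}"
    "\<And>p. p \<in> U \<Longrightarrow> p \<in> topspace T" "\<And>p. p \<in> U \<Longrightarrow> \<phi> p \<in> En n"
    "\<And>p. p \<in> U \<Longrightarrow> inv_into U \<phi> (\<phi> p) = p"
    "\<And>K. compactin (Euclidean_space n) K \<Longrightarrow> K \<subseteq> \<phi> ` U \<Longrightarrow> compactin T {p \<in> U. \<phi> p \<in> K}"
proof -
  have h: "openin T U" "openin (Euclidean_space n) (\<phi> ` U)"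
     "homeomorphic_map (subtopology T U) (subtopology (Euclidean_space n) (\<phi> ` U)) \<phi>"
    using assms by (auto simp: is_chart_def)
  have UT: "topspace (subtopology T U) = U" using openin_subset[OF h(1)] by auto
  show "openin T U" "openin (Euclidean_space n) (\<phi> ` U)" using h by auto
  show inj: "inj_on \<phi> U" using homeomorphic_imp_injective_map[OF h(3)] UT by simp
  show "openin (Euclidean_space n) (\<phi> ` S)" if "openin T S" "S \<subseteq> U" for S
  proof -
    have "openin (subtopology T U) S" using openin_open_subtopology[OF h(1)] that by simp
    then have "openin (subtopology (Euclidean_space n) (\<phi> ` U)) (\<phi> ` S)"
      using homeomorphic_imp_open_map[OF h(3)] by (simp add: open_map_def)
    then show ?thesis using openin_open_subtopology[OF h(2)] by blast
  qed
  show "openin T {p \<in> U. \<phi> p \<in> W}" if "openin (Euclidean_space n) W" for W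
  proof -
    have "continuous_map (subtopology T U) (Euclidean_space n) \<phi>"
      using homeomorphic_imp_continuous_map[OF h(3)] continuous_map_in_subtopology by blast
    then have "openin (subtopology T U) {p \<in> U. \<phi> p \<in> W}"
    proof -
      assume "continuous_map (subtopology T U) (Euclidean_space n) \<phi>"
      from openin_continuous_map_preimage[OF this that] show ?thesis unfolding UT .
    qed
    then show ?thesis using openin_open_subtopology[OF h(1)] by blast
  qed
  show "p \<in> topspace T" if "p \<in> U" for p using that openin_subset[OF h(1)] by auto
  show "\<phi> p \<in> En n" if "p \<in> U" for p using that openin_subset[OF h(2)] by auto
  show "inv_into U \<phi> (\<phi> p) = p" if "p \<in> U" for p using inv_into_f_f[OF inj that] .
  show "compactin T {p \<in> U. \<phi> p \<in> K}" if K: "compactin (Euclidean_space n) K" "K \<subseteq> \<phi> ` U" for K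
  proof -
    have "compactin (subtopology (Euclidean_space n) (\<phi> ` U)) K" using K by (simp add: compactin_subtopology)
    moreover have "\<phi> ` {p \<in> U. \<phi> p \<in> K} = K" using K(2) by auto
    ultimately have "compactin (subtopology T U) {p \<in> U. \<phi> p \<in> K}"
      using homeomorphic_map_compactness[OF h(3), of "{p \<in> U. \<phi> p \<in> K}"] UT by auto
    then show ?thesis by (simp add: compactin_subtopology)
  qed
qed

lemma transition_smoothD:
  "transition_smooth n (U, \<phi>) (V, \<psi>) \<Longrightarrow> i < n \<Longrightarrow> smooth_on n (\<phi> ` (U \<inter> V)) (\<lambda>x. \<psi> (inv_into U \<phi> x) i)"
  by (simp add: transition_smooth_def)

lemma chart_transfer:
  assumes c: "is_chart n T (U, \<phi>)" and d: "is_chart n T (V, \<psi>)" and t: "transition_smooth n (U, \<phi>) (V, \<psi>)"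
    and S: "openin T S" "S \<subseteq> U \<inter> V" and u: "smooth_on n (\<psi> ` S) (\<lambda>x. u (inv_into V \<psi> x))"
  shows "smooth_on n (\<phi> ` S) (\<lambda>x. u (inv_into U \<phi> x))"
proof -
  have oS: "openin (Euclidean_space n) (\<phi> ` S)" "openin (Euclidean_space n) (\<psi> ` S)"
    using is_chartD(4)[OF c S(1)] is_chartD(4)[OF d S(1)] S(2) by auto
  have "smooth_on n (\<phi> ` S) (\<lambda>x. u (inv_into V \<psi> (\<psi> (inv_into U \<phi> x))))"
  proof (rule smooth_on_comp[OF oS(2,1) u])
    show "smooth_on n (\<phi> ` S) (\<lambda>x. \<psi> (inv_into U \<phi> x) j)" if "j < n" for j
      by (rule smooth_on_subset[OF transition_smoothD[OF t that]]) (use S in auto)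
    show "(\<lambda>x. \<psi> (inv_into U \<phi> x)) ` \<phi> ` S \<subseteq> \<psi> ` S"
      using is_chartD(8)[OF c] S(2) by auto
  qed
  then show ?thesis
  proof (rule smooth_on_cong[OF oS(1)])
    fix x assume "x \<in> \<phi> ` S"
    then obtain p where "p \<in> U" "p \<in> V" "x = \<phi> p" using S(2) by blast
    then show "u (inv_into V \<psi> (\<psi> (inv_into U \<phi> x))) = u (inv_into U \<phi> x)"
      using is_chartD(8)[OF c] is_chartD(8)[OF d] by simp
  qed
qed

definition sm :: "'a mfd \<Rightarrow> 'a set \<Rightarrow> ('a \<Rightarrow> real) \<Rightarrow> bool" where
  "sm M S u \<longleftrightarrow> (\<forall>(U, \<phi>)\<in>atlas M. smooth_on (mdim M) (\<phi> ` (U \<inter> S)) (\<lambda>x. u (inv_into U \<phi> x)))"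

lemma mfd_chart: "mfd_ok M \<Longrightarrow> c \<in> atlas M \<Longrightarrow> is_chart (mdim M) (mtop M) c"
  by (simp add: mfd_ok_def)

lemma mfd_cover: "mfd_ok M \<Longrightarrow> p \<in> pts M \<Longrightarrow> \<exists>U \<phi>. (U, \<phi>) \<in> atlas M \<and> p \<in> U"
proof -
  assume "mfd_ok M" "p \<in> pts M"
  then have "p \<in> (\<Union>c\<in>atlas M. fst c)" by (simp add: mfd_ok_def)
  then obtain c where "c \<in> atlas M" "p \<in> fst c" by blast
  then show ?thesis by (intro exI[of _ "fst c"] exI[of _ "snd c"]) simp
qed

lemma atlas_max: "mfd_ok M \<Longrightarrow> c \<in> atlas M \<Longrightarrow> c \<in> max_atlas M"
  by (simp add: mfd_ok_def max_atlas_def)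

lemma max_chart: "c \<in> max_atlas M \<Longrightarrow> is_chart (mdim M) (mtop M) c"
  by (simp add: max_atlas_def)

lemma Cinf_iff:
  assumes M: "mfd_ok M"
  shows "f \<in> Cinf M \<longleftrightarrow> (\<forall>p. p \<notin> pts M \<longrightarrow> f p = 0) \<and> sm M (pts M) f"
proof -
  have "U \<inter> pts M = U" if "(U, \<phi>) \<in> atlas M" for U \<phi>
    using is_chartD(1)[OF mfd_chart[OF M that]] openin_subset by blast
  then have "(\<forall>(U, \<phi>)\<in>atlas M. smooth_on (mdim M) (\<phi> ` U) (\<lambda>x. f (inv_into U \<phi> x))) \<longleftrightarrow> sm M (pts M) f"
    unfolding sm_def by (intro ball_cong refl) (auto split: prod.splits)
  then show ?thesis unfolding Cinf_def by simp
qed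

lemma sm_mono: "sm M S u \<Longrightarrow> S' \<subseteq> S \<Longrightarrow> sm M S' u"
  unfolding sm_def by (clarify, rule smooth_on_subset) auto

lemma Cinf_sm: "mfd_ok M \<Longrightarrow> f \<in> Cinf M \<Longrightarrow> S \<subseteq> pts M \<Longrightarrow> sm M S f"
  by (auto simp: Cinf_iff intro: sm_mono)

lemma sm_open_img:
  assumes M: "mfd_ok M" and c: "(U, \<phi>) \<in> atlas M" and S: "openin (mtop M) S"
  shows "openin (Euclidean_space (mdim M)) (\<phi> ` (U \<inter> S))"
  by (rule is_chartD(4)[OF mfd_chart[OF M c] openin_Int[OF is_chartD(1)[OF mfd_chart[OF M c]] S]]) auto

lemma sm_cong:
  assumes M: "mfd_ok M" and S: "openin (mtop M) S" and u: "sm M S u" "\<And>p. p \<in> S \<Longrightarrow> u p = v p"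
  shows "sm M S v"
  unfolding sm_def
proof clarify
  fix U \<phi> assume c: "(U, \<phi>) \<in> atlas M"
  show "smooth_on (mdim M) (\<phi> ` (U \<inter> S)) (\<lambda>x. v (inv_into U \<phi> x))"
    by (rule smooth_on_cong[OF sm_open_img[OF M c S], of "\<lambda>x. u (inv_into U \<phi> x)"])
       (use u c is_chartD(8)[OF mfd_chart[OF M c]] in \<open>auto simp: sm_def\<close>)
qed

lemma smI:
  assumes M: "mfd_ok M" and S: "openin (mtop M) S"
    and *: "\<And>p. p \<in> S \<Longrightarrow> \<exists>U \<phi> S'. (U, \<phi>) \<in> max_atlas M \<and> openin (mtop M) S' \<and> p \<in> S' \<and> S' \<subseteq> U \<and>
        smooth_on (mdim M) (\<phi> ` S') (\<lambda>x. u (inv_into U \<phi> x))"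
  shows "sm M S u"
  unfolding sm_def
proof clarify
  fix V \<psi> assume d: "(V, \<psi>) \<in> atlas M"
  note dc = mfd_chart[OF M d]
  show "smooth_on (mdim M) (\<psi> ` (V \<inter> S)) (\<lambda>x. u (inv_into V \<psi> x))"
  proof (rule smooth_on_local[OF openin_En_sub[OF sm_open_img[OF M d S]]])
    fix x assume "x \<in> \<psi> ` (V \<inter> S)"
    then obtain p where p: "p \<in> V" "p \<in> S" "x = \<psi> p" by blast
    obtain U \<phi> S' where c: "(U, \<phi>) \<in> max_atlas M" and S': "openin (mtop M) S'" "p \<in> S'" "S' \<subseteq> U"
       and sm: "smooth_on (mdim M) (\<phi> ` S') (\<lambda>x. u (inv_into U \<phi> x))" using *[OF p(2)] by blast
    have t: "transition_smooth (mdim M) (V, \<psi>) (U, \<phi>)" using c d by (auto simp: max_atlas_def)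
    have oSV: "openin (mtop M) (S' \<inter> V)" using S'(1) is_chartD(1)[OF dc] by auto
    have "smooth_on (mdim M) (\<psi> ` (S' \<inter> V)) (\<lambda>x. u (inv_into V \<psi> x))"
    proof (rule chart_transfer[OF dc max_chart[OF c] t oSV])
      show "S' \<inter> V \<subseteq> V \<inter> U" using S'(3) by auto
      show "smooth_on (mdim M) (\<phi> ` (S' \<inter> V)) (\<lambda>x. u (inv_into U \<phi> x))" by (rule smooth_on_subset[OF sm]) auto
    qed
    moreover have "openin (Euclidean_space (mdim M)) (\<psi> ` (S' \<inter> V))" by (rule is_chartD(4)[OF dc oSV]) auto
    moreover have "x \<in> \<psi> ` (S' \<inter> V)" using p S' by auto
    ultimately show "\<exists>W'. openin (Euclidean_space (mdim M)) W' \<and> x \<in> W' \<and> smooth_on (mdim M) (W' \<inter> \<psi> ` (V \<inter> S)) (\<lambda>x. u (inv_into V \<psi> x))"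
      by (meson Int_lower1 smooth_on_subset)
  qed
qed

lemma smD:
  assumes M: "mfd_ok M" and S: "openin (mtop M) S" and u: "sm M S u" and c: "(U, \<phi>) \<in> max_atlas M"
  shows "smooth_on (mdim M) (\<phi> ` (U \<inter> S)) (\<lambda>x. u (inv_into U \<phi> x))"
proof -
  note cc = max_chart[OF c]
  have oUS: "openin (mtop M) (U \<inter> S)" using is_chartD(1)[OF cc] S by auto
  show ?thesis
  proof (rule smooth_on_local)
    show "\<phi> ` (U \<inter> S) \<subseteq> En (mdim M)" using is_chartD(7)[OF cc] by auto
    fix x assume "x \<in> \<phi> ` (U \<inter> S)"
    then obtain p where p: "p \<in> U" "p \<in> S" "x = \<phi> p" by blast
    obtain V \<psi> where d: "(V, \<psi>) \<in> atlas M" "p \<in> V" using mfd_cover[OF M is_chartD(6)[OF cc p(1)]] by blast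
    note dc = mfd_chart[OF M d(1)]
    have t: "transition_smooth (mdim M) (U, \<phi>) (V, \<psi>)" using c d by (auto simp: max_atlas_def)
    have oS: "openin (mtop M) (U \<inter> S \<inter> V)" using oUS is_chartD(1)[OF dc] by auto
    have "smooth_on (mdim M) (\<phi> ` (U \<inter> S \<inter> V)) (\<lambda>x. u (inv_into U \<phi> x))"
    proof (rule chart_transfer[OF cc dc t oS])
      have "smooth_on (mdim M) (\<psi> ` (V \<inter> S)) (\<lambda>x. u (inv_into V \<psi> x))" using u d(1) by (auto simp: sm_def)
      then show "smooth_on (mdim M) (\<psi> ` (U \<inter> S \<inter> V)) (\<lambda>x. u (inv_into V \<psi> x))"
        by (rule smooth_on_subset) auto
    qed auto
    moreover have "openin (Euclidean_space (mdim M)) (\<phi> ` (U \<inter> S \<inter> V))" by (rule is_chartD(4)[OF cc oS]) auto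
    moreover have "x \<in> \<phi> ` (U \<inter> S \<inter> V)" using p d by auto
    ultimately show "\<exists>W'. openin (Euclidean_space (mdim M)) W' \<and> x \<in> W' \<and> smooth_on (mdim M) (W' \<inter> \<phi> ` (U \<inter> S)) (\<lambda>x. u (inv_into U \<phi> x))"
      by (meson Int_lower1 smooth_on_subset)
  qed
qed

lemma sm_local:
  assumes M: "mfd_ok M" and S: "openin (mtop M) S"
    and *: "\<And>p. p \<in> S \<Longrightarrow> \<exists>S'. openin (mtop M) S' \<and> p \<in> S' \<and> sm M S' u"
  shows "sm M S u"
proof (rule smI[OF M S])
  fix p assume p: "p \<in> S"
  obtain S' where S': "openin (mtop M) S'" "p \<in> S'" "sm M S' u" using *[OF p] by blast
  have "p \<in> pts M" using openin_subset[OF S] p by auto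
  then obtain U \<phi> where c: "(U, \<phi>) \<in> atlas M" "p \<in> U" using mfd_cover[OF M] by blast
  have "openin (mtop M) (U \<inter> S')" using is_chartD(1)[OF mfd_chart[OF M c(1)]] S'(1) by auto
  then show "\<exists>U \<phi> S'. (U, \<phi>) \<in> max_atlas M \<and> openin (mtop M) S' \<and> p \<in> S' \<and> S' \<subseteq> U \<and>
        smooth_on (mdim M) (\<phi> ` S') (\<lambda>x. u (inv_into U \<phi> x))"
    using atlas_max[OF M c(1)] c(2) S' smD[OF M S'(1,3)] by (meson IntI Int_lower1)
qed

lemma sm_coord:
  assumes M: "mfd_ok M" and c: "(U, \<phi>) \<in> max_atlas M" and i: "i < mdim M"
  shows "sm M U (\<lambda>p. \<phi> p i)"
  unfolding sm_def
proof clarify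
  fix V \<psi> assume "(V, \<psi>) \<in> atlas M"
  then have "transition_smooth (mdim M) (V, \<psi>) (U, \<phi>)" using c by (auto simp: max_atlas_def)
  from transition_smoothD[OF this i] show "smooth_on (mdim M) (\<psi> ` (V \<inter> U)) (\<lambda>x. \<phi> (inv_into V \<psi> x) i)" .
qed

lemma sm_compose:
  assumes M: "mfd_ok M" and S: "openin (mtop M) S" and W: "openin (Euclidean_space m) W" and g: "smooth_on m W g"
    and u: "\<And>j. j < m \<Longrightarrow> sm M S (\<lambda>p. F p j)" and F: "F ` S \<subseteq> W"
  shows "sm M S (\<lambda>p. g (F p))"
  unfolding sm_def
proof clarify
  fix U \<phi> assume c: "(U, \<phi>) \<in> atlas M"
  have "smooth_on (mdim M) (\<phi> ` (U \<inter> S)) (\<lambda>x. g ((\<lambda>x. F (inv_into U \<phi> x)) x))"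
  proof (rule smooth_on_comp[OF W sm_open_img[OF M c S] g])
    show "smooth_on (mdim M) (\<phi> ` (U \<inter> S)) (\<lambda>x. F (inv_into U \<phi> x) j)" if "j < m" for j
      using u[OF that] c by (auto simp: sm_def)
    show "(\<lambda>x. F (inv_into U \<phi> x)) ` \<phi> ` (U \<inter> S) \<subseteq> W"
      using F is_chartD(8)[OF mfd_chart[OF M c]] by auto
  qed
  then show "smooth_on (mdim M) (\<phi> ` (U \<inter> S)) (\<lambda>x. g (F (inv_into U \<phi> x)))" by simp
qed

lemma sm_const: "mfd_ok M \<Longrightarrow> openin (mtop M) S \<Longrightarrow> sm M S (\<lambda>_. c)"
  by (auto simp: sm_def intro!: smooth_on_const sm_open_img)

lemma sm_add: "mfd_ok M \<Longrightarrow> openin (mtop M) S \<Longrightarrow> sm M S u \<Longrightarrow> sm M S v \<Longrightarrow> sm M S (\<lambda>p. u p + v p)"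
  unfolding sm_def by (clarify, rule smooth_on_add) (auto intro: sm_open_img)

lemma sm_mult: "mfd_ok M \<Longrightarrow> openin (mtop M) S \<Longrightarrow> sm M S u \<Longrightarrow> sm M S v \<Longrightarrow> sm M S (\<lambda>p. u p * v p)"
  unfolding sm_def by (clarify, rule smooth_on_mult) (auto intro: sm_open_img)

definition oneM :: "'a mfd \<Rightarrow> 'a \<Rightarrow> real" where
  "oneM M p = (if p \<in> pts M then 1 else 0)"

lemma sum_fun_app: "(\<Sum>i\<in>I. F i) x = (\<Sum>i\<in>I. F i x)" for F :: "'i \<Rightarrow> 'a \<Rightarrow> 'b::comm_monoid_add"
  by (induction I rule: infinite_finite_induct) auto

context
  fixes M :: "'a mfd"
  assumes M: "mfd_ok M"
begin

lemma CinfI: "(\<And>p. p \<notin> pts M \<Longrightarrow> f p = 0) \<Longrightarrow> sm M (pts M) f \<Longrightarrow> f \<in> Cinf M"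
  by (simp add: Cinf_iff[OF M])

lemma Cinf_zero_off: "f \<in> Cinf M \<Longrightarrow> p \<notin> pts M \<Longrightarrow> f p = 0"
  by (simp add: Cinf_iff[OF M])

lemma Cinf_localI:
  assumes "\<And>p. p \<notin> pts M \<Longrightarrow> f p = 0" "\<And>p. p \<in> pts M \<Longrightarrow> \<exists>S. openin (mtop M) S \<and> p \<in> S \<and> sm M S f"
  shows "f \<in> Cinf M"
  by (rule CinfI[OF assms(1) sm_local[OF M openin_topspace assms(2)]])

lemma Cinf_localI':
  assumes "\<And>p. p \<notin> pts M \<Longrightarrow> f p = 0"
    "\<And>p. p \<in> pts M \<Longrightarrow> \<exists>S g. openin (mtop M) S \<and> p \<in> S \<and> g \<in> Cinf M \<and> (\<forall>q\<in>S. f q = g q)"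
  shows "f \<in> Cinf M"
proof (rule Cinf_localI[OF assms(1)])
  fix p assume "p \<in> pts M"
  then obtain S g where S: "openin (mtop M) S" "p \<in> S" "g \<in> Cinf M" "\<And>q. q \<in> S \<Longrightarrow> f q = g q" using assms(2)[of p] by blast
  have "sm M S g" by (rule Cinf_sm[OF M S(3) openin_subset[OF S(1)]])
  then have "sm M S f" by (rule sm_cong[OF M S(1)]) (simp add: S(4))
  then show "\<exists>S. openin (mtop M) S \<and> p \<in> S \<and> sm M S f" using S by blast
qed auto

lemma Cinf_one: "oneM M \<in> Cinf M"
proof (rule CinfI)
  show "sm M (pts M) (oneM M)"
    by (rule sm_cong[OF M openin_topspace sm_const[OF M openin_topspace, of 1]]) (simp add: oneM_def)
qed (simp add: oneM_def)

lemma Cinf_add: "f \<in> Cinf M \<Longrightarrow> g \<in> Cinf M \<Longrightarrow> f + g \<in> Cinf M"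
  using sm_add[OF M openin_topspace, of f g] by (simp add: Cinf_iff[OF M] plus_fun_def)

lemma Cinf_mult: "f \<in> Cinf M \<Longrightarrow> g \<in> Cinf M \<Longrightarrow> f * g \<in> Cinf M"
  using sm_mult[OF M openin_topspace, of f g] by (simp add: Cinf_iff[OF M] times_fun_def)

lemma Cinf_scale: "f \<in> Cinf M \<Longrightarrow> c *\<^sub>R f \<in> Cinf M"
  using sm_mult[OF M openin_topspace sm_const[OF M openin_topspace, of c], of f] by (simp add: Cinf_iff[OF M] scaleR_fun_def)

lemma Cinf_zero: "0 \<in> Cinf M"
  using Cinf_scale[OF Cinf_one, of 0] by simp

lemma Cinf_minus: "f \<in> Cinf M \<Longrightarrow> - f \<in> Cinf M"
  using Cinf_scale[of f "-1"] by (simp add: scaleR_fun_def fun_Compl_def)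

lemma Cinf_diff: "f \<in> Cinf M \<Longrightarrow> g \<in> Cinf M \<Longrightarrow> f - g \<in> Cinf M"
  using Cinf_add[OF _ Cinf_minus, of f g] by simp

lemma Cinf_sum: "(\<And>i. i \<in> I \<Longrightarrow> F i \<in> Cinf M) \<Longrightarrow> (\<Sum>i\<in>I. F i) \<in> Cinf M"
  by (induction I rule: infinite_finite_induct) (auto intro: Cinf_zero Cinf_add)

lemma bump_M:
  assumes S: "openin (mtop M) S" and p: "p \<in> S"
  shows "\<exists>b\<in>Cinf M. \<exists>S1 S2. openin (mtop M) S1 \<and> openin (mtop M) S2 \<and> p \<in> S1 \<and> S1 \<subseteq> S \<and>
    (\<forall>q\<in>S1. b q = 1) \<and> (\<forall>q\<in>S2. b q = 0) \<and> pts M \<subseteq> S \<union> S2"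
proof -
  have "p \<in> pts M" using openin_subset[OF S] p by auto
  then obtain U \<phi> where c: "(U, \<phi>) \<in> atlas M" "p \<in> U" using mfd_cover[OF M] by blast
  note cc = mfd_chart[OF M c(1)]
  define n where "n = mdim M"
  note cc = cc[folded n_def]
  have oUS: "openin (mtop M) (U \<inter> S)" using is_chartD(1)[OF cc] S by auto
  have W: "openin (Euclidean_space n) (\<phi> ` (U \<inter> S))" by (rule is_chartD(4)[OF cc oUS]) auto
  obtain b K r where b: "smooth_on n (En n) b" "compactin (Euclidean_space n) K" "K \<subseteq> \<phi> ` (U \<inter> S)"
     "\<And>x. x \<in> En n - K \<Longrightarrow> b x = 0" "r > 0" "\<And>x. x \<in> cube n (\<phi> p) r \<Longrightarrow> b x = 1" "cube n (\<phi> p) r \<subseteq> K"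
    using bump_E[OF W, of "\<phi> p"] c(2) p by blast
  define K' where "K' = {q \<in> U. \<phi> q \<in> K}"
  have K'S: "K' \<subseteq> U \<inter> S"
  proof
    fix q assume q: "q \<in> K'"
    then obtain q' where q': "q' \<in> U \<inter> S" "\<phi> q = \<phi> q'" using b(3) by (auto simp: K'_def)
    then have "q = q'" using is_chartD(2)[OF cc] q by (auto simp: K'_def inj_on_def)
    then show "q \<in> U \<inter> S" using q' by simp
  qed
  have "compactin (mtop M) K'" unfolding K'_def by (rule is_chartD(9)[OF cc b(2)]) (use b(3) in auto)
  moreover have "Hausdorff_space (mtop M)" using M by (simp add: mfd_ok_def)
  ultimately have cl: "closedin (mtop M) K'" using compactin_imp_closedin by blast
  define S2 where "S2 = pts M - K'"
  have S2: "openin (mtop M) S2" using cl by (simp add: S2_def openin_diff)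
  define S1 where "S1 = {q \<in> U. \<phi> q \<in> cube n (\<phi> p) r}"
  have S1: "openin (mtop M) S1" unfolding S1_def by (rule is_chartD(5)[OF cc openin_cube])
  define \<beta> where "\<beta> q = (if q \<in> U then b (\<phi> q) else 0)" for q
  have z: "\<beta> q = 0" if "q \<in> S2" for q
    using that b(4)[of "\<phi> q"] is_chartD(7)[OF cc] by (auto simp: \<beta>_def S2_def K'_def)
  have "\<beta> \<in> Cinf M"
  proof (rule Cinf_localI)
    show "\<beta> q = 0" if "q \<notin> pts M" for q using that is_chartD(6)[OF cc] by (auto simp: \<beta>_def)
    fix q assume q: "q \<in> pts M"
    show "\<exists>S. openin (mtop M) S \<and> q \<in> S \<and> sm M S \<beta>"
    proof (cases "q \<in> U")
      case True
      have "sm M U (\<lambda>q. b (\<phi> q))"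
        by (rule sm_compose[OF M is_chartD(1)[OF cc] _ b(1)])
           (use sm_coord[OF M atlas_max[OF M c(1)]] is_chartD(7)[OF cc] in \<open>auto simp: n_def\<close>)
      then have "sm M U \<beta>" by (rule sm_cong[OF M is_chartD(1)[OF cc]]) (simp add: \<beta>_def)
      then show ?thesis using True is_chartD(1)[OF cc] by blast
    next
      case False
      then have "q \<in> S2" using q by (auto simp: S2_def K'_def)
      moreover have "sm M S2 \<beta>" by (rule sm_cong[OF M S2 sm_const[OF M S2, of 0]]) (simp add: z)
      ultimately show ?thesis using S2 by blast
    qed
  qed
  moreover have "p \<in> S1" using c(2) b(5) is_chartD(7)[OF cc c(2)] by (auto simp: S1_def in_cube)
  moreover have "S1 \<subseteq> S" using b(7) K'S by (auto simp: S1_def K'_def)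
  moreover have "\<forall>q\<in>S1. \<beta> q = 1" using b(6) by (auto simp: S1_def \<beta>_def)
  moreover have "pts M \<subseteq> S \<union> S2" using K'S by (auto simp: S2_def)
  ultimately show ?thesis using S1 S2 z by blast
qed

lemma extend_sm:
  assumes S: "openin (mtop M) S" and p: "p \<in> S" and u: "sm M S u"
  shows "\<exists>f\<in>Cinf M. \<exists>S1. openin (mtop M) S1 \<and> p \<in> S1 \<and> S1 \<subseteq> S \<and> (\<forall>q\<in>S1. f q = u q)"
proof -
  obtain b S1 S2 where b: "b \<in> Cinf M" "openin (mtop M) S1" "openin (mtop M) S2" "p \<in> S1" "S1 \<subseteq> S"
    "\<And>q. q \<in> S1 \<Longrightarrow> b q = 1" "\<And>q. q \<in> S2 \<Longrightarrow> b q = 0" "pts M \<subseteq> S \<union> S2"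
    using bump_M[OF S p] by blast
  define f where "f q = (if q \<in> S then b q * u q else 0)" for q
  have "f \<in> Cinf M"
  proof (rule Cinf_localI)
    show "f q = 0" if "q \<notin> pts M" for q using that openin_subset[OF S] by (auto simp: f_def)
    fix q assume q: "q \<in> pts M"
    have "sm M S (\<lambda>q. b q * u q)" by (rule sm_mult[OF M S Cinf_sm[OF M b(1) openin_subset[OF S]] u])
    then have "sm M S f" by (rule sm_cong[OF M S]) (simp add: f_def)
    moreover have "sm M S2 f" by (rule sm_cong[OF M b(3) sm_const[OF M b(3), of 0]]) (simp add: b(7) f_def)
    ultimately show "\<exists>S. openin (mtop M) S \<and> q \<in> S \<and> sm M S f" using q b(3,8) S by blast
  qed
  moreover have "\<forall>q\<in>S1. f q = u q" using b(5,6) by (auto simp: f_def)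
  ultimately show ?thesis using b(2,4,5) by blast
qed

lemma tan_add: "v \<in> tangent M p \<Longrightarrow> f \<in> Cinf M \<Longrightarrow> g \<in> Cinf M \<Longrightarrow> v (f + g) = v f + v g"
  by (simp add: tangent_def)
lemma tan_scale: "v \<in> tangent M p \<Longrightarrow> f \<in> Cinf M \<Longrightarrow> v (c *\<^sub>R f) = c * v f"
  by (simp add: tangent_def)
lemma tan_mult: "v \<in> tangent M p \<Longrightarrow> f \<in> Cinf M \<Longrightarrow> g \<in> Cinf M \<Longrightarrow> v (f * g) = v f * g p + f p * v g"
  by (simp add: tangent_def)
lemma tan_off: "v \<in> tangent M p \<Longrightarrow> f \<notin> Cinf M \<Longrightarrow> v f = 0"
  by (simp add: tangent_def)
lemma tan_zero: "v \<in> tangent M p \<Longrightarrow> v 0 = 0"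
  using tan_scale[of v p 0 0] Cinf_zero by simp
lemma tan_minus: "v \<in> tangent M p \<Longrightarrow> f \<in> Cinf M \<Longrightarrow> v (- f) = - v f"
  using tan_scale[of v p f "-1"] by (simp add: scaleR_fun_def fun_Compl_def)
lemma tan_diff: "v \<in> tangent M p \<Longrightarrow> f \<in> Cinf M \<Longrightarrow> g \<in> Cinf M \<Longrightarrow> v (f - g) = v f - v g"
  using tan_add[of v p f "- g"] tan_minus[of v p g] Cinf_minus[of g] by simp
lemma tan_sum: "v \<in> tangent M p \<Longrightarrow> (\<And>i. i \<in> I \<Longrightarrow> F i \<in> Cinf M) \<Longrightarrow> v (\<Sum>i\<in>I. F i) = (\<Sum>i\<in>I. v (F i))"
  by (induction I rule: infinite_finite_induct) (auto simp: tan_zero tan_add Cinf_sum)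
lemma tan_one: "v \<in> tangent M p \<Longrightarrow> p \<in> pts M \<Longrightarrow> v (oneM M) = 0"
proof -
  assume v: "v \<in> tangent M p" and p: "p \<in> pts M"
  have "oneM M * oneM M = oneM M" by (rule ext) (simp add: oneM_def)
  then show ?thesis using tan_mult[OF v Cinf_one Cinf_one] p by (simp add: oneM_def)
qed

lemma tan_local:
  assumes v: "v \<in> tangent M p" and S: "openin (mtop M) S" "p \<in> S" and f: "f \<in> Cinf M" "g \<in> Cinf M"
    and eq: "\<And>q. q \<in> S \<Longrightarrow> f q = g q"
  shows "v f = v g"
proof -
  obtain b S1 S2 where b: "b \<in> Cinf M" "openin (mtop M) S1" "openin (mtop M) S2" "p \<in> S1" "S1 \<subseteq> S"
    "\<And>q. q \<in> S1 \<Longrightarrow> b q = 1" "\<And>q. q \<in> S2 \<Longrightarrow> b q = 0" "pts M \<subseteq> S \<union> S2"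
    using bump_M[OF S] by blast
  have "b * (f - g) = 0"
  proof
    fix q show "(b * (f - g)) q = 0 q"
      using eq b(7,8) Cinf_zero_off[OF f(1)] Cinf_zero_off[OF f(2)] by (cases "q \<in> pts M"; cases "q \<in> S") auto
  qed
  then have "0 = v (b * (f - g))" using tan_zero[OF v] by simp
  also have "\<dots> = v (f - g)" using tan_mult[OF v b(1) Cinf_diff[OF f]] eq[OF S(2)] b(6)[OF b(4)] by simp
  finally show ?thesis using tan_diff[OF v f] by simp
qed

lemma tangent_zero: "0 \<in> tangent M p"
  by (simp add: tangent_def)

lemma tangent_add: "v \<in> tangent M p \<Longrightarrow> w \<in> tangent M p \<Longrightarrow> v + w \<in> tangent M p"
  by (auto simp: tangent_def algebra_simps)

lemma tangent_scale: "v \<in> tangent M p \<Longrightarrow> c *\<^sub>R v \<in> tangent M p"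
  by (auto simp: tangent_def algebra_simps)

lemma tangent_sum: "(\<And>i. i \<in> I \<Longrightarrow> F i \<in> tangent M p) \<Longrightarrow> (\<Sum>i\<in>I. F i) \<in> tangent M p"
  by (induction I rule: infinite_finite_induct) (auto intro: tangent_zero tangent_add)

lemma vfD: "X \<in> vfields M \<Longrightarrow> p \<in> pts M \<Longrightarrow> X p \<in> tangent M p"
  by (simp add: vfields_def)
lemma vf_off: "X \<in> vfields M \<Longrightarrow> p \<notin> pts M \<Longrightarrow> X p = 0"
  by (simp add: vfields_def)
lemma vf_Cinf: "X \<in> vfields M \<Longrightarrow> f \<in> Cinf M \<Longrightarrow> (\<lambda>p. X p f) \<in> Cinf M"
  by (simp add: vfields_def)
lemma vfI: "(\<And>p. p \<in> pts M \<Longrightarrow> X p \<in> tangent M p) \<Longrightarrow> (\<And>p. p \<notin> pts M \<Longrightarrow> X p = 0) \<Longrightarrow>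
   (\<And>f. f \<in> Cinf M \<Longrightarrow> (\<lambda>p. X p f) \<in> Cinf M) \<Longrightarrow> X \<in> vfields M"
  by (simp add: vfields_def)

lemma coords:
  assumes c: "(U, \<phi>) \<in> max_atlas M" and p: "p \<in> U"
  shows "\<exists>V X D. openin (mtop M) V \<and> p \<in> V \<and> V \<subseteq> U \<and>
    (\<forall>i<mdim M. X i \<in> Cinf M \<and> D i \<in> vfields M \<and> (\<forall>q\<in>V. X i q = \<phi> q i)) \<and>
    (\<forall>i<mdim M. \<forall>q\<in>V. \<forall>f\<in>Cinf M. D i q f = partial i (\<lambda>x. f (inv_into U \<phi> x)) (\<phi> q)) \<and>
    (\<forall>i<mdim M. \<forall>j<mdim M. \<forall>q\<in>V. D i q (X j) = (if i = j then 1 else 0)) \<and>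
    (\<forall>q\<in>V. \<forall>v\<in>tangent M q. \<forall>f\<in>Cinf M. v f = (\<Sum>i<mdim M. v (X i) * D i q f))"
proof -
  define n where "n = mdim M"
  note cc = max_chart[OF c, folded n_def]
  have oU: "openin (mtop M) U" by (rule is_chartD(1)[OF cc])
  have UM: "U \<subseteq> pts M" by (rule openin_subset[OF oU])
  note oW = is_chartD(3)[OF cc]
  obtain b S1 S2 where b: "b \<in> Cinf M" "openin (mtop M) S1" "openin (mtop M) S2" "p \<in> S1" "S1 \<subseteq> U"
    "\<And>q. q \<in> S1 \<Longrightarrow> b q = 1" "\<And>q. q \<in> S2 \<Longrightarrow> b q = 0" "pts M \<subseteq> U \<union> S2"
    using bump_M[OF oU p] by blast
  define X where "X i q = (if q \<in> U then b q * \<phi> q i else 0)" for i q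
  define D where "D i q f = (if q \<in> U \<and> f \<in> Cinf M then b q * partial i (\<lambda>x. f (inv_into U \<phi> x)) (\<phi> q) else 0)" for i q f
  have smU: "smooth_on n (\<phi> ` U) (\<lambda>x. f (inv_into U \<phi> x))" if "f \<in> Cinf M" for f
    using smD[OF M openin_topspace _ c, of f] that UM by (simp add: Cinf_iff[OF M] n_def Int_absorb2)
  have cut: "(\<lambda>q. if q \<in> U then b q * u q else 0) \<in> Cinf M" if "sm M U u" for u
  proof (rule Cinf_localI)
    show "(if q \<in> U then b q * u q else 0) = 0" if "q \<notin> pts M" for q using that UM by auto
    fix q assume q: "q \<in> pts M"
    have "sm M U (\<lambda>q. b q * u q)" by (rule sm_mult[OF M oU Cinf_sm[OF M b(1) UM] that])
    then have "sm M U (\<lambda>q. if q \<in> U then b q * u q else 0)" by (rule sm_cong[OF M oU]) simp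
    moreover have "sm M S2 (\<lambda>q. if q \<in> U then b q * u q else 0)"
      by (rule sm_cong[OF M b(3) sm_const[OF M b(3), of 0]]) (simp add: b(7))
    ultimately show "\<exists>S. openin (mtop M) S \<and> q \<in> S \<and> sm M S (\<lambda>q. if q \<in> U then b q * u q else 0)"
      using q b(3,8) oU by blast
  qed
  have XC: "X i \<in> Cinf M" if "i < n" for i
    using cut[OF sm_coord[OF M c that[unfolded n_def]]] by (simp add: X_def[abs_def])
  have XV: "X i q = \<phi> q i" if "q \<in> S1" for i q using that b(5,6) by (auto simp: X_def)
  have DT: "D i q \<in> tangent M q" if i: "i < n" for i q
  proof (cases "q \<in> U")
    case True
    have x: "\<phi> q \<in> \<phi> ` U" using True by simp
    have fq: "f (inv_into U \<phi> (\<phi> q)) = f q" for f :: "'a \<Rightarrow> real" using is_chartD(8)[OF cc True] by simp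
    have add: "D i q (f + g) = D i q f + D i q g" if "f \<in> Cinf M" "g \<in> Cinf M" for f g
      using partial_add[OF smU[OF that(1)] smU[OF that(2)] x i] that Cinf_add[OF that] True
      by (simp add: D_def plus_fun_def algebra_simps)
    have mult: "D i q (f * g) = D i q f * g q + f q * D i q g" if "f \<in> Cinf M" "g \<in> Cinf M" for f g
      using partial_mult[OF smU[OF that(1)] smU[OF that(2)] x i] that Cinf_mult[OF that] True fq
      by (simp add: D_def times_fun_def algebra_simps)
    have scale: "D i q (r *\<^sub>R f) = r * D i q f" if "f \<in> Cinf M" for f r
      using partial_mult[OF smooth_on_const[OF oW, of r] smU[OF that] x i] that Cinf_scale[OF that] True
      by (simp add: D_def scaleR_fun_def algebra_simps)
    show ?thesis using add mult scale by (auto simp: tangent_def D_def)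
  next
    case False
    then have "D i q = 0" by (auto simp: D_def fun_eq_iff)
    then show ?thesis using tangent_zero by simp
  qed
  have DV: "D i \<in> vfields M" if i: "i < n" for i
  proof (rule vfI)
    show "D i q \<in> tangent M q" for q by (rule DT[OF i])
    show "D i q = 0" if "q \<notin> pts M" for q using that UM by (auto simp: D_def fun_eq_iff)
    fix f assume f: "f \<in> Cinf M"
    have "sm M U (\<lambda>q. partial i (\<lambda>x. f (inv_into U \<phi> x)) (\<phi> q))"
      by (rule sm_compose[OF M oU oW smooth_on_partial[OF smU[OF f] i]])
         (use sm_coord[OF M c] n_def in auto)
    from cut[OF this] show "(\<lambda>p. D i p f) \<in> Cinf M" using f by (simp add: D_def)
  qed
  have Dp: "D i q f = partial i (\<lambda>x. f (inv_into U \<phi> x)) (\<phi> q)" if "q \<in> S1" "f \<in> Cinf M" for i q f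
    using that b(5,6) by (auto simp: D_def)
  have DX: "D i q (X j) = (if i = j then 1 else 0)" if "i < n" "j < n" "q \<in> S1" for i j q
  proof -
    have "partial i (\<lambda>x. X j (inv_into U \<phi> x)) (\<phi> q) = partial i (\<lambda>x. x j) (\<phi> q)"
    proof (rule partial_cong[OF is_chartD(4)[OF cc b(2,5)]])
      show "\<phi> q \<in> \<phi> ` S1" using that by simp
      show "X j (inv_into U \<phi> y) = y j" if "y \<in> \<phi> ` S1" for y
        using that b(5) is_chartD(8)[OF cc] XV by auto
    qed (use that in auto)
    then show ?thesis using Dp[OF that(3) XC[OF that(2)], of i] by (simp add: partial_coord)
  qed
  have exp: "v f = (\<Sum>i<n. v (X i) * D i q f)" if q: "q \<in> S1" and v: "v \<in> tangent M q" and f: "f \<in> Cinf M" for q v f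
  proof -
    have qU: "q \<in> U" using q b(5) by auto
    have qM: "q \<in> pts M" using qU UM by auto
    obtain r where r: "r > 0" "cube n (\<phi> q) r \<subseteq> \<phi> ` S1"
      using openin_E_cube[OF is_chartD(4)[OF cc b(2,5)]] q by blast
    have CU: "cube n (\<phi> q) r \<subseteq> \<phi> ` U" using r b(5) by auto
    obtain g where g: "\<And>i. i < n \<Longrightarrow> smooth_on n (cube n (\<phi> q) r) (g i)"
       "\<And>i. i < n \<Longrightarrow> g i (\<phi> q) = partial i (\<lambda>x. f (inv_into U \<phi> x)) (\<phi> q)"
       "\<And>x. x \<in> cube n (\<phi> q) r \<Longrightarrow> f (inv_into U \<phi> x) = f (inv_into U \<phi> (\<phi> q)) + (\<Sum>i<n. (x i - \<phi> q i) * g i x)"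
      using Hadamard[OF r(1) is_chartD(7)[OF cc qU] smooth_on_subset[OF smU[OF f] CU]] by blast
    define V where "V = {q' \<in> U. \<phi> q' \<in> cube n (\<phi> q) r}"
    have V: "openin (mtop M) V" unfolding V_def by (rule is_chartD(5)[OF cc openin_cube])
    have qV: "q \<in> V" using qU r(1) is_chartD(7)[OF cc qU] by (auto simp: V_def in_cube)
    have VS: "V \<subseteq> S1"
    proof
      fix q' assume "q' \<in> V"
      then obtain q'' where "q'' \<in> S1" "\<phi> q' = \<phi> q''" "q' \<in> U" using r(2) by (auto simp: V_def)
      then show "q' \<in> S1" using is_chartD(2)[OF cc] b(5) by (metis inj_onD subsetD)
    qed
    have "sm M V (\<lambda>q'. g i (\<phi> q'))" if "i < n" for i
      by (rule sm_compose[OF M V openin_cube g(1)[OF that]])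
         (use sm_mono[OF sm_coord[OF M c]] in \<open>auto simp: V_def n_def\<close>)
    then have "\<forall>i\<in>{..<n}. \<exists>h. h \<in> Cinf M \<and> (\<exists>S. openin (mtop M) S \<and> q \<in> S \<and> S \<subseteq> V \<and> (\<forall>q'\<in>S. h q' = g i (\<phi> q')))"
      using extend_sm[OF V qV] by (metis lessThan_iff)
    then obtain G where "\<forall>i\<in>{..<n}. G i \<in> Cinf M \<and> (\<exists>S. openin (mtop M) S \<and> q \<in> S \<and> S \<subseteq> V \<and> (\<forall>q'\<in>S. G i q' = g i (\<phi> q')))"
      by (rule bchoice[THEN exE])
    then have G: "\<And>i. i < n \<Longrightarrow> G i \<in> Cinf M"
      and exS: "\<forall>i\<in>{..<n}. \<exists>S. openin (mtop M) S \<and> q \<in> S \<and> S \<subseteq> V \<and> (\<forall>q'\<in>S. G i q' = g i (\<phi> q'))" by auto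
    from exS obtain S where "\<forall>i\<in>{..<n}. openin (mtop M) (S i) \<and> q \<in> S i \<and> S i \<subseteq> V \<and> (\<forall>q'\<in>S i. G i q' = g i (\<phi> q'))"
      by (rule bchoice[THEN exE])
    then have S: "\<And>i. i < n \<Longrightarrow> openin (mtop M) (S i) \<and> q \<in> S i \<and> (\<forall>q'\<in>S i. G i q' = g i (\<phi> q'))"
      by blast
    define S0 where "S0 = V \<inter> (\<Inter>i\<in>{..<n}. S i)"
    have S0: "openin (mtop M) S0" "q \<in> S0"
    proof -
      have "openin (mtop M) (\<Inter>(insert V (S ` {..<n})))" using V S by (intro openin_Inter) auto
      then show "openin (mtop M) S0" by (simp add: S0_def)
      show "q \<in> S0" using qV S by (auto simp: S0_def)
    qed
    define h where "h = f q *\<^sub>R oneM M + (\<Sum>i<n. (X i - \<phi> q i *\<^sub>R oneM M) * G i)"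
    have hi: "(X i - \<phi> q i *\<^sub>R oneM M) * G i \<in> Cinf M" if "i < n" for i
      using that by (intro Cinf_mult Cinf_diff Cinf_scale Cinf_one XC G)
    have hC: "(\<Sum>i<n. (X i - \<phi> q i *\<^sub>R oneM M) * G i) \<in> Cinf M" by (rule Cinf_sum) (use hi in auto)
    have h: "h \<in> Cinf M" unfolding h_def by (intro Cinf_add Cinf_scale Cinf_one hC)
    have "v f = v h"
    proof (rule tan_local[OF v S0 f h])
      fix q' assume q': "q' \<in> S0"
      have U': "q' \<in> U" and cq: "\<phi> q' \<in> cube n (\<phi> q) r" and qS: "q' \<in> S1" using q' VS by (auto simp: S0_def V_def)
      have Gq: "G i q' = g i (\<phi> q')" if "i < n" for i using S[OF that] q' that by (auto simp: S0_def)
      have "f q' = f q + (\<Sum>i<n. (\<phi> q' i - \<phi> q i) * g i (\<phi> q'))"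
        using g(3)[OF cq] is_chartD(8)[OF cc U'] is_chartD(8)[OF cc qU] by simp
      moreover have "q' \<in> pts M" using U' UM by auto
      ultimately show "f q' = h q'" using Gq XV[OF qS] by (simp add: h_def sum_fun_app oneM_def)
    qed
    also have "\<dots> = (\<Sum>i<n. v ((X i - \<phi> q i *\<^sub>R oneM M) * G i))"
      using tan_add[OF v Cinf_scale[OF Cinf_one] hC] tan_scale[OF v Cinf_one] tan_one[OF v qM] tan_sum[OF v, of "{..<n}"] hi
      by (simp add: h_def)
    also have "\<dots> = (\<Sum>i<n. v (X i) * D i q f)"
    proof (rule sum.cong[OF refl])
      fix i assume "i \<in> {..<n}"
      then have i: "i < n" by simp
      have "v ((X i - \<phi> q i *\<^sub>R oneM M) * G i) = v (X i - \<phi> q i *\<^sub>R oneM M) * G i q + (X i q - \<phi> q i) * v (G i)"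
        using tan_mult[OF v Cinf_diff[OF XC[OF i] Cinf_scale[OF Cinf_one]] G[OF i]] qM by (simp add: oneM_def)
      also have "\<dots> = v (X i) * g i (\<phi> q)"
        using tan_diff[OF v XC[OF i] Cinf_scale[OF Cinf_one]] tan_scale[OF v Cinf_one] tan_one[OF v qM] XV[OF q] S[OF i] by auto
      finally show "v ((X i - \<phi> q i *\<^sub>R oneM M) * G i) = v (X i) * D i q f" using g(2)[OF i] Dp[OF q f] by simp
    qed
    finally show ?thesis .
  qed
  show ?thesis unfolding n_def[symmetric]
    by (rule exI[of _ S1], rule exI[of _ X], rule exI[of _ D]) (use b(2,4,5) XC DV XV Dp DX exp in auto)
qed

end

section \<open>Smooth maps, products and related vector fields\<close>

definition coord_frame ::
  "'a mfd \<Rightarrow> 'a set \<Rightarrow> ('a \<Rightarrow> nat \<Rightarrow> real) \<Rightarrow> 'a set \<Rightarrow> (nat \<Rightarrow> 'a \<Rightarrow> real) \<Rightarrow> (nat \<Rightarrow> 'a vfield) \<Rightarrow> bool" where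
  "coord_frame M U \<phi> V X D \<longleftrightarrow> openin (mtop M) V \<and> V \<subseteq> U \<and>
    (\<forall>i<mdim M. X i \<in> Cinf M \<and> D i \<in> vfields M \<and> (\<forall>q\<in>V. X i q = \<phi> q i)) \<and>
    (\<forall>i<mdim M. \<forall>q\<in>V. \<forall>f\<in>Cinf M. D i q f = partial i (\<lambda>x. f (inv_into U \<phi> x)) (\<phi> q)) \<and>
    (\<forall>i<mdim M. \<forall>j<mdim M. \<forall>q\<in>V. D i q (X j) = (if i = j then 1 else 0)) \<and>
    (\<forall>q\<in>V. \<forall>v\<in>tangent M q. \<forall>f\<in>Cinf M. v f = (\<Sum>i<mdim M. v (X i) * D i q f))"

lemma coord_frame_ex:
  assumes "mfd_ok M" "(U, \<phi>) \<in> max_atlas M" "p \<in> U"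
  shows "\<exists>V X D. coord_frame M U \<phi> V X D \<and> p \<in> V"
  using coords[OF assms]
proof (elim exE conjE, goal_cases)
  case (1 V X D)
  then show ?case by (intro exI[of _ V] exI[of _ X] exI[of _ D] conjI) (simp_all only: coord_frame_def simp_thms)
qed

lemma coord_frameD:
  assumes "coord_frame M U \<phi> V X D"
  shows "openin (mtop M) V" "V \<subseteq> U"
    "\<And>i. i < mdim M \<Longrightarrow> X i \<in> Cinf M" "\<And>i. i < mdim M \<Longrightarrow> D i \<in> vfields M"
    "\<And>i q. i < mdim M \<Longrightarrow> q \<in> V \<Longrightarrow> X i q = \<phi> q i"
    "\<And>i q f. i < mdim M \<Longrightarrow> q \<in> V \<Longrightarrow> f \<in> Cinf M \<Longrightarrow> D i q f = partial i (\<lambda>x. f (inv_into U \<phi> x)) (\<phi> q)"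
    "\<And>i j q. i < mdim M \<Longrightarrow> j < mdim M \<Longrightarrow> q \<in> V \<Longrightarrow> D i q (X j) = (if i = j then 1 else 0)"
    "\<And>q v f. q \<in> V \<Longrightarrow> v \<in> tangent M q \<Longrightarrow> f \<in> Cinf M \<Longrightarrow> v f = (\<Sum>i<mdim M. v (X i) * D i q f)"
  using assms unfolding coord_frame_def by blast+

lemma Cinf_chart: "f \<in> Cinf M \<Longrightarrow> (U, \<phi>) \<in> atlas M \<Longrightarrow> smooth_on (mdim M) (\<phi> ` U) (\<lambda>x. f (inv_into U \<phi> x))"
  by (auto simp: Cinf_def)

definition Cmap :: "'a mfd \<Rightarrow> 'b mfd \<Rightarrow> ('a \<Rightarrow> 'b) \<Rightarrow> bool" where
  "Cmap M N F \<longleftrightarrow> continuous_map (mtop M) (mtop N) F \<and> (\<forall>f\<in>Cinf N. pull0 M F f \<in> Cinf M)"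

lemma Cmap_pts: "Cmap M N F \<Longrightarrow> p \<in> pts M \<Longrightarrow> F p \<in> pts N"
  by (auto simp: Cmap_def continuous_map_def)

lemma Cmap_pull: "Cmap M N F \<Longrightarrow> f \<in> Cinf N \<Longrightarrow> pull0 M F f \<in> Cinf M"
  by (simp add: Cmap_def)

lemma Cmap_open: "Cmap M N F \<Longrightarrow> openin (mtop N) S \<Longrightarrow> openin (mtop M) {p \<in> pts M. F p \<in> S}"
  unfolding Cmap_def by (elim conjE) (rule openin_continuous_map_preimage)

lemma pull0_comp: "Cmap M N F \<Longrightarrow> pull0 M F (pull0 N H h) = pull0 M (\<lambda>x. H (F x)) h"
  by (rule ext) (auto simp: pull0_def dest: Cmap_pts)

lemma Cmap_comp: "Cmap M N F \<Longrightarrow> Cmap N L H \<Longrightarrow> Cmap M L (\<lambda>x. H (F x))"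
  unfolding Cmap_def[of M L]
proof (intro conjI ballI)
  assume F: "Cmap M N F" and H: "Cmap N L H"
  show "continuous_map (mtop M) (mtop L) (\<lambda>x. H (F x))"
    using continuous_map_compose[of "mtop M" "mtop N" F "mtop L" H] F H by (simp add: Cmap_def o_def)
  fix f assume "f \<in> Cinf L"
  then have "pull0 M F (pull0 N H f) \<in> Cinf M" by (intro Cmap_pull[OF F] Cmap_pull[OF H])
  then show "pull0 M (\<lambda>x. H (F x)) f \<in> Cinf M" by (simp add: pull0_comp[OF F])
qed

lemma Cmap_id: "mfd_ok M \<Longrightarrow> Cmap M M (\<lambda>x. x)"
proof -
  assume M: "mfd_ok M"
  have "pull0 M (\<lambda>x. x) f = f" if "f \<in> Cinf M" for f
    using Cinf_zero_off[OF M that] by (auto simp: pull0_def)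
  then show ?thesis by (simp add: Cmap_def continuous_map_id[unfolded id_def])
qed

lemma pull0_const: "pull0 M (\<lambda>_. c) f = f c *\<^sub>R oneM M"
  by (rule ext) (simp add: pull0_def oneM_def)

lemma Cmap_const: "mfd_ok M \<Longrightarrow> c \<in> pts N \<Longrightarrow> Cmap M N (\<lambda>_. c)"
  unfolding Cmap_def by (simp add: pull0_const Cinf_scale Cinf_one)

lemma pull0_add: "pull0 M F (f + g) = pull0 M F f + pull0 M F g"
  by (rule ext) (simp add: pull0_def)
lemma pull0_mult: "pull0 M F (f * g) = pull0 M F f * pull0 M F g"
  by (rule ext) (simp add: pull0_def)
lemma pull0_scale: "pull0 M F (c *\<^sub>R f) = c *\<^sub>R pull0 M F f"
  by (rule ext) (simp add: pull0_def)

lemma smooth_map_Cmap: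
  assumes M: "mfd_ok M" and N: "mfd_ok N" and F: "smooth_map M N F"
  shows "Cmap M N F"
  unfolding Cmap_def
proof (intro conjI ballI)
  show cF: "continuous_map (mtop M) (mtop N) F" using F by (simp add: smooth_map_def)
  fix f assume f: "f \<in> Cinf N"
  show "pull0 M F f \<in> Cinf M"
  proof (rule Cinf_localI[OF M])
    show "pull0 M F f p = 0" if "p \<notin> pts M" for p using that by (simp add: pull0_def)
    fix p assume p: "p \<in> pts M"
    then have "F p \<in> pts N" using cF by (auto simp: continuous_map_def)
    then obtain V \<psi> where d: "(V, \<psi>) \<in> atlas N" "F p \<in> V" using mfd_cover[OF N] by blast
    note dc = mfd_chart[OF N d(1)]
    define S where "S = {q \<in> pts M. F q \<in> V}"
    have S: "openin (mtop M) S" unfolding S_def by (rule openin_continuous_map_preimage[OF cF is_chartD(1)[OF dc]])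
    have "sm M S (\<lambda>q. f (inv_into V \<psi> (\<psi> (F q))))"
    proof (rule sm_compose[where g="\<lambda>x. f (inv_into V \<psi> x)" and F="\<lambda>q. \<psi> (F q)", OF M S is_chartD(3)[OF dc]])
      show "smooth_on (mdim N) (\<psi> ` V) (\<lambda>x. f (inv_into V \<psi> x))"
        using f d(1) by (auto simp: Cinf_def)
      show "(\<lambda>q. \<psi> (F q)) ` S \<subseteq> \<psi> ` V" by (auto simp: S_def)
      fix j assume j: "j < mdim N"
      show "sm M S (\<lambda>q. \<psi> (F q) j)"
        unfolding sm_def
      proof clarify
        fix U \<phi> assume c: "(U, \<phi>) \<in> atlas M"
        have "U \<inter> S = {p \<in> U. F p \<in> V}" using is_chartD(6)[OF mfd_chart[OF M c]] by (auto simp: S_def)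
        then show "smooth_on (mdim M) (\<phi> ` (U \<inter> S)) (\<lambda>x. \<psi> (F (inv_into U \<phi> x)) j)"
        proof -
          have "\<forall>c\<in>atlas M. \<forall>d\<in>atlas N. \<forall>i<mdim N. smooth_on (mdim M) (snd c ` {p \<in> fst c. F p \<in> fst d}) (\<lambda>x. snd d (F (inv_into (fst c) (snd c) x)) i)"
            using F by (simp add: smooth_map_def split_beta)
          from this[rule_format, OF c d(1) j] show ?thesis using \<open>U \<inter> S = {p \<in> U. F p \<in> V}\<close> by simp
        qed
      qed
    qed
    then have "sm M S (pull0 M F f)"
      by (rule sm_cong[OF M S]) (use is_chartD(8)[OF dc] in \<open>auto simp: S_def pull0_def\<close>)
    then show "\<exists>S. openin (mtop M) S \<and> p \<in> S \<and> sm M S (pull0 M F f)" using S p d(2) by (auto simp: S_def)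
  qed
qed

lemma Cmap_coord:
  assumes M: "mfd_ok M" and N: "mfd_ok N" and F: "Cmap M N F" and c: "(V, \<psi>) \<in> max_atlas N" and i: "i < mdim N"
  shows "sm M {q \<in> pts M. F q \<in> V} (\<lambda>q. \<psi> (F q) i)"
proof (rule sm_local[OF M Cmap_open[OF F is_chartD(1)[OF max_chart[OF c]]]])
  fix p assume "p \<in> {q \<in> pts M. F q \<in> V}"
  then have p: "p \<in> pts M" "F p \<in> V" by auto
  obtain f S1 where f: "f \<in> Cinf N" "openin (mtop N) S1" "F p \<in> S1" "\<And>q. q \<in> S1 \<Longrightarrow> f q = \<psi> q i"
    using extend_sm[OF N is_chartD(1)[OF max_chart[OF c]] p(2) sm_coord[OF N c i]] by blast
  define S where "S = {q \<in> pts M. F q \<in> S1}"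
  have S: "openin (mtop M) S" unfolding S_def by (rule Cmap_open[OF F f(2)])
  have "sm M S (pull0 M F f)" by (rule Cinf_sm[OF M Cmap_pull[OF F f(1)] openin_subset[OF S]])
  then have "sm M S (\<lambda>q. \<psi> (F q) i)" by (rule sm_cong[OF M S]) (simp add: S_def pull0_def f(4))
  then show "\<exists>S'. openin (mtop M) S' \<and> p \<in> S' \<and> sm M S' (\<lambda>q. \<psi> (F q) i)" using S p f(3) by (auto simp: S_def)
qed

lemma push_tangent:
  assumes F: "Cmap M N F" and N: "mfd_ok N" and p: "p \<in> pts M" and v: "v \<in> tangent M p"
  shows "push M N F v \<in> tangent N (F p)"
proof -
  have 1: "v (f + g) = v f + v g" if "f \<in> Cinf M" "g \<in> Cinf M" for f g using v that by (simp add: tangent_def)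
  have 2: "v (c *\<^sub>R f) = c * v f" if "f \<in> Cinf M" for f c using v that by (simp add: tangent_def)
  have 3: "v (f * g) = v f * g p + f p * v g" if "f \<in> Cinf M" "g \<in> Cinf M" for f g using v that by (simp add: tangent_def)
  have ev: "pull0 M F f p = f (F p)" for f using p by (simp add: pull0_def)
  show ?thesis
    unfolding tangent_def push_def
    by (auto simp: pull0_add pull0_scale pull0_mult 1 2 3 Cmap_pull[OF F] Cinf_add[OF N] Cinf_scale[OF N] Cinf_mult[OF N] ev)
qed

lemma push_app: "h \<in> Cinf N \<Longrightarrow> push M N F v h = v (pull0 M F h)"
  by (simp add: push_def)

lemma push_comp:
  assumes "Cmap M N F" "Cmap N L H"
  shows "push N L H (push M N F v) = push M L (\<lambda>x. H (F x)) v"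
  by (rule ext) (simp add: push_def pull0_comp[OF assms(1)] Cmap_pull[OF assms(2)])

lemma push_cong:
  assumes "\<And>p. p \<in> pts M \<Longrightarrow> F p = F' p" shows "push M N F v = push M N F' v"
proof -
  have eq: "pull0 M F = pull0 M F'" by (intro ext) (simp add: pull0_def assms)
  show ?thesis unfolding push_def by (subst eq) (rule refl)
qed

lemma push_add: "push M N F (v + w) = push M N F v + push M N F w"
  by (rule ext) (simp add: push_def)
lemma push_scale: "push M N F (c *\<^sub>R v) = c *\<^sub>R push M N F v"
  by (rule ext) (simp add: push_def)
lemma push_zero: "push M N F 0 = 0"
  by (rule ext) (simp add: push_def)
lemma push_diff: "push M N F (v - w) = push M N F v - push M N F w"
  by (rule ext) (simp add: push_def)

lemma push_id: "mfd_ok M \<Longrightarrow> v \<in> tangent M p \<Longrightarrow> push M M (\<lambda>x. x) v = v"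
proof (rule ext)
  fix h assume M: "mfd_ok M" and v: "v \<in> tangent M p"
  show "push M M (\<lambda>x. x) v h = v h"
  proof (cases "h \<in> Cinf M")
    case True
    then have "pull0 M (\<lambda>x. x) h = h" using Cinf_zero_off[OF M True] by (auto simp: pull0_def)
    then show ?thesis using True by (simp add: push_def)
  qed (simp add: push_def tan_off[OF M v])
qed

lemma push_const:
  assumes "mfd_ok M" "p \<in> pts M" "v \<in> tangent M p"
  shows "push M N (\<lambda>_. c) v = 0"
  by (rule ext) (simp add: push_def pull0_const tan_scale[OF assms(1,3) Cinf_one] tan_one[OF assms(1,3,2)] assms(1))

lemma tangent_eqI:
  assumes "mfd_ok M" "v \<in> tangent M p" "w \<in> tangent M p" "\<And>f. f \<in> Cinf M \<Longrightarrow> v f = w f"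
  shows "v = w"
proof (rule ext)
  fix f show "v f = w f"
    using assms(4) tan_off[OF assms(1,2), of f] tan_off[OF assms(1,3), of f] by (cases "f \<in> Cinf M") auto
qed

lemma tangent_minus: "mfd_ok M \<Longrightarrow> v \<in> tangent M p \<Longrightarrow> - v \<in> tangent M p"
  using tangent_scale[of M v p "-1"] by (simp add: scaleR_fun_def fun_Compl_def)

lemma tangent_diff: "mfd_ok M \<Longrightarrow> v \<in> tangent M p \<Longrightarrow> w \<in> tangent M p \<Longrightarrow> v - w \<in> tangent M p"
  using tangent_add[of M v p "- w"] tangent_minus[of M w p] by simp

lemma vfields_add: "mfd_ok M \<Longrightarrow> X \<in> vfields M \<Longrightarrow> Y \<in> vfields M \<Longrightarrow> X + Y \<in> vfields M"
  by (rule vfI) (auto simp: vfD vf_off tangent_add vf_Cinf intro: Cinf_add[of M "\<lambda>p. X p _" "\<lambda>p. Y p _", unfolded plus_fun_def, simplified])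

lemma vfields_fmult:
  assumes M: "mfd_ok M" and X: "X \<in> vfields M" and f: "f \<in> Cinf M"
  shows "(\<lambda>p. f p *\<^sub>R X p) \<in> vfields M"
proof (rule vfI[OF M])
  show "f p *\<^sub>R X p \<in> tangent M p" if "p \<in> pts M" for p by (rule tangent_scale[OF M vfD[OF M X that]])
  show "f p *\<^sub>R X p = 0" if "p \<notin> pts M" for p using Cinf_zero_off[OF M f that] by simp
  fix g assume "g \<in> Cinf M"
  from Cinf_mult[OF M f vf_Cinf[OF M X this]] show "(\<lambda>p. (f p *\<^sub>R X p) g) \<in> Cinf M"
    by (simp add: times_fun_def)
qed

lemma vfields_scale:
  assumes M: "mfd_ok M" and X: "X \<in> vfields M" shows "c *\<^sub>R X \<in> vfields M"
proof -
  have "c *\<^sub>R X = (\<lambda>p. (c *\<^sub>R oneM M) p *\<^sub>R X p)"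
    by (rule ext) (auto simp: oneM_def vf_off[OF M X])
  then show ?thesis using vfields_fmult[OF M X Cinf_scale[OF M Cinf_one[OF M], of c]] by simp
qed

lemma vfields_minus: "mfd_ok M \<Longrightarrow> X \<in> vfields M \<Longrightarrow> - X \<in> vfields M"
  using vfields_scale[of M X "-1"] by simp

lemma vfields_diff: "mfd_ok M \<Longrightarrow> X \<in> vfields M \<Longrightarrow> Y \<in> vfields M \<Longrightarrow> X - Y \<in> vfields M"
  using vfields_add[OF _ _ vfields_minus, of M X Y] by simp

lemma vfields_zero: "mfd_ok M \<Longrightarrow> 0 \<in> vfields M"
proof -
  assume M: "mfd_ok M"
  have "(\<lambda>p. 0) \<in> Cinf M" using Cinf_zero[OF M] by (simp add: zero_fun_def)
  then show ?thesis by (intro vfI[OF M]) (simp_all add: tangent_zero[OF M])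
qed

lemma vfields_sum:
  "mfd_ok M \<Longrightarrow> (\<And>i. i \<in> I \<Longrightarrow> X i \<in> vfields M) \<Longrightarrow> (\<Sum>i\<in>I. X i) \<in> vfields M"
  by (induction I rule: infinite_finite_induct) (auto intro: vfields_zero vfields_add)

lemma lie_vf_fields:
  assumes M: "mfd_ok M" and X: "X \<in> vfields M" and Y: "Y \<in> vfields M"
  shows "lie_vf X Y \<in> vfields M"
proof -
  have tn: "lie_vf X Y p \<in> tangent M p" if p: "p \<in> pts M" for p
  proof -
    note x = vfD[OF M X p] and y = vfD[OF M Y p]
    note XC = vf_Cinf[OF M X] and YC = vf_Cinf[OF M Y]
    have off: "(\<lambda>q. Z q f) = 0" if "Z \<in> vfields M" "f \<notin> Cinf M" for Z f
    proof
      fix q show "Z q f = 0 q"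
        using tan_off[OF M vfD[OF M that(1)] that(2)] vf_off[OF M that(1)] by (cases "q \<in> pts M") auto
    qed
    have add: "(\<lambda>q. Z q (f + g)) = (\<lambda>q. Z q f) + (\<lambda>q. Z q g)" if Z: "Z \<in> vfields M" and fg: "f \<in> Cinf M" "g \<in> Cinf M" for Z f g
    proof
      fix q show "Z q (f + g) = ((\<lambda>q. Z q f) + (\<lambda>q. Z q g)) q"
        using tan_add[OF M vfD[OF M Z] fg] vf_off[OF M Z] by (cases "q \<in> pts M") auto
    qed
    have scale: "(\<lambda>q. Z q (c *\<^sub>R f)) = c *\<^sub>R (\<lambda>q. Z q f)" if Z: "Z \<in> vfields M" and f: "f \<in> Cinf M" for Z c f
    proof
      fix q show "Z q (c *\<^sub>R f) = (c *\<^sub>R (\<lambda>q. Z q f)) q"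
        using tan_scale[OF M vfD[OF M Z] f] vf_off[OF M Z] by (cases "q \<in> pts M") auto
    qed
    have mult: "(\<lambda>q. Z q (f * g)) = (\<lambda>q. Z q f) * g + f * (\<lambda>q. Z q g)" if Z: "Z \<in> vfields M" and fg: "f \<in> Cinf M" "g \<in> Cinf M" for Z f g
    proof
      fix q show "Z q (f * g) = ((\<lambda>q. Z q f) * g + f * (\<lambda>q. Z q g)) q"
        using tan_mult[OF M vfD[OF M Z] fg] vf_off[OF M Z] by (cases "q \<in> pts M") auto
    qed
    have 1: "lie_vf X Y p f = 0" if "f \<notin> Cinf M" for f
      by (simp add: lie_vf_def off[OF X that] off[OF Y that] tan_zero[OF M x] tan_zero[OF M y])
    have 2: "lie_vf X Y p (f + g) = lie_vf X Y p f + lie_vf X Y p g" if "f \<in> Cinf M" "g \<in> Cinf M" for f g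
      by (simp add: lie_vf_def add[OF X that] add[OF Y that] tan_add[OF M x YC YC] tan_add[OF M y XC XC] that)
    have 3: "lie_vf X Y p (c *\<^sub>R f) = c * lie_vf X Y p f" if "f \<in> Cinf M" for f c
      by (simp add: lie_vf_def scale[OF X that] scale[OF Y that] tan_scale[OF M x YC] tan_scale[OF M y XC] that algebra_simps)
    have 4: "lie_vf X Y p (f * g) = lie_vf X Y p f * g p + f p * lie_vf X Y p g" if fg: "f \<in> Cinf M" "g \<in> Cinf M" for f g
      using fg by (simp add: lie_vf_def mult[OF X fg] mult[OF Y fg] tan_add[OF M x] tan_add[OF M y] Cinf_mult[OF M] XC YC
        tan_mult[OF M x] tan_mult[OF M y] algebra_simps)
    show ?thesis using 1 2 3 4 by (simp add: tangent_def)
  qed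
  show ?thesis
  proof (rule vfI[OF M tn])
    show "lie_vf X Y p = 0" if "p \<notin> pts M" for p
      by (rule ext) (simp add: lie_vf_def vf_off[OF M X that] vf_off[OF M Y that])
    fix f assume f: "f \<in> Cinf M"
    have "(\<lambda>p. X p (\<lambda>q. Y q f)) - (\<lambda>p. Y p (\<lambda>q. X q f)) \<in> Cinf M"
      by (intro Cinf_diff[OF M] vf_Cinf[OF M X] vf_Cinf[OF M Y] f)
    then show "(\<lambda>p. lie_vf X Y p f) \<in> Cinf M" by (simp add: lie_vf_def fun_diff_def)
  qed
qed

lemma lie_vf_antisym: "lie_vf X Y = - lie_vf Y X"
  by (intro ext) (simp add: lie_vf_def)

lemma lie_vf_add_right:
  assumes M: "mfd_ok M" and X: "X \<in> vfields M" and Y: "Y \<in> vfields M" and Z: "Z \<in> vfields M"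
  shows "lie_vf X (Y + Z) = lie_vf X Y + lie_vf X Z"
proof (intro ext)
  fix p f
  show "lie_vf X (Y + Z) p f = (lie_vf X Y + lie_vf X Z) p f"
  proof (cases "p \<in> pts M \<and> f \<in> Cinf M")
    case True
    have "(\<lambda>q. (Y + Z) q f) = (\<lambda>q. Y q f) + (\<lambda>q. Z q f)" by (rule ext) simp
    then show ?thesis using True tan_add[OF M vfD[OF M X] vf_Cinf[OF M Y] vf_Cinf[OF M Z]] by (simp add: lie_vf_def)
  next
    case False
    have "W p f = 0" if "W \<in> vfields M" for W
      using False tan_off[OF M vfD[OF M that]] vf_off[OF M that] by (cases "p \<in> pts M") auto
    note z = this
    show ?thesis
      using z[OF lie_vf_fields[OF M X vfields_add[OF M Y Z]]] z[OF lie_vf_fields[OF M X Y]] z[OF lie_vf_fields[OF M X Z]] by simp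
  qed
qed

lemma lie_vf_add_left:
  assumes "mfd_ok M" "X \<in> vfields M" "Y \<in> vfields M" "Z \<in> vfields M"
  shows "lie_vf (X + Y) Z = lie_vf X Z + lie_vf Y Z"
  using lie_vf_add_right[OF assms(1,4,2,3)] by (simp add: lie_vf_antisym[of _ Z])

definition related :: "'a mfd \<Rightarrow> 'b mfd \<Rightarrow> ('a \<Rightarrow> 'b) \<Rightarrow> 'a vfield \<Rightarrow> 'b vfield \<Rightarrow> bool" where
  "related M N F X Y \<longleftrightarrow> (\<forall>p\<in>pts M. push M N F (X p) = Y (F p))"

lemma related_pull:
  assumes M: "mfd_ok M" and X: "X \<in> vfields M" and r: "related M N F X Y" and h: "h \<in> Cinf N"
  shows "(\<lambda>p. X p (pull0 M F h)) = pull0 M F (\<lambda>q. Y q h)"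
proof
  fix p show "X p (pull0 M F h) = pull0 M F (\<lambda>q. Y q h) p"
  proof (cases "p \<in> pts M")
    case True
    then have "push M N F (X p) h = Y (F p) h" using r by (simp add: related_def)
    then show ?thesis using True h by (simp add: push_def pull0_def)
  qed (simp add: vf_off[OF M X] pull0_def)
qed

lemma related_lie:
  assumes M: "mfd_ok M" and N: "mfd_ok N" and F: "Cmap M N F"
    and X: "X \<in> vfields M" "Y \<in> vfields M" and X': "X' \<in> vfields N" "Y' \<in> vfields N"
    and r: "related M N F X X'" "related M N F Y Y'"
  shows "related M N F (lie_vf X Y) (lie_vf X' Y')"
  unfolding related_def
proof
  fix p assume p: "p \<in> pts M"
  show "push M N F (lie_vf X Y p) = lie_vf X' Y' (F p)"
  proof (rule tangent_eqI[OF N push_tangent[OF F N p vfD[OF M lie_vf_fields[OF M X] p]]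
        vfD[OF N lie_vf_fields[OF N X'] Cmap_pts[OF F p]]])
    fix h assume h: "h \<in> Cinf N"
    have a: "X p (pull0 M F g) = X' (F p) g" "Y p (pull0 M F g) = Y' (F p) g" if "g \<in> Cinf N" for g
      using r p that by (auto simp: related_def push_def fun_eq_iff split: if_splits)
    show "push M N F (lie_vf X Y p) h = lie_vf X' Y' (F p) h"
      using h by (simp add: push_def lie_vf_def related_pull[OF M X(1) r(1)] related_pull[OF M X(2) r(2)]
          a vf_Cinf[OF N X'(1)] vf_Cinf[OF N X'(2)])
  qed
qed

lemma vfields_coordI:
  assumes M: "mfd_ok M" and t: "\<And>p. p \<in> pts M \<Longrightarrow> W p \<in> tangent M p" and off: "\<And>p. p \<notin> pts M \<Longrightarrow> W p = 0"
    and c: "\<And>p. p \<in> pts M \<Longrightarrow> \<exists>U \<phi>. (U, \<phi>) \<in> max_atlas M \<and> p \<in> U \<and>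
      (\<forall>i<mdim M. \<forall>Z\<in>Cinf M. \<forall>S. openin (mtop M) S \<and> p \<in> S \<and> (\<forall>q\<in>S. q \<in> U \<and> Z q = \<phi> q i) \<longrightarrow>
          (\<exists>S' g. openin (mtop M) S' \<and> p \<in> S' \<and> g \<in> Cinf M \<and> (\<forall>q\<in>S'. W q Z = g q)))"
  shows "W \<in> vfields M"
proof (rule vfI[OF M t off])
  fix f assume f: "f \<in> Cinf M"
  show "(\<lambda>p. W p f) \<in> Cinf M"
  proof (rule Cinf_localI'[OF M])
    show "W p f = 0" if "p \<notin> pts M" for p using off[OF that] by simp
    fix p assume p: "p \<in> pts M"
    obtain U \<phi> where c': "(U, \<phi>) \<in> max_atlas M" "p \<in> U" and
      loc: "\<forall>i<mdim M. \<forall>Z\<in>Cinf M. \<forall>S. openin (mtop M) S \<and> p \<in> S \<and> (\<forall>q\<in>S. q \<in> U \<and> Z q = \<phi> q i) \<longrightarrow>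
          (\<exists>S' g. openin (mtop M) S' \<and> p \<in> S' \<and> g \<in> Cinf M \<and> (\<forall>q\<in>S'. W q Z = g q))"
      using c[OF p] by (elim exE conjE) (rule that)
    obtain V X D where cf: "coord_frame M U \<phi> V X D" and pV: "p \<in> V" using coord_frame_ex[OF M c'] by blast
    note V = coord_frameD(1)[OF cf] pV coord_frameD(2)[OF cf] and X = coord_frameD(3,4,5)[OF cf] and ex = coord_frameD(8)[OF cf]
    have "\<forall>i\<in>{..<mdim M}. \<exists>g. g \<in> Cinf M \<and> (\<exists>S'. openin (mtop M) S' \<and> p \<in> S' \<and> (\<forall>q\<in>S'. W q (X i) = g q))"
    proof
      fix i assume "i \<in> {..<mdim M}"
      then have i: "i < mdim M" by simp
      have "\<forall>q\<in>V. q \<in> U \<and> X i q = \<phi> q i" using V(3) X(3)[OF i] by blast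
      from loc[THEN spec, THEN mp, OF i, THEN bspec, OF X(1)[OF i], THEN spec, THEN mp, OF conjI[OF V(1) conjI[OF V(2) this]]]
      show "\<exists>g. g \<in> Cinf M \<and> (\<exists>S'. openin (mtop M) S' \<and> p \<in> S' \<and> (\<forall>q\<in>S'. W q (X i) = g q))" by blast
    qed
    then obtain g where g: "\<forall>i\<in>{..<mdim M}. g i \<in> Cinf M \<and> (\<exists>S'. openin (mtop M) S' \<and> p \<in> S' \<and> (\<forall>q\<in>S'. W q (X i) = g i q))"
      by (rule bchoice[THEN exE])
    then have "\<forall>i\<in>{..<mdim M}. \<exists>S'. openin (mtop M) S' \<and> p \<in> S' \<and> (\<forall>q\<in>S'. W q (X i) = g i q)" by blast
    then obtain S where S: "\<forall>i\<in>{..<mdim M}. openin (mtop M) (S i) \<and> p \<in> S i \<and> (\<forall>q\<in>S i. W q (X i) = g i q)"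
      by (rule bchoice[THEN exE])
    define S0 where "S0 = V \<inter> (\<Inter>i\<in>{..<mdim M}. S i)"
    have S0: "openin (mtop M) S0" "p \<in> S0"
    proof -
      have "openin (mtop M) (\<Inter>(insert V (S ` {..<mdim M})))" using V S by (intro openin_Inter) auto
      then show "openin (mtop M) S0" by (simp add: S0_def)
      show "p \<in> S0" using V(2) S by (auto simp: S0_def)
    qed
    have "(\<Sum>i<mdim M. g i * (\<lambda>q. D i q f)) \<in> Cinf M"
      by (intro Cinf_sum[OF M] Cinf_mult[OF M]) (use g X(2) vf_Cinf[OF M _ f] in auto)
    moreover have "\<forall>q\<in>S0. W q f = (\<Sum>i<mdim M. g i * (\<lambda>q. D i q f)) q"
    proof
      fix q assume q: "q \<in> S0"
      then have qV: "q \<in> V" and qM: "q \<in> pts M" using openin_subset[OF S0(1)] by (auto simp: S0_def)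
      have "W q (X i) = g i q" if "i < mdim M" for i using S q that by (auto simp: S0_def)
      then show "W q f = (\<Sum>i<mdim M. g i * (\<lambda>q. D i q f)) q" using ex[OF qV t[OF qM] f] by (simp add: sum_fun_app)
    qed
    ultimately show "\<exists>S g. openin (mtop M) S \<and> p \<in> S \<and> g \<in> Cinf M \<and> (\<forall>q\<in>S. W q f = g q)" using S0 by blast
  qed
qed

lemma vfield_through:
  assumes M: "mfd_ok M" and p: "p \<in> pts M" and v: "v \<in> tangent M p"
  shows "\<exists>X\<in>vfields M. X p = v"
proof -
  obtain U \<phi> where c: "(U, \<phi>) \<in> atlas M" "p \<in> U" using mfd_cover[OF M p] by blast
  obtain V X D where cf: "coord_frame M U \<phi> V X D" and pV: "p \<in> V"
    using coord_frame_ex[OF M atlas_max[OF M c(1)] c(2)] by blast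
  note V = coord_frameD(1)[OF cf] pV coord_frameD(2)[OF cf] and X = coord_frameD(3,4,5)[OF cf] and ex = coord_frameD(8)[OF cf]
  define Y where "Y = (\<Sum>i<mdim M. v (X i) *\<^sub>R D i)"
  have Y: "Y \<in> vfields M" unfolding Y_def by (intro vfields_sum[OF M] vfields_scale[OF M]) (use X in auto)
  have "Y p = v"
    by (rule tangent_eqI[OF M vfD[OF M Y p] v]) (simp add: ex[OF V(2) v] Y_def sum_fun_app)
  then show ?thesis using Y by blast
qed

subsection \<open>Products\<close>

lemma is_chartI:
  assumes "openin T U" "openin (Euclidean_space n) (\<phi> ` U)"
    "\<And>i. i < n \<Longrightarrow> continuous_map (subtopology T U) euclideanreal (\<lambda>p. \<phi> p i)"
    "continuous_map (subtopology (Euclidean_space n) (\<phi> ` U)) T \<theta>" "\<And>p. p \<in> U \<Longrightarrow> \<theta> (\<phi> p) = p"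
  shows "is_chart n T (U, \<phi>)"
proof -
  have UT: "U \<subseteq> topspace T" using openin_subset[OF assms(1)] .
  have UE: "\<phi> ` U \<subseteq> En n" using openin_subset[OF assms(2)] .
  have "continuous_map (subtopology T U) (Euclidean_space n) (\<lambda>p i. if i < n then \<phi> p i else 0)"
    unfolding continuous_map_componentwise_Euclidean_space using assms(3) by blast
  then have "continuous_map (subtopology T U) (Euclidean_space n) \<phi>"
  proof (rule continuous_map_eq)
    fix p assume "p \<in> topspace (subtopology T U)"
    then have "\<phi> p \<in> En n" using UE by auto
    then show "(\<lambda>i. if i < n then \<phi> p i else 0) = \<phi> p" by (auto simp: En_iff)
  qed
  then have 1: "continuous_map (subtopology T U) (subtopology (Euclidean_space n) (\<phi> ` U)) \<phi>"
    by (auto simp: continuous_map_in_subtopology)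
  have 2: "continuous_map (subtopology (Euclidean_space n) (\<phi> ` U)) (subtopology T U) \<theta>"
    using assms(4,5) by (auto simp: continuous_map_in_subtopology)
  have "homeomorphic_maps (subtopology T U) (subtopology (Euclidean_space n) (\<phi> ` U)) \<phi> \<theta>"
    unfolding homeomorphic_maps_def using 1 2 assms(5) by auto
  then have "homeomorphic_map (subtopology T U) (subtopology (Euclidean_space n) (\<phi> ` U)) \<phi>"
    using homeomorphic_map_maps by blast
  then show ?thesis using assms(1,2) by (simp add: is_chart_def)
qed

lemma is_chart_cont:
  assumes c: "is_chart n T (U, \<phi>)"
  shows "continuous_map (subtopology T U) euclideanreal (\<lambda>p. \<phi> p i)"
    "continuous_map (subtopology (Euclidean_space n) (\<phi> ` U)) T (inv_into U \<phi>)"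
proof -
  have h: "homeomorphic_map (subtopology T U) (subtopology (Euclidean_space n) (\<phi> ` U)) \<phi>"
    using c by (auto simp: is_chart_def)
  have "continuous_map (subtopology T U) (powertop_real UNIV) \<phi>"
    using homeomorphic_imp_continuous_map[OF h] unfolding Euclidean_space_def
    by (simp add: continuous_map_in_subtopology)
  then show "continuous_map (subtopology T U) euclideanreal (\<lambda>p. \<phi> p i)"
    by (simp add: continuous_map_componentwise_UNIV)
  obtain g where g: "homeomorphic_maps (subtopology T U) (subtopology (Euclidean_space n) (\<phi> ` U)) \<phi> g"
    using h homeomorphic_map_maps by blast
  then have gc: "continuous_map (subtopology (Euclidean_space n) (\<phi> ` U)) T g"
    by (auto simp: homeomorphic_maps_def continuous_map_in_subtopology)
  show "continuous_map (subtopology (Euclidean_space n) (\<phi> ` U)) T (inv_into U \<phi>)"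
  proof (rule continuous_map_eq[OF gc])
    fix x assume "x \<in> topspace (subtopology (Euclidean_space n) (\<phi> ` U))"
    then obtain p where p: "p \<in> U" "x = \<phi> p" by auto
    have "p \<in> topspace (subtopology T U)" using p is_chartD(6)[OF c] by auto
    then have "g (\<phi> p) = p" using g by (auto simp: homeomorphic_maps_def)
    then show "g x = inv_into U \<phi> x" using p is_chartD(8)[OF c] by simp
  qed
qed

definition vjoin :: "nat \<Rightarrow> (nat \<Rightarrow> real) \<Rightarrow> (nat \<Rightarrow> real) \<Rightarrow> nat \<Rightarrow> real" where
  "vjoin m x y = (\<lambda>i. if i < m then x i else y (i - m))"

definition shift :: "nat \<Rightarrow> (nat \<Rightarrow> real) \<Rightarrow> nat \<Rightarrow> real" where
  "shift m z = (\<lambda>i. z (i + m))"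

lemma trunc_vjoin: "x \<in> En m \<Longrightarrow> trunc m (vjoin m x y) = x"
  by (auto simp: trunc_def vjoin_def En_iff fun_eq_iff)
lemma shift_vjoin: "shift m (vjoin m x y) = y"
  by (auto simp: shift_def vjoin_def fun_eq_iff)
lemma vjoin_En: "y \<in> En n \<Longrightarrow> vjoin m x y \<in> En (m + n)"
  by (auto simp: vjoin_def En_iff)
lemma shift_En: "z \<in> En (m + n) \<Longrightarrow> shift m z \<in> En n"
  by (auto simp: shift_def En_iff)
lemma vjoin_trunc_shift: "vjoin m (trunc m z) (shift m z) = z"
  by (auto simp: vjoin_def trunc_def shift_def fun_eq_iff)

lemma cont_coord: "continuous_on (S :: (nat \<Rightarrow> real) set) (\<lambda>x. x i)"
  by (rule continuous_on_subset[OF continuous_on_product_coordinates]) simp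

lemma openin_shift:
  assumes "openin (Euclidean_space n) W"
  shows "openin (Euclidean_space (m + n)) {z \<in> En (m + n). shift m z \<in> W}"
proof (rule openin_preimage_E[OF _ assms])
  show "shift m ` En (m + n) \<subseteq> En n" using shift_En by blast
  show "continuous_on (En (m + n)) (\<lambda>z. shift m z j)" for j unfolding shift_def by (rule cont_coord)
qed simp

lemma prod_chart:
  assumes c: "is_chart m S (U, \<phi>)" and d: "is_chart n T (V, \<psi>)"
  shows "is_chart (m + n) (prod_topology S T) (U \<times> V, \<lambda>(p, q) i. if i < m then \<phi> p i else \<psi> q (i - m))"
    "(\<lambda>(p, q) i. if i < m then \<phi> p i else \<psi> q (i - m)) ` (U \<times> V) = {z \<in> En (m + n). trunc m z \<in> \<phi> ` U \<and> shift m z \<in> \<psi> ` V}"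
    "\<And>z. z \<in> (\<lambda>(p, q) i. if i < m then \<phi> p i else \<psi> q (i - m)) ` (U \<times> V) \<Longrightarrow>
       inv_into (U \<times> V) (\<lambda>(p, q) i. if i < m then \<phi> p i else \<psi> q (i - m)) z = (inv_into U \<phi> (trunc m z), inv_into V \<psi> (shift m z))"
proof -
  define \<Theta> where "\<Theta> = (\<lambda>(p, q) i. if i < m then \<phi> p i else \<psi> q (i - m))"
  have \<Theta>: "\<Theta> (p, q) = vjoin m (\<phi> p) (\<psi> q)" for p q by (simp add: \<Theta>_def vjoin_def)
  have im: "\<Theta> ` (U \<times> V) = {z \<in> En (m + n). trunc m z \<in> \<phi> ` U \<and> shift m z \<in> \<psi> ` V}"
  proof (intro Set.set_eqI iffI)
    fix z assume "z \<in> \<Theta> ` (U \<times> V)"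
    then obtain p q where "p \<in> U" "q \<in> V" "z = vjoin m (\<phi> p) (\<psi> q)" using \<Theta> by auto
    then show "z \<in> {z \<in> En (m + n). trunc m z \<in> \<phi> ` U \<and> shift m z \<in> \<psi> ` V}"
      using is_chartD(7)[OF c] is_chartD(7)[OF d] by (simp add: trunc_vjoin shift_vjoin vjoin_En)
  next
    fix z assume "z \<in> {z \<in> En (m + n). trunc m z \<in> \<phi> ` U \<and> shift m z \<in> \<psi> ` V}"
    then obtain p q where "p \<in> U" "q \<in> V" "trunc m z = \<phi> p" "shift m z = \<psi> q" by auto
    then have "z = \<Theta> (p, q)" using vjoin_trunc_shift[of m z] \<Theta> by simp
    then show "z \<in> \<Theta> ` (U \<times> V)" using \<open>p \<in> U\<close> \<open>q \<in> V\<close> by blast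
  qed
  define \<theta> where "\<theta> z = (inv_into U \<phi> (trunc m z), inv_into V \<psi> (shift m z))" for z
  have inv: "\<theta> (\<Theta> p) = p" if "p \<in> U \<times> V" for p
    using that is_chartD(7,8)[OF c] is_chartD(8)[OF d] by (auto simp: \<theta>_def \<Theta> trunc_vjoin shift_vjoin)
  have "is_chart (m + n) (prod_topology S T) (U \<times> V, \<Theta>)"
  proof (rule is_chartI)
    show "openin (prod_topology S T) (U \<times> V)"
      using is_chartD(1)[OF c] is_chartD(1)[OF d] by (simp add: openin_prod_Times_iff)
    have "\<Theta> ` (U \<times> V) = {z \<in> En (m + n). trunc m z \<in> \<phi> ` U} \<inter> {z \<in> En (m + n). shift m z \<in> \<psi> ` V}"
      unfolding im by auto
    then show oI: "openin (Euclidean_space (m + n)) (\<Theta> ` (U \<times> V))"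
      using openin_trunc[OF is_chartD(3)[OF c]] openin_shift[OF is_chartD(3)[OF d]] by auto
    have t: "subtopology (prod_topology S T) (U \<times> V) = prod_topology (subtopology S U) (subtopology T V)"
      by (simp add: subtopology_Times)
    show "continuous_map (subtopology (prod_topology S T) (U \<times> V)) euclideanreal (\<lambda>p. \<Theta> p i)" if "i < m + n" for i
    proof (cases "i < m")
      case True
      have "continuous_map (prod_topology (subtopology S U) (subtopology T V)) euclideanreal ((\<lambda>p. \<phi> p i) \<circ> fst)"
        by (rule continuous_map_compose[OF continuous_map_fst is_chart_cont(1)[OF c]])
      moreover have "(\<lambda>p. \<phi> p i) \<circ> fst = (\<lambda>p. \<Theta> p i)" using True by (auto simp: \<Theta>_def)
      ultimately show ?thesis unfolding t by simp
    next
      case False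
      have "continuous_map (prod_topology (subtopology S U) (subtopology T V)) euclideanreal ((\<lambda>p. \<psi> p (i - m)) \<circ> snd)"
        by (rule continuous_map_compose[OF continuous_map_snd is_chart_cont(1)[OF d]])
      moreover have "(\<lambda>p. \<psi> p (i - m)) \<circ> snd = (\<lambda>p. \<Theta> p i)" using False by (auto simp: \<Theta>_def)
      ultimately show ?thesis unfolding t by simp
    qed
    have "continuous_map (subtopology (Euclidean_space (m + n)) (\<Theta> ` (U \<times> V))) S (inv_into U \<phi> \<circ> trunc m)"
    proof (rule continuous_map_compose[OF _ is_chart_cont(2)[OF c]])
      have "continuous_map (subtopology (Euclidean_space (m + n)) (\<Theta> ` (U \<times> V))) (Euclidean_space m) (trunc m)"
        unfolding cm_Euclidean_space_iff_continuous_on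
      proof
        have "continuous_on (topspace (subtopology (Euclidean_space (m + n)) (\<Theta> ` (U \<times> V)))) (\<lambda>x. trunc m x i)" for i
          by (cases "i < m") (simp_all add: trunc_def cont_coord)
        then show "continuous_on (topspace (subtopology (Euclidean_space (m + n)) (\<Theta> ` (U \<times> V)))) (trunc m)"
          by (rule continuous_on_coordinatewise_then_product)
      qed simp
      then show "continuous_map (subtopology (Euclidean_space (m + n)) (\<Theta> ` (U \<times> V))) (subtopology (Euclidean_space m) (\<phi> ` U)) (trunc m)"
        using im by (auto simp: continuous_map_in_subtopology)
    qed
    moreover have "continuous_map (subtopology (Euclidean_space (m + n)) (\<Theta> ` (U \<times> V))) T (inv_into V \<psi> \<circ> shift m)"
    proof (rule continuous_map_compose[OF _ is_chart_cont(2)[OF d]])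
      have "continuous_map (subtopology (Euclidean_space (m + n)) (\<Theta> ` (U \<times> V))) (Euclidean_space n) (shift m)"
        unfolding cm_Euclidean_space_iff_continuous_on
      proof
        show "continuous_on (topspace (subtopology (Euclidean_space (m + n)) (\<Theta> ` (U \<times> V)))) (shift m)"
          unfolding shift_def[abs_def] by (intro continuous_on_coordinatewise_then_product cont_coord)
        show "shift m \<in> topspace (subtopology (Euclidean_space (m + n)) (\<Theta> ` (U \<times> V))) \<rightarrow> En n"
          using shift_En by auto
      qed
      then show "continuous_map (subtopology (Euclidean_space (m + n)) (\<Theta> ` (U \<times> V))) (subtopology (Euclidean_space n) (\<psi> ` V)) (shift m)"
        using im by (auto simp: continuous_map_in_subtopology)
    qed
    ultimately show "continuous_map (subtopology (Euclidean_space (m + n)) (\<Theta> ` (U \<times> V))) (prod_topology S T) \<theta>"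
      unfolding \<theta>_def by (simp add: continuous_map_paired o_def)
    show "\<theta> (\<Theta> p) = p" if "p \<in> U \<times> V" for p by (rule inv[OF that])
  qed
  note main = this
  then show "is_chart (m + n) (prod_topology S T) (U \<times> V, \<lambda>(p, q) i. if i < m then \<phi> p i else \<psi> q (i - m))"
    by (simp add: \<Theta>_def)
  from im show "(\<lambda>(p, q) i. if i < m then \<phi> p i else \<psi> q (i - m)) ` (U \<times> V) = {z \<in> En (m + n). trunc m z \<in> \<phi> ` U \<and> shift m z \<in> \<psi> ` V}"
    by (simp add: \<Theta>_def)
  show "inv_into (U \<times> V) (\<lambda>(p, q) i. if i < m then \<phi> p i else \<psi> q (i - m)) z = (inv_into U \<phi> (trunc m z), inv_into V \<psi> (shift m z))"
    if z: "z \<in> (\<lambda>(p, q) i. if i < m then \<phi> p i else \<psi> q (i - m)) ` (U \<times> V)" for z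
  proof -
    obtain p where p: "p \<in> U \<times> V" "z = \<Theta> p" using z by (auto simp: \<Theta>_def)
    have "inv_into (U \<times> V) \<Theta> z = p" using is_chartD(8)[OF main p(1)] p(2) by simp
    also have "p = \<theta> z" using inv[OF p(1)] p(2) by simp
    finally show ?thesis by (simp add: \<Theta>_def \<theta>_def)
  qed
qed

context
  fixes M :: "'a mfd" and N :: "'b mfd"
  assumes M: "mfd_ok M" and N: "mfd_ok N"
begin

lemma prod_simps: "mtop (prod_mfd M N) = prod_topology (mtop M) (mtop N)" "mdim (prod_mfd M N) = mdim M + mdim N"
  "pts (prod_mfd M N) = pts M \<times> pts N"
  by (auto simp: prod_mfd_def)

lemma atlas_prodD:
  assumes "c \<in> atlas (prod_mfd M N)"
  obtains U \<phi> V \<psi> where "(U, \<phi>) \<in> atlas M" "(V, \<psi>) \<in> atlas N"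
    "c = (U \<times> V, \<lambda>(p, q) i. if i < mdim M then \<phi> p i else \<psi> q (i - mdim M))"
  using assms by (auto simp: prod_mfd_def)

lemma prod_mfd_ok: "mfd_ok (prod_mfd M N)"
  unfolding mfd_ok_def
proof (intro conjI ballI)
  show "Hausdorff_space (mtop (prod_mfd M N))"
    using M N by (simp add: prod_simps Hausdorff_space_prod_topology mfd_ok_def)
  show "is_chart (mdim (prod_mfd M N)) (mtop (prod_mfd M N)) c" if "c \<in> atlas (prod_mfd M N)" for c
    using that
  proof (rule atlas_prodD)
    fix U \<phi> V \<psi> assume a: "(U, \<phi>) \<in> atlas M" "(V, \<psi>) \<in> atlas N"
      "c = (U \<times> V, \<lambda>(p, q) i. if i < mdim M then \<phi> p i else \<psi> q (i - mdim M))"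
    show ?thesis unfolding prod_simps a(3) by (rule prod_chart(1)[OF mfd_chart[OF M a(1)] mfd_chart[OF N a(2)]])
  qed
  have "pts M = (\<Union>c\<in>atlas M. fst c)" "pts N = (\<Union>c\<in>atlas N. fst c)" using M N by (auto simp: mfd_ok_def)
  moreover have "(\<Union>c\<in>atlas (prod_mfd M N). fst c) = (\<Union>c\<in>atlas M. fst c) \<times> (\<Union>c\<in>atlas N. fst c)"
  proof (intro Set.set_eqI iffI)
    fix z assume "z \<in> (\<Union>c\<in>atlas (prod_mfd M N). fst c)"
    then obtain c where c: "c \<in> atlas (prod_mfd M N)" "z \<in> fst c" by (elim UN_E)
    obtain U \<phi> V \<psi> where "(U, \<phi>) \<in> atlas M" "(V, \<psi>) \<in> atlas N"
      "c = (U \<times> V, \<lambda>(p, q) i. if i < mdim M then \<phi> p i else \<psi> q (i - mdim M))" using c(1) by (rule atlas_prodD)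
    then show "z \<in> (\<Union>c\<in>atlas M. fst c) \<times> (\<Union>c\<in>atlas N. fst c)" using c(2) by force
  next
    fix z assume "z \<in> (\<Union>c\<in>atlas M. fst c) \<times> (\<Union>c\<in>atlas N. fst c)"
    then obtain U \<phi> V \<psi> where cd: "(U, \<phi>) \<in> atlas M" "(V, \<psi>) \<in> atlas N" "z \<in> U \<times> V" by (cases z) auto
    have "(U \<times> V, \<lambda>(p, q) i. if i < mdim M then \<phi> p i else \<psi> q (i - mdim M)) \<in> atlas (prod_mfd M N)"
      using cd(1,2) by (auto simp: prod_mfd_def)
    then show "z \<in> (\<Union>c\<in>atlas (prod_mfd M N). fst c)" using cd(3) by (intro UN_I) auto
  qed
  ultimately show "(\<Union>c\<in>atlas (prod_mfd M N). fst c) = pts (prod_mfd M N)" by (simp add: prod_simps)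
  fix c d assume c: "c \<in> atlas (prod_mfd M N)" and d: "d \<in> atlas (prod_mfd M N)"
  obtain U \<phi> V \<psi> where a: "(U, \<phi>) \<in> atlas M" "(V, \<psi>) \<in> atlas N"
      "c = (U \<times> V, \<lambda>(p, q) i. if i < mdim M then \<phi> p i else \<psi> q (i - mdim M))" using c by (rule atlas_prodD)
  obtain U' \<phi>' V' \<psi>' where b: "(U', \<phi>') \<in> atlas M" "(V', \<psi>') \<in> atlas N"
      "d = (U' \<times> V', \<lambda>(p, q) i. if i < mdim M then \<phi>' p i else \<psi>' q (i - mdim M))" using d by (rule atlas_prodD)
  define m where "m = mdim M" define n where "n = mdim N"
  define \<Theta> where "\<Theta> = (\<lambda>(p, q) i. if i < m then \<phi> p i else \<psi> q (i - m))"
  define \<Theta>' where "\<Theta>' = (\<lambda>(p, q) i. if i < m then \<phi>' p i else \<psi>' q (i - m))"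
  note aU = mfd_chart[OF M a(1), folded m_def] and aV = mfd_chart[OF N a(2), folded n_def]
  have ic: "is_chart (m + n) (prod_topology (mtop M) (mtop N)) (U \<times> V, \<Theta>)"
    unfolding \<Theta>_def by (rule prod_chart(1)[OF aU aV])
  have oS: "openin (prod_topology (mtop M) (mtop N)) ((U \<times> V) \<inter> (U' \<times> V'))"
    using is_chartD(1)[OF ic] is_chartD(1)[OF mfd_chart[OF M b(1)]] is_chartD(1)[OF mfd_chart[OF N b(2)]]
    by (auto simp: openin_prod_Times_iff)
  define I where "I = \<Theta> ` ((U \<times> V) \<inter> (U' \<times> V'))"
  have oI: "openin (Euclidean_space (m + n)) I" unfolding I_def by (rule is_chartD(4)[OF ic oS]) auto
  have IE: "I \<subseteq> En (m + n)" using openin_subset[OF oI] .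
  have inv: "inv_into (U \<times> V) \<Theta> z = (inv_into U \<phi> (trunc m z), inv_into V \<psi> (shift m z))" if "z \<in> I" for z
    unfolding \<Theta>_def by (rule prod_chart(3)[OF aU aV]) (use that in \<open>auto simp: I_def \<Theta>_def\<close>)
  have proj: "trunc m z \<in> \<phi> ` (U \<inter> U')" "shift m z \<in> \<psi> ` (V \<inter> V')" if zI: "z \<in> I" for z
  proof -
    obtain w where w: "w \<in> (U \<times> V) \<inter> (U' \<times> V')" "z = \<Theta> w" using zI unfolding I_def by blast
    obtain p q where pq: "p \<in> U \<inter> U'" "q \<in> V \<inter> V'" "z = vjoin m (\<phi> p) (\<psi> q)"
    proof -
      show thesis by (rule that[of "fst w" "snd w"]) (use w in \<open>auto simp: \<Theta>_def vjoin_def\<close>)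
    qed
    show "trunc m z \<in> \<phi> ` (U \<inter> U')" "shift m z \<in> \<psi> ` (V \<inter> V')"
      using pq is_chartD(7)[OF aU] by (auto simp: trunc_vjoin shift_vjoin)
  qed
  have "smooth_on (m + n) I (\<lambda>x. \<Theta>' (inv_into (U \<times> V) \<Theta> x) i)" if i: "i < m + n" for i
  proof (cases "i < m")
    case True
    have t: "transition_smooth m (U, \<phi>) (U', \<phi>')" using M a(1) b(1) by (auto simp: mfd_ok_def m_def)
    have "smooth_on (m + n) I (\<lambda>x. (\<lambda>x. \<phi>' (inv_into U \<phi> x) i) (trunc m x))"
    proof (rule smooth_on_comp[OF is_chartD(4)[OF aU] oI transition_smoothD[OF t True]])
      show "openin (mtop M) (U \<inter> U')" using is_chartD(1)[OF aU] is_chartD(1)[OF mfd_chart[OF M b(1)]] by auto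
      show "smooth_on (m + n) I (\<lambda>x. trunc m x j)" if "j < m" for j
        using smooth_on_coord[OF oI] that by (simp add: trunc_def)
    qed (use proj in auto)
    then show ?thesis by (rule smooth_on_cong[OF oI]) (simp add: inv \<Theta>'_def True)
  next
    case False
    have t: "transition_smooth n (V, \<psi>) (V', \<psi>')" using N a(2) b(2) by (auto simp: mfd_ok_def n_def)
    have "smooth_on (m + n) I (\<lambda>x. (\<lambda>x. \<psi>' (inv_into V \<psi> x) (i - m)) (shift m x))"
    proof (rule smooth_on_comp[OF is_chartD(4)[OF aV] oI transition_smoothD[OF t]])
      show "openin (mtop N) (V \<inter> V')" using is_chartD(1)[OF aV] is_chartD(1)[OF mfd_chart[OF N b(2)]] by auto
      show "smooth_on (m + n) I (\<lambda>x. shift m x j)" for j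
        using smooth_on_coord[OF oI] by (simp add: shift_def)
    qed (use proj i False in auto)
    then show ?thesis by (rule smooth_on_cong[OF oI]) (simp add: inv \<Theta>'_def False)
  qed
  then show "transition_smooth (mdim (prod_mfd M N)) c d"
    unfolding prod_simps a(3) b(3) transition_smooth_def m_def[symmetric] n_def[symmetric] I_def \<Theta>_def \<Theta>'_def by simp
qed

lemma prod_atlas: "(U, \<phi>) \<in> atlas M \<Longrightarrow> (V, \<psi>) \<in> atlas N \<Longrightarrow>
   (U \<times> V, \<lambda>(p, q) i. if i < mdim M then \<phi> p i else \<psi> q (i - mdim M)) \<in> max_atlas (prod_mfd M N)"
  by (rule atlas_max[OF prod_mfd_ok]) (auto simp: prod_mfd_def)

lemma Cmap_fst: "Cmap (prod_mfd M N) M fst"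
  unfolding Cmap_def
proof (intro conjI ballI)
  show "continuous_map (mtop (prod_mfd M N)) (mtop M) fst" by (simp add: prod_simps continuous_map_fst)
  fix f assume f: "f \<in> Cinf M"
  show "pull0 (prod_mfd M N) fst f \<in> Cinf (prod_mfd M N)"
  proof (rule Cinf_localI[OF prod_mfd_ok])
    fix z assume "z \<in> pts (prod_mfd M N)"
    then obtain p q where z: "z = (p, q)" "p \<in> pts M" "q \<in> pts N" by (auto simp: prod_simps)
    obtain U \<phi> where c: "(U, \<phi>) \<in> atlas M" "p \<in> U" using mfd_cover[OF M z(2)] by blast
    obtain V \<psi> where d: "(V, \<psi>) \<in> atlas N" "q \<in> V" using mfd_cover[OF N z(3)] by blast
    note cc = mfd_chart[OF M c(1)]
    define \<Theta> where "\<Theta> = (\<lambda>(p, q) i. if i < mdim M then \<phi> p i else \<psi> q (i - mdim M))"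
    have ch: "(U \<times> V, \<Theta>) \<in> max_atlas (prod_mfd M N)" unfolding \<Theta>_def by (rule prod_atlas[OF c(1) d(1)])
    have oUV: "openin (mtop (prod_mfd M N)) (U \<times> V)" by (rule is_chartD(1)[OF max_chart[OF ch]])
    have "sm (prod_mfd M N) (U \<times> V) (\<lambda>z. f (inv_into U \<phi> (\<phi> (fst z))))"
    proof (rule sm_compose[where g="\<lambda>x. f (inv_into U \<phi> x)" and F="\<lambda>z. \<phi> (fst z)", OF prod_mfd_ok oUV is_chartD(3)[OF cc]])
      show "smooth_on (mdim M) (\<phi> ` U) (\<lambda>x. f (inv_into U \<phi> x))" using f c(1) by (auto simp: Cinf_def)
      fix j assume j: "j < mdim M"
      have "sm (prod_mfd M N) (U \<times> V) (\<lambda>z. \<Theta> z j)"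
        by (rule sm_coord[OF prod_mfd_ok ch]) (use j in \<open>simp add: prod_simps\<close>)
      moreover have "(\<lambda>z. \<Theta> z j) = (\<lambda>z. \<phi> (fst z) j)" using j by (auto simp: \<Theta>_def)
      ultimately show "sm (prod_mfd M N) (U \<times> V) (\<lambda>z. \<phi> (fst z) j)" by simp
    qed auto
    then have "sm (prod_mfd M N) (U \<times> V) (pull0 (prod_mfd M N) fst f)"
      by (rule sm_cong[OF prod_mfd_ok oUV]) (use is_chartD(8)[OF cc] openin_subset[OF oUV] in \<open>auto simp: pull0_def\<close>)
    then show "\<exists>S. openin (mtop (prod_mfd M N)) S \<and> z \<in> S \<and> sm (prod_mfd M N) S (pull0 (prod_mfd M N) fst f)"
      using oUV c(2) d(2) z(1) by blast
  qed (simp add: pull0_def)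
qed

lemma Cmap_snd: "Cmap (prod_mfd M N) N snd"
  unfolding Cmap_def
proof (intro conjI ballI)
  show "continuous_map (mtop (prod_mfd M N)) (mtop N) snd" by (simp add: prod_simps continuous_map_snd)
  fix f assume f: "f \<in> Cinf N"
  show "pull0 (prod_mfd M N) snd f \<in> Cinf (prod_mfd M N)"
  proof (rule Cinf_localI[OF prod_mfd_ok])
    fix z assume "z \<in> pts (prod_mfd M N)"
    then obtain p q where z: "z = (p, q)" "p \<in> pts M" "q \<in> pts N" by (auto simp: prod_simps)
    obtain U \<phi> where c: "(U, \<phi>) \<in> atlas M" "p \<in> U" using mfd_cover[OF M z(2)] by blast
    obtain V \<psi> where d: "(V, \<psi>) \<in> atlas N" "q \<in> V" using mfd_cover[OF N z(3)] by blast
    note dc = mfd_chart[OF N d(1)]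
    define \<Theta> where "\<Theta> = (\<lambda>(p, q) i. if i < mdim M then \<phi> p i else \<psi> q (i - mdim M))"
    have ch: "(U \<times> V, \<Theta>) \<in> max_atlas (prod_mfd M N)" unfolding \<Theta>_def by (rule prod_atlas[OF c(1) d(1)])
    have oUV: "openin (mtop (prod_mfd M N)) (U \<times> V)" by (rule is_chartD(1)[OF max_chart[OF ch]])
    have "sm (prod_mfd M N) (U \<times> V) (\<lambda>z. f (inv_into V \<psi> (\<psi> (snd z))))"
    proof (rule sm_compose[where g="\<lambda>x. f (inv_into V \<psi> x)" and F="\<lambda>z. \<psi> (snd z)", OF prod_mfd_ok oUV is_chartD(3)[OF dc]])
      show "smooth_on (mdim N) (\<psi> ` V) (\<lambda>x. f (inv_into V \<psi> x))" using f d(1) by (auto simp: Cinf_def)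
      fix j assume j: "j < mdim N"
      have "sm (prod_mfd M N) (U \<times> V) (\<lambda>z. \<Theta> z (j + mdim M))"
        by (rule sm_coord[OF prod_mfd_ok ch]) (use j in \<open>simp add: prod_simps\<close>)
      moreover have "(\<lambda>z. \<Theta> z (j + mdim M)) = (\<lambda>z. \<psi> (snd z) j)" by (auto simp: \<Theta>_def)
      ultimately show "sm (prod_mfd M N) (U \<times> V) (\<lambda>z. \<psi> (snd z) j)" by simp
    qed auto
    then have "sm (prod_mfd M N) (U \<times> V) (pull0 (prod_mfd M N) snd f)"
      by (rule sm_cong[OF prod_mfd_ok oUV]) (use is_chartD(8)[OF dc] openin_subset[OF oUV] in \<open>auto simp: pull0_def\<close>)
    then show "\<exists>S. openin (mtop (prod_mfd M N)) S \<and> z \<in> S \<and> sm (prod_mfd M N) S (pull0 (prod_mfd M N) snd f)"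
      using oUV c(2) d(2) z(1) by blast
  qed (simp add: pull0_def)
qed

lemma Cmap_pair:
  assumes L: "mfd_ok L" and F: "Cmap L M F" and H: "Cmap L N H"
  shows "Cmap L (prod_mfd M N) (\<lambda>x. (F x, H x))"
  unfolding Cmap_def
proof (intro conjI ballI)
  show "continuous_map (mtop L) (mtop (prod_mfd M N)) (\<lambda>x. (F x, H x))"
    using F H by (simp add: prod_simps Cmap_def continuous_map_paired)
  fix f assume f: "f \<in> Cinf (prod_mfd M N)"
  show "pull0 L (\<lambda>x. (F x, H x)) f \<in> Cinf L"
  proof (rule Cinf_localI[OF L])
    fix x assume x: "x \<in> pts L"
    obtain U \<phi> where c: "(U, \<phi>) \<in> atlas M" "F x \<in> U" using mfd_cover[OF M Cmap_pts[OF F x]] by blast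
    obtain V \<psi> where d: "(V, \<psi>) \<in> atlas N" "H x \<in> V" using mfd_cover[OF N Cmap_pts[OF H x]] by blast
    define \<Theta> where "\<Theta> = (\<lambda>(p, q) i. if i < mdim M then \<phi> p i else \<psi> q (i - mdim M))"
    have ch: "(U \<times> V, \<Theta>) \<in> max_atlas (prod_mfd M N)" unfolding \<Theta>_def by (rule prod_atlas[OF c(1) d(1)])
    note cc = max_chart[OF ch]
    define S where "S = {q \<in> pts L. F q \<in> U} \<inter> {q \<in> pts L. H q \<in> V}"
    have S1: "openin (mtop L) {q \<in> pts L. F q \<in> U}" by (rule Cmap_open[OF F is_chartD(1)[OF mfd_chart[OF M c(1)]]])
    have S2: "openin (mtop L) {q \<in> pts L. H q \<in> V}" by (rule Cmap_open[OF H is_chartD(1)[OF mfd_chart[OF N d(1)]]])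
    have S: "openin (mtop L) S" unfolding S_def using S1 S2 by auto
    have "sm L S (\<lambda>q. f (inv_into (U \<times> V) \<Theta> (\<Theta> (F q, H q))))"
    proof (rule sm_compose[where g="\<lambda>x. f (inv_into (U \<times> V) \<Theta> x)" and F="\<lambda>q. \<Theta> (F q, H q)", OF L S is_chartD(3)[OF cc]])
      show "smooth_on (mdim (prod_mfd M N)) (\<Theta> ` (U \<times> V)) (\<lambda>x. f (inv_into (U \<times> V) \<Theta> x))"
      proof (rule Cinf_chart[OF f])
        show "(U \<times> V, \<Theta>) \<in> atlas (prod_mfd M N)" using c(1) d(1) by (auto simp: prod_mfd_def \<Theta>_def)
      qed
      show "(\<lambda>q. \<Theta> (F q, H q)) ` S \<subseteq> \<Theta> ` (U \<times> V)" by (auto simp: S_def)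
      fix j assume j: "j < mdim (prod_mfd M N)"
      show "sm L S (\<lambda>q. \<Theta> (F q, H q) j)"
      proof (cases "j < mdim M")
        case True
        have "sm L S (\<lambda>q. \<phi> (F q) j)"
          by (rule sm_mono[OF Cmap_coord[OF L M F atlas_max[OF M c(1)] True]]) (auto simp: S_def)
        then show ?thesis using True by (simp add: \<Theta>_def)
      next
        case False
        have "sm L S (\<lambda>q. \<psi> (H q) (j - mdim M))"
          by (rule sm_mono[OF Cmap_coord[OF L N H atlas_max[OF N d(1)]]]) (use j False in \<open>auto simp: S_def prod_simps\<close>)
        then show ?thesis using False by (simp add: \<Theta>_def)
      qed
    qed
    then have "sm L S (pull0 L (\<lambda>x. (F x, H x)) f)"
      by (rule sm_cong[OF L S]) (use is_chartD(8)[OF cc] in \<open>auto simp: S_def pull0_def\<close>)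
    then show "\<exists>S. openin (mtop L) S \<and> x \<in> S \<and> sm L S (pull0 L (\<lambda>x. (F x, H x)) f)"
      using S x c(2) d(2) by (auto simp: S_def)
  qed (simp add: pull0_def)
qed

lemma prod_tangent_eq:
  assumes pq: "p \<in> pts M" "q \<in> pts N" and v: "v \<in> tangent (prod_mfd M N) (p, q)" "w \<in> tangent (prod_mfd M N) (p, q)"
    and eq: "push (prod_mfd M N) M fst v = push (prod_mfd M N) M fst w"
      "push (prod_mfd M N) N snd v = push (prod_mfd M N) N snd w"
  shows "v = w"
proof (rule tangent_eqI[OF prod_mfd_ok v])
  fix f assume f: "f \<in> Cinf (prod_mfd M N)"
  let ?P = "prod_mfd M N"
  obtain U \<phi> where c: "(U, \<phi>) \<in> atlas M" "p \<in> U" using mfd_cover[OF M pq(1)] by blast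
  obtain V \<psi> where d: "(V, \<psi>) \<in> atlas N" "q \<in> V" using mfd_cover[OF N pq(2)] by blast
  define \<Theta> where "\<Theta> = (\<lambda>(p, q) i. if i < mdim M then \<phi> p i else \<psi> q (i - mdim M))"
  have ch: "(U \<times> V, \<Theta>) \<in> max_atlas ?P" unfolding \<Theta>_def by (rule prod_atlas[OF c(1) d(1)])
  have pqUV: "(p, q) \<in> U \<times> V" using c(2) d(2) by simp
  obtain S X D where cf: "coord_frame ?P (U \<times> V) \<Theta> S X D" and pV: "(p, q) \<in> S"
    using coord_frame_ex[OF prod_mfd_ok ch pqUV] by blast
  note S = coord_frameD(1)[OF cf] pV coord_frameD(2)[OF cf] and X = coord_frameD(3,4,5)[OF cf] and ex = coord_frameD(8)[OF cf]
  have "v (X i) = w (X i)" if i: "i < mdim ?P" for i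
  proof (cases "i < mdim M")
    case True
    obtain g S1 where g: "g \<in> Cinf M" "openin (mtop M) S1" "p \<in> S1" "\<And>q. q \<in> S1 \<Longrightarrow> g q = \<phi> q i"
      using extend_sm[OF M is_chartD(1)[OF mfd_chart[OF M c(1)]] c(2) sm_coord[OF M atlas_max[OF M c(1)] True]] by blast
    have o: "openin (mtop ?P) (S \<inter> S1 \<times> pts N)"
      using S(1) g(2) by (auto simp: prod_simps openin_prod_Times_iff intro!: openin_Int)
    have "u (X i) = u (pull0 ?P fst g)" if u: "u \<in> tangent ?P (p, q)" for u
    proof (rule tan_local[OF prod_mfd_ok u o _ X(1)[OF i] Cmap_pull[OF Cmap_fst g(1)]])
      show "(p, q) \<in> S \<inter> S1 \<times> pts N" using S(2) g(3) pq by auto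
      fix z assume z: "z \<in> S \<inter> S1 \<times> pts N"
      then have "z \<in> pts ?P" using openin_subset[OF o] by auto
      then show "X i z = pull0 ?P fst g z" using z X(3)[OF i] g(4) True by (auto simp: pull0_def \<Theta>_def)
    qed
    then show ?thesis using v eq(1) g(1) by (metis push_app)
  next
    case False
    then have i': "i - mdim M < mdim N" using i by (simp add: prod_simps)
    obtain g S1 where g: "g \<in> Cinf N" "openin (mtop N) S1" "q \<in> S1" "\<And>q. q \<in> S1 \<Longrightarrow> g q = \<psi> q (i - mdim M)"
      using extend_sm[OF N is_chartD(1)[OF mfd_chart[OF N d(1)]] d(2) sm_coord[OF N atlas_max[OF N d(1)] i']] by blast
    have o: "openin (mtop ?P) (S \<inter> pts M \<times> S1)"
      using S(1) g(2) by (auto simp: prod_simps openin_prod_Times_iff intro!: openin_Int)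
    have "u (X i) = u (pull0 ?P snd g)" if u: "u \<in> tangent ?P (p, q)" for u
    proof (rule tan_local[OF prod_mfd_ok u o _ X(1)[OF i] Cmap_pull[OF Cmap_snd g(1)]])
      show "(p, q) \<in> S \<inter> pts M \<times> S1" using S(2) g(3) pq by auto
      fix z assume z: "z \<in> S \<inter> pts M \<times> S1"
      then have "z \<in> pts ?P" using openin_subset[OF o] by auto
      then show "X i z = pull0 ?P snd g z" using z X(3)[OF i] g(4) False by (auto simp: pull0_def \<Theta>_def)
    qed
    then show ?thesis using v eq(2) g(1) by (metis push_app)
  qed
  then show "v f = w f" using ex[OF S(2) v(1) f] ex[OF S(2) v(2) f] by simp
qed

definition pvec :: "'a \<Rightarrow> 'b \<Rightarrow> 'a tvec \<Rightarrow> 'b tvec \<Rightarrow> ('a \<times> 'b) tvec" where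
  "pvec p q v w = push M (prod_mfd M N) (\<lambda>x. (x, q)) v + push N (prod_mfd M N) (\<lambda>y. (p, y)) w"

lemma pvec:
  assumes pq: "p \<in> pts M" "q \<in> pts N" and v: "v \<in> tangent M p" and w: "w \<in> tangent N q"
  shows "pvec p q v w \<in> tangent (prod_mfd M N) (p, q)" "push (prod_mfd M N) M fst (pvec p q v w) = v"
    "push (prod_mfd M N) N snd (pvec p q v w) = w"
proof -
  have c1: "Cmap M (prod_mfd M N) (\<lambda>x. (x, q))" by (rule Cmap_pair[OF M Cmap_id[OF M] Cmap_const[OF M pq(2)]])
  have c2: "Cmap N (prod_mfd M N) (\<lambda>y. (p, y))" by (rule Cmap_pair[OF N Cmap_const[OF N pq(1)] Cmap_id[OF N]])
  show "pvec p q v w \<in> tangent (prod_mfd M N) (p, q)"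
    unfolding pvec_def
    by (rule tangent_add[OF prod_mfd_ok push_tangent[OF c1 prod_mfd_ok pq(1) v] push_tangent[OF c2 prod_mfd_ok pq(2) w]])
  show "push (prod_mfd M N) M fst (pvec p q v w) = v" "push (prod_mfd M N) N snd (pvec p q v w) = w"
    unfolding pvec_def push_add
    by (simp_all add: push_comp[OF c1 Cmap_fst] push_comp[OF c2 Cmap_fst] push_comp[OF c1 Cmap_snd] push_comp[OF c2 Cmap_snd]
        push_id[OF M v] push_id[OF N w] push_const[OF M pq(1) v] push_const[OF N pq(2) w])
qed

lemma prod_vfield:
  assumes X: "X \<in> vfields M" and Y: "Y \<in> vfields N"
  shows "\<exists>Z\<in>vfields (prod_mfd M N). related (prod_mfd M N) M fst Z X \<and> related (prod_mfd M N) N snd Z Y"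
proof -
  let ?P = "prod_mfd M N"
  define Z where "Z z = (if z \<in> pts ?P then pvec (fst z) (snd z) (X (fst z)) (Y (snd z)) else 0)" for z
  have Zt: "Z z \<in> tangent ?P z" "push ?P M fst (Z z) = X (fst z)" "push ?P N snd (Z z) = Y (snd z)" if "z \<in> pts ?P" for z
    using that pvec[OF _ _ vfD[OF M X] vfD[OF N Y], of "fst z" "snd z"] by (auto simp: Z_def prod_simps)
  have r: "related ?P M fst Z X" "related ?P N snd Z Y" using Zt by (auto simp: related_def)
  have "Z \<in> vfields ?P"
  proof (rule vfields_coordI[OF prod_mfd_ok Zt(1)])
    show "Z z = 0" if "z \<notin> pts ?P" for z using that by (simp add: Z_def)
    fix z assume z: "z \<in> pts ?P"
    then obtain p q where zz: "z = (p, q)" "p \<in> pts M" "q \<in> pts N" by (auto simp: prod_simps)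
    obtain U \<phi> where c: "(U, \<phi>) \<in> atlas M" "p \<in> U" using mfd_cover[OF M zz(2)] by blast
    obtain V \<psi> where d: "(V, \<psi>) \<in> atlas N" "q \<in> V" using mfd_cover[OF N zz(3)] by blast
    define \<Theta> where "\<Theta> = (\<lambda>(p, q) i. if i < mdim M then \<phi> p i else \<psi> q (i - mdim M))"
    have ch: "(U \<times> V, \<Theta>) \<in> max_atlas ?P" unfolding \<Theta>_def by (rule prod_atlas[OF c(1) d(1)])
    have main: "\<exists>S' g. openin (mtop ?P) S' \<and> z \<in> S' \<and> g \<in> Cinf ?P \<and> (\<forall>x\<in>S'. Z x f = g x)"
      if i: "i < mdim ?P" and f: "f \<in> Cinf ?P" and S: "openin (mtop ?P) S" "z \<in> S"
        and fS: "\<And>x. x \<in> S \<Longrightarrow> x \<in> U \<times> V \<and> f x = \<Theta> x i" for i f S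
    proof (cases "i < mdim M")
      case True
      obtain g S1 where g: "g \<in> Cinf M" "openin (mtop M) S1" "p \<in> S1" "\<And>q. q \<in> S1 \<Longrightarrow> g q = \<phi> q i"
        using extend_sm[OF M is_chartD(1)[OF mfd_chart[OF M c(1)]] c(2) sm_coord[OF M atlas_max[OF M c(1)] True]] by blast
      have o: "openin (mtop ?P) (S \<inter> S1 \<times> pts N)"
        using S(1) g(2) by (auto simp: prod_simps openin_prod_Times_iff intro!: openin_Int)
      have "Z x f = pull0 ?P fst (\<lambda>y. X y g) x" if x: "x \<in> S \<inter> S1 \<times> pts N" for x
      proof -
        have xP: "x \<in> pts ?P" using x openin_subset[OF o] by auto
        have "Z x f = Z x (pull0 ?P fst g)"
        proof (rule tan_local[OF prod_mfd_ok Zt(1)[OF xP] o x f Cmap_pull[OF Cmap_fst g(1)]])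
          fix y assume y: "y \<in> S \<inter> S1 \<times> pts N"
          then have "y \<in> pts ?P" using openin_subset[OF o] by auto
          then show "f y = pull0 ?P fst g y" using y fS g(4) True by (auto simp: pull0_def \<Theta>_def)
        qed
        then show ?thesis using Zt(2)[OF xP] xP g(1) push_app[of g M ?P fst "Z x"] by (simp add: pull0_def)
      qed
      moreover have "pull0 ?P fst (\<lambda>y. X y g) \<in> Cinf ?P" by (rule Cmap_pull[OF Cmap_fst vf_Cinf[OF M X g(1)]])
      moreover have "z \<in> S \<inter> S1 \<times> pts N" using S(2) zz g(3) by auto
      ultimately show ?thesis using o by blast
    next
      case False
      then have i': "i - mdim M < mdim N" using i by (simp add: prod_simps)
      obtain g S1 where g: "g \<in> Cinf N" "openin (mtop N) S1" "q \<in> S1" "\<And>q. q \<in> S1 \<Longrightarrow> g q = \<psi> q (i - mdim M)"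
        using extend_sm[OF N is_chartD(1)[OF mfd_chart[OF N d(1)]] d(2) sm_coord[OF N atlas_max[OF N d(1)] i']] by blast
      have o: "openin (mtop ?P) (S \<inter> pts M \<times> S1)"
        using S(1) g(2) by (auto simp: prod_simps openin_prod_Times_iff intro!: openin_Int)
      have "Z x f = pull0 ?P snd (\<lambda>y. Y y g) x" if x: "x \<in> S \<inter> pts M \<times> S1" for x
      proof -
        have xP: "x \<in> pts ?P" using x openin_subset[OF o] by auto
        have "Z x f = Z x (pull0 ?P snd g)"
        proof (rule tan_local[OF prod_mfd_ok Zt(1)[OF xP] o x f Cmap_pull[OF Cmap_snd g(1)]])
          fix y assume y: "y \<in> S \<inter> pts M \<times> S1"
          then have "y \<in> pts ?P" using openin_subset[OF o] by auto
          then show "f y = pull0 ?P snd g y" using y fS g(4) False by (auto simp: pull0_def \<Theta>_def)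
        qed
        then show ?thesis using Zt(3)[OF xP] xP g(1) push_app[of g N ?P snd "Z x"] by (simp add: pull0_def)
      qed
      moreover have "pull0 ?P snd (\<lambda>y. Y y g) \<in> Cinf ?P" by (rule Cmap_pull[OF Cmap_snd vf_Cinf[OF N Y g(1)]])
      moreover have "z \<in> S \<inter> pts M \<times> S1" using S(2) zz g(3) by auto
      ultimately show ?thesis using o by blast
    qed
    show "\<exists>U \<phi>. (U, \<phi>) \<in> max_atlas ?P \<and> z \<in> U \<and>
      (\<forall>i<mdim ?P. \<forall>Z'\<in>Cinf ?P. \<forall>S. openin (mtop ?P) S \<and> z \<in> S \<and> (\<forall>q\<in>S. q \<in> U \<and> Z' q = \<phi> q i) \<longrightarrow>
          (\<exists>S' g. openin (mtop ?P) S' \<and> z \<in> S' \<and> g \<in> Cinf ?P \<and> (\<forall>q\<in>S'. Z q Z' = g q)))"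
      by (rule exI[of _ "U \<times> V"], rule exI[of _ \<Theta>]) (use ch c(2) d(2) zz(1) main in blast)
  qed
  then show ?thesis using r by blast
qed

end

lemma lie_vf_zero_right:
  assumes M: "mfd_ok M" and X: "X \<in> vfields M"
  shows "lie_vf X 0 = 0"
  using lie_vf_add_right[OF M X vfields_zero[OF M] vfields_zero[OF M]] by simp

lemma the_elem_image_const: "A \<noteq> {} \<Longrightarrow> (\<And>x. x \<in> A \<Longrightarrow> f x = c) \<Longrightarrow> the_elem (f ` A) = c"
  by (metis (no_types, lifting) ex_in_conv the_elem_image_unique)

section \<open>Embedded submanifolds\<close>

lemma max_transition:
  assumes M: "mfd_ok M" and c: "(U, \<phi>) \<in> max_atlas M" and d: "(V, \<psi>) \<in> max_atlas M"
  shows "transition_smooth (mdim M) (U, \<phi>) (V, \<psi>)"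
proof -
  have "smooth_on (mdim M) (\<phi> ` (U \<inter> V)) (\<lambda>x. \<psi> (inv_into U \<phi> x) i)" if "i < mdim M" for i
    by (rule smD[OF M is_chartD(1)[OF max_chart[OF d]] sm_coord[OF M d that] c])
  then show ?thesis by (simp add: transition_smooth_def)
qed

lemma chart_change:
  assumes M: "mfd_ok M" and c: "(U, \<phi>) \<in> max_atlas M" and C: "openin (Euclidean_space (mdim M)) C" "C \<subseteq> \<phi> ` U"
    and G: "G ` C \<subseteq> En (mdim M)" "inj_on G C" "\<And>i. i < mdim M \<Longrightarrow> smooth_on (mdim M) C (\<lambda>x. G x i)"
    and K: "\<And>i. i < mdim M \<Longrightarrow> smooth_on (mdim M) (G ` C) (\<lambda>y. inv_into C G y i)"
  shows "({q \<in> U. \<phi> q \<in> C}, \<lambda>q. G (\<phi> q)) \<in> max_atlas M"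
proof -
  define n where "n = mdim M"
  note cc = max_chart[OF c, folded n_def] and C = C[folded n_def] and G = G[folded n_def] and K = K[folded n_def]
  define U' where "U' = {q \<in> U. \<phi> q \<in> C}"
  define \<phi>' where "\<phi>' q = G (\<phi> q)" for q
  have oU': "openin (mtop M) U'" unfolding U'_def by (rule is_chartD(5)[OF cc C(1)])
  have phiU': "\<phi> ` U' = C" using C(2) by (auto simp: U'_def)
  have imG: "\<phi>' ` S = G ` \<phi> ` S" for S by (auto simp: \<phi>'_def)
  have CE: "C \<subseteq> En n" by (rule openin_En_sub[OF C(1)])
  have contG: "continuous_map (subtopology (Euclidean_space n) T) (Euclidean_space n) G" if "T \<subseteq> C" for T
  proof -
    have "continuous_on C G" by (rule continuous_on_E[OF smooth_on_cont[OF G(3) CE] G(1)])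
    then show ?thesis unfolding cm_Euclidean_space_iff_continuous_on
      using that G(1) by (auto intro: continuous_on_subset)
  qed
  have openG: "openin (Euclidean_space n) (G ` T)" if "openin (Euclidean_space n) T" "T \<subseteq> C" for T
    by (rule invariance_of_domain_Euclidean_space[OF that(1) contG[OF that(2)] inj_on_subset[OF G(2) that(2)]])
  have KG: "inv_into C G (G x) = x" if "x \<in> C" for x using inv_into_f_f[OF G(2) that] .
  have inv': "inv_into U \<phi> (inv_into C G (\<phi>' q)) = q" if "q \<in> U'" for q
    using that KG is_chartD(8)[OF cc] by (simp add: \<phi>'_def U'_def)
  have inj': "inj_on \<phi>' U'" using inv' by (metis inj_onI)
  have inv'': "inv_into U' \<phi>' (\<phi>' q) = q" if "q \<in> U'" for q using inv_into_f_f[OF inj' that] .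
  have ch': "is_chart n (mtop M) (U', \<phi>')"
  proof (rule is_chartI[where \<theta>="\<lambda>y. inv_into U \<phi> (inv_into C G y)"])
    show "openin (mtop M) U'" by (rule oU')
    show "openin (Euclidean_space n) (\<phi>' ` U')" unfolding imG phiU' by (rule openG[OF C(1)]) simp
    fix i assume i: "i < n"
    have "continuous_map (subtopology (mtop M) U') (Euclidean_space n) \<phi>"
    proof -
      have "continuous_map (subtopology (mtop M) U) (subtopology (Euclidean_space n) (\<phi> ` U)) \<phi>"
        using cc by (auto simp: is_chart_def intro: homeomorphic_imp_continuous_map)
      then show ?thesis
        by (auto simp: continuous_map_in_subtopology U'_def intro: continuous_map_from_subtopology_mono)
    qed
    then have "continuous_map (subtopology (mtop M) U') (subtopology (Euclidean_space n) C) \<phi>"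
      using phiU' by (auto simp: continuous_map_in_subtopology)
    moreover have "continuous_map (subtopology (Euclidean_space n) C) euclideanreal (\<lambda>x. G x i)"
      using cm_iff_cont[OF CE] smooth_on_cont[OF G(3)[OF i] CE] by simp
    ultimately have "continuous_map (subtopology (mtop M) U') euclideanreal ((\<lambda>x. G x i) \<circ> \<phi>)"
      by (rule continuous_map_compose)
    then show "continuous_map (subtopology (mtop M) U') euclideanreal (\<lambda>p. \<phi>' p i)" by (simp add: \<phi>'_def o_def)
  next
    show "inv_into U \<phi> (inv_into C G (\<phi>' q)) = q" if "q \<in> U'" for q by (rule inv'[OF that])
    have GC: "G ` C \<subseteq> En n" by (rule G(1))
    have "continuous_map (subtopology (Euclidean_space n) (G ` C)) (Euclidean_space n) (inv_into C G)"
    proof -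
      have KC: "inv_into C G ` G ` C \<subseteq> En n" using CE KG by auto
      have "continuous_on (G ` C) (inv_into C G)"
        by (rule continuous_on_E[OF smooth_on_cont[OF K GC] KC])
      then show ?thesis unfolding cm_Euclidean_space_iff_continuous_on
        using GC KC by (auto simp: Int_absorb1 Int_absorb2)
    qed
    then have "continuous_map (subtopology (Euclidean_space n) (G ` C)) (subtopology (Euclidean_space n) (\<phi> ` U)) (inv_into C G)"
      using KG C(2) by (auto simp: continuous_map_in_subtopology)
    from continuous_map_compose[OF this is_chart_cont(2)[OF cc]]
    show "continuous_map (subtopology (Euclidean_space n) (\<phi>' ` U')) (mtop M) (\<lambda>y. inv_into U \<phi> (inv_into C G y))"
      unfolding imG phiU' by (simp add: o_def)
  qed
  have t1: "smooth_on n (\<phi>' ` (U' \<inter> V)) (\<lambda>x. \<psi> (inv_into U' \<phi>' x) i)" if d: "(V, \<psi>) \<in> atlas M" and i: "i < n" for V \<psi> i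
  proof -
    have oUV: "openin (mtop M) (U' \<inter> V)" using oU' is_chartD(1)[OF mfd_chart[OF M d]] by auto
    have o1: "openin (Euclidean_space n) (\<phi> ` (U' \<inter> V))" by (rule is_chartD(4)[OF cc oUV]) (auto simp: U'_def)
    have o2: "openin (Euclidean_space n) (\<phi>' ` (U' \<inter> V))" by (rule is_chartD(4)[OF ch' oUV]) auto
    have t: "transition_smooth n (U, \<phi>) (V, \<psi>)" using c d by (auto simp: max_atlas_def n_def)
    have s: "smooth_on n (\<phi> ` (U' \<inter> V)) (\<lambda>x. \<psi> (inv_into U \<phi> x) i)"
      by (rule smooth_on_subset[OF transition_smoothD[OF t i]]) (auto simp: U'_def)
    have "smooth_on n (\<phi>' ` (U' \<inter> V)) (\<lambda>y. \<psi> (inv_into U \<phi> (inv_into C G y)) i)"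
    proof (rule smooth_on_comp[where g="\<lambda>x. \<psi> (inv_into U \<phi> x) i" and F="inv_into C G", OF o1 o2 s])
      show "smooth_on n (\<phi>' ` (U' \<inter> V)) (\<lambda>x. inv_into C G x j)" if "j < n" for j
        by (rule smooth_on_subset[OF K[OF that]]) (auto simp: \<phi>'_def U'_def)
      show "inv_into C G ` \<phi>' ` (U' \<inter> V) \<subseteq> \<phi> ` (U' \<inter> V)"
        using KG by (auto simp: \<phi>'_def U'_def)
    qed
    then show ?thesis by (rule smooth_on_cong[OF o2]) (use inv' inv'' in auto)
  qed
  have t2: "smooth_on n (\<psi> ` (V \<inter> U')) (\<lambda>x. \<phi>' (inv_into V \<psi> x) i)" if d: "(V, \<psi>) \<in> atlas M" and i: "i < n" for V \<psi> i
  proof -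
    note dc = mfd_chart[OF M d, folded n_def]
    have oUV: "openin (mtop M) (V \<inter> U')" using oU' is_chartD(1)[OF dc] by auto
    have o1: "openin (Euclidean_space n) (\<psi> ` (V \<inter> U'))" by (rule is_chartD(4)[OF dc oUV]) auto
    have t: "transition_smooth n (V, \<psi>) (U, \<phi>)" using c d by (auto simp: max_atlas_def n_def)
    have "smooth_on n (\<psi> ` (V \<inter> U')) (\<lambda>x. G (\<phi> (inv_into V \<psi> x)) i)"
    proof (rule smooth_on_comp[where g="\<lambda>x. G x i" and F="\<lambda>x. \<phi> (inv_into V \<psi> x)", OF C(1) o1 G(3)[OF i]])
      show "smooth_on n (\<psi> ` (V \<inter> U')) (\<lambda>x. \<phi> (inv_into V \<psi> x) j)" if "j < n" for j
        by (rule smooth_on_subset[OF transition_smoothD[OF t that]]) (auto simp: U'_def)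
      show "(\<lambda>x. \<phi> (inv_into V \<psi> x)) ` \<psi> ` (V \<inter> U') \<subseteq> C"
        using is_chartD(8)[OF dc] by (auto simp: U'_def)
    qed
    then show ?thesis by (simp add: \<phi>'_def)
  qed
  show ?thesis
    unfolding max_atlas_def using ch' t1 t2
    by (auto simp: transition_smooth_def n_def U'_def[symmetric] \<phi>'_def[symmetric, abs_def])
qed

lemma chart_restrict:
  assumes M: "mfd_ok M" and c: "(U, \<phi>) \<in> max_atlas M" and S: "openin (mtop M) S" "S \<subseteq> U"
  shows "(S, \<phi>) \<in> max_atlas M"
proof -
  note cc = max_chart[OF c]
  have o: "openin (Euclidean_space (mdim M)) (\<phi> ` S)" by (rule is_chartD(4)[OF cc S])
  have "({q \<in> U. \<phi> q \<in> \<phi> ` S}, \<lambda>q. id (\<phi> q)) \<in> max_atlas M"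
  proof (rule chart_change[OF M c o])
    show "smooth_on (mdim M) (\<phi> ` S) (\<lambda>x. id x i)" for i using smooth_on_coord[OF o] by simp
    show "smooth_on (mdim M) (id ` \<phi> ` S) (\<lambda>y. inv_into (\<phi> ` S) id y i)" for i
      by (rule smooth_on_cong[of _ _ "\<lambda>x. x i"]) (use o smooth_on_coord[OF o] in \<open>auto simp: inv_into_f_f[of id "\<phi> ` S", simplified]\<close>)
  qed (use S(2) openin_subset[OF o] in auto)
  moreover have "{q \<in> U. \<phi> q \<in> \<phi> ` S} = S"
    using S(2) is_chartD(2)[OF cc] by (auto simp: inj_on_def)
  ultimately show ?thesis by simp
qed

lemma chart_swap:
  assumes M: "mfd_ok M" and c: "(U, \<phi>) \<in> max_atlas M" and ij: "i < mdim M" "j < mdim M"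
  shows "(U, \<lambda>q l. \<phi> q (Transposition.transpose i j l)) \<in> max_atlas M"
proof -
  note cc = max_chart[OF c]
  define n where "n = mdim M"
  define C where "C = \<phi> ` U"
  define G where "G x = (\<lambda>l. x (Transposition.transpose i j l))" for x :: "nat \<Rightarrow> real"
  have oC: "openin (Euclidean_space n) C" unfolding C_def n_def by (rule is_chartD(3)[OF cc])
  have GG: "G (G x) = x" for x by (simp add: G_def)
  have GE: "G x \<in> En n" if "x \<in> En n" for x
    using that ij by (auto simp: G_def En_iff n_def Transposition.transpose_def)
  have inj: "inj_on G C" using GG by (metis inj_onI)
  have CE: "C \<subseteq> En n" using openin_subset[OF oC] .
  have oGC: "openin (Euclidean_space n) (G ` C)"
  proof -
    have "G ` C = {x \<in> En n. G x \<in> C}" using GG GE CE by (auto simp: image_iff) (metis GG)+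
    moreover have "openin (Euclidean_space n) {x \<in> En n. G x \<in> C}"
    proof (rule openin_preimage_E[OF _ oC])
      show "continuous_on (En n) (\<lambda>x. G x l)" for l unfolding G_def by (rule cont_coord)
    qed (use GE in auto)
    ultimately show ?thesis by simp
  qed
  have "({q \<in> U. \<phi> q \<in> C}, \<lambda>q. G (\<phi> q)) \<in> max_atlas M"
  proof (rule chart_change[OF M c])
    show "inj_on G C" by (rule inj)
    show "smooth_on (mdim M) C (\<lambda>x. G x l)" for l
      using smooth_on_coord[OF oC] by (simp add: G_def n_def)
    show "smooth_on (mdim M) (G ` C) (\<lambda>y. inv_into C G y l)" for l
    proof (rule smooth_on_cong[OF oGC[unfolded n_def]])
      show "smooth_on (mdim M) (G ` C) (\<lambda>y. G y l)"
        using smooth_on_coord[OF oGC] by (simp add: G_def n_def)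
      show "G y l = inv_into C G y l" if "y \<in> G ` C" for y
        using that inv_into_f_f[OF inj] GG by auto
    qed
  qed (use oC CE GE in \<open>auto simp: n_def C_def\<close>)
  moreover have "{q \<in> U. \<phi> q \<in> C} = U" by (auto simp: C_def)
  ultimately show ?thesis by (simp add: G_def)
qed

lemma chart_exchange:
  assumes M: "mfd_ok M" and c: "(U, \<phi>) \<in> max_atlas M" and p: "p \<in> U" and i: "i < mdim M" and h: "h \<in> Cinf M"
    and nz: "partial i (\<lambda>x. h (inv_into U \<phi> x)) (\<phi> p) \<noteq> 0"
  shows "\<exists>U' \<phi>'. (U', \<phi>') \<in> max_atlas M \<and> p \<in> U' \<and> U' \<subseteq> U \<and> (\<forall>q\<in>U'. \<phi>' q = (\<phi> q)(i := h q))"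
proof -
  define n where "n = mdim M"
  note cc = max_chart[OF c, folded n_def]
  define g where "g x = h (inv_into U \<phi> x)" for x
  have UM: "U \<subseteq> pts M" using openin_subset[OF is_chartD(1)[OF cc]] .
  have g: "smooth_on n (\<phi> ` U) g"
    using smD[OF M openin_topspace Cinf_sm[OF M h order_refl] c] UM unfolding g_def[abs_def] n_def by (simp add: Int_absorb2)
  obtain r where r: "r > 0" "cube n (\<phi> p) r \<subseteq> \<phi> ` U" "inj_on (\<lambda>x. x(i := g x)) (cube n (\<phi> p) r)"
    "\<And>j. j < n \<Longrightarrow> smooth_on n ((\<lambda>x. x(i := g x)) ` cube n (\<phi> p) r) (\<lambda>y. inv_into (cube n (\<phi> p) r) (\<lambda>x. x(i := g x)) y j)"
    using exchange_E[OF is_chartD(3)[OF cc] _ i[folded n_def] g, of "\<phi> p"] p nz unfolding g_def[abs_def] by blast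
  define C where "C = cube n (\<phi> p) r"
  have oC: "openin (Euclidean_space n) C" unfolding C_def by (rule openin_cube)
  define U' where "U' = {q \<in> U. \<phi> q \<in> C}"
  have "(U', \<lambda>q. (\<lambda>x. x(i := g x)) (\<phi> q)) \<in> max_atlas M"
    unfolding U'_def
  proof (rule chart_change[OF M c])
    show "smooth_on (mdim M) C (\<lambda>x. (x(i := g x)) j)" if "j < mdim M" for j
      using smooth_on_coord[OF oC] smooth_on_subset[OF g r(2)] by (cases "j = i") (auto simp: n_def C_def)
    show "(\<lambda>x. x(i := g x)) ` C \<subseteq> En (mdim M)"
      using openin_subset[OF oC] i by (auto simp: n_def intro: En_upd)
    show "inj_on (\<lambda>x. x(i := g x)) C" unfolding C_def by (rule r(3))
    show "smooth_on (mdim M) ((\<lambda>x. x(i := g x)) ` C) (\<lambda>y. inv_into C (\<lambda>x. x(i := g x)) y j)" if "j < mdim M" for j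
      using r(4) that unfolding C_def n_def by blast
    show "openin (Euclidean_space (mdim M)) C" using oC by (simp add: n_def)
    show "C \<subseteq> \<phi> ` U" using r(2) by (simp add: C_def)
  qed
  moreover have "p \<in> U'" using p r(1) is_chartD(7)[OF cc p] by (auto simp: U'_def C_def in_cube)
  moreover have "U' \<subseteq> U" by (auto simp: U'_def)
  moreover have "\<forall>q\<in>U'. (\<lambda>x. x(i := g x)) (\<phi> q) = (\<phi> q)(i := h q)"
    using is_chartD(8)[OF cc] by (simp add: g_def U'_def)
  ultimately show ?thesis by blast
qed

lemma sub_E: "A \<subseteq> En n \<Longrightarrow> subtopology (Euclidean_space n) A = top_of_set A"
  unfolding Euclidean_space_def
  by (simp add: subtopology_subtopology euclidean_product_topology topspace_Euclidean_space Int_absorb1)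

lemma En_mono: "k \<le> n \<Longrightarrow> x \<in> En k \<Longrightarrow> x \<in> En n"
  by (auto simp: En_iff)

lemma openin_En_lower:
  assumes W: "openin (Euclidean_space n) W" and k: "k \<le> n"
  shows "openin (Euclidean_space k) (W \<inter> En k)"
proof (rule openin_E_I)
  fix x assume x: "x \<in> W \<inter> En k"
  then obtain r where r: "r > 0" "cube n x r \<subseteq> W" using openin_E_cube[OF W] by blast
  have "cube k x r \<subseteq> cube n x r"
  proof
    fix y assume y: "y \<in> cube k x r"
    have "\<bar>y i - x i\<bar> < r" for i
      using y x r(1) by (cases "i < k") (auto simp: cube_def En_iff)
    then show "y \<in> cube n x r" using y En_mono[OF k] by (auto simp: cube_def)
  qed
  moreover have "cube k x r \<subseteq> En k" by (auto simp: cube_def)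
  ultimately show "\<exists>r>0. cube k x r \<subseteq> W \<inter> En k" using r by blast
qed auto

definition slices :: "'a mfd \<Rightarrow> nat \<Rightarrow> 'a set \<Rightarrow> bool" where
  "slices M k S \<longleftrightarrow> k \<le> mdim M \<and> S \<subseteq> pts M \<and>
     (\<forall>p\<in>S. \<exists>U \<phi>. (U, \<phi>) \<in> max_atlas M \<and> p \<in> U \<and> \<phi> ` (U \<inter> S) = \<phi> ` U \<inter> En k)"

lemma slice_chart:
  assumes c: "is_chart n T (U, \<phi>)" and s: "\<phi> ` (U \<inter> S) = \<phi> ` U \<inter> En k" and k: "k \<le> n"
  shows "is_chart k (subtopology T S) (U \<inter> S, \<phi>)"
    "\<And>x. x \<in> \<phi> ` (U \<inter> S) \<Longrightarrow> inv_into (U \<inter> S) \<phi> x = inv_into U \<phi> x"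
proof -
  have inv: "inv_into U \<phi> (\<phi> p) = p" if "p \<in> U \<inter> S" for p using is_chartD(8)[OF c] that by auto
  show ch: "is_chart k (subtopology T S) (U \<inter> S, \<phi>)"
  proof (rule is_chartI[where \<theta>="inv_into U \<phi>"])
    show "openin (subtopology T S) (U \<inter> S)" using is_chartD(1)[OF c] by (rule openin_subtopology_Int)
    show "openin (Euclidean_space k) (\<phi> ` (U \<inter> S))"
      unfolding s by (rule openin_En_lower[OF is_chartD(3)[OF c] k])
    have "subtopology (subtopology T S) (U \<inter> S) = subtopology T (S \<inter> (U \<inter> S))" by (rule subtopology_subtopology)
    moreover have "S \<inter> (U \<inter> S) \<subseteq> U" by auto
    ultimately show "continuous_map (subtopology (subtopology T S) (U \<inter> S)) euclideanreal (\<lambda>p. \<phi> p i)" for i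
      using continuous_map_from_subtopology_mono[OF is_chart_cont(1)[OF c]] by simp
    have A: "\<phi> ` (U \<inter> S) \<subseteq> En k" unfolding s by blast
    then have A': "\<phi> ` (U \<inter> S) \<subseteq> En n" using En_mono[OF k] by blast
    have "continuous_map (subtopology (Euclidean_space n) (\<phi> ` (U \<inter> S))) T (inv_into U \<phi>)"
      by (rule continuous_map_from_subtopology_mono[OF is_chart_cont(2)[OF c]]) auto
    then have "continuous_map (subtopology (Euclidean_space k) (\<phi> ` (U \<inter> S))) T (inv_into U \<phi>)"
      unfolding sub_E[OF A] sub_E[OF A'] .
    moreover have "inv_into U \<phi> x \<in> S" if "x \<in> \<phi> ` (U \<inter> S)" for x using that inv by auto
    ultimately show "continuous_map (subtopology (Euclidean_space k) (\<phi> ` (U \<inter> S))) (subtopology T S) (inv_into U \<phi>)"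
      by (auto simp: continuous_map_in_subtopology)
    show "inv_into U \<phi> (\<phi> p) = p" if "p \<in> U \<inter> S" for p by (rule inv[OF that])
  qed
  show "inv_into (U \<inter> S) \<phi> x = inv_into U \<phi> x" if "x \<in> \<phi> ` (U \<inter> S)" for x
    using that is_chartD(8)[OF ch] inv by auto
qed

context
  fixes M :: "'a mfd" and k :: nat and S :: "'a set"
  assumes M: "mfd_ok M" and sl: "slices M k S"
begin

lemma slD: "k \<le> mdim M" "S \<subseteq> pts M"
  using sl by (auto simp: slices_def)

lemma sub_simps: "mtop (submfd M k S) = subtopology (mtop M) S" "mdim (submfd M k S) = k" "pts (submfd M k S) = S"
  using slD by (auto simp: submfd_def)

lemma atlas_subD:
  assumes "c \<in> atlas (submfd M k S)"
  obtains U \<phi> where "(U, \<phi>) \<in> max_atlas M" "c = (U \<inter> S, \<phi>)" "\<phi> ` (U \<inter> S) = \<phi> ` U \<inter> En k"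
  using assms by (auto simp: submfd_def topspace_Euclidean_space)

lemma atlas_subI: "(U, \<phi>) \<in> max_atlas M \<Longrightarrow> \<phi> ` (U \<inter> S) = \<phi> ` U \<inter> En k \<Longrightarrow> (U \<inter> S, \<phi>) \<in> atlas (submfd M k S)"
  by (auto simp: submfd_def topspace_Euclidean_space)

lemma submfd_ok: "mfd_ok (submfd M k S)"
  unfolding mfd_ok_def
proof (intro conjI ballI)
  show "Hausdorff_space (mtop (submfd M k S))"
    using M by (simp add: sub_simps Hausdorff_space_subtopology mfd_ok_def)
  show "is_chart (mdim (submfd M k S)) (mtop (submfd M k S)) c" if "c \<in> atlas (submfd M k S)" for c
    using that
  proof (rule atlas_subD)
    fix U \<phi> assume a: "(U, \<phi>) \<in> max_atlas M" "c = (U \<inter> S, \<phi>)" "\<phi> ` (U \<inter> S) = \<phi> ` U \<inter> En k"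
    show ?thesis unfolding sub_simps a(2) by (rule slice_chart(1)[OF max_chart[OF a(1)] a(3) slD(1)])
  qed
  show "(\<Union>c\<in>atlas (submfd M k S). fst c) = pts (submfd M k S)"
  proof (intro Set.set_eqI iffI)
    fix p assume "p \<in> (\<Union>c\<in>atlas (submfd M k S). fst c)"
    then obtain c where c: "c \<in> atlas (submfd M k S)" "p \<in> fst c" by blast
    obtain U \<phi> where "c = (U \<inter> S, \<phi>)" using c(1) by (rule atlas_subD)
    then show "p \<in> pts (submfd M k S)" using c(2) slD(2) by (auto simp: sub_simps)
  next
    fix p assume "p \<in> pts (submfd M k S)"
    then have p: "p \<in> S" by (simp add: sub_simps)
    then obtain U \<phi> where U: "(U, \<phi>) \<in> max_atlas M" "p \<in> U" "\<phi> ` (U \<inter> S) = \<phi> ` U \<inter> En k"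
      using sl unfolding slices_def by blast
    from atlas_subI[OF U(1,3)] U(2) p show "p \<in> (\<Union>c\<in>atlas (submfd M k S). fst c)" by (intro UN_I) auto
  qed
  fix c d assume c: "c \<in> atlas (submfd M k S)" and d: "d \<in> atlas (submfd M k S)"
  obtain U \<phi> where a: "(U, \<phi>) \<in> max_atlas M" "c = (U \<inter> S, \<phi>)" "\<phi> ` (U \<inter> S) = \<phi> ` U \<inter> En k" using c by (rule atlas_subD)
  obtain V \<psi> where b: "(V, \<psi>) \<in> max_atlas M" "d = (V \<inter> S, \<psi>)" "\<psi> ` (V \<inter> S) = \<psi> ` V \<inter> En k" using d by (rule atlas_subD)
  note ch = slice_chart[OF max_chart[OF a(1)] a(3) slD(1)]
  have oV: "openin (subtopology (mtop M) S) (V \<inter> S)" using is_chartD(1)[OF max_chart[OF b(1)]] by (rule openin_subtopology_Int)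
  have o: "openin (Euclidean_space k) (\<phi> ` ((U \<inter> S) \<inter> (V \<inter> S)))"
    by (rule is_chartD(4)[OF ch(1) openin_Int[OF is_chartD(1)[OF ch(1)] oV]]) auto
  have "smooth_on k (\<phi> ` ((U \<inter> S) \<inter> (V \<inter> S))) (\<lambda>x. \<psi> (inv_into (U \<inter> S) \<phi> x) i)" if i: "i < k" for i
  proof -
    have "smooth_on (mdim M) (\<phi> ` (U \<inter> V)) (\<lambda>x. \<psi> (inv_into U \<phi> x) i)"
      using transition_smoothD[OF max_transition[OF M a(1) b(1)]] i slD(1) by simp
    from smooth_on_lower[OF slD(1) this]
    have "smooth_on k (\<phi> ` ((U \<inter> S) \<inter> (V \<inter> S))) (\<lambda>x. \<psi> (inv_into U \<phi> x) i)"
      by (rule smooth_on_subset) (use a(3) in auto)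
    then show ?thesis by (rule smooth_on_cong[OF o]) (use ch(2) in auto)
  qed
  then show "transition_smooth (mdim (submfd M k S)) c d"
    unfolding sub_simps a(2) b(2) transition_smooth_def by simp
qed

lemma Cmap_incl: "Cmap (submfd M k S) M id"
  unfolding Cmap_def
proof (intro conjI ballI)
  show "continuous_map (mtop (submfd M k S)) (mtop M) id" by (simp add: sub_simps continuous_map_from_subtopology)
  fix f assume f: "f \<in> Cinf M"
  show "pull0 (submfd M k S) id f \<in> Cinf (submfd M k S)"
  proof (rule CinfI[OF submfd_ok])
    show "sm (submfd M k S) (pts (submfd M k S)) (pull0 (submfd M k S) id f)"
    proof (rule smI[OF submfd_ok openin_topspace])
      fix p assume "p \<in> pts (submfd M k S)"
      then have p: "p \<in> S" by (simp add: sub_simps)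
      then obtain U \<phi> where U: "(U, \<phi>) \<in> max_atlas M" "p \<in> U" "\<phi> ` (U \<inter> S) = \<phi> ` U \<inter> En k"
        using sl unfolding slices_def by blast
      note ch = slice_chart[OF max_chart[OF U(1)] U(3) slD(1)]
      have UM: "U \<subseteq> pts M" using openin_subset[OF is_chartD(1)[OF max_chart[OF U(1)]]] .
      have "smooth_on (mdim M) (\<phi> ` U) (\<lambda>x. f (inv_into U \<phi> x))"
        using smD[OF M openin_topspace Cinf_sm[OF M f order_refl] U(1)] UM by (simp add: Int_absorb2)
      from smooth_on_lower[OF slD(1) this] have "smooth_on k (\<phi> ` (U \<inter> S)) (\<lambda>x. f (inv_into U \<phi> x))"
        unfolding U(3) .
      then have "smooth_on k (\<phi> ` (U \<inter> S)) (\<lambda>x. pull0 (submfd M k S) id f (inv_into (U \<inter> S) \<phi> x))"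
      proof (rule smooth_on_cong[OF is_chartD(3)[OF ch(1)]])
        fix x assume "x \<in> \<phi> ` (U \<inter> S)"
        then obtain q where q: "q \<in> U \<inter> S" "x = \<phi> q" by blast
        then have "inv_into (U \<inter> S) \<phi> x = q" "inv_into U \<phi> x = q"
          using is_chartD(8)[OF ch(1)] is_chartD(8)[OF max_chart[OF U(1)]] by auto
        then show "f (inv_into U \<phi> x) = pull0 (submfd M k S) id f (inv_into (U \<inter> S) \<phi> x)"
          using q(1) slD(2) by (auto simp: pull0_def sub_simps)
      qed
      moreover have "(U \<inter> S, \<phi>) \<in> max_atlas (submfd M k S)" by (rule atlas_max[OF submfd_ok atlas_subI[OF U(1,3)]])
      moreover have "openin (mtop (submfd M k S)) (U \<inter> S)" using is_chartD(1)[OF ch(1)] by (simp add: sub_simps)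
      ultimately show "\<exists>U \<phi> S'. (U, \<phi>) \<in> max_atlas (submfd M k S) \<and> openin (mtop (submfd M k S)) S' \<and> p \<in> S' \<and> S' \<subseteq> U \<and>
        smooth_on (mdim (submfd M k S)) (\<phi> ` S') (\<lambda>x. pull0 (submfd M k S) id f (inv_into U \<phi> x))"
        unfolding sub_simps using U(2) p by blast
    qed
  qed (simp add: pull0_def)
qed

lemma sub_extend:
  assumes f: "f \<in> Cinf (submfd M k S)" and p: "p \<in> S"
  shows "\<exists>F\<in>Cinf M. \<exists>A. openin (mtop M) A \<and> p \<in> A \<and> (\<forall>q\<in>A \<inter> S. F q = f q)"
proof -
  obtain U \<phi> where U: "(U, \<phi>) \<in> max_atlas M" "p \<in> U" "\<phi> ` (U \<inter> S) = \<phi> ` U \<inter> En k"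
    using sl p unfolding slices_def by blast
  note cc = max_chart[OF U(1)]
  note ch = slice_chart[OF cc U(3) slD(1)]
  define g where "g x = f (inv_into (U \<inter> S) \<phi> x)" for x
  have g: "smooth_on k (\<phi> ` (U \<inter> S)) g"
    using Cinf_chart[OF f atlas_subI[OF U(1,3)]] unfolding g_def[abs_def] sub_simps .
  define W where "W = {x \<in> En (mdim M). trunc k x \<in> \<phi> ` (U \<inter> S)}"
  have W: "openin (Euclidean_space (mdim M)) W" unfolding W_def by (rule openin_trunc[OF is_chartD(3)[OF ch(1)]])
  define A0 where "A0 = {q \<in> U. \<phi> q \<in> W}"
  have A0: "openin (mtop M) A0" unfolding A0_def by (rule is_chartD(5)[OF cc W])
  have smA: "sm M A0 (\<lambda>q. g (trunc k (\<phi> q)))"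
  proof (rule sm_compose[where g="\<lambda>x. g (trunc k x)" and F=\<phi>, OF M A0 W])
    show "smooth_on (mdim M) W (\<lambda>x. g (trunc k x))" unfolding W_def by (rule smooth_on_trunc[OF is_chartD(3)[OF ch(1)] g])
    show "sm M A0 (\<lambda>p. \<phi> p j)" if "j < mdim M" for j
      by (rule sm_mono[OF sm_coord[OF M U(1) that]]) (auto simp: A0_def)
  qed (auto simp: A0_def)
  have val: "g (trunc k (\<phi> q)) = f q" "q \<in> A0" if "q \<in> U \<inter> S" for q
  proof -
    have "\<phi> q \<in> En k" using that U(3) by auto
    then have "trunc k (\<phi> q) = \<phi> q" by (rule trunc_id)
    then show "g (trunc k (\<phi> q)) = f q" "q \<in> A0"
      using that is_chartD(8)[OF ch(1) that] is_chartD(7)[OF cc] by (auto simp: g_def A0_def W_def)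
  qed
  have pA: "p \<in> A0" using val(2) p U(2) by auto
  obtain F A where F: "F \<in> Cinf M" "openin (mtop M) A" "p \<in> A" "A \<subseteq> A0" "\<And>q. q \<in> A \<Longrightarrow> F q = g (trunc k (\<phi> q))"
    using extend_sm[OF M A0 pA smA] by blast
  have "F q = f q" if "q \<in> A \<inter> S" for q
    using that F(4,5) val(1)[of q] by (auto simp: A0_def)
  then show ?thesis using F(1-3) by blast
qed

lemma sub_into:
  assumes L: "mfd_ok L" and g: "Cmap L M g" and im: "\<And>x. x \<in> pts L \<Longrightarrow> g x \<in> S"
  shows "Cmap L (submfd M k S) g"
  unfolding Cmap_def
proof (intro conjI ballI)
  show "continuous_map (mtop L) (mtop (submfd M k S)) g"
    using g im by (auto simp: Cmap_def sub_simps continuous_map_in_subtopology)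
  fix f assume f: "f \<in> Cinf (submfd M k S)"
  show "pull0 L g f \<in> Cinf L"
  proof (rule Cinf_localI'[OF L])
    fix x assume x: "x \<in> pts L"
    obtain F A where F: "F \<in> Cinf M" "openin (mtop M) A" "g x \<in> A" "\<And>q. q \<in> A \<inter> S \<Longrightarrow> F q = f q"
      using sub_extend[OF f im[OF x]] by blast
    have "\<forall>q\<in>{q \<in> pts L. g q \<in> A}. pull0 L g f q = pull0 L g F q"
      using F(4) im by (auto simp: pull0_def)
    then show "\<exists>S' h. openin (mtop L) S' \<and> x \<in> S' \<and> h \<in> Cinf L \<and> (\<forall>q\<in>S'. pull0 L g f q = h q)"
      using Cmap_open[OF g F(2)] x F(3) Cmap_pull[OF g F(1)] by blast
  qed (simp add: pull0_def)
qed

lemma sub_push_inj: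
  assumes p: "p \<in> S" and u: "u \<in> tangent (submfd M k S) p" "u' \<in> tangent (submfd M k S) p"
    and eq: "push (submfd M k S) M id u = push (submfd M k S) M id u'"
  shows "u = u'"
proof (rule tangent_eqI[OF submfd_ok u])
  fix f assume f: "f \<in> Cinf (submfd M k S)"
  obtain F A where F: "F \<in> Cinf M" "openin (mtop M) A" "p \<in> A" "\<And>q. q \<in> A \<inter> S \<Longrightarrow> F q = f q"
    using sub_extend[OF f p] by blast
  have o: "openin (mtop (submfd M k S)) (A \<inter> S)" unfolding sub_simps by (rule openin_subtopology_Int[OF F(2)])
  have *: "w f = push (submfd M k S) M id w F" if w: "w \<in> tangent (submfd M k S) p" for w
    unfolding push_app[OF F(1)]
    by (rule tan_local[OF submfd_ok w o _ f Cmap_pull[OF Cmap_incl F(1)]])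
       (use p F(3,4) slD(2) in \<open>auto simp: pull0_def sub_simps\<close>)
  show "u f = u' f" unfolding *[OF u(1)] *[OF u(2)] eq ..
qed

lemma sub_lift:
  assumes p: "p \<in> S" and v: "v \<in> tangent M p"
    and z: "\<And>F A. F \<in> Cinf M \<Longrightarrow> openin (mtop M) A \<Longrightarrow> p \<in> A \<Longrightarrow> (\<And>q. q \<in> A \<Longrightarrow> q \<in> S \<Longrightarrow> F q = 0) \<Longrightarrow> v F = 0"
  shows "\<exists>u\<in>tangent (submfd M k S) p. push (submfd M k S) M id u = v"
proof -
  define ext where "ext f F \<longleftrightarrow> F \<in> Cinf M \<and> (\<exists>A. openin (mtop M) A \<and> p \<in> A \<and> (\<forall>q\<in>A \<inter> S. F q = f q))" for f F
  define u where "u f = (if f \<in> Cinf (submfd M k S) then v (SOME F. ext f F) else 0)" for f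
  have ex: "\<exists>F. ext f F" if "f \<in> Cinf (submfd M k S)" for f
    using sub_extend[OF that p] unfolding ext_def by blast
  have u: "u f = v F" if f: "f \<in> Cinf (submfd M k S)" and F: "ext f F" for f F
  proof -
    have E: "ext f (SOME F. ext f F)" using ex[OF f] by (rule someI_ex)
    then obtain A where A: "openin (mtop M) A" "p \<in> A" "\<forall>q\<in>A \<inter> S. (SOME F. ext f F) q = f q" unfolding ext_def by blast
    obtain A' where A': "openin (mtop M) A'" "p \<in> A'" "\<forall>q\<in>A' \<inter> S. F q = f q" using F unfolding ext_def by blast
    have C: "(SOME F. ext f F) \<in> Cinf M" "F \<in> Cinf M" using E F unfolding ext_def by blast+
    have "v ((SOME F. ext f F) - F) = 0"
      by (rule z[OF Cinf_diff[OF M C], of "A \<inter> A'"]) (use A A' in auto)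
    then show ?thesis using tan_diff[OF M v C] f by (simp add: u_def)
  qed
  have ext_val: "F p = f p" if "ext f F" for f F using that p unfolding ext_def by blast
  have ext2: "ext (h f g) (h F G)" if e1: "ext f F" and e2: "ext g G" and hC: "h F G \<in> Cinf M" and hq: "\<And>f g q. h f g q = (h' (f q) (g q) :: real)" for f g F G h h'
  proof -
    obtain A where A: "openin (mtop M) A" "p \<in> A" "\<forall>q\<in>A \<inter> S. F q = f q" using e1 unfolding ext_def by blast
    obtain A' where A': "openin (mtop M) A'" "p \<in> A'" "\<forall>q\<in>A' \<inter> S. G q = g q" using e2 unfolding ext_def by blast
    have "openin (mtop M) (A \<inter> A') \<and> p \<in> A \<inter> A' \<and> (\<forall>q\<in>(A \<inter> A') \<inter> S. h F G q = h f g q)"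
      using A A' hq by auto
    then show ?thesis unfolding ext_def using hC by blast
  qed
  have extC: "F \<in> Cinf M" if "ext f F" for f F using that by (simp add: ext_def)
  note N = submfd_ok
  have add: "u (f + g) = u f + u g" if fg: "f \<in> Cinf (submfd M k S)" "g \<in> Cinf (submfd M k S)" for f g
  proof -
    obtain F G where FG: "ext f F" "ext g G" using ex fg by blast
    have "ext (f + g) (F + G)" by (rule ext2[where h="(+)" and h'="(+)", OF FG Cinf_add[OF M extC[OF FG(1)] extC[OF FG(2)]]]) simp
    then show ?thesis using u[OF fg(1) FG(1)] u[OF fg(2) FG(2)] u[OF Cinf_add[OF N fg]] tan_add[OF M v extC[OF FG(1)] extC[OF FG(2)]] by simp
  qed
  have mult: "u (f * g) = u f * g p + f p * u g" if fg: "f \<in> Cinf (submfd M k S)" "g \<in> Cinf (submfd M k S)" for f g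
  proof -
    obtain F G where FG: "ext f F" "ext g G" using ex fg by blast
    have "ext (f * g) (F * G)" by (rule ext2[where h="(*)" and h'="(*)", OF FG Cinf_mult[OF M extC[OF FG(1)] extC[OF FG(2)]]]) simp
    then show ?thesis using u[OF fg(1) FG(1)] u[OF fg(2) FG(2)] u[OF Cinf_mult[OF N fg]] tan_mult[OF M v extC[OF FG(1)] extC[OF FG(2)]]
      ext_val[OF FG(1)] ext_val[OF FG(2)] by simp
  qed
  have scale: "u (c *\<^sub>R f) = c * u f" if f: "f \<in> Cinf (submfd M k S)" for c f
  proof -
    obtain F where F: "ext f F" using ex f by blast
    have "ext (c *\<^sub>R f) (c *\<^sub>R F)"
      by (rule ext2[where h="\<lambda>f g. c *\<^sub>R f" and h'="\<lambda>x y. c * x", OF F F Cinf_scale[OF M extC[OF F]]]) simp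
    then show ?thesis using u[OF f F] u[OF Cinf_scale[OF N f]] tan_scale[OF M v extC[OF F]] by simp
  qed
  have "u \<in> tangent (submfd M k S) p"
    unfolding tangent_def using add mult scale by (auto simp: u_def)
  moreover have "push (submfd M k S) M id u = v"
  proof (rule ext)
    fix h show "push (submfd M k S) M id u h = v h"
    proof (cases "h \<in> Cinf M")
      case True
      have "ext (pull0 (submfd M k S) id h) h"
        unfolding ext_def using True p slD(2) openin_topspace[of "mtop M"] by (auto simp: pull0_def sub_simps intro!: exI[of _ "pts M"])
      then show ?thesis using u[OF Cmap_pull[OF Cmap_incl True]] True by (simp add: push_def)
    qed (simp add: push_def tan_off[OF M v])
  qed
  ultimately show ?thesis by blast
qed

lemma sub_vfield:
  assumes X: "X \<in> vfields M" and t: "\<And>p. p \<in> S \<Longrightarrow> \<exists>u\<in>tangent (submfd M k S) p. push (submfd M k S) M id u = X p"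
  shows "\<exists>Y\<in>vfields (submfd M k S). related (submfd M k S) M id Y X"
proof -
  obtain Y0 where Y0: "\<And>p. p \<in> S \<Longrightarrow> Y0 p \<in> tangent (submfd M k S) p \<and> push (submfd M k S) M id (Y0 p) = X p"
    using t by metis
  define Y where "Y p = (if p \<in> S then Y0 p else 0)" for p
  have Y: "Y p \<in> tangent (submfd M k S) p" "push (submfd M k S) M id (Y p) = X p" if "p \<in> S" for p
    using Y0 that by (auto simp: Y_def)
  have "Y \<in> vfields (submfd M k S)"
  proof (rule vfI[OF submfd_ok])
    fix f assume f: "f \<in> Cinf (submfd M k S)"
    show "(\<lambda>p. Y p f) \<in> Cinf (submfd M k S)"
    proof (rule Cinf_localI'[OF submfd_ok])
      fix p assume "p \<in> pts (submfd M k S)"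
      then have p: "p \<in> S" by (simp add: sub_simps)
      obtain F A where F: "F \<in> Cinf M" "openin (mtop M) A" "p \<in> A" "\<And>q. q \<in> A \<inter> S \<Longrightarrow> F q = f q"
        using sub_extend[OF f p] by blast
      have o: "openin (mtop (submfd M k S)) (A \<inter> S)" unfolding sub_simps by (rule openin_subtopology_Int[OF F(2)])
      have "Y q f = pull0 (submfd M k S) id (\<lambda>q. X q F) q" if q: "q \<in> A \<inter> S" for q
      proof -
        have qS: "q \<in> S" using q by auto
        have "Y q f = Y q (pull0 (submfd M k S) id F)"
          by (rule tan_local[OF submfd_ok Y(1)[OF qS] o q f Cmap_pull[OF Cmap_incl F(1)]])
             (use F(4) slD(2) in \<open>auto simp: pull0_def sub_simps\<close>)
        also have "\<dots> = X q F" using Y(2)[OF qS] push_app[OF F(1), of "submfd M k S" id "Y q"] by simp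
        finally show ?thesis using qS slD(2) by (auto simp: pull0_def sub_simps)
      qed
      then show "\<exists>S' g. openin (mtop (submfd M k S)) S' \<and> p \<in> S' \<and> g \<in> Cinf (submfd M k S) \<and> (\<forall>q\<in>S'. Y q f = g q)"
        using o p F(3) Cmap_pull[OF Cmap_incl vf_Cinf[OF M X F(1)]] by blast
    qed (use slD(2) in \<open>auto simp: Y_def sub_simps\<close>)
  qed (use Y slD(2) in \<open>auto simp: sub_simps Y_def\<close>)
  moreover have "related (submfd M k S) M id Y X" using Y(2) by (simp add: related_def sub_simps)
  ultimately show ?thesis by blast
qed

end

lemma level_chart:
  assumes M: "mfd_ok M" and p: "p \<in> pts M" and h: "\<And>j. j < c \<Longrightarrow> h j \<in> Cinf M"
    and v: "\<And>j. j < c \<Longrightarrow> v j \<in> tangent M p" "\<And>j l. j < c \<Longrightarrow> l < c \<Longrightarrow> v j (h l) = (if j = l then 1 else 0)"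
  shows "k \<le> c \<Longrightarrow> k \<le> mdim M \<and> (\<exists>U \<phi>. (U, \<phi>) \<in> max_atlas M \<and> p \<in> U \<and> (\<forall>j<k. \<forall>q\<in>U. \<phi> q (mdim M - 1 - j) = h j q))"
proof (induction k)
  case 0
  obtain U \<phi> where "(U, \<phi>) \<in> atlas M" "p \<in> U" using mfd_cover[OF M p] by blast
  then show ?case using atlas_max[OF M] by auto
next
  case (Suc k)
  define n where "n = mdim M"
  have kc: "k < c" using Suc.prems by simp
  obtain U \<phi> where kn: "k \<le> n" and U: "(U, \<phi>) \<in> max_atlas M" "p \<in> U" "\<And>j q. j < k \<Longrightarrow> q \<in> U \<Longrightarrow> \<phi> q (n - 1 - j) = h j q"
    using Suc unfolding n_def by auto
  obtain V X D where cf: "coord_frame M U \<phi> V X D" and pV: "p \<in> V" using coord_frame_ex[OF M U(1,2)] by blast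
  have "1 = (\<Sum>i<n. v k (X i) * D i p (h k))"
    using coord_frameD(8)[OF cf pV v(1)[OF kc] h[OF kc]] v(2)[OF kc kc] by (simp add: n_def)
  then have "\<exists>i<n. v k (X i) * D i p (h k) \<noteq> 0"
    by (metis (no_types, lifting) lessThan_iff sum.neutral zero_neq_one)
  then obtain i where i: "i < n" "v k (X i) \<noteq> 0" "D i p (h k) \<noteq> 0" by auto
  have ne: "i \<noteq> n - 1 - j" if j: "j < k" for j
  proof
    assume eq: "i = n - 1 - j"
    have jc: "j < c" using j kc by simp
    have "v k (X i) = v k (h j)"
    proof (rule tan_local[OF M v(1)[OF kc] coord_frameD(1)[OF cf] pV])
      show "X i \<in> Cinf M" using coord_frameD(3)[OF cf] i(1) by (simp add: n_def)
      show "h j \<in> Cinf M" by (rule h[OF jc])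
      fix q assume q: "q \<in> V"
      then have "X i q = \<phi> q i" using coord_frameD(5)[OF cf] i(1) by (simp add: n_def)
      also have "\<dots> = h j q" using U(3)[OF j] q coord_frameD(2)[OF cf] eq by auto
      finally show "X i q = h j q" .
    qed
    then show False using v(2)[OF kc jc] j i(2) by simp
  qed
  have kn': "k < n"
  proof (rule ccontr)
    assume "\<not> k < n"
    then have "n - 1 - i < k" "i = n - 1 - (n - 1 - i)" using kn i(1) by auto
    then show False using ne by blast
  qed
  have nz: "partial i (\<lambda>x. h k (inv_into U \<phi> x)) (\<phi> p) \<noteq> 0"
    using coord_frameD(6)[OF cf _ pV h[OF kc], of i] i by (simp add: n_def)
  obtain U' \<phi>' where U': "(U', \<phi>') \<in> max_atlas M" "p \<in> U'" "U' \<subseteq> U" "\<And>q. q \<in> U' \<Longrightarrow> \<phi>' q = (\<phi> q)(i := h k q)"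
    using chart_exchange[OF M U(1,2) i(1)[unfolded n_def] h[OF kc] nz] by blast
  define m where "m = n - 1 - k"
  have mn: "m < n" using kn' by (simp add: m_def)
  have sw: "(U', \<lambda>q l. \<phi>' q (Transposition.transpose i m l)) \<in> max_atlas M"
    by (rule chart_swap[OF M U'(1)]) (use i(1) mn in \<open>auto simp: n_def\<close>)
  have "\<phi>' q (Transposition.transpose i m (n - 1 - j)) = h j q" if j: "j < Suc k" and q: "q \<in> U'" for j q
  proof (cases "j = k")
    case True
    then have "Transposition.transpose i m (n - 1 - j) = i" by (simp add: m_def)
    then show ?thesis using U'(4)[OF q] True by simp
  next
    case False
    then have jk: "j < k" using j by simp
    then have "n - 1 - j \<noteq> m" using kn' by (simp add: m_def)
    then have "Transposition.transpose i m (n - 1 - j) = n - 1 - j" using ne[OF jk] by (simp add: Transposition.transpose_def)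
    then show ?thesis using U'(4)[OF q] ne[OF jk] U(3)[OF jk] U'(3) q by auto
  qed
  then show ?case using sw U'(2) kn' unfolding n_def by (intro conjI exI[of _ U'] exI) auto
qed


context
  fixes M :: "'a mfd" and N :: "'b mfd" and a b :: "'a \<Rightarrow> 'b" and S :: "'a set"
  assumes M: "mfd_ok M" and N: "mfd_ok N" and a: "Cmap M N a" and b: "Cmap M N b"
    and S: "S = {p \<in> pts M. a p = b p}"
    and onto: "\<And>p w. p \<in> pts M \<Longrightarrow> a p = b p \<Longrightarrow> w \<in> tangent N (a p) \<Longrightarrow> \<exists>v\<in>tangent M p. push M N a v - push M N b v = w"
begin

lemma eq_local:
  assumes p: "p \<in> S"
  shows "(\<exists>U \<phi>. (U, \<phi>) \<in> max_atlas M \<and> p \<in> U \<and> \<phi> ` (U \<inter> S) = \<phi> ` U \<inter> En (mdim M - mdim N)) \<and>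
    (\<forall>v\<in>tangent M p. push M N a v = push M N b v \<longrightarrow>
       (\<forall>F\<in>Cinf M. \<forall>A. openin (mtop M) A \<and> p \<in> A \<and> (\<forall>q\<in>A \<inter> S. F q = 0) \<longrightarrow> v F = 0))"
proof -
  define n where "n = mdim M"
  define c where "c = mdim N"
  have pM: "p \<in> pts M" and ab: "a p = b p" using p S by auto
  obtain V \<psi> where d: "(V, \<psi>) \<in> atlas N" "a p \<in> V" using mfd_cover[OF N Cmap_pts[OF a pM]] by blast
  note dc = mfd_chart[OF N d(1)]
  obtain V' Y E where cf: "coord_frame N V \<psi> V' Y E" and aV: "a p \<in> V'" using coord_frame_ex[OF N atlas_max[OF N d(1)] d(2)] by blast
  note V' = coord_frameD(1,2)[OF cf] and Y = coord_frameD(3,5)[OF cf, folded c_def] and E = coord_frameD(4,7)[OF cf, folded c_def]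
  define h where "h j = pull0 M a (Y j) - pull0 M b (Y j)" for j
  have h: "h j \<in> Cinf M" if "j < c" for j
    unfolding h_def by (intro Cinf_diff[OF M] Cmap_pull[OF a] Cmap_pull[OF b] Y(1) that)
  have vh: "u (h j) = (push M N a u - push M N b u) (Y j)" if "j < c" "u \<in> tangent M p" for u j
    using tan_diff[OF M that(2) Cmap_pull[OF a Y(1)[OF that(1)]] Cmap_pull[OF b Y(1)[OF that(1)]]] Y(1)[OF that(1)]
    by (simp add: h_def push_def)
  have "\<exists>u\<in>tangent M p. push M N a u - push M N b u = E j (a p)" if "j < c" for j
    by (rule onto[OF pM ab vfD[OF N E(1)[OF that] Cmap_pts[OF a pM]]])
  then obtain v where v: "\<And>j. j < c \<Longrightarrow> v j \<in> tangent M p" "\<And>j. j < c \<Longrightarrow> push M N a (v j) - push M N b (v j) = E j (a p)"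
    by metis
  have vd: "v j (h l) = (if j = l then 1 else 0)" if "j < c" "l < c" for j l
    using vh[OF that(2) v(1)[OF that(1)]] v(2)[OF that(1)] E(2)[OF that aV] by simp
  obtain U \<phi> where cn: "c \<le> n" and U: "(U, \<phi>) \<in> max_atlas M" "p \<in> U" "\<And>j q. j < c \<Longrightarrow> q \<in> U \<Longrightarrow> \<phi> q (n - 1 - j) = h j q"
    using level_chart[where c=c and k=c and h=h and v=v, OF M pM h v(1) vd order_refl] unfolding n_def by blast
  define B where "B = {q \<in> pts M. a q \<in> V'} \<inter> {q \<in> pts M. b q \<in> V'}"
  have B: "openin (mtop M) B" unfolding B_def by (intro openin_Int Cmap_open[OF a V'(1)] Cmap_open[OF b V'(1)])
  have pB: "p \<in> B" using pM aV ab by (simp add: B_def)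
  have SB: "q \<in> S \<longleftrightarrow> (\<forall>j<c. h j q = 0)" if q: "q \<in> B" for q
  proof
    assume "q \<in> S" then show "\<forall>j<c. h j q = 0" using S by (simp add: h_def pull0_def)
  next
    assume z: "\<forall>j<c. h j q = 0"
    have q': "q \<in> pts M" "a q \<in> V'" "b q \<in> V'" using q by (auto simp: B_def)
    have "\<psi> (a q) j = \<psi> (b q) j" for j
    proof (cases "j < c")
      case True then show ?thesis using z q' Y(2) by (simp add: h_def pull0_def)
    next
      case False
      have "a q \<in> V" "b q \<in> V" using q'(2,3) V'(2) by auto
      then have "\<psi> (a q) \<in> En c" "\<psi> (b q) \<in> En c" using is_chartD(7)[OF dc] unfolding c_def by blast+
      then show ?thesis using False by (simp add: En_iff)
    qed
    then have "\<psi> (a q) = \<psi> (b q)" by blast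
    then have "a q = b q" using is_chartD(2)[OF dc] q'(2,3) V'(2) by (meson inj_onD subsetD)
    then show "q \<in> S" using q'(1) S by simp
  qed
  define U1 where "U1 = U \<inter> B"
  have U1: "(U1, \<phi>) \<in> max_atlas M"
    by (rule chart_restrict[OF M U(1)]) (use is_chartD(1)[OF max_chart[OF U(1)]] B in \<open>auto simp: U1_def\<close>)
  note cc = max_chart[OF U1, folded n_def]
  have pU1: "p \<in> U1" using U(2) pB by (simp add: U1_def)
  have SE: "q \<in> S \<longleftrightarrow> \<phi> q \<in> En (n - c)" if q: "q \<in> U1" for q
  proof -
    have "q \<in> S \<longleftrightarrow> (\<forall>j<c. \<phi> q (n - 1 - j) = 0)" using SB[of q] U(3)[of _ q] q by (auto simp: U1_def)
    also have "\<dots> \<longleftrightarrow> (\<forall>i. n - c \<le> i \<and> i < n \<longrightarrow> \<phi> q i = 0)"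
    proof
      assume L: "\<forall>j<c. \<phi> q (n - 1 - j) = 0"
      show "\<forall>i. n - c \<le> i \<and> i < n \<longrightarrow> \<phi> q i = 0"
      proof (intro allI impI)
        fix i assume i: "n - c \<le> i \<and> i < n"
        then have "n - 1 - i < c" "n - 1 - (n - 1 - i) = i" using cn by auto
        then show "\<phi> q i = 0" using L by metis
      qed
    next
      assume R: "\<forall>i. n - c \<le> i \<and> i < n \<longrightarrow> \<phi> q i = 0"
      show "\<forall>j<c. \<phi> q (n - 1 - j) = 0" using R cn by auto
    qed
    also have "\<dots> \<longleftrightarrow> \<phi> q \<in> En (n - c)"
      using is_chartD(7)[OF cc q] by (auto simp: En_iff) (metis not_le)
    finally show ?thesis .
  qed
  have "\<phi> ` (U1 \<inter> S) = \<phi> ` U1 \<inter> En (n - c)" using SE by auto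
  moreover have "v F = 0" if v: "v \<in> tangent M p" "push M N a v = push M N b v" and F: "F \<in> Cinf M"
    and A: "openin (mtop M) A" "p \<in> A" "\<And>q. q \<in> A \<inter> S \<Longrightarrow> F q = 0" for v F A
  proof -
    obtain V2 X D where cf2: "coord_frame M U1 \<phi> V2 X D" and pV2: "p \<in> V2" using coord_frame_ex[OF M U1 pU1] by blast
    have "v (X i) * D i p F = 0" if i: "i < n" for i
    proof (cases "i < n - c")
      case True
      have oW: "openin (Euclidean_space n) (\<phi> ` (U1 \<inter> A))"
        by (rule is_chartD(4)[OF cc openin_Int[OF is_chartD(1)[OF cc] A(1)]]) auto
      have pE: "\<phi> p \<in> En (n - c)" using SE[OF pU1] p by simp
      have "\<forall>\<^sub>F t in nhds (\<phi> p i). (\<phi> p)(i := t) \<in> \<phi> ` (U1 \<inter> A)"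
        by (rule eventually_line[OF oW _ i]) (use pU1 A(2) in auto)
      then have "\<forall>\<^sub>F t in nhds (\<phi> p i). F (inv_into U1 \<phi> ((\<phi> p)(i := t))) = 0"
      proof eventually_elim
        case (elim t)
        then obtain q where q: "q \<in> U1" "q \<in> A" "(\<phi> p)(i := t) = \<phi> q" by blast
        have "\<phi> q \<in> En (n - c)" using En_upd[OF pE True] q(3) by metis
        then have "q \<in> S" using SE[OF q(1)] by simp
        then show ?case using A(3)[of q] q is_chartD(8)[OF cc q(1)] by simp
      qed
      then have "partial i (\<lambda>x. F (inv_into U1 \<phi> x)) (\<phi> p) = deriv (\<lambda>t. 0) (\<phi> p i)"
        unfolding partial_def by (intro deriv_cong_ev) auto
      then have "D i p F = 0" using coord_frameD(6)[OF cf2 _ pV2 F, of i] i by (simp add: n_def)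
      then show ?thesis by simp
    next
      case False
      define j where "j = n - 1 - i"
      have j: "j < c" "n - 1 - j = i" using False i cn by (auto simp: j_def)
      have "v (X i) = v (h j)"
      proof (rule tan_local[OF M v(1) coord_frameD(1)[OF cf2] pV2])
        show "X i \<in> Cinf M" using coord_frameD(3)[OF cf2] i by (simp add: n_def)
        show "h j \<in> Cinf M" by (rule h[OF j(1)])
        fix q assume q: "q \<in> V2"
        then have "X i q = \<phi> q i" using coord_frameD(5)[OF cf2] i by (simp add: n_def)
        also have "\<dots> = h j q" using U(3)[OF j(1), of q] j(2) q coord_frameD(2)[OF cf2] by (auto simp: U1_def)
        finally show "X i q = h j q" .
      qed
      then show ?thesis using vh[OF j(1) v(1)] v(2) by simp
    qed
    then have "(\<Sum>i<n. v (X i) * D i p F) = 0" by (intro sum.neutral) auto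
    then show ?thesis using coord_frameD(8)[OF cf2 pV2 v(1) F] by (simp add: n_def)
  qed
  ultimately show ?thesis using U1 pU1 unfolding n_def c_def by blast
qed

lemma eq_slices: "slices M (mdim M - mdim N) S"
  unfolding slices_def using eq_local S by (auto simp: S)

lemma eq_tangent:
  assumes p: "p \<in> S" and v: "v \<in> tangent M p" "push M N a v = push M N b v"
  shows "\<exists>u\<in>tangent (submfd M (mdim M - mdim N) S) p. push (submfd M (mdim M - mdim N) S) M id u = v"
proof (rule sub_lift[OF M eq_slices p v(1)])
  fix F A assume "F \<in> Cinf M" "openin (mtop M) A" "p \<in> A" "\<And>q. q \<in> A \<Longrightarrow> q \<in> S \<Longrightarrow> F q = 0"
  then show "v F = 0" using eq_local[OF p] v by blast
qed

end

section \<open>Exterior derivative of 1-forms\<close>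

lemma forms1D:
  assumes "\<alpha> \<in> forms1 M"
  shows "\<And>p v. p \<notin> pts M \<Longrightarrow> \<alpha> p v = 0" "\<And>p v. v \<notin> tangent M p \<Longrightarrow> \<alpha> p v = 0"
    "\<And>p v w. p \<in> pts M \<Longrightarrow> v \<in> tangent M p \<Longrightarrow> w \<in> tangent M p \<Longrightarrow> \<alpha> p (v + w) = \<alpha> p v + \<alpha> p w"
    "\<And>p v c. p \<in> pts M \<Longrightarrow> v \<in> tangent M p \<Longrightarrow> \<alpha> p (c *\<^sub>R v) = c * \<alpha> p v"
    "\<And>X. X \<in> vfields M \<Longrightarrow> contract X \<alpha> \<in> Cinf M"
  using assms by (simp_all add: forms1_def lin_at_def contract_def)

lemma forms1_minus:
  assumes "\<alpha> \<in> forms1 M" "mfd_ok M" "p \<in> pts M" "v \<in> tangent M p"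
  shows "\<alpha> p (- v) = - \<alpha> p v"
  using forms1D(4)[OF assms(1,3,4), of "-1"] by (simp add: scaleR_fun_def fun_Compl_def)

lemma forms1_diff_vec:
  assumes "\<alpha> \<in> forms1 M" "mfd_ok M" "p \<in> pts M" "v \<in> tangent M p" "w \<in> tangent M p"
  shows "\<alpha> p (v - w) = \<alpha> p v - \<alpha> p w"
  using forms1D(3)[OF assms(1,3,4) tangent_minus[OF assms(2,5)]] forms1_minus[OF assms(1-3,5)] by simp

lemma forms1_zero_vec:
  assumes "\<alpha> \<in> forms1 M" "mfd_ok M" "p \<in> pts M"
  shows "\<alpha> p 0 = 0"
  using forms1D(4)[OF assms(1,3) tangent_zero[OF assms(2)], of 0] by simp

lemma forms1_diff:
  assumes "mfd_ok M" "\<alpha> \<in> forms1 M" "\<beta> \<in> forms1 M"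
  shows "\<alpha> - \<beta> \<in> forms1 M"
proof -
  have "(\<lambda>p. (\<alpha> - \<beta>) p (X p)) \<in> Cinf M" if "X \<in> vfields M" for X
    using Cinf_diff[OF assms(1) forms1D(5)[OF assms(2) that] forms1D(5)[OF assms(3) that]]
    by (simp add: contract_def fun_diff_def)
  then show ?thesis
    using forms1D[OF assms(2)] forms1D[OF assms(3)]
    by (auto simp: forms1_def lin_at_def algebra_simps)
qed

lemma d0_forms1:
  assumes M: "mfd_ok M" and f: "f \<in> Cinf M"
  shows "d0 M f \<in> forms1 M"
proof -
  have "(\<lambda>p. d0 M f p (X p)) = (\<lambda>p. X p f)" if X: "X \<in> vfields M" for X
  proof
    fix p show "d0 M f p (X p) = X p f"
      by (cases "p \<in> pts M") (simp_all add: d0_def vfD[OF M X] vf_off[OF M X])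
  qed
  then show ?thesis
    using vf_Cinf[OF M _ f] tangent_add[OF M] tangent_scale[OF M]
    by (simp add: forms1_def lin_at_def) (simp add: d0_def)
qed

lemma forms2D:
  assumes "B \<in> forms2 M"
  shows "\<And>p v w. p \<notin> pts M \<Longrightarrow> B p v w = 0" "\<And>p v w. v \<notin> tangent M p \<Longrightarrow> B p v w = 0"
    "\<And>p v w. w \<notin> tangent M p \<Longrightarrow> B p v w = 0"
    "\<And>p u v w. p \<in> pts M \<Longrightarrow> u \<in> tangent M p \<Longrightarrow> v \<in> tangent M p \<Longrightarrow> w \<in> tangent M p \<Longrightarrow> B p u (v + w) = B p u v + B p u w"
    "\<And>p u v c. p \<in> pts M \<Longrightarrow> u \<in> tangent M p \<Longrightarrow> v \<in> tangent M p \<Longrightarrow> B p u (c *\<^sub>R v) = c * B p u v"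
    "\<And>p v w. B p v w = - B p w v"
    "\<And>X Y. X \<in> vfields M \<Longrightarrow> Y \<in> vfields M \<Longrightarrow> contract Y (contract X B) \<in> Cinf M"
proof -
  note D = assms[unfolded forms2_def mem_Collect_eq]
  note A = conjunct1[OF D] and L = conjunct1[OF conjunct2[OF D]]
    and S = conjunct1[OF conjunct2[OF conjunct2[OF D]]] and C = conjunct2[OF conjunct2[OF conjunct2[OF D]]]
  show "B p v w = 0" if "p \<notin> pts M" for p v w using A that by blast
  show "B p v w = 0" if "v \<notin> tangent M p" for p v w using A that by blast
  show "B p v w = 0" if "w \<notin> tangent M p" for p v w using A that by blast
  show "B p v w = - B p w v" for p v w using S by blast
  show "contract Y (contract X B) \<in> Cinf M" if "X \<in> vfields M" "Y \<in> vfields M" for X Y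
    using C that unfolding contract_def by blast
  show "B p u (v + w) = B p u v + B p u w"
    if "p \<in> pts M" "u \<in> tangent M p" "v \<in> tangent M p" "w \<in> tangent M p" for p u v w
    using L that unfolding lin_at_def by blast
  show "B p u (c *\<^sub>R v) = c * B p u v"
    if "p \<in> pts M" "u \<in> tangent M p" "v \<in> tangent M p" for p u v c
    using L that unfolding lin_at_def by blast
qed

lemma contract_forms2:
  assumes M: "mfd_ok M" and X: "X \<in> vfields M" and B: "B \<in> forms2 M"
  shows "contract X B \<in> forms1 M"
  unfolding forms1_def lin_at_def
  using forms2D(1,3,4,5)[OF B] vfD[OF M X] forms2D(7)[OF B X]
  by (auto simp: contract_def)

context
  fixes M :: "'a mfd" and \<alpha> :: "'a form1"
  assumes M: "mfd_ok M" and a: "\<alpha> \<in> forms1 M"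
begin

definition koszul :: "'a vfield \<Rightarrow> 'a vfield \<Rightarrow> 'a \<Rightarrow> real" where
  "koszul X Y p = X p (contract Y \<alpha>) - Y p (contract X \<alpha>) - \<alpha> p (lie_vf X Y p)"

lemma contract_add:
  assumes "X \<in> vfields M" "Y \<in> vfields M"
  shows "contract (X + Y) \<alpha> = contract X \<alpha> + contract Y \<alpha>"
proof
  fix p show "contract (X + Y) \<alpha> p = (contract X \<alpha> + contract Y \<alpha>) p"
    using forms1D(3)[OF a _ vfD[OF M assms(1)] vfD[OF M assms(2)]] forms1D(1)[OF a]
    by (cases "p \<in> pts M") (simp_all add: contract_def)
qed

lemma koszul_antisym: "X \<in> vfields M \<Longrightarrow> Y \<in> vfields M \<Longrightarrow> p \<in> pts M \<Longrightarrow> koszul X Y p = - koszul Y X p"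
  using forms1_minus[OF a M _ vfD[OF M lie_vf_fields[OF M]], of p Y X] by (simp add: koszul_def lie_vf_antisym[of X Y])

lemma koszul_add:
  assumes "X \<in> vfields M" "X' \<in> vfields M" "Y \<in> vfields M" and p: "p \<in> pts M"
  shows "koszul (X + X') Y p = koszul X Y p + koszul X' Y p"
  unfolding koszul_def
  using tan_add[OF M vfD[OF M assms(3) p] forms1D(5)[OF a assms(1)] forms1D(5)[OF a assms(2)]]
    forms1D(3)[OF a p vfD[OF M lie_vf_fields[OF M assms(1,3)] p] vfD[OF M lie_vf_fields[OF M assms(2,3)] p]]
  by (simp add: contract_add[OF assms(1,2)] lie_vf_add_left[OF M assms(1-3)])

lemma koszul_fmult:
  assumes X: "X \<in> vfields M" and Y: "Y \<in> vfields M" and f: "f \<in> Cinf M" and p: "p \<in> pts M"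
  shows "koszul (\<lambda>p. f p *\<^sub>R X p) Y p = f p * koszul X Y p"
proof -
  note fX = vfields_fmult[OF M X f]
  have c: "contract (\<lambda>p. f p *\<^sub>R X p) \<alpha> = f * contract X \<alpha>"
  proof
    fix q show "contract (\<lambda>p. f p *\<^sub>R X p) \<alpha> q = (f * contract X \<alpha>) q"
      using forms1D(4)[OF a _ vfD[OF M X]] forms1D(1)[OF a] by (cases "q \<in> pts M") (simp_all add: contract_def)
  qed
  have L: "lie_vf (\<lambda>p. f p *\<^sub>R X p) Y p = f p *\<^sub>R lie_vf X Y p - Y p f *\<^sub>R X p"
  proof (rule tangent_eqI[OF M vfD[OF M lie_vf_fields[OF M fX Y] p]
      tangent_diff[OF M tangent_scale[OF M vfD[OF M lie_vf_fields[OF M X Y] p]] tangent_scale[OF M vfD[OF M X p]]]])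
    fix g assume g: "g \<in> Cinf M"
    have "(\<lambda>q. (f q *\<^sub>R X q) g) = f * (\<lambda>q. X q g)" by (rule ext) simp
    then show "lie_vf (\<lambda>p. f p *\<^sub>R X p) Y p g = (f p *\<^sub>R lie_vf X Y p - Y p f *\<^sub>R X p) g"
      using tan_mult[OF M vfD[OF M Y p] f vf_Cinf[OF M X g]] by (simp add: lie_vf_def algebra_simps)
  qed
  have "\<alpha> p (lie_vf (\<lambda>p. f p *\<^sub>R X p) Y p) = f p * \<alpha> p (lie_vf X Y p) - Y p f * \<alpha> p (X p)"
    unfolding L
    using forms1_diff_vec[OF a M p tangent_scale[OF M vfD[OF M lie_vf_fields[OF M X Y] p]] tangent_scale[OF M vfD[OF M X p]]]
      forms1D(4)[OF a p vfD[OF M lie_vf_fields[OF M X Y] p]] forms1D(4)[OF a p vfD[OF M X p]] by simp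
  moreover have "Y p (f * contract X \<alpha>) = Y p f * \<alpha> p (X p) + f p * Y p (contract X \<alpha>)"
    using tan_mult[OF M vfD[OF M Y p] f forms1D(5)[OF a X]] by (simp add: contract_def)
  ultimately show ?thesis unfolding koszul_def c by (simp add: algebra_simps)
qed

lemma koszul_sum:
  assumes "\<And>i. i \<in> I \<Longrightarrow> X i \<in> vfields M" and Y: "Y \<in> vfields M" and p: "p \<in> pts M"
  shows "koszul (\<Sum>i\<in>I. X i) Y p = (\<Sum>i\<in>I. koszul (X i) Y p)"
proof -
  have z: "koszul 0 Y p = 0"
    using koszul_add[OF vfields_zero[OF M] vfields_zero[OF M] Y p] by simp
  show ?thesis using assms(1)
    by (induction I rule: infinite_finite_induct) (auto simp: z koszul_add[OF _ vfields_sum[OF M] Y p])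
qed

lemma koszul_vanish:
  assumes X: "X \<in> vfields M" and Y: "Y \<in> vfields M" and p: "p \<in> pts M" and X0: "X p = 0"
  shows "koszul X Y p = 0"
proof -
  obtain U \<phi> where c: "(U, \<phi>) \<in> atlas M" "p \<in> U" using mfd_cover[OF M p] by blast
  obtain V Z D where cf: "coord_frame M U \<phi> V Z D" and pV: "p \<in> V"
    using coord_frame_ex[OF M atlas_max[OF M c(1)] c(2)] by blast
  obtain b S1 S2 where b': "b \<in> Cinf M" "openin (mtop M) S1" "openin (mtop M) S2" "p \<in> S1" "S1 \<subseteq> V"
    "\<And>q. q \<in> S1 \<Longrightarrow> b q = 1" "\<And>q. q \<in> S2 \<Longrightarrow> b q = 0" "pts M \<subseteq> V \<union> S2"
    using bump_M[OF M coord_frameD(1)[OF cf] pV] by blast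
  note b = b'(1,4,6,7,8)
  define g where "g i = b * (\<lambda>q. X q (Z i))" for i
  have g: "g i \<in> Cinf M" if "i < mdim M" for i
    unfolding g_def by (intro Cinf_mult[OF M] b vf_Cinf[OF M X] coord_frameD(3)[OF cf that])
  define R where "R = (\<lambda>q. (oneM M - b) q *\<^sub>R X q)"
  define T where "T = (\<Sum>i<mdim M. (\<lambda>q. g i q *\<^sub>R D i q))"
  have TD: "(\<lambda>q. g i q *\<^sub>R D i q) \<in> vfields M" if "i < mdim M" for i
    by (rule vfields_fmult[OF M coord_frameD(4)[OF cf that] g[OF that]])
  have RV: "R \<in> vfields M" unfolding R_def by (rule vfields_fmult[OF M X Cinf_diff[OF M Cinf_one[OF M] b(1)]])
  have TV: "T \<in> vfields M" unfolding T_def by (rule vfields_sum[OF M]) (use TD in auto)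
  have "X = R + T"
  proof
    fix q show "X q = (R + T) q"
    proof (cases "q \<in> pts M")
      case False
      then show ?thesis using vf_off[OF M X] vf_off[OF M RV] vf_off[OF M TV] by simp
    next
      case True
      show ?thesis
      proof (rule tangent_eqI[OF M vfD[OF M X True] vfD[OF M vfields_add[OF M RV TV] True]])
        fix f assume f: "f \<in> Cinf M"
        have Tq: "T q f = (\<Sum>i<mdim M. b q * (X q (Z i) * D i q f))"
          by (simp add: T_def sum_fun_app g_def algebra_simps)
        have "T q f = b q * X q f"
        proof (cases "q \<in> V")
          case qV: True
          show ?thesis unfolding Tq sum_distrib_left[symmetric]
            using coord_frameD(8)[OF cf qV vfD[OF M X True] f] by simp
        next
          case False
          then have "b q = 0" using b(4,5) True by auto
          then show ?thesis unfolding Tq by simp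
        qed
        then show "X q f = (R + T) q f" using True by (simp add: R_def oneM_def algebra_simps)
      qed
    qed
  qed
  then have "koszul X Y p = koszul R Y p + koszul T Y p" using koszul_add[OF RV TV Y p] by simp
  also have "koszul R Y p = 0"
    unfolding R_def using koszul_fmult[OF X Y Cinf_diff[OF M Cinf_one[OF M] b(1)] p] b(3)[OF b(2)] p by (simp add: oneM_def)
  also have "koszul T Y p = (\<Sum>i<mdim M. g i p * koszul (D i) Y p)"
    unfolding T_def using koszul_sum[of "{..<mdim M}" "\<lambda>i q. g i q *\<^sub>R D i q", OF _ Y p] TD
    by (simp add: koszul_fmult[OF coord_frameD(4)[OF cf] Y g p])
  also have "\<dots> = 0" by (simp add: g_def X0)
  finally show ?thesis by simp
qed

lemma koszul_point:
  assumes "X \<in> vfields M" "X' \<in> vfields M" "Y \<in> vfields M" "Y' \<in> vfields M" and p: "p \<in> pts M"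
    and eq: "X p = X' p" "Y p = Y' p"
  shows "koszul X Y p = koszul X' Y' p"
proof -
  have 1: "koszul Z W p = koszul Z' W p" if "Z \<in> vfields M" "Z' \<in> vfields M" "W \<in> vfields M" "Z p = Z' p" for Z Z' W
  proof -
    have "koszul ((Z - Z') + Z') W p = koszul (Z - Z') W p + koszul Z' W p"
      by (rule koszul_add[OF vfields_diff[OF M that(1,2)] that(2,3) p])
    moreover have "koszul (Z - Z') W p = 0"
      by (rule koszul_vanish[OF vfields_diff[OF M that(1,2)] that(3) p]) (simp add: that(4))
    ultimately show ?thesis by simp
  qed
  have "koszul X Y p = koszul X' Y p" by (rule 1[OF assms(1-3) eq(1)])
  also have "\<dots> = - koszul Y X' p" by (rule koszul_antisym[OF assms(2,3) p])
  also have "\<dots> = - koszul Y' X' p" using 1[OF assms(3,4,2) eq(2)] by simp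
  also have "\<dots> = koszul X' Y' p" using koszul_antisym[OF assms(2,4) p] by simp
  finally show ?thesis .
qed

lemma d1_exists:
  "\<exists>\<eta>. \<eta> \<in> forms2 M \<and> (\<forall>X\<in>vfields M. \<forall>Y\<in>vfields M. \<forall>p\<in>pts M. \<eta> p (X p) (Y p) = koszul X Y p)"
proof -
  define E where "E p v = (SOME X. X \<in> vfields M \<and> X p = v)" for p v
  have E: "E p v \<in> vfields M" "E p v p = v" if "p \<in> pts M" "v \<in> tangent M p" for p v
    using someI_ex[of "\<lambda>X. X \<in> vfields M \<and> X p = v"] vfield_through[OF M that] unfolding E_def by blast+
  define \<eta> where "\<eta> p v w = (if p \<in> pts M \<and> v \<in> tangent M p \<and> w \<in> tangent M p then koszul (E p v) (E p w) p else 0)" for p v w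
  have eta: "\<eta> p (X p) (Y p) = koszul X Y p" if "X \<in> vfields M" "Y \<in> vfields M" "p \<in> pts M" for X Y p
    using koszul_point[OF E(1)[OF that(3) vfD[OF M that(1,3)]] that(1) E(1)[OF that(3) vfD[OF M that(2,3)]] that(2,3)
       E(2)[OF that(3) vfD[OF M that(1,3)]] E(2)[OF that(3) vfD[OF M that(2,3)]]] vfD[OF M that(1,3)] vfD[OF M that(2,3)] that(3)
    by (simp add: \<eta>_def)
  have anti: "\<eta> p v w = - \<eta> p w v" for p v w
    using koszul_antisym[OF E(1) E(1), of p v p w] by (simp add: \<eta>_def)
  have addl: "\<eta> p (v + v') w = \<eta> p v w + \<eta> p v' w"
    if p: "p \<in> pts M" and v: "v \<in> tangent M p" "v' \<in> tangent M p" "w \<in> tangent M p" for p v v' w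
    using eta[OF vfields_add[OF M E(1)[OF p v(1)] E(1)[OF p v(2)]] E(1)[OF p v(3)] p]
      eta[OF E(1)[OF p v(1)] E(1)[OF p v(3)] p] eta[OF E(1)[OF p v(2)] E(1)[OF p v(3)] p]
      koszul_add[OF E(1)[OF p v(1)] E(1)[OF p v(2)] E(1)[OF p v(3)] p] E(2)[OF p v(1)] E(2)[OF p v(2)] E(2)[OF p v(3)] by simp
  have scl: "\<eta> p (c *\<^sub>R v) w = c * \<eta> p v w"
    if p: "p \<in> pts M" and v: "v \<in> tangent M p" "w \<in> tangent M p" for p c v w
  proof -
    note C = Cinf_scale[OF M Cinf_one[OF M], of c]
    have "\<eta> p ((c *\<^sub>R oneM M) p *\<^sub>R E p v p) (E p w p) = (c *\<^sub>R oneM M) p * koszul (E p v) (E p w) p"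
      using eta[OF vfields_fmult[OF M E(1)[OF p v(1)] C] E(1)[OF p v(2)] p] koszul_fmult[OF E(1)[OF p v(1)] E(1)[OF p v(2)] C p] by simp
    then show ?thesis using E(2)[OF p v(1)] E(2)[OF p v(2)] eta[OF E(1)[OF p v(1)] E(1)[OF p v(2)] p] p by (simp add: oneM_def)
  qed
  have sm: "(\<lambda>p. \<eta> p (X p) (Y p)) \<in> Cinf M" if X: "X \<in> vfields M" and Y: "Y \<in> vfields M" for X Y
  proof -
    have "(\<lambda>p. \<eta> p (X p) (Y p)) = (\<lambda>p. X p (contract Y \<alpha>)) - (\<lambda>p. Y p (contract X \<alpha>)) - contract (lie_vf X Y) \<alpha>"
    proof
      fix p show "\<eta> p (X p) (Y p) = ((\<lambda>p. X p (contract Y \<alpha>)) - (\<lambda>p. Y p (contract X \<alpha>)) - contract (lie_vf X Y) \<alpha>) p"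
      proof (cases "p \<in> pts M")
        case True then show ?thesis by (simp add: eta[OF X Y] koszul_def contract_def)
      next
        case False then show ?thesis
          using vf_off[OF M X] vf_off[OF M Y] forms1D(1)[OF a] by (simp add: \<eta>_def contract_def)
      qed
    qed
    then show ?thesis
      using Cinf_diff[OF M Cinf_diff[OF M vf_Cinf[OF M X forms1D(5)[OF a Y]] vf_Cinf[OF M Y forms1D(5)[OF a X]]] forms1D(5)[OF a lie_vf_fields[OF M X Y]]]
      by simp
  qed
  have "\<eta> \<in> forms2 M"
    unfolding forms2_def lin_at_def
  proof (intro CollectI conjI allI ballI impI)
    fix p v w assume "p \<notin> pts M \<or> v \<notin> tangent M p \<or> w \<notin> tangent M p" then show "\<eta> p v w = 0" by (auto simp: \<eta>_def)
  next
    fix p u v w assume "p \<in> pts M" "u \<in> tangent M p" "v \<in> tangent M p" "w \<in> tangent M p"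
    then show "\<eta> p u (v + w) = \<eta> p u v + \<eta> p u w" using addl[of p v w u] anti[of p u] by simp
  next
    fix p u v c assume "p \<in> pts M" "u \<in> tangent M p" "v \<in> tangent M p"
    then show "\<eta> p u (c *\<^sub>R v) = c * \<eta> p u v" using scl[of p v u c] anti[of p u] by simp
  next
    show "\<eta> p v w = - \<eta> p w v" for p v w by (rule anti)
  next
    fix X Y assume "X \<in> vfields M" "Y \<in> vfields M" then show "(\<lambda>p. \<eta> p (X p) (Y p)) \<in> Cinf M" by (rule sm)
  qed
  then show ?thesis using eta by blast
qed

lemma d1_formula:
  assumes "X \<in> vfields M" "Y \<in> vfields M" "p \<in> pts M"
  shows "d1 M \<alpha> p (X p) (Y p) = X p (contract Y \<alpha>) - Y p (contract X \<alpha>) - \<alpha> p (lie_vf X Y p)"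
proof -
  let ?P = "\<lambda>\<eta>. \<eta> \<in> forms2 M \<and> (\<forall>X\<in>vfields M. \<forall>Y\<in>vfields M. \<forall>p\<in>pts M. \<eta> p (X p) (Y p) =
       X p (contract Y \<alpha>) - Y p (contract X \<alpha>) - \<alpha> p (lie_vf X Y p))"
  obtain \<eta> where \<eta>: "?P \<eta>" using d1_exists unfolding koszul_def by blast
  have "\<eta>' = \<eta>" if \<eta>': "?P \<eta>'" for \<eta>'
  proof (intro ext)
    fix p v w
    have F: "\<eta> \<in> forms2 M" "\<eta>' \<in> forms2 M" using \<eta> \<eta>' by auto
    show "\<eta>' p v w = \<eta> p v w"
    proof (cases "p \<in> pts M \<and> v \<in> tangent M p \<and> w \<in> tangent M p")
      case True
      then obtain X Y where XY: "X \<in> vfields M" "X p = v" "Y \<in> vfields M" "Y p = w" using vfield_through[OF M] by metis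
      have "\<eta>' p (X p) (Y p) = \<eta> p (X p) (Y p)" using \<eta> \<eta>' XY(1,3) True by simp
      then show ?thesis using XY by simp
    next
      case False
      then show ?thesis using forms2D(1-3)[OF F(1)] forms2D(1-3)[OF F(2)] by metis
    qed
  qed
  then have "?P (THE \<eta>. ?P \<eta>)" using theI[of ?P \<eta>] \<eta> by blast
  then show ?thesis using assms unfolding d1_def by blast
qed

end

section \<open>Submersions and descent\<close>

lemma Cinf_cont:
  assumes M: "mfd_ok M" and f: "f \<in> Cinf M"
  shows "continuous_map (mtop M) euclideanreal f"
  unfolding continuous_map_def
proof (intro conjI allI impI)
  fix T :: "real set" assume "openin euclideanreal T"
  then have T: "open T" by simp
  show "openin (mtop M) {p \<in> pts M. f p \<in> T}"
  proof (subst openin_subopen, intro ballI)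
    fix p assume "p \<in> {p \<in> pts M. f p \<in> T}"
    then have p: "p \<in> pts M" "f p \<in> T" by auto
    obtain U \<phi> where c: "(U, \<phi>) \<in> atlas M" "p \<in> U" using mfd_cover[OF M p(1)] by blast
    note cc = mfd_chart[OF M c(1)]
    define g where "g x = f (inv_into U \<phi> x)" for x
    have "continuous_on (\<phi> ` U) g"
      unfolding g_def by (rule smooth_on_cont[OF Cinf_chart[OF f c(1)] openin_En_sub[OF is_chartD(3)[OF cc]]])
    then have "openin (top_of_set (\<phi> ` U)) (\<phi> ` U \<inter> g -` T)" using T by (rule continuous_openin_preimage_gen)
    then have o: "openin (Euclidean_space (mdim M)) (\<phi> ` U \<inter> g -` T)"
      using is_chartD(3)[OF cc] unfolding openin_En_alt by (metis openin_trans)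
    have gq: "g (\<phi> q) = f q" if "q \<in> U" for q using is_chartD(8)[OF cc that] by (simp add: g_def)
    show "\<exists>S. openin (mtop M) S \<and> p \<in> S \<and> S \<subseteq> {p \<in> pts M. f p \<in> T}"
    proof (intro exI[of _ "{q \<in> U. \<phi> q \<in> \<phi> ` U \<inter> g -` T}"] conjI)
      show "openin (mtop M) {q \<in> U. \<phi> q \<in> \<phi> ` U \<inter> g -` T}" by (rule is_chartD(5)[OF cc o])
      show "p \<in> {q \<in> U. \<phi> q \<in> \<phi> ` U \<inter> g -` T}" using c(2) p(2) gq by simp
      show "{q \<in> U. \<phi> q \<in> \<phi> ` U \<inter> g -` T} \<subseteq> {p \<in> pts M. f p \<in> T}"
      proof
        fix q assume "q \<in> {q \<in> U. \<phi> q \<in> \<phi> ` U \<inter> g -` T}"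
        then have "q \<in> U" "g (\<phi> q) \<in> T" by auto
        then show "q \<in> {p \<in> pts M. f p \<in> T}" using gq is_chartD(6)[OF cc] by simp
      qed
    qed
  qed
qed simp

context
  fixes M :: "'a mfd" and N :: "'b mfd" and F :: "'a \<Rightarrow> 'b"
  assumes M: "mfd_ok M" and N: "mfd_ok N" and F: "Cmap M N F"
    and onto: "\<And>p w. p \<in> pts M \<Longrightarrow> w \<in> tangent N (F p) \<Longrightarrow> \<exists>v\<in>tangent M p. push M N F v = w"
begin

lemma submersion_frame:
  assumes p: "p \<in> pts M"
  shows "\<exists>V \<psi> V' Y E U \<phi> V2 X D. (V, \<psi>) \<in> max_atlas N \<and> coord_frame N V \<psi> V' Y E \<and> F p \<in> V' \<and>
    (U, \<phi>) \<in> max_atlas M \<and> coord_frame M U \<phi> V2 X D \<and> p \<in> V2 \<and> mdim N \<le> mdim M \<and>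
    (\<forall>q\<in>U. F q \<in> V') \<and> (\<forall>j<mdim N. \<forall>q\<in>U. \<phi> q (mdim M - 1 - j) = Y j (F q))"
proof -
  define n where "n = mdim M"
  define c where "c = mdim N"
  obtain V \<psi> where d: "(V, \<psi>) \<in> atlas N" "F p \<in> V" using mfd_cover[OF N Cmap_pts[OF F p]] by blast
  obtain V' Y E where cf: "coord_frame N V \<psi> V' Y E" and aV: "F p \<in> V'" using coord_frame_ex[OF N atlas_max[OF N d(1)] d(2)] by blast
  note V' = coord_frameD(1,2)[OF cf] and Y = coord_frameD(3,5)[OF cf, folded c_def] and E = coord_frameD(4,7)[OF cf, folded c_def]
  define h where "h j = pull0 M F (Y j)" for j
  have h: "h j \<in> Cinf M" if "j < c" for j unfolding h_def by (rule Cmap_pull[OF F Y(1)[OF that]])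
  have "\<exists>u\<in>tangent M p. push M N F u = E j (F p)" if "j < c" for j
    by (rule onto[OF p vfD[OF N E(1)[OF that] Cmap_pts[OF F p]]])
  then obtain v where v: "\<And>j. j < c \<Longrightarrow> v j \<in> tangent M p" "\<And>j. j < c \<Longrightarrow> push M N F (v j) = E j (F p)"
    by metis
  have vd: "v j (h l) = (if j = l then 1 else 0)" if "j < c" "l < c" for j l
    using push_app[OF Y(1)[OF that(2)], of M F "v j"] v(2)[OF that(1)] E(2)[OF that aV] by (simp add: h_def)
  obtain U \<phi> where cn: "c \<le> n" and U: "(U, \<phi>) \<in> max_atlas M" "p \<in> U" "\<And>j q. j < c \<Longrightarrow> q \<in> U \<Longrightarrow> \<phi> q (n - 1 - j) = h j q"
    using level_chart[where c=c and k=c and h=h and v=v, OF M p h v(1) vd order_refl] unfolding n_def by blast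
  define U1 where "U1 = U \<inter> {q \<in> pts M. F q \<in> V'}"
  have oU1: "openin (mtop M) U1" unfolding U1_def by (intro openin_Int is_chartD(1)[OF max_chart[OF U(1)]] Cmap_open[OF F V'(1)])
  have U1: "(U1, \<phi>) \<in> max_atlas M" by (rule chart_restrict[OF M U(1) oU1]) (auto simp: U1_def)
  have pU1: "p \<in> U1" using U(2) aV p by (simp add: U1_def)
  obtain V2 X D where cf2: "coord_frame M U1 \<phi> V2 X D" and pV2: "p \<in> V2" using coord_frame_ex[OF M U1 pU1] by blast
  have "\<forall>q\<in>U1. F q \<in> V'" by (auto simp: U1_def)
  moreover have "\<forall>j<c. \<forall>q\<in>U1. \<phi> q (n - 1 - j) = Y j (F q)" using U(3) by (auto simp: U1_def h_def pull0_def)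
  ultimately show ?thesis
    using atlas_max[OF N d(1)] cf aV U1 cf2 pV2 cn unfolding n_def c_def by blast
qed

lemma frame_inj:
  assumes "(V, \<psi>) \<in> max_atlas N" "coord_frame N V \<psi> V' Y E" "x \<in> V'" "y \<in> V'" "\<And>j. j < mdim N \<Longrightarrow> Y j x = Y j y"
  shows "x = y"
proof -
  note dc = max_chart[OF assms(1)]
  have xy: "x \<in> V" "y \<in> V" using assms(3,4) coord_frameD(2)[OF assms(2)] by auto
  then have "\<psi> x \<in> En (mdim N)" "\<psi> y \<in> En (mdim N)" using is_chartD(7)[OF dc] by blast+
  moreover have "\<psi> x j = \<psi> y j" if "j < mdim N" for j
    using assms(5)[OF that] coord_frameD(5)[OF assms(2) that assms(3)] coord_frameD(5)[OF assms(2) that assms(4)] by simp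
  ultimately have "\<psi> x j = \<psi> y j" for j by (cases "j < mdim N") (simp_all add: En_iff)
  then have "\<psi> x = \<psi> y" by blast
  then show ?thesis using is_chartD(2)[OF dc] xy by (simp add: inj_on_def)
qed

lemma submersion_smooth:
  assumes surj: "\<And>n. n \<in> pts N \<Longrightarrow> \<exists>p\<in>pts M. F p = n"
    and off: "\<And>n. n \<notin> pts N \<Longrightarrow> h n = 0" and h: "pull0 M F h \<in> Cinf M"
  shows "h \<in> Cinf N"
proof (rule Cinf_localI[OF N off])
  fix x assume "x \<in> pts N"
  then obtain p where p: "p \<in> pts M" "F p = x" using surj by blast
  define n where "n = mdim M"
  define c where "c = mdim N"
  obtain V \<psi> V' Y E U \<phi> V2 X D where d: "(V, \<psi>) \<in> max_atlas N" and cf: "coord_frame N V \<psi> V' Y E" and xV': "F p \<in> V'"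
    and U: "(U, \<phi>) \<in> max_atlas M" and cf2: "coord_frame M U \<phi> V2 X D" and pV2: "p \<in> V2" and cn: "c \<le> n"
    and FU: "\<And>q. q \<in> U \<Longrightarrow> F q \<in> V'" and phi: "\<And>j q. j < c \<Longrightarrow> q \<in> U \<Longrightarrow> \<phi> q (n - 1 - j) = Y j (F q)"
    using submersion_frame[OF p(1)] unfolding n_def c_def by blast
  note cc = max_chart[OF U, folded n_def]
  have pU: "p \<in> U" using pV2 coord_frameD(2)[OF cf2] by auto
  have UM: "U \<subseteq> pts M" using openin_subset[OF is_chartD(1)[OF cc]] .
  define f where "f z = pull0 M F h (inv_into U \<phi> z)" for z
  have f: "smooth_on n (\<phi> ` U) f"
    using smD[OF M openin_topspace Cinf_sm[OF M h order_refl] U] UM unfolding f_def[abs_def] n_def by (simp add: Int_absorb2)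
  define z where "z y i = (if i < n - c then \<phi> p i else if i < n then Y (n - 1 - i) y else 0)" for y i
  have zs: "sm N (pts N) (\<lambda>y. z y i)" for i
  proof (cases "n - c \<le> i \<and> i < n")
    case True
    then have "n - 1 - i < mdim N" using cn by (auto simp: c_def)
    from Cinf_sm[OF N coord_frameD(3)[OF cf this] order_refl] show ?thesis using True by (simp add: z_def)
  next
    case False
    then have "(\<lambda>y. z y i) = (\<lambda>y. if i < n - c then \<phi> p i else 0)" by (auto simp: z_def)
    then show ?thesis using sm_const[OF N openin_topspace] by simp
  qed
  have zE: "z y \<in> En n" for y by (auto simp: z_def En_iff)
  have zx: "z (F p) = \<phi> p"
  proof
    fix i
    consider "i < n - c" | "n - c \<le> i" "i < n" | "n \<le> i" by linarith
    then show "z (F p) i = \<phi> p i"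
    proof cases
      case 1 then show ?thesis by (simp add: z_def)
    next
      case 2
      then have "n - 1 - i < c" "n - 1 - (n - 1 - i) = i" using cn by auto
      then show ?thesis using phi[OF _ pU, of "n - 1 - i"] 2 by (simp add: z_def)
    next
      case 3 then show ?thesis using is_chartD(7)[OF cc pU] by (simp add: z_def En_iff)
    qed
  qed
  obtain r where r: "r > 0" "cube n (\<phi> p) r \<subseteq> \<phi> ` U" using openin_E_cube[OF is_chartD(3)[OF cc], of "\<phi> p"] pU by blast
  have zc: "\<exists>A. openin (mtop N) A \<and> F p \<in> A \<and> A \<subseteq> V' \<and> (\<forall>y\<in>A. z y \<in> cube n (\<phi> p) r)"
  proof -
    have "\<exists>A. openin (mtop N) A \<and> F p \<in> A \<and> (\<forall>y\<in>A. \<bar>z y i - \<phi> p i\<bar> < r)" for i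
    proof -
      have "\<exists>g\<in>Cinf N. \<forall>y\<in>pts N. g y = z y i"
      proof
        show "(\<lambda>y. if y \<in> pts N then z y i else 0) \<in> Cinf N"
          by (rule CinfI[OF N]) (auto intro!: sm_cong[OF N openin_topspace zs])
      qed auto
      then obtain g where g: "g \<in> Cinf N" "\<And>y. y \<in> pts N \<Longrightarrow> g y = z y i" by blast
      have "openin (mtop N) {y \<in> pts N. g y \<in> {\<phi> p i - r<..<\<phi> p i + r}}"
        by (rule openin_continuous_map_preimage[OF Cinf_cont[OF N g(1)]]) simp
      moreover have "F p \<in> {y \<in> pts N. g y \<in> {\<phi> p i - r<..<\<phi> p i + r}}"
        using g(2) Cmap_pts[OF F p(1)] zx r(1) by simp
      ultimately show ?thesis using g(2) by (intro exI[of _ "{y \<in> pts N. g y \<in> {\<phi> p i - r<..<\<phi> p i + r}}"]) (auto simp: abs_less_iff)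
    qed
    then obtain A where A: "\<And>i. openin (mtop N) (A i) \<and> F p \<in> A i \<and> (\<forall>y\<in>A i. \<bar>z y i - \<phi> p i\<bar> < r)" by metis
    have "openin (mtop N) (\<Inter>(insert V' (A ` {..<n})))" using A coord_frameD(1)[OF cf] by (intro openin_Inter) auto
    moreover have "\<forall>y\<in>\<Inter>(insert V' (A ` {..<n})). z y \<in> cube n (\<phi> p) r" using A zE by (auto simp: cube_def)
    ultimately show ?thesis using A xV' by (intro exI[of _ "\<Inter>(insert V' (A ` {..<n}))"]) auto
  qed
  then obtain A where A: "openin (mtop N) A" "F p \<in> A" "A \<subseteq> V'" "\<And>y. y \<in> A \<Longrightarrow> z y \<in> cube n (\<phi> p) r" by blast
  have "sm N A (\<lambda>y. f (z y))"
  proof (rule sm_compose[where g=f and F=z, OF N A(1) is_chartD(3)[OF cc] f])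
    show "sm N A (\<lambda>y. z y j)" for j by (rule sm_mono[OF zs openin_subset[OF A(1)]])
    show "z ` A \<subseteq> \<phi> ` U" using A(4) r(2) by blast
  qed
  then have "sm N A h"
  proof (rule sm_cong[OF N A(1)])
    fix y assume y: "y \<in> A"
    then obtain q where q: "q \<in> U" "z y = \<phi> q" using A(4) r(2) by blast
    have "F q = y"
    proof (rule frame_inj[OF d cf FU[OF q(1)]])
      show "y \<in> V'" using y A(3) by auto
      fix j assume "j < mdim N"
      then have j: "j < c" by (simp add: c_def)
      then have "n - c \<le> n - 1 - j" "n - 1 - j < n" "n - 1 - (n - 1 - j) = j" using cn by auto
      then have "z y (n - 1 - j) = Y j y" by (simp add: z_def)
      then show "Y j (F q) = Y j y" using phi[OF j q(1)] q(2) by simp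
    qed
    then show "f (z y) = h y" using is_chartD(8)[OF cc q(1)] q UM by (auto simp: f_def pull0_def)
  qed
  then show "\<exists>S. openin (mtop N) S \<and> x \<in> S \<and> sm N S h" using A(1,2) p(2) by blast
qed

lemma submersion_lift:
  assumes Z: "Z \<in> vfields N" and p: "p \<in> pts M"
  shows "\<exists>W\<in>vfields M. \<exists>A. openin (mtop M) A \<and> p \<in> A \<and> (\<forall>q\<in>A. push M N F (W q) = Z (F q))"
proof -
  define n where "n = mdim M"
  define c where "c = mdim N"
  obtain V \<psi> V' Y E U \<phi> V2 X D where d: "(V, \<psi>) \<in> max_atlas N" and cf: "coord_frame N V \<psi> V' Y E" and xV': "F p \<in> V'"
    and U: "(U, \<phi>) \<in> max_atlas M" and cf2: "coord_frame M U \<phi> V2 X D" and pV2: "p \<in> V2" and cn: "c \<le> n"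
    and FU: "\<And>q. q \<in> U \<Longrightarrow> F q \<in> V'" and phi: "\<And>j q. j < c \<Longrightarrow> q \<in> U \<Longrightarrow> \<phi> q (n - 1 - j) = Y j (F q)"
    using submersion_frame[OF p(1)] unfolding n_def c_def by blast
  define g where "g j = pull0 M F (\<lambda>y. Z y (Y j))" for j
  have g: "g j \<in> Cinf M" if "j < c" for j
    unfolding g_def by (rule Cmap_pull[OF F vf_Cinf[OF N Z coord_frameD(3)[OF cf]]]) (use that in \<open>simp add: c_def\<close>)
  have D: "D (n - 1 - j) \<in> vfields M" if "j < c" for j
    by (rule coord_frameD(4)[OF cf2]) (use that cn in \<open>simp add: n_def\<close>)
  define W where "W = (\<Sum>j<c. (\<lambda>q. g j q *\<^sub>R D (n - 1 - j) q))"
  have W: "W \<in> vfields M" unfolding W_def by (rule vfields_sum[OF M]) (use vfields_fmult[OF M D g] in auto)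
  have V2U: "V2 \<subseteq> U" by (rule coord_frameD(2)[OF cf2])
  have V2M: "V2 \<subseteq> pts M" by (rule openin_subset[OF coord_frameD(1)[OF cf2]])
  have "push M N F (W q) = Z (F q)" if q: "q \<in> V2" for q
  proof -
    have qM: "q \<in> pts M" using q V2M by auto
    have t: "push M N F (W q) \<in> tangent N (F q)" by (rule push_tangent[OF F N qM vfD[OF M W qM]])
    have FV': "F q \<in> V'" using FU q V2U by auto
    have *: "push M N F (W q) (Y l) = Z (F q) (Y l)" if l: "l < c" for l
    proof -
      have Yl: "Y l \<in> Cinf N" using coord_frameD(3)[OF cf] l by (simp add: c_def)
      have "D (n - 1 - j) q (pull0 M F (Y l)) = (if j = l then 1 else 0)" if j: "j < c" for j
      proof -
        have nl: "n - 1 - l < n" "n - 1 - j < n" "n - 1 - j = n - 1 - l \<longleftrightarrow> j = l" using l j cn by auto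
        have "D (n - 1 - j) q (pull0 M F (Y l)) = D (n - 1 - j) q (X (n - 1 - l))"
        proof (rule tan_local[OF M vfD[OF M D[OF j] qM] coord_frameD(1)[OF cf2] q Cmap_pull[OF F Yl]])
          show "X (n - 1 - l) \<in> Cinf M" using coord_frameD(3)[OF cf2] nl by (simp add: n_def)
          fix q' assume q': "q' \<in> V2"
          then have "X (n - 1 - l) q' = \<phi> q' (n - 1 - l)" using coord_frameD(5)[OF cf2] nl by (simp add: n_def)
          also have "\<dots> = Y l (F q')" using phi[OF l] q' V2U by auto
          finally show "pull0 M F (Y l) q' = X (n - 1 - l) q'" using q' V2M by (auto simp: pull0_def)
        qed
        then show ?thesis using coord_frameD(7)[OF cf2 _ _ q, of "n - 1 - j" "n - 1 - l"] nl by (simp add: n_def)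
      qed
      then have "W q (pull0 M F (Y l)) = (\<Sum>j<c. g j q * (if j = l then 1 else 0))"
        by (simp add: W_def sum_fun_app)
      also have "\<dots> = (\<Sum>j<c. if j = l then g j q else 0)" by (rule sum.cong) auto
      also have "\<dots> = g l q" using l by simp
      finally show ?thesis using Yl qM by (simp add: push_app g_def pull0_def)
    qed
    show ?thesis
    proof (rule tangent_eqI[OF N t vfD[OF N Z Cmap_pts[OF F qM]]])
      fix h assume h: "h \<in> Cinf N"
      show "push M N F (W q) h = Z (F q) h"
        unfolding coord_frameD(8)[OF cf FV' t h] coord_frameD(8)[OF cf FV' vfD[OF N Z Cmap_pts[OF F qM]] h]
        using * by (simp add: c_def)
    qed
  qed
  then show ?thesis using W coord_frameD(1)[OF cf2] pV2 by blast
qed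

context
  assumes surj: "\<And>n. n \<in> pts N \<Longrightarrow> \<exists>p\<in>pts M. F p = n"
begin

lemma vfield_descend:
  assumes x: "x \<in> vfields M" and inv: "\<And>p q. p \<in> pts M \<Longrightarrow> q \<in> pts M \<Longrightarrow> F p = F q \<Longrightarrow> push M N F (x p) = push M N F (x q)"
  shows "\<exists>!u. u \<in> vfields N \<and> (\<forall>p\<in>pts M. u (F p) = push M N F (x p))"
proof -
  define s where "s n = (SOME p. p \<in> pts M \<and> F p = n)" for n
  have s: "s n \<in> pts M" "F (s n) = n" if "n \<in> pts N" for n
    using someI_ex[of "\<lambda>p. p \<in> pts M \<and> F p = n"] surj[OF that] unfolding s_def by blast+
  define u where "u n = (if n \<in> pts N then push M N F (x (s n)) else 0)" for n
  have uF: "u (F p) = push M N F (x p)" if "p \<in> pts M" for p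
    using inv[of "s (F p)" p] s[OF Cmap_pts[OF F that]] that Cmap_pts[OF F that] by (simp add: u_def)
  have "u \<in> vfields N"
  proof (rule vfI[OF N])
    show "u n \<in> tangent N n" if "n \<in> pts N" for n
      using push_tangent[OF F N s(1)[OF that] vfD[OF M x s(1)[OF that]]] s(2)[OF that] that by (simp add: u_def)
    show "u n = 0" if "n \<notin> pts N" for n using that by (simp add: u_def)
    fix h assume h: "h \<in> Cinf N"
    show "(\<lambda>n. u n h) \<in> Cinf N"
    proof (rule submersion_smooth[OF surj])
      show "u n h = 0" if "n \<notin> pts N" for n using that by (simp add: u_def)
      have "pull0 M F (\<lambda>n. u n h) = (\<lambda>p. x p (pull0 M F h))"
      proof
        fix p show "pull0 M F (\<lambda>n. u n h) p = x p (pull0 M F h)"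
          using uF h by (cases "p \<in> pts M") (simp_all add: pull0_def[of _ _ "\<lambda>n. u n h"] push_app vf_off[OF M x])
      qed
      then show "pull0 M F (\<lambda>n. u n h) \<in> Cinf M" using vf_Cinf[OF M x Cmap_pull[OF F h]] by simp
    qed
  qed
  moreover have "u' = u" if "u' \<in> vfields N" "\<forall>p\<in>pts M. u' (F p) = push M N F (x p)" for u'
  proof
    fix n show "u' n = u n"
      using that s[of n] vf_off[OF N that(1)] by (cases "n \<in> pts N") (auto simp: u_def)
  qed
  ultimately show ?thesis using uF by blast
qed

lemma form1_descend:
  assumes e: "\<eta> \<in> forms1 M"
    and inv: "\<And>p q v w. p \<in> pts M \<Longrightarrow> q \<in> pts M \<Longrightarrow> F p = F q \<Longrightarrow> v \<in> tangent M p \<Longrightarrow> w \<in> tangent M q \<Longrightarrow>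
       push M N F v = push M N F w \<Longrightarrow> \<eta> p v = \<eta> q w"
  shows "\<exists>!\<epsilon>. \<epsilon> \<in> forms1 N \<and> pull1 M N F \<epsilon> = \<eta>"
proof -
  define s where "s n = (SOME p. p \<in> pts M \<and> F p = n)" for n
  have s: "s n \<in> pts M" "F (s n) = n" if "n \<in> pts N" for n
    using someI_ex[of "\<lambda>p. p \<in> pts M \<and> F p = n"] surj[OF that] unfolding s_def by blast+
  define l where "l n w = (SOME v. v \<in> tangent M (s n) \<and> push M N F v = w)" for n w
  have l: "l n w \<in> tangent M (s n)" "push M N F (l n w) = w" if "n \<in> pts N" "w \<in> tangent N n" for n w
    using someI_ex[of "\<lambda>v. v \<in> tangent M (s n) \<and> push M N F v = w"] onto[OF s(1)[OF that(1)], of w] s(2)[OF that(1)] that(2)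
    unfolding l_def by auto
  define \<epsilon> where "\<epsilon> n w = (if n \<in> pts N \<and> w \<in> tangent N n then \<eta> (s n) (l n w) else 0)" for n w
  have eps: "\<epsilon> (F p) (push M N F v) = \<eta> p v" if "p \<in> pts M" "v \<in> tangent M p" for p v
  proof -
    have n: "F p \<in> pts N" and w: "push M N F v \<in> tangent N (F p)" using Cmap_pts[OF F that(1)] push_tangent[OF F N that] .
    show ?thesis using inv[OF s(1)[OF n] that(1) s(2)[OF n] l(1)[OF n w] that(2) l(2)[OF n w]] n w by (simp add: \<epsilon>_def)
  qed
  have add: "\<epsilon> n (v + w) = \<epsilon> n v + \<epsilon> n w" if n: "n \<in> pts N" and v: "v \<in> tangent N n" and w: "w \<in> tangent N n" for n v w
    using eps[OF s(1)[OF n] tangent_add[OF M l(1)[OF n v] l(1)[OF n w]]] eps[OF s(1)[OF n] l(1)[OF n v]] eps[OF s(1)[OF n] l(1)[OF n w]]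
      forms1D(3)[OF e s(1)[OF n] l(1)[OF n v] l(1)[OF n w]] l(2)[OF n v] l(2)[OF n w] s(2)[OF n] by (simp add: push_add)
  have scl: "\<epsilon> n (c *\<^sub>R v) = c * \<epsilon> n v" if n: "n \<in> pts N" and v: "v \<in> tangent N n" for n v c
    using eps[OF s(1)[OF n] tangent_scale[OF M l(1)[OF n v]]] eps[OF s(1)[OF n] l(1)[OF n v]]
      forms1D(4)[OF e s(1)[OF n] l(1)[OF n v]] l(2)[OF n v] s(2)[OF n] by (simp add: push_scale)
  have sm: "(\<lambda>n. \<epsilon> n (Z n)) \<in> Cinf N" if Z: "Z \<in> vfields N" for Z
  proof (rule submersion_smooth[OF surj])
    show "\<epsilon> n (Z n) = 0" if "n \<notin> pts N" for n using that by (simp add: \<epsilon>_def)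
    show "pull0 M F (\<lambda>n. \<epsilon> n (Z n)) \<in> Cinf M"
    proof (rule Cinf_localI'[OF M])
      fix p assume p: "p \<in> pts M"
      obtain W A where W: "W \<in> vfields M" "openin (mtop M) A" "p \<in> A" "\<And>q. q \<in> A \<Longrightarrow> push M N F (W q) = Z (F q)"
        using submersion_lift[OF Z p] by blast
      have "pull0 M F (\<lambda>n. \<epsilon> n (Z n)) q = contract W \<eta> q" if q: "q \<in> A" for q
      proof -
        have "q \<in> pts M" using q openin_subset[OF W(2)] by auto
        then show ?thesis using eps[OF _ vfD[OF M W(1)], of q] W(4)[OF q] by (simp add: pull0_def contract_def)
      qed
      then show "\<exists>S g. openin (mtop M) S \<and> p \<in> S \<and> g \<in> Cinf M \<and> (\<forall>q\<in>S. pull0 M F (\<lambda>n. \<epsilon> n (Z n)) q = g q)"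
        using W(2,3) forms1D(5)[OF e W(1)] by blast
    qed (simp add: pull0_def)
  qed
  have "\<epsilon> \<in> forms1 N"
    unfolding forms1_def lin_at_def using add scl sm by (auto simp: \<epsilon>_def)
  moreover have "pull1 M N F \<epsilon> = \<eta>"
    using eps forms1D(1,2)[OF e] by (intro ext) (auto simp: pull1_def)
  moreover have "\<epsilon>' = \<epsilon>" if e': "\<epsilon>' \<in> forms1 N" "pull1 M N F \<epsilon>' = \<eta>" for \<epsilon>'
  proof (intro ext)
    fix n w show "\<epsilon>' n w = \<epsilon> n w"
    proof (cases "n \<in> pts N \<and> w \<in> tangent N n")
      case True
      then have n: "n \<in> pts N" "w \<in> tangent N n" by auto
      have "\<epsilon>' (F (s n)) (push M N F (l n w)) = \<eta> (s n) (l n w)"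
        unfolding e'(2)[symmetric] using s(1)[OF n(1)] l(1)[OF n] by (simp add: pull1_def)
      then show ?thesis using n s(2)[OF n(1)] l(2)[OF n] by (simp add: \<epsilon>_def)
    next
      case False then show ?thesis using forms1D(1,2)[OF e'(1)] by (auto simp: \<epsilon>_def)
    qed
  qed
  ultimately show ?thesis by blast
qed

end

end

lemma d0_add:
  assumes M: "mfd_ok M" and f: "f \<in> Cinf M" and g: "g \<in> Cinf M"
  shows "d0 M (f + g) = d0 M f + d0 M g"
proof (intro ext)
  fix p v show "d0 M (f + g) p v = (d0 M f + d0 M g) p v"
    using tan_add[OF M _ f g, of v p] by (cases "v \<in> tangent M p") (simp_all add: d0_def)
qed

lemma forms1_uminus:
  assumes M: "mfd_ok M" and e: "\<epsilon> \<in> forms1 M" shows "- \<epsilon> \<in> forms1 M"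
  using forms1_diff[OF M forms1_diff[OF M e e] e] by simp

lemma vf_fun_add_left: "vf_fun (X + Y) f = vf_fun X f + vf_fun Y f"
  by (rule ext) (simp add: vf_fun_def)

lemma vf_fun_add:
  assumes M: "mfd_ok M" and X: "X \<in> vfields M" and f: "f \<in> Cinf M" and g: "g \<in> Cinf M"
  shows "vf_fun X (f + g) = vf_fun X f + vf_fun X g"
proof (rule ext)
  fix p show "vf_fun X (f + g) p = (vf_fun X f + vf_fun X g) p"
    by (cases "p \<in> pts M") (simp_all add: vf_fun_def tan_add[OF M vfD[OF M X] f g] vf_off[OF M X])
qed

lemma vf_fun_diff:
  assumes M: "mfd_ok M" and X: "X \<in> vfields M" and f: "f \<in> Cinf M" and g: "g \<in> Cinf M"
  shows "vf_fun X (f - g) = vf_fun X f - vf_fun X g"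
  using vf_fun_add[OF M X Cinf_diff[OF M f g] g] by (simp add: algebra_simps)

lemma vf_fun_zero:
  assumes M: "mfd_ok M" and X: "X \<in> vfields M"
  shows "vf_fun X 0 = 0"
  using vf_fun_add[OF M X Cinf_zero[OF M] Cinf_zero[OF M]] by simp

lemma contract2_add:
  assumes M: "mfd_ok M" and B: "B \<in> forms2 M" and X: "X \<in> vfields M" "Y \<in> vfields M" "Z \<in> vfields M"
  shows "contract (Y + Z) (contract X B) = contract Y (contract X B) + contract Z (contract X B)"
proof (rule ext)
  fix p show "contract (Y + Z) (contract X B) p = (contract Y (contract X B) + contract Z (contract X B)) p"
    by (cases "p \<in> pts M")
       (simp_all add: contract_def forms2D(4)[OF B _ vfD[OF M X(1)] vfD[OF M X(2)] vfD[OF M X(3)]] forms2D(1)[OF B])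
qed

lemma contract2_swap:
  assumes B: "B \<in> forms2 M"
  shows "contract Y (contract X B) = - contract X (contract Y B)"
proof (rule ext)
  fix p
  have "B p (X p) (Y p) = - B p (Y p) (X p)" by (rule forms2D(6)[OF B])
  then show "contract Y (contract X B) p = (- contract X (contract Y B)) p" by (simp add: contract_def)
qed

lemma contract2_add':
  assumes M: "mfd_ok M" and B: "B \<in> forms2 M" and X: "X \<in> vfields M" "Y \<in> vfields M" "Z \<in> vfields M"
  shows "contract X (contract (Y + Z) B) = contract X (contract Y B) + contract X (contract Z B)"
  using contract2_add[OF M B X] contract2_swap[OF B, of X "Y + Z"] contract2_swap[OF B, of X Y] contract2_swap[OF B, of X Z]
  by simp

section \<open>Tangent spaces of the gerbe groupoid\<close>

lemma open_slices:
  assumes N: "mfd_ok N" and U: "openin (mtop N) U"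
  shows "slices N (mdim N) U"
  unfolding slices_def
proof (intro conjI ballI)
  show "U \<subseteq> pts N" by (rule openin_subset[OF U])
  fix p assume p: "p \<in> U"
  then obtain V \<phi> where c: "(V, \<phi>) \<in> atlas N" "p \<in> V" using mfd_cover[OF N] openin_subset[OF U] by blast
  have c': "(V \<inter> U, \<phi>) \<in> max_atlas N"
    by (rule chart_restrict[OF N atlas_max[OF N c(1)]]) (use is_chartD(1)[OF mfd_chart[OF N c(1)]] U in auto)
  moreover have "\<phi> ` ((V \<inter> U) \<inter> U) = \<phi> ` (V \<inter> U) \<inter> En (mdim N)"
    using is_chartD(7)[OF max_chart[OF c']] by auto
  ultimately show "\<exists>V \<phi>. (V, \<phi>) \<in> max_atlas N \<and> p \<in> V \<and> \<phi> ` (V \<inter> U) = \<phi> ` V \<inter> En (mdim N)"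
    using c(2) p by blast
qed simp

lemma open_lift:
  assumes N: "mfd_ok N" and U: "openin (mtop N) U" and p: "p \<in> U" and v: "v \<in> tangent N p"
  shows "\<exists>u\<in>tangent (submfd N (mdim N) U) p. push (submfd N (mdim N) U) N id u = v"
proof (rule sub_lift[OF N open_slices[OF N U] p v])
  fix F A assume F: "F \<in> Cinf N" and A: "openin (mtop N) A" "p \<in> A" "\<And>q. q \<in> A \<Longrightarrow> q \<in> U \<Longrightarrow> F q = 0"
  have "v F = v 0"
    by (rule tan_local[OF N v openin_Int[OF A(1) U] _ F Cinf_zero[OF N]]) (use A p in auto)
  then show "v F = 0" using tan_zero[OF N v] by simp
qed

lemma complex_mfd_ok: "mfd_ok complex_mfd"
proof -
  define \<phi> where "\<phi> = (\<lambda>(z::complex) (i::nat). if i = 0 then Re z else if i = 1 then Im z else (0::real))"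
  have im: "\<phi> ` UNIV = En 2"
  proof (intro Set.set_eqI iffI)
    fix x assume "x \<in> En 2"
    then have "x = \<phi> (Complex (x 0) (x 1))" by (auto simp: \<phi>_def En_iff fun_eq_iff)
    then show "x \<in> \<phi> ` UNIV" by blast
  qed (auto simp: \<phi>_def En_iff)
  have inv: "Complex (\<phi> z 0) (\<phi> z 1) = z" for z by (simp add: \<phi>_def)
  have ch: "is_chart 2 (euclidean :: complex topology) (UNIV, \<phi>)"
  proof (rule is_chartI[where \<theta>="\<lambda>x. Complex (x 0) (x 1)"])
    show "openin (Euclidean_space 2) (\<phi> ` UNIV)" unfolding im by simp
    show "continuous_map (subtopology euclidean UNIV) euclideanreal (\<lambda>p. \<phi> p i)" for i
      by (cases "i = 0"; cases "i = 1") (auto simp: \<phi>_def intro!: continuous_intros)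
    have "continuous_on (En 2) (\<lambda>x. complex_of_real (x 0) + \<i> * complex_of_real (x 1))"
      by (intro continuous_intros cont_coord)
    then show "continuous_map (subtopology (Euclidean_space 2) (\<phi> ` UNIV)) euclidean (\<lambda>x. Complex (x 0) (x 1))"
      unfolding im sub_E[OF order_refl] Complex_eq by simp
  qed (simp_all add: inv[unfolded One_nat_def])
  have t: "smooth_on 2 (\<phi> ` (UNIV \<inter> UNIV)) (\<lambda>x. \<phi> (inv_into UNIV \<phi> x) i)" for i
  proof -
    have o: "openin (Euclidean_space 2) (\<phi> ` (UNIV \<inter> UNIV))" using im by simp
    show ?thesis
    proof (rule smooth_on_cong[OF o smooth_on_coord[OF o]])
      fix x assume "x \<in> \<phi> ` (UNIV \<inter> UNIV)"
      then have "\<phi> (inv_into UNIV \<phi> x) = x" using f_inv_into_f[of x \<phi> UNIV] by simp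
      then show "x i = \<phi> (inv_into UNIV \<phi> x) i" by simp
    qed
  qed
  have *: "complex_mfd = \<lparr>mtop = euclidean, mdim = 2, atlas = {(UNIV, \<phi>)}\<rparr>"
    unfolding complex_mfd_def \<phi>_def by simp
  show ?thesis unfolding * mfd_ok_def transition_smooth_def using ch t
    by (simp add: Hausdorff_space_euclidean)
qed

lemma circle_slices: "slices complex_mfd 1 (sphere 0 1)"
  unfolding slices_def
proof (intro conjI ballI)
  let ?C = complex_mfd
  define \<phi> where "\<phi> = (\<lambda>(z::complex) (i::nat). if i = 0 then Re z else if i = 1 then Im z else (0::real))"
  have at: "(UNIV, \<phi>) \<in> atlas ?C" and d2: "mdim ?C = 2" and ptsC: "pts ?C = UNIV"
    by (simp_all add: complex_mfd_def \<phi>_def)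
  note ok = complex_mfd_ok
  note cc = mfd_chart[OF ok at]
  show "1 \<le> mdim ?C" "sphere 0 1 \<subseteq> pts ?C" by (simp_all add: d2 ptsC)
  fix p :: complex assume p: "p \<in> sphere 0 1"
  define h where "h z = Re z * Re z + Im z * Im z - 1" for z
  have smc: "sm ?C UNIV (\<lambda>z. \<phi> z i)" if "i < 2" for i by (rule sm_coord[OF ok atlas_max[OF ok at]]) (simp add: d2 that)
  have oU: "openin (mtop ?C) UNIV" using openin_topspace[of "mtop ?C"] ptsC by simp
  have "sm ?C UNIV (\<lambda>z. \<phi> z 0 * \<phi> z 0 + \<phi> z 1 * \<phi> z 1 + (-1))"
    by (intro sm_add[OF ok oU] sm_mult[OF ok oU] sm_const[OF ok oU] smc) simp_all
  then have h: "h \<in> Cinf ?C" by (intro CinfI[OF ok]) (simp_all add: ptsC h_def[abs_def] \<phi>_def)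
  obtain V X D where cf: "coord_frame ?C UNIV \<phi> V X D" and pV: "p \<in> V"
    using coord_frame_ex[OF ok atlas_max[OF ok at], of p] by auto
  have hin: "h (inv_into UNIV \<phi> x) = x 0 * x 0 + x 1 * x 1 - 1" if "x \<in> \<phi> ` UNIV" for x
  proof -
    have "\<phi> (inv_into UNIV \<phi> x) = x" using f_inv_into_f[OF that] .
    then have "Re (inv_into UNIV \<phi> x) = x 0" "Im (inv_into UNIV \<phi> x) = x 1" by (metis \<phi>_def one_neq_zero)+
    then show ?thesis by (simp add: h_def)
  qed
  have par: "partial i (\<lambda>x. h (inv_into UNIV \<phi> x)) (\<phi> p) = 2 * \<phi> p i" if i: "i < 2" for i
  proof -
    have "partial i (\<lambda>x. h (inv_into UNIV \<phi> x)) (\<phi> p) = partial i (\<lambda>x. x 0 * x 0 + x 1 * x 1 - 1) (\<phi> p)"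
      by (rule partial_cong[OF is_chartD(3)[OF cc]]) (use i d2 hin in auto)
    also have "\<dots> = 2 * \<phi> p i" unfolding partial_def
      using i by (intro DERIV_imp_deriv) (auto simp: less_2_cases_iff intro!: derivative_eq_intros)
    finally show ?thesis .
  qed
  have Dh: "D i p h = 2 * \<phi> p i" if "i < 2" for i
    using coord_frameD(6)[OF cf _ pV h, of i] par that by (simp add: d2)
  define v where "v = (\<phi> p 0 / 2) *\<^sub>R D 0 p + (\<phi> p 1 / 2) *\<^sub>R D 1 p"
  have v: "v \<in> tangent ?C p"
    unfolding v_def by (intro tangent_add[OF ok] tangent_scale[OF ok] vfD[OF ok] coord_frameD(4)[OF cf]) (simp_all add: d2 ptsC)
  have "Re p * Re p + Im p * Im p = 1" using p by (simp add: cmod_def power2_eq_square)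
  then have vh: "v h = 1" using Dh[of 0] Dh[of 1] by (simp add: v_def \<phi>_def)
  have hp: "q \<in> sphere 0 1 \<longleftrightarrow> h q = 0" for q
    by (simp add: h_def cmod_def power2_eq_square real_sqrt_eq_1_iff)
  obtain U \<psi> where U: "(U, \<psi>) \<in> max_atlas ?C" "p \<in> U" "\<And>q. q \<in> U \<Longrightarrow> \<psi> q 1 = h q"
    using level_chart[where c=1 and k=1 and h="\<lambda>_. h" and v="\<lambda>_. v", OF ok _ h v] vh ptsC d2 by auto
  have "\<psi> ` (U \<inter> sphere 0 1) = \<psi> ` U \<inter> En 1"
  proof -
    have "q \<in> sphere 0 1 \<longleftrightarrow> \<psi> q \<in> En 1" if q: "q \<in> U" for q
    proof -
      have "\<psi> q \<in> En 2" using is_chartD(7)[OF max_chart[OF U(1)] q] by (simp add: d2)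
      then have "\<psi> q \<in> En 1 \<longleftrightarrow> \<psi> q 1 = 0" by (auto simp: En_iff) (metis Suc_leI le_neq_implies_less numeral_2_eq_2)
      then show ?thesis using hp U(3)[OF q] by simp
    qed
    then show ?thesis by auto
  qed
  then show "\<exists>U \<phi>. (U, \<phi>) \<in> max_atlas ?C \<and> p \<in> U \<and> \<phi> ` (U \<inter> sphere 0 1) = \<phi> ` U \<inter> En 1" using U by blast
qed

lemma circle_ok: "mfd_ok circle" "1 \<in> pts circle"
  unfolding circle_def using submfd_ok[OF complex_mfd_ok circle_slices] sub_simps(3)[OF complex_mfd_ok circle_slices] by auto

locale gerbe_loc =
  fixes G :: "('m, 'x, 'p) gerbe"
  assumes G: "bundle_gerbe G"
begin

abbreviation "Mm \<equiv> gM G"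
abbreviation "Xm \<equiv> gX G"
abbreviation "Pm \<equiv> gP G"
abbreviation "src \<equiv> gs G"
abbreviation "tgt \<equiv> gt G"
abbreviation "un \<equiv> gunit G"
abbreviation "iv \<equiv> ginv G"
abbreviation "mu \<equiv> gmult G"
abbreviation "pr \<equiv> gproj G"
abbreviation "PxP \<equiv> prod_mfd Pm Pm"
abbreviation "XxX \<equiv> prod_mfd Xm Xm"
abbreviation "dfst \<equiv> push (PP G) Pm fst"
abbreviation "dsnd \<equiv> push (PP G) Pm snd"
abbreviation "dmul \<equiv> push (PP G) Pm (gm G)"

lemma lie: "lie_groupoid G" using G by (simp add: bundle_gerbe_def)

lemma okM: "mfd_ok Mm" and okX: "mfd_ok Xm" and okP: "mfd_ok Pm"
  using G by (simp_all add: bundle_gerbe_def lie_groupoid_def smooth_manifold_imp_mfd_ok)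

lemma subm: "surjective_submersion Pm Xm src" "surjective_submersion Pm Xm tgt" "surjective_submersion Xm Mm pr"
  using G by (simp_all add: bundle_gerbe_def lie_groupoid_def)

lemma Cs: "Cmap Pm Xm src" and Ct: "Cmap Pm Xm tgt" and Cpr: "Cmap Xm Mm pr"
  using subm smooth_map_Cmap[OF okP okX] smooth_map_Cmap[OF okX okM] by (simp_all add: surjective_submersion_def)

lemma Cun: "Cmap Xm Pm un" and Civ: "Cmap Pm Pm iv"
  using lie smooth_map_Cmap[OF okX okP] smooth_map_Cmap[OF okP okP] by (simp_all add: lie_groupoid_def)

lemma onto_sub:
  assumes "surjective_submersion A B F" "p \<in> pts A" "w \<in> tangent B (F p)"
  shows "\<exists>v\<in>tangent A p. push A B F v = w"
proof -
  have "push A B F ` tangent A p = tangent B (F p)" using assms(1,2) by (simp add: surjective_submersion_def)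
  then have "w \<in> push A B F ` tangent A p" using assms(3) by simp
  then show ?thesis by (auto simp: image_iff)
qed

lemma pr_surj: "n \<in> pts Mm \<Longrightarrow> \<exists>y\<in>pts Xm. pr y = n"
proof -
  assume "n \<in> pts Mm"
  then have "n \<in> pr ` pts Xm" using subm(3) by (simp add: surjective_submersion_def)
  then show ?thesis by blast
qed

lemma PP_eq: "PP G = submfd PxP (mdim PxP - mdim Xm)
    {z \<in> pts PxP. src (fst z) = tgt (snd z)}"
proof -
  have "{(p, q). p \<in> pts Pm \<and> q \<in> pts Pm \<and> src p = tgt q} = {z \<in> pts PxP. src (fst z) = tgt (snd z)}"
    by (auto simp: prod_simps[OF okP okP])
  moreover have "mdim PxP - mdim Xm = 2 * mdim Pm - mdim Xm" by (simp add: prod_simps[OF okP okP])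
  ultimately show ?thesis unfolding PP_def by simp
qed

lemmas ok2 = prod_mfd_ok[OF okP okP]

lemma CPa: "Cmap PxP Xm (\<lambda>z. src (fst z))" and CPb: "Cmap PxP Xm (\<lambda>z. tgt (snd z))"
  by (rule Cmap_comp[OF Cmap_fst[OF okP okP] Cs] Cmap_comp[OF Cmap_snd[OF okP okP] Ct])+

lemma PP_onto:
  assumes "z \<in> pts PxP" "src (fst z) = tgt (snd z)" "w \<in> tangent Xm (src (fst z))"
  shows "\<exists>v\<in>tangent PxP z. push PxP Xm (\<lambda>z. src (fst z)) v - push PxP Xm (\<lambda>z. tgt (snd z)) v = w"
proof -
  have z: "fst z \<in> pts Pm" "snd z \<in> pts Pm" using assms(1) by (auto simp: prod_simps[OF okP okP])
  obtain v where v: "v \<in> tangent Pm (fst z)" "push Pm Xm src v = w" using onto_sub[OF subm(1) z(1) assms(3)] by blast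
  note pv = pvec[OF okP okP z v(1) tangent_zero[OF okP]]
  show ?thesis
    by (rule bexI[of _ "pvec Pm Pm (fst z) (snd z) v 0"])
       (use pv v(2) in \<open>simp_all add: push_comp[OF Cmap_fst[OF okP okP] Cs, symmetric] push_comp[OF Cmap_snd[OF okP okP] Ct, symmetric] push_zero\<close>)
qed

lemma PPsl: "slices PxP (mdim PxP - mdim Xm) {z \<in> pts PxP. src (fst z) = tgt (snd z)}"
  by (rule eq_slices[OF ok2 okX CPa CPb refl]) (rule PP_onto)

lemma PPtan:
  assumes "z \<in> {z \<in> pts PxP. src (fst z) = tgt (snd z)}" "v \<in> tangent PxP z"
    "push PxP Xm (\<lambda>z. src (fst z)) v = push PxP Xm (\<lambda>z. tgt (snd z)) v"
  shows "\<exists>u\<in>tangent (PP G) z. push (PP G) PxP id u = v"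
  unfolding PP_eq by (rule eq_tangent[OF ok2 okX CPa CPb refl _ assms]) (rule PP_onto)

lemma okPP: "mfd_ok (PP G)" unfolding PP_eq by (rule submfd_ok[OF ok2 PPsl])

lemma ptsPP_raw: "pts (PP G) = {z \<in> pts PxP. src (fst z) = tgt (snd z)}"
  unfolding PP_eq by (rule sub_simps(3)[OF ok2 PPsl])

lemma ptsPP: "z \<in> pts (PP G) \<longleftrightarrow> fst z \<in> pts Pm \<and> snd z \<in> pts Pm \<and> src (fst z) = tgt (snd z)"
  unfolding ptsPP_raw mem_Collect_eq prod_simps[OF okP okP] topspace_prod_topology mem_Times_iff by blast

lemma PPincl: "Cmap (PP G) PxP id" unfolding PP_eq by (rule Cmap_incl[OF ok2 PPsl])

lemma CPfst: "Cmap (PP G) Pm fst" and CPsnd: "Cmap (PP G) Pm snd"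
  using Cmap_comp[OF PPincl Cmap_fst[OF okP okP]] Cmap_comp[OF PPincl Cmap_snd[OF okP okP]] by simp_all

lemma Cmu: "Cmap (PP G) Pm (gm G)"
  using lie smooth_map_Cmap[OF okPP okP] by (simp add: lie_groupoid_def)

lemma PP_into:
  assumes L: "mfd_ok L" and F: "Cmap L Pm f" and H: "Cmap L Pm h" and eq: "\<And>x. x \<in> pts L \<Longrightarrow> src (f x) = tgt (h x)"
  shows "Cmap L (PP G) (\<lambda>x. (f x, h x))"
  unfolding PP_eq
proof (rule sub_into[OF ok2 PPsl L Cmap_pair[OF okP okP L F H]])
  fix x assume "x \<in> pts L"
  then show "(f x, h x) \<in> {z \<in> pts PxP. src (fst z) = tgt (snd z)}"
    using eq Cmap_pts[OF F] Cmap_pts[OF H] by (simp add: prod_simps[OF okP okP])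
qed

lemma PP_tan_inj:
  assumes z: "z \<in> pts (PP G)" and u: "u \<in> tangent (PP G) z" "u' \<in> tangent (PP G) z"
    and eq: "dfst u = dfst u'" "dsnd u = dsnd u'"
  shows "u = u'"
proof -
  have a: "push PxP Pm fst (push (PP G) PxP id w) = dfst w"
     "push PxP Pm snd (push (PP G) PxP id w) = dsnd w" for w
    by (simp_all add: push_comp[OF PPincl Cmap_fst[OF okP okP]] push_comp[OF PPincl Cmap_snd[OF okP okP]])
  have t: "push (PP G) PxP id w \<in> tangent PxP (fst z, snd z)" if "w \<in> tangent (PP G) z" for w
    using push_tangent[OF PPincl ok2 z that] by simp
  have "push (PP G) PxP id u = push (PP G) PxP id u'"
    by (rule prod_tangent_eq[OF okP okP _ _ t[OF u(1)] t[OF u(2)]]) (use z eq in \<open>auto simp: ptsPP a\<close>)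
  then show ?thesis
    using sub_push_inj[OF ok2 PPsl, of z u u'] z u unfolding ptsPP_raw PP_eq[symmetric] by blast
qed

lemma PP_tan_ex:
  assumes z: "z \<in> pts (PP G)" and v: "v \<in> tangent Pm (fst z)" "w \<in> tangent Pm (snd z)" and eq: "push Pm Xm src v = push Pm Xm tgt w"
  shows "\<exists>u\<in>tangent (PP G) z. dfst u = v \<and> dsnd u = w"
proof -
  have z': "fst z \<in> pts Pm" "snd z \<in> pts Pm" "src (fst z) = tgt (snd z)" using z by (auto simp: ptsPP)
  note pv = pvec[OF okP okP z'(1,2) v]
  have zS: "z \<in> {z \<in> pts PxP. src (fst z) = tgt (snd z)}"
    using z unfolding ptsPP_raw .
  have "push PxP Xm (\<lambda>z. src (fst z)) (pvec Pm Pm (fst z) (snd z) v w) = push PxP Xm (\<lambda>z. tgt (snd z)) (pvec Pm Pm (fst z) (snd z) v w)"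
    using pv eq by (simp add: push_comp[OF Cmap_fst[OF okP okP] Cs, symmetric] push_comp[OF Cmap_snd[OF okP okP] Ct, symmetric])
  then obtain u where u: "u \<in> tangent (PP G) z" "push (PP G) PxP id u = pvec Pm Pm (fst z) (snd z) v w"
    using PPtan[OF zS, of "pvec Pm Pm (fst z) (snd z) v w"] pv(1) by auto
  have "dfst u = v" "dsnd u = w"
    using push_comp[OF PPincl Cmap_fst[OF okP okP], of u] push_comp[OF PPincl Cmap_snd[OF okP okP], of u] u(2) pv(2,3) by simp_all
  then show ?thesis using u(1) by blast
qed

lemma tmult_eq:
  assumes z: "(p, q) \<in> pts (PP G)" and u: "u \<in> tangent (PP G) (p, q)"
  shows "tmult G p q (dfst u) (dsnd u) = dmul u"
proof -
  have "(THE u'. u' \<in> tangent (PP G) (p, q) \<and> dfst u' = dfst u \<and> dsnd u' = dsnd u) = u"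
    by (rule the_equality) (use u PP_tan_inj[OF z] in auto)
  then show ?thesis by (simp add: tmult_def)
qed

lemma grp:
  "\<And>p q. p \<in> pts Pm \<Longrightarrow> q \<in> pts Pm \<Longrightarrow> src p = tgt q \<Longrightarrow> mu p q \<in> pts Pm \<and> src (mu p q) = src q \<and> tgt (mu p q) = tgt p"
  "\<And>p q r. p \<in> pts Pm \<Longrightarrow> q \<in> pts Pm \<Longrightarrow> r \<in> pts Pm \<Longrightarrow> src p = tgt q \<Longrightarrow> src q = tgt r \<Longrightarrow> mu (mu p q) r = mu p (mu q r)"
  "\<And>y. y \<in> pts Xm \<Longrightarrow> un y \<in> pts Pm \<and> src (un y) = y \<and> tgt (un y) = y"
  "\<And>p. p \<in> pts Pm \<Longrightarrow> mu (un (tgt p)) p = p \<and> mu p (un (src p)) = p"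
  "\<And>p. p \<in> pts Pm \<Longrightarrow> iv p \<in> pts Pm \<and> src (iv p) = tgt p \<and> tgt (iv p) = src p"
  "\<And>p. p \<in> pts Pm \<Longrightarrow> mu (iv p) p = un (src p) \<and> mu p (iv p) = un (tgt p)"
  "\<And>p. p \<in> pts Pm \<Longrightarrow> src p \<in> pts Xm \<and> tgt p \<in> pts Xm"
proof -
  have A: "\<forall>(p, q)\<in>pts (PP G). src (mu p q) = src q \<and> tgt (mu p q) = tgt p"
    "\<forall>p\<in>pts Pm. \<forall>q\<in>pts Pm. \<forall>r\<in>pts Pm. src p = tgt q \<and> src q = tgt r \<longrightarrow> mu (mu p q) r = mu p (mu q r)"
    "\<forall>x\<in>pts Xm. src (un x) = x \<and> tgt (un x) = x"
    "\<forall>p\<in>pts Pm. mu (un (tgt p)) p = p \<and> mu p (un (src p)) = p"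
    "\<forall>p\<in>pts Pm. src (iv p) = tgt p \<and> tgt (iv p) = src p \<and> mu (iv p) p = un (src p) \<and> mu p (iv p) = un (tgt p)"
    using lie unfolding lie_groupoid_def by blast+
  fix p assume p: "p \<in> pts Pm"
  show "mu (un (tgt p)) p = p \<and> mu p (un (src p)) = p" using A(4) p by blast
  show "iv p \<in> pts Pm \<and> src (iv p) = tgt p \<and> tgt (iv p) = src p" using A(5) p Cmap_pts[OF Civ p] by blast
  show "mu (iv p) p = un (src p) \<and> mu p (iv p) = un (tgt p)" using A(5) p by blast
  show "src p \<in> pts Xm \<and> tgt p \<in> pts Xm" using Cmap_pts[OF Cs p] Cmap_pts[OF Ct p] by blast
  fix q assume q: "q \<in> pts Pm"
  show "mu p q \<in> pts Pm \<and> src (mu p q) = src q \<and> tgt (mu p q) = tgt p" if "src p = tgt q"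
  proof -
    have z: "(p, q) \<in> pts (PP G)" using p q that by (simp add: ptsPP)
    show ?thesis using A(1) z Cmap_pts[OF Cmu z] by auto
  qed
  fix r assume r: "r \<in> pts Pm"
  show "mu (mu p q) r = mu p (mu q r)" if "src p = tgt q" "src q = tgt r" using A(2) p q r that by blast
next
  fix y assume y: "y \<in> pts Xm"
  have "\<forall>x\<in>pts Xm. src (un x) = x \<and> tgt (un x) = x" using lie unfolding lie_groupoid_def by blast
  then show "un y \<in> pts Pm \<and> src (un y) = y \<and> tgt (un y) = y" using y Cmap_pts[OF Cun y] by blast
qed

lemma iv_unique:
  assumes p: "p \<in> pts Pm" and q: "q \<in> pts Pm" and e: "src q = tgt p" "mu q p = un (src p)"
  shows "q = iv p"
proof -
  have i: "iv p \<in> pts Pm" "src (iv p) = tgt p" "tgt (iv p) = src p" using grp(5)[OF p] by auto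
  have "q = mu q (mu p (iv p))" using grp(4)[OF q] grp(6)[OF p] e(1) by simp
  also have "\<dots> = mu (mu q p) (iv p)" using grp(2)[OF q p i(1)] e(1) i(3) by simp
  also have "\<dots> = iv p" using e(2) grp(4)[OF i(1)] i(3) by simp
  finally show ?thesis .
qed

lemma iv_iv: "p \<in> pts Pm \<Longrightarrow> iv (iv p) = p"
  using iv_unique[of "iv p" p] grp(5,6)[of p] by simp

lemma iv_un: "y \<in> pts Xm \<Longrightarrow> iv (un y) = un y"
  using iv_unique[of "un y" "un y"] grp(3)[of y] grp(4)[of "un y"] by simp

lemma iv_mu:
  assumes p: "p \<in> pts Pm" and q: "q \<in> pts Pm" and e: "src p = tgt q"
  shows "iv (mu p q) = mu (iv q) (iv p)"
proof -
  have i: "iv p \<in> pts Pm" "src (iv p) = tgt p" "tgt (iv p) = src p" "iv q \<in> pts Pm" "src (iv q) = tgt q" "tgt (iv q) = src q"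
    using grp(5)[OF p] grp(5)[OF q] by auto
  have pq: "mu p q \<in> pts Pm" "src (mu p q) = src q" "tgt (mu p q) = tgt p" using grp(1)[OF p q e] by auto
  have m: "mu (iv q) (iv p) \<in> pts Pm" "src (mu (iv q) (iv p)) = tgt p" using grp(1)[OF i(4,1)] i e by auto
  have "mu (mu (iv q) (iv p)) (mu p q) = mu (iv q) (mu (iv p) (mu p q))" using grp(2)[OF i(4,1) pq(1)] i pq e by simp
  also have "mu (iv p) (mu p q) = mu (mu (iv p) p) q" using grp(2)[OF i(1) p q] i e by simp
  also have "\<dots> = q" using grp(6)[OF p] grp(4)[OF q] e by simp
  also have "mu (iv q) q = un (src (mu p q))" using grp(6)[OF q] pq by simp
  finally have "mu (mu (iv q) (iv p)) (mu p q) = un (src (mu p q))" .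
  then show ?thesis using iv_unique[OF pq(1) m(1)] m(2) pq(3) by simp
qed

lemma sfib_eq: "sfib G y = submfd Pm (mdim Pm - mdim Xm) {q \<in> pts Pm. src q = y}"
  by (simp add: sfib_def)

lemma sfib_onto:
  assumes "y \<in> pts Xm" "p \<in> pts Pm" "src p = y" "w \<in> tangent Xm (src p)"
  shows "\<exists>v\<in>tangent Pm p. push Pm Xm src v - push Pm Xm (\<lambda>_. y) v = w"
proof -
  obtain v where "v \<in> tangent Pm p" "push Pm Xm src v = w" using onto_sub[OF subm(1) assms(2,4)] by blast
  then show ?thesis using push_const[OF okP assms(2)] by (intro bexI[of _ v]) simp_all
qed

context
  fixes y assumes y: "y \<in> pts Xm"
begin

lemma fsl: "slices Pm (mdim Pm - mdim Xm) {q \<in> pts Pm. src q = y}"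
  by (rule eq_slices[OF okP okX Cs Cmap_const[OF okP y] refl]) (rule sfib_onto[OF y])

lemma ftan:
  assumes "q \<in> {q \<in> pts Pm. src q = y}" "v \<in> tangent Pm q" "push Pm Xm src v = push Pm Xm (\<lambda>_. y) v"
  shows "\<exists>u\<in>tangent (sfib G y) q. push (sfib G y) Pm id u = v"
  unfolding sfib_eq by (rule eq_tangent[OF okP okX Cs Cmap_const[OF okP y] refl _ assms]) (rule sfib_onto[OF y])

lemma sfib_ok: "mfd_ok (sfib G y)" unfolding sfib_eq by (rule submfd_ok[OF okP fsl])
lemma sfib_pts: "q \<in> pts (sfib G y) \<longleftrightarrow> q \<in> pts Pm \<and> src q = y"
  unfolding sfib_eq sub_simps(3)[OF okP fsl] by simp
lemma sfib_incl: "Cmap (sfib G y) Pm id" unfolding sfib_eq by (rule Cmap_incl[OF okP fsl])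
lemma sfib_un: "un y \<in> pts (sfib G y)" using grp(3)[OF y] by (simp add: sfib_pts)

lemma vert:
  assumes a: "a \<in> algd G"
  shows "vert G a y \<in> tangent (sfib G y) (un y)" "push (sfib G y) Pm id (vert G a y) = a y"
proof -
  have ay: "a y \<in> tangent Pm (un y)" "push Pm Xm src (a y) = 0" using a y by (simp_all add: algd_def)
  have uS: "un y \<in> {q \<in> pts Pm. src q = y}" using grp(3)[OF y] by simp
  have "\<exists>u\<in>tangent (sfib G y) (un y). push (sfib G y) Pm id u = a y"
    by (rule ftan[OF uS ay(1)]) (use ay push_const[OF okP _ ay(1)] grp(3)[OF y] in simp)
  moreover have "u = u'" if "u \<in> tangent (sfib G y) (un y)" "u' \<in> tangent (sfib G y) (un y)"
    "push (sfib G y) Pm id u = push (sfib G y) Pm id u'" for u u'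
    using sub_push_inj[OF okP fsl uS] that unfolding sfib_eq by blast
  ultimately have "\<exists>!u. u \<in> tangent (sfib G y) (un y) \<and> push (sfib G y) Pm id u = a y" by metis
  from theI'[OF this] show "vert G a y \<in> tangent (sfib G y) (un y)" "push (sfib G y) Pm id (vert G a y) = a y"
    by (simp_all add: vert_def)
qed

lemma sfib_PP:
  assumes f: "Cmap (sfib G y) Pm f" and h: "Cmap (sfib G y) Pm h" and eq: "\<And>q. q \<in> pts Pm \<Longrightarrow> src q = y \<Longrightarrow> src (f q) = tgt (h q)"
    and a: "a \<in> algd G"
  shows "\<exists>u\<in>tangent (PP G) (f (un y), h (un y)). dfst u = push (sfib G y) Pm f (vert G a y) \<and>
     dsnd u = push (sfib G y) Pm h (vert G a y) \<and>
     dmul u = push (sfib G y) Pm (\<lambda>q. mu (f q) (h q)) (vert G a y)"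
proof -
  have C: "Cmap (sfib G y) (PP G) (\<lambda>q. (f q, h q))" by (rule PP_into[OF sfib_ok f h]) (simp add: sfib_pts eq)
  show ?thesis
    by (rule bexI[OF _ push_tangent[OF C okPP sfib_un vert(1)[OF a]]])
       (simp add: push_comp[OF C CPfst] push_comp[OF C CPsnd] push_comp[OF C Cmu])
qed

end

section \<open>Invariant vector fields\<close>

lemma Cmu2:
  assumes "mfd_ok L" "Cmap L Pm f" "Cmap L Pm h" "\<And>x. x \<in> pts L \<Longrightarrow> src (f x) = tgt (h x)"
  shows "Cmap L Pm (\<lambda>x. mu (f x) (h x))"
  using Cmap_comp[OF PP_into[OF assms] Cmu] by simp

context
  fixes a assumes a: "a \<in> algd G"
begin

lemma algd_at: "y \<in> pts Xm \<Longrightarrow> a y \<in> tangent Pm (un y)" "y \<in> pts Xm \<Longrightarrow> push Pm Xm src (a y) = 0"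
  "y \<notin> pts Xm \<Longrightarrow> a y = 0" "f \<in> Cinf Pm \<Longrightarrow> (\<lambda>y. a y f) \<in> Cinf Xm"
  using a by (simp_all add: algd_def)

lemma right_ex:
  assumes q: "q \<in> pts Pm" and r: "r \<in> pts Pm" and e: "src q = tgt r"
  shows "\<exists>u\<in>tangent (PP G) (q, r). dfst u = right_vf G a q \<and> dsnd u = 0 \<and>
     dmul u = right_vf G a (mu q r)"
proof -
  have y: "tgt q \<in> pts Xm" using grp(7)[OF q] by simp
  have Cq: "Cmap (sfib G (tgt q)) Pm (\<lambda>g. mu g q)"
    using Cmu2[OF sfib_ok[OF y] sfib_incl[OF y] Cmap_const[OF sfib_ok[OF y] q]] by (simp add: sfib_pts[OF y])
  have Cr: "Cmap (sfib G (tgt q)) Pm (\<lambda>_. r)" by (rule Cmap_const[OF sfib_ok[OF y] r])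
  have m: "mu q r \<in> pts Pm" "tgt (mu q r) = tgt q" using grp(1)[OF q r e] by auto
  have eq: "src (mu g q) = tgt r" if "g \<in> pts Pm" "src g = tgt q" for g using grp(1)[OF that(1) q that(2)] e by simp
  obtain u where u: "u \<in> tangent (PP G) (mu (un (tgt q)) q, r)"
     "dfst u = push (sfib G (tgt q)) Pm (\<lambda>g. mu g q) (vert G a (tgt q))"
     "dsnd u = push (sfib G (tgt q)) Pm (\<lambda>_. r) (vert G a (tgt q))"
     "dmul u = push (sfib G (tgt q)) Pm (\<lambda>g. mu (mu g q) r) (vert G a (tgt q))"
    using sfib_PP[OF y Cq Cr eq a] by blast
  have "push (sfib G (tgt q)) Pm (\<lambda>g. mu (mu g q) r) (vert G a (tgt q)) = push (sfib G (tgt q)) Pm (\<lambda>g. mu g (mu q r)) (vert G a (tgt q))"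
    by (rule push_cong) (use grp(2)[OF _ q r _ e] in \<open>simp add: sfib_pts[OF y]\<close>)
  moreover have "push (sfib G (tgt q)) Pm (\<lambda>_. r) (vert G a (tgt q)) = 0"
    by (rule push_const[OF sfib_ok[OF y] sfib_un[OF y] vert(1)[OF y a]])
  ultimately show ?thesis using u grp(4)[OF q] q m by (intro bexI[of _ u]) (simp_all add: right_vf_def)
qed

lemma left_ex:
  assumes q: "q \<in> pts Pm" and r: "r \<in> pts Pm" and e: "src q = tgt r"
  shows "\<exists>u\<in>tangent (PP G) (q, r). dfst u = 0 \<and> dsnd u = left_vf G a r \<and>
     dmul u = left_vf G a (mu q r)"
proof -
  have y: "src r \<in> pts Xm" using grp(7)[OF r] by simp
  have Ci: "Cmap (sfib G (src r)) Pm (\<lambda>g. iv g)" using Cmap_comp[OF sfib_incl[OF y] Civ] by simp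
  have Cr: "Cmap (sfib G (src r)) Pm (\<lambda>g. mu r (iv g))"
    by (rule Cmu2[OF sfib_ok[OF y] Cmap_const[OF sfib_ok[OF y] r] Ci]) (simp add: sfib_pts[OF y] grp(5))
  have Cq: "Cmap (sfib G (src r)) Pm (\<lambda>_. q)" by (rule Cmap_const[OF sfib_ok[OF y] q])
  have m: "mu q r \<in> pts Pm" "src (mu q r) = src r" using grp(1)[OF q r e] by auto
  have eq: "src q = tgt (mu r (iv g))" if "g \<in> pts Pm" "src g = src r" for g
    using grp(1)[OF r, of "iv g"] grp(5)[OF that(1)] that(2) e by simp
  obtain u where u: "u \<in> tangent (PP G) (q, mu r (iv (un (src r))))"
     "dfst u = push (sfib G (src r)) Pm (\<lambda>_. q) (vert G a (src r))"
     "dsnd u = push (sfib G (src r)) Pm (\<lambda>g. mu r (iv g)) (vert G a (src r))"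
     "dmul u = push (sfib G (src r)) Pm (\<lambda>g. mu q (mu r (iv g))) (vert G a (src r))"
    using sfib_PP[OF y Cq Cr eq a] by blast
  have "push (sfib G (src r)) Pm (\<lambda>g. mu q (mu r (iv g))) (vert G a (src r)) = push (sfib G (src r)) Pm (\<lambda>g. mu (mu q r) (iv g)) (vert G a (src r))"
  proof (rule push_cong)
    fix g assume "g \<in> pts (sfib G (src r))"
    then have g: "g \<in> pts Pm" "src g = src r" by (auto simp: sfib_pts[OF y])
    show "mu q (mu r (iv g)) = mu (mu q r) (iv g)" using grp(2)[OF q r _ e, of "iv g"] grp(5)[OF g(1)] g(2) by simp
  qed
  moreover have "push (sfib G (src r)) Pm (\<lambda>_. q) (vert G a (src r)) = 0"
    by (rule push_const[OF sfib_ok[OF y] sfib_un[OF y] vert(1)[OF y a]])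
  ultimately show ?thesis using u grp(4)[OF r] r m iv_un[OF y] by (intro bexI[of _ u]) (simp_all add: left_vf_def)
qed

lemma mid_ex:
  assumes q: "q \<in> pts Pm" and r: "r \<in> pts Pm" and e: "src q = tgt r"
  shows "\<exists>u\<in>tangent (PP G) (q, r). dfst u = left_vf G a q \<and> dsnd u = right_vf G a r \<and>
     dmul u = 0"
proof -
  have y: "src q \<in> pts Xm" using grp(7)[OF q] by simp
  have Ci: "Cmap (sfib G (src q)) Pm (\<lambda>g. iv g)" using Cmap_comp[OF sfib_incl[OF y] Civ] by simp
  have Cq: "Cmap (sfib G (src q)) Pm (\<lambda>g. mu q (iv g))"
    by (rule Cmu2[OF sfib_ok[OF y] Cmap_const[OF sfib_ok[OF y] q] Ci]) (simp add: sfib_pts[OF y] grp(5))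
  have Cr: "Cmap (sfib G (src q)) Pm (\<lambda>g. mu g r)"
  proof (rule Cmu2[where f="\<lambda>g. g", OF sfib_ok[OF y] _ Cmap_const[OF sfib_ok[OF y] r]])
    show "Cmap (sfib G (src q)) Pm (\<lambda>g. g)" using sfib_incl[OF y] by (simp add: id_def)
    show "src g = tgt r" if "g \<in> pts (sfib G (src q))" for g using sfib_pts[OF y, of g] e that by simp
  qed
  have eq: "src (mu q (iv g)) = tgt (mu g r)" if "g \<in> pts Pm" "src g = src q" for g
    using grp(1)[OF q, of "iv g"] grp(1)[OF that(1) r] grp(5)[OF that(1)] that(2) e by simp
  obtain u where u: "u \<in> tangent (PP G) (mu q (iv (un (src q))), mu (un (src q)) r)"
     "dfst u = push (sfib G (src q)) Pm (\<lambda>g. mu q (iv g)) (vert G a (src q))"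
     "dsnd u = push (sfib G (src q)) Pm (\<lambda>g. mu g r) (vert G a (src q))"
     "dmul u = push (sfib G (src q)) Pm (\<lambda>g. mu (mu q (iv g)) (mu g r)) (vert G a (src q))"
    using sfib_PP[OF y Cq Cr eq a] by blast
  have "push (sfib G (src q)) Pm (\<lambda>g. mu (mu q (iv g)) (mu g r)) (vert G a (src q)) = push (sfib G (src q)) Pm (\<lambda>_. mu q r) (vert G a (src q))"
  proof (rule push_cong)
    fix g assume "g \<in> pts (sfib G (src q))"
    then have g: "g \<in> pts Pm" "src g = src q" by (auto simp: sfib_pts[OF y])
    have i: "iv g \<in> pts Pm" "src (iv g) = tgt g" "tgt (iv g) = src q" using grp(5)[OF g(1)] g(2) by auto
    have gr: "mu g r \<in> pts Pm" "tgt (mu g r) = tgt g" using grp(1)[OF g(1) r] g(2) e by auto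
    have "mu (mu q (iv g)) (mu g r) = mu q (mu (iv g) (mu g r))" using grp(2)[OF q i(1) gr(1)] i gr by simp
    also have "mu (iv g) (mu g r) = mu (mu (iv g) g) r" using grp(2)[OF i(1) g(1) r] i g e by simp
    also have "\<dots> = r" using grp(6)[OF g(1)] grp(4)[OF r] g(2) e by simp
    finally show "mu (mu q (iv g)) (mu g r) = mu q r" .
  qed
  also have "\<dots> = 0"
    by (rule push_const[OF sfib_ok[OF y] sfib_un[OF y] vert(1)[OF y a]])
  finally show ?thesis using u grp(4)[OF q] grp(4)[OF r] q r e iv_un[OF y]
    by (intro bexI[of _ u]) (simp_all add: left_vf_def right_vf_def)
qed

lemma right_un: assumes y: "y \<in> pts Xm" shows "right_vf G a (un y) = a y"
proof -
  have "right_vf G a (un y) = push (sfib G y) Pm (\<lambda>q. mu q (un y)) (vert G a y)" using grp(3)[OF y] by (simp add: right_vf_def)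
  also have "\<dots> = push (sfib G y) Pm id (vert G a y)"
    by (rule push_cong) (use grp(4) in \<open>auto simp: sfib_pts[OF y]\<close>)
  finally show ?thesis using vert(2)[OF y a] by simp
qed

lemma right_char:
  assumes p: "p \<in> pts Pm" and u: "u \<in> tangent (PP G) (un (tgt p), p)" "dfst u = a (tgt p)" "dsnd u = 0"
  shows "right_vf G a p = dmul u"
proof -
  have y: "tgt p \<in> pts Xm" using grp(7)[OF p] by simp
  have e: "un (tgt p) \<in> pts Pm" "src (un (tgt p)) = tgt p" using grp(3)[OF y] by auto
  obtain u' where u': "u' \<in> tangent (PP G) (un (tgt p), p)" "dfst u' = right_vf G a (un (tgt p))"
    "dsnd u' = 0" "dmul u' = right_vf G a (mu (un (tgt p)) p)"
    using right_ex[OF e(1) p e(2)] by blast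
  have "u = u'" by (rule PP_tan_inj[OF _ u(1) u'(1)]) (use u u' right_un[OF y] p e in \<open>auto simp: ptsPP\<close>)
  then show ?thesis using u'(4) grp(4)[OF p] by simp
qed

lemma right_tan:
  assumes p: "p \<in> pts Pm"
  shows "right_vf G a p \<in> tangent Pm p" "push Pm Xm src (right_vf G a p) = 0" "push Pm Xm tgt (right_vf G a p) = anchor G a (tgt p)"
proof -
  have y: "tgt p \<in> pts Xm" using grp(7)[OF p] by simp
  have e: "un (tgt p) \<in> pts Pm" "src (un (tgt p)) = tgt p" using grp(3)[OF y] by auto
  have z: "(un (tgt p), p) \<in> pts (PP G)" using p e by (simp add: ptsPP)
  obtain u where u: "u \<in> tangent (PP G) (un (tgt p), p)" "dfst u = right_vf G a (un (tgt p))"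
    "dsnd u = 0" "dmul u = right_vf G a (mu (un (tgt p)) p)"
    using right_ex[OF e(1) p e(2)] by blast
  have R: "right_vf G a p = dmul u" using u(4) grp(4)[OF p] by simp
  show "right_vf G a p \<in> tangent Pm p" unfolding R using push_tangent[OF Cmu okP z u(1)] grp(4)[OF p] by simp
  have "push Pm Xm src (right_vf G a p) = push (PP G) Xm (\<lambda>z. src (snd z)) u"
    unfolding R push_comp[OF Cmu Cs] by (rule push_cong) (use grp(1) in \<open>auto simp: ptsPP\<close>)
  also have "\<dots> = 0" unfolding push_comp[OF CPsnd Cs, symmetric] u(3) push_zero ..
  finally show "push Pm Xm src (right_vf G a p) = 0" .
  have "push Pm Xm tgt (right_vf G a p) = push (PP G) Xm (\<lambda>z. tgt (fst z)) u"
    unfolding R push_comp[OF Cmu Ct] by (rule push_cong) (use grp(1) in \<open>auto simp: ptsPP\<close>)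
  also have "\<dots> = anchor G a (tgt p)" unfolding push_comp[OF CPfst Ct, symmetric] u(2) right_un[OF y] anchor_def ..
  finally show "push Pm Xm tgt (right_vf G a p) = anchor G a (tgt p)" .
qed

lemma right_vfield: "right_vf G a \<in> vfields Pm"
proof (rule vfI[OF okP right_tan(1)])
  show "right_vf G a p = 0" if "p \<notin> pts Pm" for p using that by (simp add: right_vf_def)
  fix f assume f: "f \<in> Cinf Pm"
  show "(\<lambda>p. right_vf G a p f) \<in> Cinf Pm"
  proof (rule Cinf_localI'[OF okP])
    show "right_vf G a p f = 0" if "p \<notin> pts Pm" for p using that by (simp add: right_vf_def)
    fix p0 assume p0: "p0 \<in> pts Pm"
    define e where "e p = (un (tgt p), p)" for p
    have Cut: "Cmap Pm Pm (\<lambda>p. un (tgt p))" by (rule Cmap_comp[OF Ct Cun])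
    have Ce: "Cmap Pm (PP G) e" unfolding e_def
      by (rule PP_into[OF okP Cut Cmap_id[OF okP]]) (use grp(3,7) in auto)
    have Ce2: "Cmap Pm PxP e" using Cmap_comp[OF Ce PPincl] by simp
    define F where "F = pull0 (PP G) (gm G) f"
    have F: "F \<in> Cinf (PP G)" unfolding F_def by (rule Cmap_pull[OF Cmu f])
    have e0: "e p0 \<in> {z \<in> pts PxP. src (fst z) = tgt (snd z)}"
      using Cmap_pts[OF Ce p0] unfolding ptsPP_raw .
    obtain F' A where F': "F' \<in> Cinf PxP" "openin (mtop PxP) A" "e p0 \<in> A"
      "\<And>z. z \<in> A \<inter> {z \<in> pts PxP. src (fst z) = tgt (snd z)} \<Longrightarrow> F' z = F z"
      using sub_extend[OF ok2 PPsl F[unfolded PP_eq] e0] by blast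
    have u0: "un (tgt p0) \<in> pts Pm" using grp(3,7) p0 by blast
    obtain U \<phi> where c: "(U, \<phi>) \<in> atlas Pm" "un (tgt p0) \<in> U" using mfd_cover[OF okP u0] by blast
    obtain V Z D where cf: "coord_frame Pm U \<phi> V Z D" and V: "un (tgt p0) \<in> V"
      using coord_frame_ex[OF okP atlas_max[OF okP c(1)] c(2)] by blast
    have "\<forall>i\<in>{..<mdim Pm}. \<exists>E. E \<in> vfields PxP \<and> related PxP Pm fst E (D i) \<and> related PxP Pm snd E 0"
      using prod_vfield[OF okP okP coord_frameD(4)[OF cf] vfields_zero[OF okP]] by blast
    then obtain E where E: "\<forall>i\<in>{..<mdim Pm}. E i \<in> vfields PxP \<and> related PxP Pm fst (E i) (D i) \<and> related PxP Pm snd (E i) 0"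
      by (rule bchoice[THEN exE])
    define g where "g = (\<Sum>i<mdim Pm. pull0 Pm tgt (\<lambda>y. a y (Z i)) * pull0 Pm e (\<lambda>z. E i z F'))"
    have g: "g \<in> Cinf Pm" unfolding g_def
    proof (rule Cinf_sum[OF okP])
      fix i assume i: "i \<in> {..<mdim Pm}"
      show "pull0 Pm tgt (\<lambda>y. a y (Z i)) * pull0 Pm e (\<lambda>z. E i z F') \<in> Cinf Pm"
        using i E coord_frameD(3)[OF cf]
        by (intro Cinf_mult[OF okP] Cmap_pull[OF Ct] Cmap_pull[OF Ce2] algd_at(4) vf_Cinf[OF ok2 _ F'(1)]) auto
    qed
    define S where "S = {p \<in> pts Pm. e p \<in> A} \<inter> {p \<in> pts Pm. un (tgt p) \<in> V}"
    have S: "openin (mtop Pm) S" unfolding S_def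
      by (intro openin_Int Cmap_open[OF Ce2 F'(2)] Cmap_open[OF Cut coord_frameD(1)[OF cf]])
    have "right_vf G a p f = g p" if pS: "p \<in> S" for p
    proof -
      have p: "p \<in> pts Pm" "e p \<in> A" "un (tgt p) \<in> V" using pS by (auto simp: S_def)
      have y: "tgt p \<in> pts Xm" using grp(7)[OF p(1)] by simp
      have up: "un (tgt p) \<in> pts Pm" "src (un (tgt p)) = tgt p" using grp(3)[OF y] by auto
      have z: "e p \<in> pts (PP G)" by (rule Cmap_pts[OF Ce p(1)])
      have z2: "e p \<in> pts PxP" by (rule Cmap_pts[OF Ce2 p(1)])
      obtain u where u: "u \<in> tangent (PP G) (e p)" "dfst u = a (tgt p)" "dsnd u = 0"
        using PP_tan_ex[OF z, of "a (tgt p)" 0] algd_at(1,2)[OF y] tangent_zero[OF okP] by (auto simp: e_def push_zero)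
      have R: "right_vf G a p = dmul u" by (rule right_char[OF p(1)]) (use u in \<open>simp_all add: e_def\<close>)
      define w where "w = push (PP G) PxP id u"
      have w: "w \<in> tangent PxP (e p)" unfolding w_def using push_tangent[OF PPincl ok2 z u(1)] by simp
      have w1: "push PxP Pm fst w = a (tgt p)" "push PxP Pm snd w = 0"
        unfolding w_def using u by (simp_all add: push_comp[OF PPincl Cmap_fst[OF okP okP]] push_comp[OF PPincl Cmap_snd[OF okP okP]])
      define w' where "w' = (\<Sum>i<mdim Pm. a (tgt p) (Z i) *\<^sub>R E i (e p))"
      have w't: "w' \<in> tangent PxP (e p)" unfolding w'_def
        by (intro tangent_sum[OF ok2] tangent_scale[OF ok2] vfD[OF ok2 _ z2]) (use E in auto)
      have psum: "push PxP Pm H w' = (\<Sum>i<mdim Pm. a (tgt p) (Z i) *\<^sub>R push PxP Pm H (E i (e p)))" for H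
        by (rule ext) (simp add: w'_def push_def sum_fun_app)
      have wf: "push PxP Pm fst w' = a (tgt p)"
      proof -
        have "push PxP Pm fst (E i (e p)) = D i (un (tgt p))" if "i < mdim Pm" for i
          using E z2 that by (simp add: related_def e_def)
        then have s1: "push PxP Pm fst w' = (\<Sum>i<mdim Pm. a (tgt p) (Z i) *\<^sub>R D i (un (tgt p)))" by (simp add: psum)
        show ?thesis
        proof (rule tangent_eqI[OF okP _ algd_at(1)[OF y]])
          show "push PxP Pm fst w' \<in> tangent Pm (un (tgt p))"
            using push_tangent[OF Cmap_fst[OF okP okP] okP z2 w't] by (simp add: e_def)
          fix k assume "k \<in> Cinf Pm"
          then show "push PxP Pm fst w' k = a (tgt p) k"
            unfolding s1 using coord_frameD(8)[OF cf p(3) algd_at(1)[OF y], of k] by (simp add: sum_fun_app)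
        qed
      qed
      have ws: "push PxP Pm snd w' = 0"
      proof -
        have "push PxP Pm snd (E i (e p)) = 0" if "i < mdim Pm" for i
          using E z2 that by (simp add: related_def)
        then show ?thesis by (simp add: psum)
      qed
      have ww: "w = w'"
        using prod_tangent_eq[OF okP okP up(1) p(1), of w w'] w w't w1 wf ws by (simp add: e_def)
      have "right_vf G a p f = u F" using R f by (simp add: push_app F_def)
      also have "\<dots> = u (pull0 (PP G) id F')"
      proof (rule tan_local[OF okPP u(1) _ _ F Cmap_pull[OF PPincl F'(1)]])
        show "openin (mtop (PP G)) {z \<in> pts (PP G). id z \<in> A}" by (rule Cmap_open[OF PPincl F'(2)])
        show "e p \<in> {z \<in> pts (PP G). id z \<in> A}" using z p(2) by simp
        fix x assume x: "x \<in> {z \<in> pts (PP G). id z \<in> A}"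
        then have "x \<in> {z \<in> pts PxP. src (fst z) = tgt (snd z)}"
          unfolding ptsPP_raw by simp
        then show "F x = pull0 (PP G) id F' x" using F'(4)[of x] x by (simp add: pull0_def)
      qed
      also have "\<dots> = w F'" unfolding w_def push_app[OF F'(1)] ..
      also have "\<dots> = g p" unfolding ww w'_def using p(1) by (simp add: g_def sum_fun_app pull0_def)
      finally show ?thesis .
    qed
    moreover have "p0 \<in> S" using p0 F'(3) V by (simp add: S_def)
    ultimately show "\<exists>S g. openin (mtop Pm) S \<and> p0 \<in> S \<and> g \<in> Cinf Pm \<and> (\<forall>q\<in>S. right_vf G a q f = g q)" using S g by blast
  qed
qed

end

lemma algd_iff: "a \<in> algd G \<longleftrightarrow> (\<forall>y\<in>pts Xm. a y \<in> tangent Pm (un y) \<and> push Pm Xm src (a y) = 0) \<and>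
    (\<forall>y. y \<notin> pts Xm \<longrightarrow> a y = 0) \<and> (\<forall>f\<in>Cinf Pm. (\<lambda>y. a y f) \<in> Cinf Xm)"
  by (simp add: algd_def)

lemma algd_add: assumes a: "a \<in> algd G" and b: "b \<in> algd G" shows "a + b \<in> algd G"
  unfolding algd_iff
proof (intro conjI ballI allI impI)
  fix y assume y: "y \<in> pts Xm"
  show "(a + b) y \<in> tangent Pm (un y)"
    using tangent_add[OF okP algd_at(1)[OF a y] algd_at(1)[OF b y]] by simp
  show "push Pm Xm src ((a + b) y) = 0" using algd_at(2)[OF a y] algd_at(2)[OF b y] by (simp add: push_add)
next
  fix y assume "y \<notin> pts Xm" then show "(a + b) y = 0" using algd_at(3)[OF a] algd_at(3)[OF b] by simp
next
  fix f assume f: "f \<in> Cinf Pm"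
  show "(\<lambda>y. (a + b) y f) \<in> Cinf Xm"
    using Cinf_add[OF okX algd_at(4)[OF a f] algd_at(4)[OF b f]] by (simp add: plus_fun_def)
qed

lemma algd_scale: assumes a: "a \<in> algd G" shows "c *\<^sub>R a \<in> algd G"
  unfolding algd_iff
proof (intro conjI ballI allI impI)
  fix y assume y: "y \<in> pts Xm"
  show "(c *\<^sub>R a) y \<in> tangent Pm (un y)"
    using tangent_scale[OF okP algd_at(1)[OF a y]] by simp
  show "push Pm Xm src ((c *\<^sub>R a) y) = 0" using algd_at(2)[OF a y] by (simp add: push_scale)
next
  fix y assume "y \<notin> pts Xm" then show "(c *\<^sub>R a) y = 0" using algd_at(3)[OF a] by simp
next
  fix f assume f: "f \<in> Cinf Pm"
  show "(\<lambda>y. (c *\<^sub>R a) y f) \<in> Cinf Xm"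
    using Cinf_scale[OF okX algd_at(4)[OF a f], of c] by (simp add: scaleR_fun_def)
qed

lemma algd_zero: "0 \<in> algd G"
  using Cinf_zero[OF okX] tangent_zero[OF okP] push_zero[of Pm Xm src] by (simp add: algd_iff zero_fun_def)

lemma algd_diff: "a \<in> algd G \<Longrightarrow> b \<in> algd G \<Longrightarrow> a - b \<in> algd G"
  using algd_add[of a "(-1) *\<^sub>R b"] algd_scale[of b "-1"] by simp

lemma right_lift:
  assumes a: "a \<in> algd G" and p: "p \<in> pts Pm"
  shows "\<exists>u\<in>tangent (PP G) (un (tgt p), p). dfst u = a (tgt p) \<and> dsnd u = 0 \<and>
     dmul u = right_vf G a p"
proof -
  have y: "tgt p \<in> pts Xm" using grp(7)[OF p] by simp
  have e: "un (tgt p) \<in> pts Pm" "src (un (tgt p)) = tgt p" using grp(3)[OF y] by auto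
  show ?thesis using right_ex[OF a e(1) p e(2)] right_un[OF a y] grp(4)[OF p] by simp
qed

lemma right_add:
  assumes a: "a \<in> algd G" and b: "b \<in> algd G"
  shows "right_vf G (a + b) = right_vf G a + right_vf G b"
proof (rule ext)
  fix p show "right_vf G (a + b) p = (right_vf G a + right_vf G b) p"
  proof (cases "p \<in> pts Pm")
    case True
    obtain u where u: "u \<in> tangent (PP G) (un (tgt p), p)" "dfst u = a (tgt p)" "dsnd u = 0"
      "dmul u = right_vf G a p" using right_lift[OF a True] by blast
    obtain w where w: "w \<in> tangent (PP G) (un (tgt p), p)" "dfst w = b (tgt p)" "dsnd w = 0"
      "dmul w = right_vf G b p" using right_lift[OF b True] by blast
    have "right_vf G (a + b) p = dmul (u + w)"
      by (rule right_char[OF algd_add[OF a b] True tangent_add[OF okPP u(1) w(1)]]) (simp_all add: push_add u w)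
    then show ?thesis by (simp add: push_add u w)
  qed (simp add: right_vf_def)
qed

lemma right_scale:
  assumes a: "a \<in> algd G"
  shows "right_vf G (c *\<^sub>R a) = c *\<^sub>R right_vf G a"
proof (rule ext)
  fix p show "right_vf G (c *\<^sub>R a) p = (c *\<^sub>R right_vf G a) p"
  proof (cases "p \<in> pts Pm")
    case True
    obtain u where u: "u \<in> tangent (PP G) (un (tgt p), p)" "dfst u = a (tgt p)" "dsnd u = 0"
      "dmul u = right_vf G a p" using right_lift[OF a True] by blast
    have "right_vf G (c *\<^sub>R a) p = dmul (c *\<^sub>R u)"
      by (rule right_char[OF algd_scale[OF a] True tangent_scale[OF okPP u(1)]]) (simp_all add: push_scale u)
    then show ?thesis by (simp add: push_scale u)
  qed (simp add: right_vf_def)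
qed

lemma left_eq:
  assumes a: "a \<in> algd G" and p: "p \<in> pts Pm"
  shows "left_vf G a p = push Pm Pm iv (right_vf G a (iv p))"
proof -
  have y: "src p \<in> pts Xm" using grp(7)[OF p] by simp
  have i: "iv p \<in> pts Pm" "src (iv p) = tgt p" "tgt (iv p) = src p" using grp(5)[OF p] by auto
  have C: "Cmap (sfib G (src p)) Pm (\<lambda>q. mu q (iv p))"
  proof (rule Cmu2[where f="\<lambda>g. g", OF sfib_ok[OF y] _ Cmap_const[OF sfib_ok[OF y] i(1)]])
    show "Cmap (sfib G (src p)) Pm (\<lambda>g. g)" using sfib_incl[OF y] by (simp add: id_def)
    show "src g = tgt (iv p)" if "g \<in> pts (sfib G (src p))" for g using sfib_pts[OF y, of g] i that by simp
  qed
  have "push Pm Pm iv (right_vf G a (iv p)) = push (sfib G (src p)) Pm (\<lambda>q. iv (mu q (iv p))) (vert G a (src p))"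
    using i by (simp add: right_vf_def push_comp[OF C Civ])
  also have "\<dots> = push (sfib G (src p)) Pm (\<lambda>q. mu p (iv q)) (vert G a (src p))"
  proof (rule push_cong)
    fix g assume "g \<in> pts (sfib G (src p))"
    then have g: "g \<in> pts Pm" "src g = tgt (iv p)" using sfib_pts[OF y, of g] i by auto
    show "iv (mu g (iv p)) = mu p (iv g)" using iv_mu[OF g(1) i(1) g(2)] iv_iv[OF p] by simp
  qed
  finally show ?thesis using p by (simp add: left_vf_def)
qed

lemma left_add:
  assumes a: "a \<in> algd G" and b: "b \<in> algd G"
  shows "left_vf G (a + b) = left_vf G a + left_vf G b"
proof (rule ext)
  fix p show "left_vf G (a + b) p = (left_vf G a + left_vf G b) p"
    by (cases "p \<in> pts Pm") (simp_all add: left_eq algd_add a b right_add push_add, simp add: left_vf_def)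
qed

lemma left_scale:
  assumes a: "a \<in> algd G"
  shows "left_vf G (c *\<^sub>R a) = c *\<^sub>R left_vf G a"
proof (rule ext)
  fix p show "left_vf G (c *\<^sub>R a) p = (c *\<^sub>R left_vf G a) p"
    by (cases "p \<in> pts Pm") (simp_all add: left_eq algd_scale a right_scale push_scale, simp add: left_vf_def)
qed

lemma anchor_add: "anchor G (a + b) = anchor G a + anchor G b"
  by (rule ext) (simp add: anchor_def push_add)

lemma anchor_scale: "anchor G (c *\<^sub>R a) = c *\<^sub>R anchor G a"
  by (rule ext) (simp add: anchor_def push_scale)

lemma bar_add: "a \<in> algd G \<Longrightarrow> b \<in> algd G \<Longrightarrow> bar_vf G (a + b) = bar_vf G a + bar_vf G b"
  by (simp add: bar_vf_def right_add left_add)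

lemma bar_scale: "a \<in> algd G \<Longrightarrow> bar_vf G (c *\<^sub>R a) = c *\<^sub>R bar_vf G a"
  by (simp add: bar_vf_def right_scale left_scale scaleR_add_right)

context
  fixes a assumes a: "a \<in> algd G"
begin

lemma left_vfield: "left_vf G a \<in> vfields Pm"
proof (rule vfI[OF okP])
  show "left_vf G a p = 0" if "p \<notin> pts Pm" for p using that by (simp add: left_vf_def)
  fix p assume p: "p \<in> pts Pm"
  have i: "iv p \<in> pts Pm" using grp(5)[OF p] by simp
  show "left_vf G a p \<in> tangent Pm p"
    using push_tangent[OF Civ okP i right_tan(1)[OF a i]] left_eq[OF a p] iv_iv[OF p] by simp
next
  fix f assume f: "f \<in> Cinf Pm"
  have "(\<lambda>p. left_vf G a p f) = pull0 Pm iv (\<lambda>q. right_vf G a q (pull0 Pm iv f))"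
  proof (rule ext)
    fix p show "left_vf G a p f = pull0 Pm iv (\<lambda>q. right_vf G a q (pull0 Pm iv f)) p"
      by (cases "p \<in> pts Pm") (simp_all add: left_eq[OF a] push_app[OF f] pull0_def, simp add: left_vf_def)
  qed
  then show "(\<lambda>p. left_vf G a p f) \<in> Cinf Pm"
    using Cmap_pull[OF Civ vf_Cinf[OF okP right_vfield[OF a] Cmap_pull[OF Civ f]]] by simp
qed

lemma left_tan:
  assumes p: "p \<in> pts Pm"
  shows "push Pm Xm tgt (left_vf G a p) = 0" "push Pm Xm src (left_vf G a p) = anchor G a (src p)"
proof -
  have i: "iv p \<in> pts Pm" "tgt (iv p) = src p" using grp(5)[OF p] by auto
  have "push Pm Xm tgt (left_vf G a p) = push Pm Xm src (right_vf G a (iv p))"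
    unfolding left_eq[OF a p] push_comp[OF Civ Ct] by (rule push_cong) (simp add: grp(5))
  then show "push Pm Xm tgt (left_vf G a p) = 0" using right_tan(2)[OF a i(1)] by simp
  have "push Pm Xm src (left_vf G a p) = push Pm Xm tgt (right_vf G a (iv p))"
    unfolding left_eq[OF a p] push_comp[OF Civ Cs] by (rule push_cong) (simp add: grp(5))
  then show "push Pm Xm src (left_vf G a p) = anchor G a (src p)" using right_tan(3)[OF a i(1)] i(2) by simp
qed

lemma anchor_vfield: "anchor G a \<in> vfields Xm"
proof (rule vfI[OF okX])
  fix y assume y: "y \<in> pts Xm"
  show "anchor G a y \<in> tangent Xm y"
    using push_tangent[OF Ct okX _ algd_at(1)[OF a y]] grp(3)[OF y] by (simp add: anchor_def)
next
  fix y assume "y \<notin> pts Xm"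
  then show "anchor G a y = 0" by (simp add: anchor_def algd_at(3)[OF a] push_zero)
next
  fix f assume f: "f \<in> Cinf Xm"
  show "(\<lambda>y. anchor G a y f) \<in> Cinf Xm"
    using algd_at(4)[OF a Cmap_pull[OF Ct f]] by (simp add: anchor_def push_app[OF f])
qed

lemma bar_mult_vf: "(anchor G a, bar_vf G a) \<in> mult_vf G"
proof -
  have "bar_vf G a \<in> vfields Pm" unfolding bar_vf_def by (rule vfields_add[OF okP right_vfield[OF a] left_vfield])
  moreover have "push Pm Xm src (bar_vf G a q) = anchor G a (src q)" "push Pm Xm tgt (bar_vf G a q) = anchor G a (tgt q)"
    if q: "q \<in> pts Pm" for q using right_tan[OF a q] left_tan[OF q] by (simp_all add: bar_vf_def push_add)
  moreover have "bar_vf G a (un y) = push Xm Pm un (anchor G a y)" if y: "y \<in> pts Xm" for y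
  proof -
    have e: "un y \<in> pts Pm" "src (un y) = y" "tgt (un y) = y" using grp(3)[OF y] by auto
    have Ce: "Cmap Pm (PP G) (\<lambda>q. (q, iv q))" by (rule PP_into[OF okP Cmap_id[OF okP] Civ]) (simp add: grp(5))
    define u where "u = push Pm (PP G) (\<lambda>q. (q, iv q)) (a y)"
    have z: "(un y, un y) \<in> pts (PP G)" using e by (simp add: ptsPP)
    have u: "u \<in> tangent (PP G) (un y, un y)"
      unfolding u_def using push_tangent[OF Ce okPP e(1) algd_at(1)[OF a y]] iv_un[OF y] by simp
    have u1: "dfst u = a y"
      unfolding u_def push_comp[OF Ce CPfst] using push_id[OF okP algd_at(1)[OF a y]] by simp
    have u2: "dsnd u = left_vf G a (un y)"
      unfolding u_def push_comp[OF Ce CPsnd] using left_eq[OF a e(1)] right_un[OF a y] iv_un[OF y] by simp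
    have "dmul u = push Pm Pm (\<lambda>q. un (tgt q)) (a y)"
      unfolding u_def push_comp[OF Ce Cmu] by (rule push_cong) (simp add: grp(6))
    also have "\<dots> = push Xm Pm un (anchor G a y)" unfolding anchor_def push_comp[OF Ct Cun] ..
    finally have u3: "dmul u = push Xm Pm un (anchor G a y)" .
    obtain v where v: "v \<in> tangent (PP G) (un y, un y)" "dfst v = right_vf G a (un y)" "dsnd v = 0"
      "dmul v = right_vf G a (mu (un y) (un y))" using right_ex[OF a e(1) e(1)] e by auto
    obtain w where w: "w \<in> tangent (PP G) (un y, un y)" "dfst w = 0" "dsnd w = left_vf G a (un y)"
      "dmul w = left_vf G a (mu (un y) (un y))" using left_ex[OF a e(1) e(1)] e by auto
    have "u = v + w"
      by (rule PP_tan_inj[OF z u tangent_add[OF okPP v(1) w(1)]]) (simp_all add: push_add u1 u2 v w right_un[OF a y])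
    then show ?thesis using u3 v(4) w(4) grp(4)[OF e(1)] e by (simp add: push_add bar_vf_def)
  qed
  moreover have "bar_vf G a (mu q r) = tmult G q r (bar_vf G a q) (bar_vf G a r)" if "(q, r) \<in> pts (PP G)" for q r
  proof -
    have qr: "q \<in> pts Pm" "r \<in> pts Pm" "src q = tgt r" using that by (auto simp: ptsPP)
    obtain u where u: "u \<in> tangent (PP G) (q, r)" "dfst u = right_vf G a q" "dsnd u = 0"
      "dmul u = right_vf G a (mu q r)" using right_ex[OF a qr] by auto
    obtain v where v: "v \<in> tangent (PP G) (q, r)" "dfst v = left_vf G a q" "dsnd v = right_vf G a r"
      "dmul v = 0" using mid_ex[OF a qr] by auto
    obtain w where w: "w \<in> tangent (PP G) (q, r)" "dfst w = 0" "dsnd w = left_vf G a r"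
      "dmul w = left_vf G a (mu q r)" using left_ex[OF a qr] by auto
    show ?thesis
      using tmult_eq[OF that tangent_add[OF okPP tangent_add[OF okPP u(1) v(1)] w(1)]]
      by (simp add: push_add u v w bar_vf_def)
  qed
  ultimately show ?thesis using anchor_vfield by (auto simp: mult_vf_def)
qed

end

lemma PP_vfield:
  assumes X: "X \<in> vfields Pm" and Y: "Y \<in> vfields Pm"
    and eq: "\<And>q r. q \<in> pts Pm \<Longrightarrow> r \<in> pts Pm \<Longrightarrow> src q = tgt r \<Longrightarrow> push Pm Xm src (X q) = push Pm Xm tgt (Y r)"
  shows "\<exists>W\<in>vfields (PP G). related (PP G) Pm fst W X \<and> related (PP G) Pm snd W Y"
proof -
  obtain Z where Z: "Z \<in> vfields PxP" "related PxP Pm fst Z X" "related PxP Pm snd Z Y"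
    using prod_vfield[OF okP okP X Y] by blast
  have Zf: "push PxP Pm fst (Z z) = X (fst z)" "push PxP Pm snd (Z z) = Y (snd z)"
    if "z \<in> pts PxP" for z using Z(2,3) that by (simp_all add: related_def)
  have "\<exists>W\<in>vfields (PP G). related (PP G) PxP id W Z"
    unfolding PP_eq
  proof (rule sub_vfield[OF ok2 PPsl Z(1)])
    fix z assume z: "z \<in> {z \<in> pts PxP. src (fst z) = tgt (snd z)}"
    have z2: "z \<in> pts PxP" using z by simp
    have z': "fst z \<in> pts Pm" "snd z \<in> pts Pm" "src (fst z) = tgt (snd z)" using z ptsPP[of z] unfolding ptsPP_raw by auto
    have "push PxP Xm (\<lambda>z. src (fst z)) (Z z) = push PxP Xm (\<lambda>z. tgt (snd z)) (Z z)"
      using eq[OF z'] Zf[OF z2] by (simp add: push_comp[OF Cmap_fst[OF okP okP] Cs, symmetric] push_comp[OF Cmap_snd[OF okP okP] Ct, symmetric])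
    then show "\<exists>u\<in>tangent (submfd PxP (mdim PxP - mdim Xm) {z \<in> pts PxP. src (fst z) = tgt (snd z)}) z.
        push (submfd PxP (mdim PxP - mdim Xm) {z \<in> pts PxP. src (fst z) = tgt (snd z)}) PxP id u = Z z"
      using PPtan[OF z vfD[OF ok2 Z(1) z2]] unfolding PP_eq by blast
  qed
  then obtain W where W: "W \<in> vfields (PP G)" "\<And>z. z \<in> pts (PP G) \<Longrightarrow> push (PP G) PxP id (W z) = Z z"
    by (auto simp: related_def)
  have zz: "z \<in> pts PxP" if "z \<in> pts (PP G)" for z using that unfolding ptsPP_raw by simp
  have "dfst (W z) = X (fst z)" "dsnd (W z) = Y (snd z)" if z: "z \<in> pts (PP G)" for z
    using push_comp[OF PPincl Cmap_fst[OF okP okP], of "W z"] push_comp[OF PPincl Cmap_snd[OF okP okP], of "W z"] W(2)[OF z] Zf[OF zz[OF z]]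
    by simp_all
  then have "related (PP G) Pm fst W X" "related (PP G) Pm snd W Y" unfolding related_def by simp_all
  then show ?thesis using W(1) by blast
qed

lemma mult_vfD:
  assumes "(x, p) \<in> mult_vf G"
  shows "x \<in> vfields Xm" "p \<in> vfields Pm" "related Pm Xm src p x" "related Pm Xm tgt p x" "related Xm Pm un x p"
    "\<And>q r. (q, r) \<in> pts (PP G) \<Longrightarrow> p (mu q r) = tmult G q r (p q) (p r)"
  using assms by (auto simp: mult_vf_def related_def)

lemma gm_relatedI:
  assumes "\<And>z. z \<in> pts (PP G) \<Longrightarrow> dmul (W z) = X (mu (fst z) (snd z))"
  shows "related (PP G) Pm (gm G) W X"
  using assms by (auto simp: related_def case_prod_beta)

lemma mult_lift:
  assumes x: "(x, p) \<in> mult_vf G"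
  shows "\<exists>W\<in>vfields (PP G). related (PP G) Pm fst W p \<and> related (PP G) Pm snd W p \<and> related (PP G) Pm (gm G) W p"
proof -
  note D = mult_vfD[OF x]
  obtain W where W: "W \<in> vfields (PP G)" "related (PP G) Pm fst W p" "related (PP G) Pm snd W p"
    using PP_vfield[OF D(2) D(2)] D(3,4) by (auto simp: related_def)
  have "related (PP G) Pm (gm G) W p"
  proof (rule gm_relatedI)
    fix z assume z: "z \<in> pts (PP G)"
    have z': "(fst z, snd z) \<in> pts (PP G)" using z by simp
    have Wz: "dfst (W z) = p (fst z)" "dsnd (W z) = p (snd z)" using W(2,3) z by (auto simp: related_def)
    have t: "W z \<in> tangent (PP G) (fst z, snd z)" using vfD[OF okPP W(1) z] by simp
    show "dmul (W z) = p (mu (fst z) (snd z))"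
      using tmult_eq[OF z' t] D(6)[OF z'] unfolding Wz by simp
  qed
  then show ?thesis using W by blast
qed

lemma right_lift_vf:
  assumes a: "a \<in> algd G"
  shows "\<exists>W\<in>vfields (PP G). related (PP G) Pm fst W (right_vf G a) \<and> related (PP G) Pm snd W 0 \<and> related (PP G) Pm (gm G) W (right_vf G a)"
proof -
  obtain W where W: "W \<in> vfields (PP G)" "related (PP G) Pm fst W (right_vf G a)" "related (PP G) Pm snd W 0"
    using PP_vfield[OF right_vfield[OF a] vfields_zero[OF okP]] right_tan(2)[OF a] by (auto simp: push_zero)
  have "related (PP G) Pm (gm G) W (right_vf G a)"
  proof (rule gm_relatedI)
    fix z assume z: "z \<in> pts (PP G)"
    have z': "fst z \<in> pts Pm" "snd z \<in> pts Pm" "src (fst z) = tgt (snd z)" using z by (auto simp: ptsPP)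
    have Wz: "dfst (W z) = right_vf G a (fst z)" "dsnd (W z) = 0" using W(2,3) z by (auto simp: related_def)
    obtain u where u: "u \<in> tangent (PP G) (fst z, snd z)" "dfst u = right_vf G a (fst z)" "dsnd u = 0"
      "dmul u = right_vf G a (mu (fst z) (snd z))" using right_ex[OF a z'] by auto
    have "W z = u" by (rule PP_tan_inj[OF z vfD[OF okPP W(1) z]]) (use u Wz in simp_all)
    then show "dmul (W z) = right_vf G a (mu (fst z) (snd z))" using u(4) by simp
  qed
  then show ?thesis using W by blast
qed

lemma mult_iv:
  assumes x: "(x, p) \<in> mult_vf G"
  shows "related Pm Pm iv p p"
  unfolding related_def
proof
  fix q assume q: "q \<in> pts Pm"
  note D = mult_vfD[OF x]
  have i: "iv q \<in> pts Pm" "src (iv q) = tgt q" "tgt (iv q) = src q" using grp(5)[OF q] by auto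
  have y: "src q \<in> pts Xm" using grp(7)[OF q] by simp
  have z: "(iv q, q) \<in> pts (PP G)" using i q by (simp add: ptsPP)
  have pq: "p q \<in> tangent Pm q" by (rule vfD[OF okP D(2) q])
  obtain W where W: "W \<in> vfields (PP G)" "related (PP G) Pm fst W p" "related (PP G) Pm snd W p" "related (PP G) Pm (gm G) W p"
    using mult_lift[OF x] by blast
  have Wz: "dfst (W (iv q, q)) = p (iv q)" "dsnd (W (iv q, q)) = p q"
    "dmul (W (iv q, q)) = p (mu (iv q) q)" using W(2-4) z by (auto simp: related_def)
  have Ce: "Cmap Pm (PP G) (\<lambda>q. (iv q, q))" by (rule PP_into[OF okP Civ Cmap_id[OF okP]]) (simp add: grp(5))
  define u where "u = push Pm (PP G) (\<lambda>q. (iv q, q)) (p q)"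
  have u: "u \<in> tangent (PP G) (iv q, q)" unfolding u_def by (rule push_tangent[OF Ce okPP q pq])
  have u1: "dfst u = push Pm Pm iv (p q)" unfolding u_def push_comp[OF Ce CPfst] by simp
  have u2: "dsnd u = p q" unfolding u_def push_comp[OF Ce CPsnd] using push_id[OF okP pq] by simp
  have "dmul u = push Pm Pm (\<lambda>q. un (src q)) (p q)"
    unfolding u_def push_comp[OF Ce Cmu] by (rule push_cong) (simp add: grp(6))
  also have "\<dots> = push Xm Pm un (x (src q))"
    unfolding push_comp[OF Cs Cun, symmetric] using D(3) q by (simp add: related_def)
  also have "\<dots> = p (mu (iv q) q)" using D(5) y grp(6)[OF q] by (simp add: related_def)
  finally have u3: "dmul u = p (mu (iv q) q)" .
  define d where "d = u - W (iv q, q)"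
  have d: "d \<in> tangent (PP G) (iv q, q)" unfolding d_def by (rule tangent_diff[OF okPP u vfD[OF okPP W(1) z]])
  have d0: "dsnd d = 0" "dmul d = 0" unfolding d_def push_diff u2 u3 Wz by simp_all
  have Ciz: "Cmap (PP G) Pm (\<lambda>z. iv (snd z))" by (rule Cmap_comp[OF CPsnd Civ])
  have Ck: "Cmap (PP G) (PP G) (\<lambda>z. (gm G z, iv (snd z)))"
    by (rule PP_into[OF okPP Cmu Ciz]) (use grp(1,5) in \<open>auto simp: ptsPP case_prod_beta\<close>)
  define k where "k = push (PP G) (PP G) (\<lambda>z. (gm G z, iv (snd z))) d"
  have k: "k \<in> tangent (PP G) (gm G (iv q, q), iv (snd (iv q, q)))" unfolding k_def by (rule push_tangent[OF Ck okPP z d])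
  have k1: "dfst k = dmul d" "dsnd k = push Pm Pm iv (dsnd d)"
    unfolding k_def push_comp[OF Ck CPfst] push_comp[OF Ck CPsnd] push_comp[OF CPsnd Civ] by simp_all
  have "k = 0"
    by (rule PP_tan_inj[OF Cmap_pts[OF Ck z] k tangent_zero[OF okPP]]) (simp_all add: k1 d0 push_zero)
  then have "0 = dmul k" by (simp add: push_zero)
  also have "\<dots> = dfst d"
    unfolding k_def push_comp[OF Ck Cmu]
  proof (rule push_cong)
    fix z assume "z \<in> pts (PP G)"
    then have z: "fst z \<in> pts Pm" "snd z \<in> pts Pm" "src (fst z) = tgt (snd z)" by (auto simp: ptsPP)
    show "gm G (gm G z, iv (snd z)) = fst z"
      using grp(2)[OF z(1,2), of "iv (snd z)"] grp(5,6)[OF z(2)] grp(4)[OF z(1)] z(3) by (simp add: case_prod_beta)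
  qed
  finally show "push Pm Pm iv (p q) = p (iv q)" unfolding d_def push_diff u1 Wz by simp
qed

lemma mvf_act_props:
  assumes x: "(x, p) \<in> mult_vf G" and a: "a \<in> algd G"
  shows "mvf_act G p a \<in> algd G" "right_vf G (mvf_act G p a) = lie_vf p (right_vf G a)"
    "left_vf G (mvf_act G p a) = lie_vf p (left_vf G a)" "anchor G (mvf_act G p a) = lie_vf x (anchor G a)"
proof -
  note D = mult_vfD[OF x]
  define K where "K = lie_vf p (right_vf G a)"
  define c where "c = mvf_act G p a"
  have K: "K \<in> vfields Pm" unfolding K_def by (rule lie_vf_fields[OF okP D(2) right_vfield[OF a]])
  have c: "c y = K (un y)" if "y \<in> pts Xm" for y using that by (simp add: c_def mvf_act_def K_def)
  have Rs: "related Pm Xm src (right_vf G a) 0" and Rt: "related Pm Xm tgt (right_vf G a) (anchor G a)"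
    using right_tan[OF a] by (auto simp: related_def)
  have Ks: "push Pm Xm src (K q) = 0" if "q \<in> pts Pm" for q
    using related_lie[OF okP okX Cs D(2) right_vfield[OF a] D(1) vfields_zero[OF okX] D(3) Rs] that lie_vf_zero_right[OF okX D(1)]
    by (simp add: related_def K_def)
  have Kt: "push Pm Xm tgt (K q) = lie_vf x (anchor G a) (tgt q)" if "q \<in> pts Pm" for q
    using related_lie[OF okP okX Ct D(2) right_vfield[OF a] D(1) anchor_vfield[OF a] D(4) Rt] that
    by (simp add: related_def K_def)
  have ca: "c \<in> algd G" unfolding algd_iff
  proof (intro conjI ballI allI impI)
    fix y assume y: "y \<in> pts Xm"
    have e: "un y \<in> pts Pm" using grp(3)[OF y] by simp
    show "c y \<in> tangent Pm (un y)" "push Pm Xm src (c y) = 0" using c[OF y] vfD[OF okP K e] Ks[OF e] by simp_all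
  next
    fix y assume "y \<notin> pts Xm" then show "c y = 0" by (simp add: c_def mvf_act_def)
  next
    fix f assume f: "f \<in> Cinf Pm"
    have "(\<lambda>y. c y f) = pull0 Xm un (\<lambda>q. K q f)"
      by (rule ext) (simp add: pull0_def c, simp add: c_def mvf_act_def)
    then show "(\<lambda>y. c y f) \<in> Cinf Xm" using Cmap_pull[OF Cun vf_Cinf[OF okP K f]] by simp
  qed
  then show "mvf_act G p a \<in> algd G" by (simp add: c_def)
  obtain W where W: "W \<in> vfields (PP G)" "related (PP G) Pm fst W p" "related (PP G) Pm snd W p" "related (PP G) Pm (gm G) W p"
    using mult_lift[OF x] by blast
  obtain R where R: "R \<in> vfields (PP G)" "related (PP G) Pm fst R (right_vf G a)" "related (PP G) Pm snd R 0"
    "related (PP G) Pm (gm G) R (right_vf G a)" using right_lift_vf[OF a] by blast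
  have L1: "related (PP G) Pm fst (lie_vf W R) K" unfolding K_def
    by (rule related_lie[OF okPP okP CPfst W(1) R(1) D(2) right_vfield[OF a] W(2) R(2)])
  have L2: "related (PP G) Pm snd (lie_vf W R) 0"
    using related_lie[OF okPP okP CPsnd W(1) R(1) D(2) vfields_zero[OF okP] W(3) R(3)] lie_vf_zero_right[OF okP D(2)] by simp
  have L3: "related (PP G) Pm (gm G) (lie_vf W R) K" unfolding K_def
    by (rule related_lie[OF okPP okP Cmu W(1) R(1) D(2) right_vfield[OF a] W(4) R(4)])
  have rc: "right_vf G c = K"
  proof (rule ext)
    fix q show "right_vf G c q = K q"
    proof (cases "q \<in> pts Pm")
      case True
      have y: "tgt q \<in> pts Xm" using grp(7)[OF True] by simp
      have z: "(un (tgt q), q) \<in> pts (PP G)" using grp(3)[OF y] True by (simp add: ptsPP)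
      have "right_vf G c q = dmul (lie_vf W R (un (tgt q), q))"
        by (rule right_char[OF ca True vfD[OF okPP lie_vf_fields[OF okPP W(1) R(1)] z]])
           (use L1 L2 z c[OF y] in \<open>auto simp: related_def\<close>)
      also have "\<dots> = K (mu (un (tgt q)) q)" using L3 z by (auto simp: related_def)
      finally show ?thesis using grp(4)[OF True] by simp
    next
      case False
      then show ?thesis using vf_off[OF okP K False] by (simp add: right_vf_def)
    qed
  qed
  then show "right_vf G (mvf_act G p a) = lie_vf p (right_vf G a)" by (simp add: c_def K_def)
  have ri: "related Pm Pm iv (right_vf G a) (left_vf G a)"
    unfolding related_def using left_eq[OF a] grp(5) iv_iv by simp
  have li: "related Pm Pm iv K (lie_vf p (left_vf G a))" unfolding K_def
    by (rule related_lie[OF okP okP Civ D(2) right_vfield[OF a] D(2) left_vfield[OF a] mult_iv[OF x] ri])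
  have "left_vf G c = lie_vf p (left_vf G a)"
  proof (rule ext)
    fix q show "left_vf G c q = lie_vf p (left_vf G a) q"
    proof (cases "q \<in> pts Pm")
      case True
      then show ?thesis using left_eq[OF ca True] rc li grp(5)[OF True] iv_iv[OF True] by (auto simp: related_def)
    next
      case False
      then show ?thesis using vf_off[OF okP lie_vf_fields[OF okP D(2) left_vfield[OF a]] False] by (simp add: left_vf_def)
    qed
  qed
  then show "left_vf G (mvf_act G p a) = lie_vf p (left_vf G a)" by (simp add: c_def)
  have "anchor G c = lie_vf x (anchor G a)"
  proof (rule ext)
    fix y show "anchor G c y = lie_vf x (anchor G a) y"
    proof (cases "y \<in> pts Xm")
      case True
      then show ?thesis using c[OF True] Kt[of "un y"] grp(3)[OF True] by (simp add: anchor_def)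
    next
      case False
      then show ?thesis using vf_off[OF okX lie_vf_fields[OF okX D(1) anchor_vfield[OF a]] False]
        by (simp add: anchor_def c_def mvf_act_def push_zero)
    qed
  qed
  then show "anchor G (mvf_act G p a) = lie_vf x (anchor G a)" by (simp add: c_def)
qed

lemma bar_act:
  assumes x: "(x, p) \<in> mult_vf G" and a: "a \<in> algd G"
  shows "bar_vf G (mvf_act G p a) = lie_vf p (bar_vf G a)"
  unfolding bar_vf_def mvf_act_props[OF x a]
  using lie_vf_add_right[OF okP mult_vfD(2)[OF x] right_vfield[OF a] left_vfield[OF a]] by simp

lemma delta0_minus: "delta0 G (- f) = - delta0 G f"
  by (rule ext) (simp add: delta0_def pull0_def)

lemma anchor_diff: "anchor G (a - b) = anchor G a - anchor G b"
  using anchor_add[of "a - b" b] by (simp add: algebra_simps)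

lemma bar_diff: "a \<in> algd G \<Longrightarrow> b \<in> algd G \<Longrightarrow> bar_vf G (a - b) = bar_vf G a - bar_vf G b"
  using bar_add[of "a - b" b] algd_diff[of a b] by (simp add: algebra_simps)

lemma anchor_zero: "anchor G 0 = 0"
  using anchor_add[of 0 0] by simp

lemma bar_zero: "bar_vf G 0 = 0"
  using bar_add[OF algd_zero algd_zero] by simp

section \<open>Descent along the projection of the gerbe\<close>

lemma pcb: "principal_circle_bundle Pm (XX G) (\<lambda>p. (tgt p, src p)) (gact G)"
  using G by (simp add: bundle_gerbe_def)

lemma pr_st: "p \<in> pts Pm \<Longrightarrow> pr (src p) = pr (tgt p)"
  using G by (simp add: bundle_gerbe_def)

lemma XX_eq: "XX G = submfd XxX (mdim XxX - mdim Mm)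
    {z \<in> pts XxX. pr (fst z) = pr (snd z)}"
proof -
  have "{(x, y). x \<in> pts Xm \<and> y \<in> pts Xm \<and> pr x = pr y} = {z \<in> pts XxX. pr (fst z) = pr (snd z)}"
    by (auto simp: prod_simps[OF okX okX])
  moreover have "mdim XxX - mdim Mm = 2 * mdim Xm - mdim Mm" by (simp add: prod_simps[OF okX okX])
  ultimately show ?thesis unfolding XX_def by simp
qed

lemmas okX2 = prod_mfd_ok[OF okX okX]

lemma CXa: "Cmap XxX Mm (\<lambda>z. pr (fst z))" and CXb: "Cmap XxX Mm (\<lambda>z. pr (snd z))"
  by (rule Cmap_comp[OF Cmap_fst[OF okX okX] Cpr] Cmap_comp[OF Cmap_snd[OF okX okX] Cpr])+

lemma XX_onto:
  assumes "z \<in> pts XxX" "pr (fst z) = pr (snd z)" "w \<in> tangent Mm (pr (fst z))"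
  shows "\<exists>v\<in>tangent XxX z. push XxX Mm (\<lambda>z. pr (fst z)) v - push XxX Mm (\<lambda>z. pr (snd z)) v = w"
proof -
  have z: "fst z \<in> pts Xm" "snd z \<in> pts Xm" using assms(1) by (auto simp: prod_simps[OF okX okX])
  obtain v where v: "v \<in> tangent Xm (fst z)" "push Xm Mm pr v = w" using onto_sub[OF subm(3) z(1) assms(3)] by blast
  note pv = pvec[OF okX okX z v(1) tangent_zero[OF okX]]
  show ?thesis
    by (rule bexI[of _ "pvec Xm Xm (fst z) (snd z) v 0"])
       (use pv v(2) in \<open>simp_all add: push_comp[OF Cmap_fst[OF okX okX] Cpr, symmetric] push_comp[OF Cmap_snd[OF okX okX] Cpr, symmetric] push_zero\<close>)
qed

lemma XXsl: "slices XxX (mdim XxX - mdim Mm) {z \<in> pts XxX. pr (fst z) = pr (snd z)}"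
  by (rule eq_slices[OF okX2 okM CXa CXb refl]) (rule XX_onto)

lemma XXtan:
  assumes "z \<in> {z \<in> pts XxX. pr (fst z) = pr (snd z)}" "v \<in> tangent XxX z"
    "push XxX Mm (\<lambda>z. pr (fst z)) v = push XxX Mm (\<lambda>z. pr (snd z)) v"
  shows "\<exists>u\<in>tangent (XX G) z. push (XX G) XxX id u = v"
  unfolding XX_eq by (rule eq_tangent[OF okX2 okM CXa CXb refl _ assms]) (rule XX_onto)

lemma okXX: "mfd_ok (XX G)" unfolding XX_eq by (rule submfd_ok[OF okX2 XXsl])

lemma ptsXX_raw: "pts (XX G) = {z \<in> pts XxX. pr (fst z) = pr (snd z)}"
  unfolding XX_eq by (rule sub_simps(3)[OF okX2 XXsl])

lemma XXincl: "Cmap (XX G) XxX id" unfolding XX_eq by (rule Cmap_incl[OF okX2 XXsl])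

lemma gerbe_lift:
  assumes p: "p \<in> pts Xm" and q: "q \<in> pts Xm" and e: "pr p = pr q" and v: "v \<in> tangent Xm p" and w: "w \<in> tangent Xm q"
    and eq: "push Xm Mm pr v = push Xm Mm pr w"
  shows "\<exists>n\<in>pts Pm. \<exists>u\<in>tangent Pm n. tgt n = p \<and> src n = q \<and> push Pm Xm tgt u = v \<and> push Pm Xm src u = w"
proof -
  have z: "(p, q) \<in> {z \<in> pts XxX. pr (fst z) = pr (snd z)}" using p q e by (simp add: prod_simps[OF okX okX])
  then have zX: "(p, q) \<in> pts (XX G)" unfolding ptsXX_raw .
  note pv = pvec[OF okX okX p q v w]
  have "push XxX Mm (\<lambda>z. pr (fst z)) (pvec Xm Xm p q v w) = push XxX Mm (\<lambda>z. pr (snd z)) (pvec Xm Xm p q v w)"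
    using pv(2,3) eq by (simp add: push_comp[OF Cmap_fst[OF okX okX] Cpr, symmetric] push_comp[OF Cmap_snd[OF okX okX] Cpr, symmetric])
  then obtain t where t: "t \<in> tangent (XX G) (p, q)" "push (XX G) XxX id t = pvec Xm Xm p q v w"
    using XXtan[OF z pv(1)] by blast
  have sC: "smooth_map Pm (XX G) (\<lambda>p. (tgt p, src p))"
    and loc: "\<forall>n\<in>pts (XX G). \<exists>U \<Psi>. openin (mtop (XX G)) U \<and> n \<in> U \<and>
        diffeomorphism (prod_mfd (submfd (XX G) (mdim (XX G)) U) circle) (submfd Pm (mdim Pm) {p \<in> pts Pm. (tgt p, src p) \<in> U}) \<Psi> \<and>
        (\<forall>u\<in>U. \<forall>z\<in>sphere 0 1. (tgt (\<Psi> (u, z)), src (\<Psi> (u, z))) = u \<and>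
           (\<forall>w\<in>sphere 0 1. \<Psi> (u, w * z) = gact G w (\<Psi> (u, z))))"
    using pcb unfolding principal_circle_bundle_def by simp_all
  obtain U \<Psi> where U: "openin (mtop (XX G)) U" "(p, q) \<in> U"
    and df: "diffeomorphism (prod_mfd (submfd (XX G) (mdim (XX G)) U) circle) (submfd Pm (mdim Pm) {p \<in> pts Pm. (tgt p, src p) \<in> U}) \<Psi>"
    and sec: "\<forall>u\<in>U. \<forall>z\<in>sphere 0 1. (tgt (\<Psi> (u, z)), src (\<Psi> (u, z))) = u \<and>
           (\<forall>w\<in>sphere 0 1. \<Psi> (u, w * z) = gact G w (\<Psi> (u, z)))"
    using bspec[OF loc zX] by blast
  define N where "N = submfd (XX G) (mdim (XX G)) U"
  define Q where "Q = submfd Pm (mdim Pm) {p \<in> pts Pm. (tgt p, src p) \<in> U}"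
  note slU = open_slices[OF okXX U(1)]
  have slQ: "slices Pm (mdim Pm) {p \<in> pts Pm. (tgt p, src p) \<in> U}"
    by (rule open_slices[OF okP Cmap_open[OF smooth_map_Cmap[OF okP okXX sC] U(1)]])
  have okN: "mfd_ok N" unfolding N_def by (rule submfd_ok[OF okXX slU])
  have okQ: "mfd_ok Q" unfolding Q_def by (rule submfd_ok[OF okP slQ])
  have ptsN: "pts N = U" unfolding N_def by (rule sub_simps(3)[OF okXX slU])
  have "smooth_map (prod_mfd N circle) Q \<Psi>" using df by (simp add: diffeomorphism_def N_def Q_def)
  then have CPsi: "Cmap (prod_mfd N circle) Q \<Psi>" by (rule smooth_map_Cmap[OF prod_mfd_ok[OF okN circle_ok(1)] okQ])
  have Cs0: "Cmap N (prod_mfd N circle) (\<lambda>n. (n, 1))"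
    by (rule Cmap_pair[OF okN circle_ok(1) okN Cmap_id[OF okN] Cmap_const[OF okN circle_ok(2)]])
  have "Cmap N Q (\<lambda>n. \<Psi> (n, 1))" by (rule Cmap_comp[OF Cs0 CPsi])
  then have Cs1: "Cmap N Pm (\<lambda>n. \<Psi> (n, 1))"
    using Cmap_comp[of N Q "\<lambda>n. \<Psi> (n, 1)" Pm id] Cmap_incl[OF okP slQ] by (simp add: Q_def)
  have st: "tgt (\<Psi> (n, 1)) = fst n" "src (\<Psi> (n, 1)) = snd n" if "n \<in> pts N" for n
  proof -
    have nU: "n \<in> U" using that unfolding ptsN .
    have "(1::complex) \<in> sphere 0 1" by simp
    from bspec[OF bspec[OF sec nU] this] have e: "(tgt (\<Psi> (n, 1)), src (\<Psi> (n, 1))) = n" by (rule conjunct1)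
    show "tgt (\<Psi> (n, 1)) = fst n" by (rule arg_cong[OF e, of fst, unfolded fst_conv])
    show "src (\<Psi> (n, 1)) = snd n" by (rule arg_cong[OF e, of snd, unfolded snd_conv])
  qed
  have CNX: "Cmap N (XX G) id" unfolding N_def by (rule Cmap_incl[OF okXX slU])
  obtain t' where t': "t' \<in> tangent N (p, q)" "push N (XX G) id t' = t"
    using open_lift[OF okXX U t(1)] unfolding N_def by blast
  define u where "u = push N Pm (\<lambda>n. \<Psi> (n, 1)) t'"
  have zN: "(p, q) \<in> pts N" using U(2) ptsN by simp
  have u: "u \<in> tangent Pm (\<Psi> ((p, q), 1))" unfolding u_def by (rule push_tangent[OF Cs1 okP zN t'(1)])
  have X1: "push (XX G) Xm fst t = v" "push (XX G) Xm snd t = w"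
    using push_comp[OF XXincl Cmap_fst[OF okX okX], of t] push_comp[OF XXincl Cmap_snd[OF okX okX], of t] t(2) pv(2,3) by simp_all
  have CXf: "Cmap (XX G) Xm fst" "Cmap (XX G) Xm snd"
    using Cmap_comp[OF XXincl Cmap_fst[OF okX okX]] Cmap_comp[OF XXincl Cmap_snd[OF okX okX]] by simp_all
  have N1: "push N Xm fst t' = v" "push N Xm snd t' = w"
    using push_comp[OF CNX CXf(1), of t'] push_comp[OF CNX CXf(2), of t'] t'(2) X1 by simp_all
  have "push Pm Xm tgt u = push N Xm fst t'" unfolding u_def push_comp[OF Cs1 Ct] by (rule push_cong) (rule st)
  moreover have "push Pm Xm src u = push N Xm snd t'" unfolding u_def push_comp[OF Cs1 Cs] by (rule push_cong) (rule st)
  ultimately show ?thesis using u N1 st[OF zN] Cmap_pts[OF Cs1 zN]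
    by (intro bexI[of _ "\<Psi> ((p, q), 1)"] bexI[of _ u]) simp_all
qed

lemma pr_onto: "p \<in> pts Xm \<Longrightarrow> w \<in> tangent Mm (pr p) \<Longrightarrow> \<exists>v\<in>tangent Xm p. push Xm Mm pr v = w"
  by (rule onto_sub[OF subm(3)])

lemma delta1_descend:
  assumes e: "\<eta> \<in> forms1 Xm" and d: "delta1 G \<eta> = 0"
  shows "\<exists>!\<epsilon>. \<epsilon> \<in> forms1 Mm \<and> pull1 Xm Mm pr \<epsilon> = \<eta>"
proof (rule form1_descend[OF okX okM Cpr pr_onto pr_surj e])
  fix p q v w assume a: "p \<in> pts Xm" "q \<in> pts Xm" "pr p = pr q" "v \<in> tangent Xm p" "w \<in> tangent Xm q" "push Xm Mm pr v = push Xm Mm pr w"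
  obtain n u where n: "n \<in> pts Pm" "u \<in> tangent Pm n" "tgt n = p" "src n = q" "push Pm Xm tgt u = v" "push Pm Xm src u = w"
    using gerbe_lift[OF a] by blast
  have "delta1 G \<eta> n u = 0" by (simp add: d)
  then show "\<eta> p v = \<eta> q w" using n by (simp add: delta1_def pull1_def)
qed

lemma proj_vf:
  assumes x: "(x, p) \<in> mult_vf G"
  shows "proj_vf G x \<in> vfields Mm" "\<And>y. y \<in> pts Xm \<Longrightarrow> proj_vf G x (pr y) = push Xm Mm pr (x y)"
proof -
  note D = mult_vfD[OF x]
  have "\<exists>!u. u \<in> vfields Mm \<and> (\<forall>y\<in>pts Xm. u (pr y) = push Xm Mm pr (x y))"
  proof (rule vfield_descend[OF okX okM Cpr pr_onto pr_surj D(1)])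
    fix y z assume a: "y \<in> pts Xm" "z \<in> pts Xm" "pr y = pr z"
    obtain n where n: "n \<in> pts Pm" "tgt n = y" "src n = z"
      using gerbe_lift[OF a tangent_zero[OF okX] tangent_zero[OF okX]] by (auto simp: push_zero)
    have "push Xm Mm pr (x y) = push Xm Mm pr (push Pm Xm tgt (p n))" using D(4) n by (auto simp: related_def)
    also have "\<dots> = push Xm Mm pr (push Pm Xm src (p n))"
      unfolding push_comp[OF Ct Cpr] push_comp[OF Cs Cpr] by (rule push_cong) (simp add: pr_st)
    also have "\<dots> = push Xm Mm pr (x z)" using D(3) n by (auto simp: related_def)
    finally show "push Xm Mm pr (x y) = push Xm Mm pr (x z)" .
  qed
  from theI'[OF this] show "proj_vf G x \<in> vfields Mm" "\<And>y. y \<in> pts Xm \<Longrightarrow> proj_vf G x (pr y) = push Xm Mm pr (x y)"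
    by (simp_all add: proj_vf_def)
qed

lemma proj_vf_anchor:
  assumes a: "a \<in> algd G"
  shows "proj_vf G (x + anchor G a) = proj_vf G x"
proof -
  have "push Xm Mm pr (anchor G a y) = 0" if "y \<in> pts Xm" for y
  proof -
    have "push Xm Mm pr (anchor G a y) = push Xm Mm pr (push Pm Xm src (a y))"
      unfolding anchor_def push_comp[OF Ct Cpr] push_comp[OF Cs Cpr] by (rule push_cong) (simp add: pr_st)
    then show ?thesis using algd_at(2)[OF a that] by (simp add: push_zero)
  qed
  then have "(\<forall>y\<in>pts Xm. u (pr y) = push Xm Mm pr ((x + anchor G a) y)) \<longleftrightarrow> (\<forall>y\<in>pts Xm. u (pr y) = push Xm Mm pr (x y))" for u
    by (simp add: push_add)
  then show ?thesis by (simp add: proj_vf_def)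
qed

lemma delta0_pull: "delta0 G (pull0 Xm pr f) = 0"
  by (rule ext) (simp add: delta0_def pull0_def pr_st grp(7))

lemma delta0_add: "delta0 G (f + g) = delta0 G f + delta0 G g"
  by (simp add: delta0_def pull0_add algebra_simps)

end

section \<open>Connection and curving\<close>

locale gerbe_conn = gerbe_loc G for G :: "('m, 'x, 'p) gerbe" +
  fixes \<gamma> :: "'p form1" and B :: "'x form2"
  assumes conn: "gerbe_connection G \<gamma>" and curv: "curving G \<gamma> B"
begin

lemma gam: "\<gamma> \<in> forms1 Pm" and dgam: "deltaP1 G \<gamma> = 0"
  using conn by (simp_all add: gerbe_connection_def)

lemma Bf: "B \<in> forms2 Xm" and dB: "d1 Pm \<gamma> = delta2 G B"
  using curv by (simp_all add: curving_def)

lemma gam_mult: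
  assumes z: "z \<in> pts (PP G)" and u: "u \<in> tangent (PP G) z"
  shows "\<gamma> (gm G z) (dmul u) = \<gamma> (fst z) (dfst u) + \<gamma> (snd z) (dsnd u)"
proof -
  have "deltaP1 G \<gamma> z u = 0" by (simp add: dgam)
  then show ?thesis using z u by (simp add: deltaP1_def pull1_def)
qed

lemma v_Cinf: "a \<in> algd G \<Longrightarrow> v_fun G \<gamma> a \<in> Cinf Xm"
  unfolding v_fun_def by (rule Cmap_pull[OF Cun forms1D(5)[OF gam right_vfield]])

lemma v_at: "a \<in> algd G \<Longrightarrow> y \<in> pts Xm \<Longrightarrow> v_fun G \<gamma> a y = \<gamma> (un y) (a y)"
  by (simp add: v_fun_def pull0_def contract_def right_un)

lemma v_off: "y \<notin> pts Xm \<Longrightarrow> v_fun G \<gamma> a y = 0"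
  by (simp add: v_fun_def pull0_def)

lemma v_add:
  assumes a: "a \<in> algd G" and b: "b \<in> algd G"
  shows "v_fun G \<gamma> (a + b) = v_fun G \<gamma> a + v_fun G \<gamma> b"
proof (rule ext)
  fix y show "v_fun G \<gamma> (a + b) y = (v_fun G \<gamma> a + v_fun G \<gamma> b) y"
  proof (cases "y \<in> pts Xm")
    case True
    then show ?thesis
      using v_at[OF algd_add[OF a b] True] v_at[OF a True] v_at[OF b True]
        forms1D(3)[OF gam _ algd_at(1)[OF a True] algd_at(1)[OF b True]] grp(3)[OF True] by simp
  qed (simp add: v_off)
qed

lemma v_scale:
  assumes a: "a \<in> algd G"
  shows "v_fun G \<gamma> (c *\<^sub>R a) = c *\<^sub>R v_fun G \<gamma> a"
proof (rule ext)
  fix y show "v_fun G \<gamma> (c *\<^sub>R a) y = (c *\<^sub>R v_fun G \<gamma> a) y"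
  proof (cases "y \<in> pts Xm")
    case True
    then show ?thesis
      using v_at[OF algd_scale[OF a] True] v_at[OF a True]
        forms1D(4)[OF gam _ algd_at(1)[OF a True]] grp(3)[OF True] by simp
  qed (simp add: v_off)
qed

lemma gam_right_left:
  assumes a: "a \<in> algd G" and p: "p \<in> pts Pm"
  shows "\<gamma> p (right_vf G a p) = v_fun G \<gamma> a (tgt p)" "\<gamma> p (left_vf G a p) = - v_fun G \<gamma> a (src p)"
proof -
  have y: "tgt p \<in> pts Xm" "src p \<in> pts Xm" using grp(7)[OF p] by auto
  have e: "un (tgt p) \<in> pts Pm" "src (un (tgt p)) = tgt p" "un (src p) \<in> pts Pm" "tgt (un (src p)) = src p"
    using grp(3) y by auto
  have z: "(un (tgt p), p) \<in> pts (PP G)" "(p, un (src p)) \<in> pts (PP G)" using e p by (simp_all add: ptsPP)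
  obtain u where u: "u \<in> tangent (PP G) (un (tgt p), p)" "dfst u = a (tgt p)" "dsnd u = 0"
      "dmul u = right_vf G a p" using right_lift[OF a p] by blast
  show "\<gamma> p (right_vf G a p) = v_fun G \<gamma> a (tgt p)"
    using gam_mult[OF z(1) u(1)] u(2-4) forms1_zero_vec[OF gam okP p] grp(4)[OF p] v_at[OF a y(1)] by simp
  obtain w where w: "w \<in> tangent (PP G) (p, un (src p))" "dfst w = left_vf G a p"
     "dsnd w = right_vf G a (un (src p))" "dmul w = 0"
    using mid_ex[OF a p e(3)] e(4) by auto
  show "\<gamma> p (left_vf G a p) = - v_fun G \<gamma> a (src p)"
    using gam_mult[OF z(2) w(1)] w(2-4) forms1_zero_vec[OF gam okP p] grp(4)[OF p] v_at[OF a y(2)] right_un[OF a y(2)] by simp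
qed

lemma delta0_v:
  assumes a: "a \<in> algd G"
  shows "delta0 G (v_fun G \<gamma> a) = - contract (bar_vf G a) \<gamma>"
proof (rule ext)
  fix p show "delta0 G (v_fun G \<gamma> a) p = (- contract (bar_vf G a) \<gamma>) p"
  proof (cases "p \<in> pts Pm")
    case True
    then show ?thesis
      using gam_right_left[OF a True] forms1D(3)[OF gam True vfD[OF okP right_vfield[OF a] True] vfD[OF okP left_vfield[OF a] True]]
      by (simp add: delta0_def pull0_def contract_def bar_vf_def)
  qed (simp add: delta0_def pull0_def contract_def forms1D(1)[OF gam])
qed

lemma curv_at:
  assumes "n \<in> pts Pm" "u \<in> tangent Pm n" "w \<in> tangent Pm n"
  shows "d1 Pm \<gamma> n u w = B (src n) (push Pm Xm src u) (push Pm Xm src w) - B (tgt n) (push Pm Xm tgt u) (push Pm Xm tgt w)"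
  using assms by (simp add: dB delta2_def pull2_def)

lemma act_v:
  assumes x: "(x, p) \<in> mult_vf G" and g: "g \<in> Cinf Xm" "delta0 G g = contract p \<gamma>" and a: "a \<in> algd G"
  shows "v_fun G \<gamma> (mvf_act G p a) = vf_fun x (v_fun G \<gamma> a) + vf_fun (anchor G a) g + contract (anchor G a) (contract x B)"
proof (rule ext)
  fix y
  note D = mult_vfD[OF x]
  show "v_fun G \<gamma> (mvf_act G p a) y = (vf_fun x (v_fun G \<gamma> a) + vf_fun (anchor G a) g + contract (anchor G a) (contract x B)) y"
  proof (cases "y \<in> pts Xm")
    case True
    define e where "e = un y"
    have e: "e \<in> pts Pm" "src e = y" "tgt e = y" using grp(3)[OF True] by (auto simp: e_def)
    note R = right_vfield[OF a]
    have Rt: "right_vf G a e \<in> tangent Pm e" by (rule vfD[OF okP R e(1)])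
    have pt: "p e \<in> tangent Pm e" by (rule vfD[OF okP D(2) e(1)])
    have ps: "push Pm Xm src (p e) = x y" "push Pm Xm tgt (p e) = x y" using D(3,4) e by (auto simp: related_def)
    have Rs: "push Pm Xm src (right_vf G a e) = 0" "push Pm Xm tgt (right_vf G a e) = anchor G a y"
      using right_tan[OF a e(1)] e by auto
    have cR: "contract (right_vf G a) \<gamma> = pull0 Pm tgt (v_fun G \<gamma> a)"
      by (rule ext) (simp add: contract_def pull0_def gam_right_left(1)[OF a] forms1D(1)[OF gam])
    have d: "d1 Pm \<gamma> e (p e) (right_vf G a e) =
       p e (contract (right_vf G a) \<gamma>) - right_vf G a e (contract p \<gamma>) - \<gamma> e (lie_vf p (right_vf G a) e)"
      by (rule d1_formula[OF okP gam D(2) R e(1)])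
    have t1: "p e (contract (right_vf G a) \<gamma>) = x y (v_fun G \<gamma> a)"
      unfolding cR push_app[OF v_Cinf[OF a], of Pm tgt, symmetric] ps ..
    have gC: "pull0 Pm src g \<in> Cinf Pm" "pull0 Pm tgt g \<in> Cinf Pm" by (rule Cmap_pull[OF Cs g(1)], rule Cmap_pull[OF Ct g(1)])
    have t2: "right_vf G a e (contract p \<gamma>) = - anchor G a y g"
      unfolding g(2)[symmetric] delta0_def tan_diff[OF okP Rt gC] push_app[OF g(1), symmetric] Rs by simp
    have By: "B y (x y) 0 = 0"
    proof -
      have "contract x B \<in> forms1 Xm" by (rule contract_forms2[OF okX D(1) Bf])
      then show ?thesis using forms1_zero_vec[OF _ okX True] by (auto simp: contract_def)
    qed
    have t3: "d1 Pm \<gamma> e (p e) (right_vf G a e) = - B y (x y) (anchor G a y)"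
      unfolding curv_at[OF e(1) pt Rt] ps Rs e By by simp
    have "v_fun G \<gamma> (mvf_act G p a) y = \<gamma> e (lie_vf p (right_vf G a) e)"
      using v_at[OF mvf_act_props(1)[OF x a] True] True by (simp add: mvf_act_def e_def)
    also have "\<dots> = x y (v_fun G \<gamma> a) + anchor G a y g + B y (x y) (anchor G a y)" using d t1 t2 t3 by simp
    finally show ?thesis by (simp add: vf_fun_def contract_def)
  next
    case False
    then show ?thesis using vf_off[OF okX D(1) False] vf_off[OF okX anchor_vfield[OF a] False]
      by (simp add: v_off vf_fun_def contract_def forms2D(1)[OF Bf])
  qed
qed

lemma eta:
  assumes x: "(x, p) \<in> mult_vf G" and al: "\<alpha> \<in> forms1 Xm" "lie1 Pm p \<gamma> = delta1 G \<alpha>"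
    and g: "g \<in> Cinf Xm" "delta0 G g = contract p \<gamma>"
  shows "\<exists>!\<epsilon>. \<epsilon> \<in> forms1 Mm \<and> pull1 Xm Mm pr \<epsilon> = \<alpha> - contract x B - d0 Xm g"
proof (rule delta1_descend)
  note D = mult_vfD[OF x]
  show "\<alpha> - contract x B - d0 Xm g \<in> forms1 Xm"
    by (intro forms1_diff[OF okX] al(1) contract_forms2[OF okX D(1) Bf] d0_forms1[OF okX g(1)])
  show "delta1 G (\<alpha> - contract x B - d0 Xm g) = 0"
  proof (intro ext)
    fix n u show "delta1 G (\<alpha> - contract x B - d0 Xm g) n u = 0 n u"
    proof (cases "n \<in> pts Pm \<and> u \<in> tangent Pm n")
      case True
      then have n: "n \<in> pts Pm" and u: "u \<in> tangent Pm n" by auto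
      have pt: "p n \<in> tangent Pm n" by (rule vfD[OF okP D(2) n])
      have st: "push Pm Xm src u \<in> tangent Xm (src n)" "push Pm Xm tgt u \<in> tangent Xm (tgt n)"
        by (rule push_tangent[OF Cs okX n u], rule push_tangent[OF Ct okX n u])
      have gC: "pull0 Pm src g \<in> Cinf Pm" "pull0 Pm tgt g \<in> Cinf Pm" by (rule Cmap_pull[OF Cs g(1)], rule Cmap_pull[OF Ct g(1)])
      have "u (contract p \<gamma>) = push Pm Xm src u g - push Pm Xm tgt u g"
        unfolding g(2)[symmetric] delta0_def tan_diff[OF okP u gC] push_app[OF g(1)] ..
      moreover have "d1 Pm \<gamma> n (p n) u = B (src n) (x (src n)) (push Pm Xm src u) - B (tgt n) (x (tgt n)) (push Pm Xm tgt u)"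
        using curv_at[OF n pt u] D(3,4) n by (simp add: related_def)
      moreover have "lie1 Pm p \<gamma> n u = delta1 G \<alpha> n u" by (simp add: al(2))
      ultimately show ?thesis using n u st grp(7)[OF n]
        by (simp add: delta1_def pull1_def lie1_def d0_def contract_def)
    qed (auto simp: delta1_def pull1_def)
  qed
qed

section \<open>The isomorphism of composite butterflies\<close>

lemma v_diff: "a \<in> algd G \<Longrightarrow> b \<in> algd G \<Longrightarrow> v_fun G \<gamma> (a - b) = v_fun G \<gamma> a - v_fun G \<gamma> b"
  using v_add[of "a - b" b] algd_diff[of a b] by (simp add: algebra_simps)

lemma v_zero: "v_fun G \<gamma> 0 = 0"
  using v_add[OF algd_zero algd_zero] by simp

definition FS where
  "FS = {((x, p, \<alpha>), g). ((x, p) \<in> mult_vf G \<and> \<alpha> \<in> forms1 Xm \<and> lie1 Pm p \<gamma> = delta1 G \<alpha>) \<and>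
      g \<in> Cinf Xm \<and> delta0 G g = contract p \<gamma>}"

definition br where
  "br = (\<lambda>((x, p, \<alpha>), g) ((z, r, \<beta>), h). ((lie_vf x z, lie_vf p r, lie1 Xm x \<beta> - lie1 Xm z \<alpha>),
      vf_fun x h - vf_fun z g - contract z (contract x B)))"

text \<open>The cosets of the composite with the forgetful morphism, indexed by their unique member with vanishing
  degree 1 component.\<close>
definition nf where
  "nf = (\<lambda>((x, p, \<alpha>), k). {((b, (x, p, \<alpha>)), (x + anchor G b, p + bar_vf G b, k - v_fun G \<gamma> b)) | b. b \<in> algd G})"

abbreviation "Gu \<equiv> mor_butterfly (XGgamma G \<gamma> B) (XG G) forget_mor"
abbreviation "GB \<equiv> G_butterfly G \<gamma> B"
abbreviation "cG \<equiv> comp_coset (XG G) GB Gu"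

lemma cG_def: "cG ((a, (x, p, \<alpha>)), (x', p', g)) =
   {((a + b, (x, p, \<alpha>)), (x' + anchor G b, p' + bar_vf G b, g - v_fun G \<gamma> b)) | b. b \<in> algd G}"
  by (simp add: comp_coset_def mor_butterfly_def G_butterfly_def subspace_rvs_def XG_def zero_prod_def)

lemma nf_iff: "u \<in> nf ((x, p, \<alpha>), k) \<longleftrightarrow> (\<exists>b\<in>algd G. u = ((b, (x, p, \<alpha>)), (x + anchor G b, p + bar_vf G b, k - v_fun G \<gamma> b)))"
  by (auto simp: nf_def)

lemma cG_nf:
  assumes a: "a \<in> algd G"
  shows "cG ((a, (x, p, \<alpha>)), (x + anchor G a, p + bar_vf G a, k - v_fun G \<gamma> a)) = nf ((x, p, \<alpha>), k)"
proof -
  have "(\<exists>b\<in>algd G. s = ((a + b, (x, p, \<alpha>)), (x + anchor G a + anchor G b, p + bar_vf G a + bar_vf G b, k - v_fun G \<gamma> a - v_fun G \<gamma> b))) \<longleftrightarrow>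
     (\<exists>c\<in>algd G. s = ((c, (x, p, \<alpha>)), (x + anchor G c, p + bar_vf G c, k - v_fun G \<gamma> c)))" for s
  proof
    assume "\<exists>c\<in>algd G. s = ((c, (x, p, \<alpha>)), (x + anchor G c, p + bar_vf G c, k - v_fun G \<gamma> c))"
    then obtain c where c: "c \<in> algd G" "s = ((c, (x, p, \<alpha>)), (x + anchor G c, p + bar_vf G c, k - v_fun G \<gamma> c))" by blast
    show "\<exists>b\<in>algd G. s = ((a + b, (x, p, \<alpha>)), (x + anchor G a + anchor G b, p + bar_vf G a + bar_vf G b, k - v_fun G \<gamma> a - v_fun G \<gamma> b))"
      using algd_diff[OF c(1) a] by (intro bexI[of _ "c - a"]) (simp_all add: c(2) anchor_diff bar_diff[OF c(1) a] v_diff[OF c(1) a])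
  next
    assume "\<exists>b\<in>algd G. s = ((a + b, (x, p, \<alpha>)), (x + anchor G a + anchor G b, p + bar_vf G a + bar_vf G b, k - v_fun G \<gamma> a - v_fun G \<gamma> b))"
    then obtain b where b: "b \<in> algd G" "s = ((a + b, (x, p, \<alpha>)), (x + anchor G a + anchor G b, p + bar_vf G a + bar_vf G b, k - v_fun G \<gamma> a - v_fun G \<gamma> b))" by blast
    show "\<exists>c\<in>algd G. s = ((c, (x, p, \<alpha>)), (x + anchor G c, p + bar_vf G c, k - v_fun G \<gamma> c))"
      using algd_add[OF a b(1)] by (intro bexI[of _ "a + b"]) (simp_all add: b(2) anchor_add bar_add[OF a b(1)] v_add[OF a b(1)] algebra_simps)
  qed
  then show ?thesis unfolding cG_def by (intro Set.set_eqI) (simp only: nf_iff mem_Collect_eq Bex_def conj_commute)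
qed

lemma nf_self: "((0, (x, p, \<alpha>)), (x, p, k)) \<in> nf ((x, p, \<alpha>), k)"
  unfolding nf_iff by (rule bexI[OF _ algd_zero]) (simp add: anchor_zero bar_zero v_zero)

lemma nf_nonempty: "nf e \<noteq> {}"
proof -
  obtain x p \<alpha> k where "e = ((x, p, \<alpha>), k)" by (metis surj_pair)
  then show ?thesis using nf_self[of x p \<alpha> k] by auto
qed

lemma nf_inj: "nf e = nf e' \<Longrightarrow> e = e'"
proof -
  assume e: "nf e = nf e'"
  obtain x p \<alpha> k where e1: "e = ((x, p, \<alpha>), k)" by (metis surj_pair)
  obtain x' p' \<alpha>' k' where e2: "e' = ((x', p', \<alpha>'), k')" by (metis surj_pair)
  have "((0, (x, p, \<alpha>)), (x, p, k)) \<in> nf ((x', p', \<alpha>'), k')" using nf_self e e1 e2 by metis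
  then obtain b where "((0, (x, p, \<alpha>)), (x, p, k)) = ((b, (x', p', \<alpha>')), (x' + anchor G b, p' + bar_vf G b, k' - v_fun G \<gamma> b))"
    unfolding nf_iff by blast
  then show ?thesis by (auto simp: e1 e2 v_zero)
qed

lemma FS_iff: "((x, p, \<alpha>), g) \<in> FS \<longleftrightarrow> (x, p) \<in> mult_vf G \<and> \<alpha> \<in> forms1 Xm \<and> lie1 Pm p \<gamma> = delta1 G \<alpha> \<and> g \<in> Cinf Xm \<and> delta0 G g = contract p \<gamma>"
  by (auto simp: FS_def)

lemma vcar_G: "vcar (space (comp_butterfly (XG G) GB Gu)) = nf ` FS"
proof -
  have "vcar (space (comp_butterfly (XG G) GB Gu)) = cG ` {(x, y). x \<in> vcar (space Gu) \<and> y \<in> vcar (space GB) \<and> rho Gu x = sig GB y}"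
    by (simp add: comp_butterfly_def Let_def)
  also have "\<dots> = nf ` FS"
  proof (intro Set.set_eqI iffI)
    fix S assume "S \<in> cG ` {(x, y). x \<in> vcar (space Gu) \<and> y \<in> vcar (space GB) \<and> rho Gu x = sig GB y}"
    then obtain s t where st: "S = cG (s, t)" "s \<in> vcar (space Gu)" "t \<in> vcar (space GB)" "rho Gu s = sig GB t" by auto
    obtain a x p \<alpha> where s: "s = (a, (x, p, \<alpha>))" by (metis surj_pair)
    obtain x' p' g where t: "t = (x', p', g)" by (metis surj_pair)
    have a: "a \<in> algd G" and X: "(x, p) \<in> mult_vf G" "\<alpha> \<in> forms1 Xm" "lie1 Pm p \<gamma> = delta1 G \<alpha>"
      using st(2) by (simp_all add: s mor_butterfly_def subspace_rvs_def XG_def XGgamma_def)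
    have g: "g \<in> Cinf Xm" "delta0 G g = contract p' \<gamma>" using st(3) by (simp_all add: t G_butterfly_def subspace_rvs_def)
    have x': "x' = x + anchor G a" "p' = p + bar_vf G a"
      using st(4) by (simp_all add: s t G_butterfly_def mor_butterfly_def XG_def forget_mor_def add.commute)
    have "contract (p + bar_vf G a) \<gamma> = contract p \<gamma> + contract (bar_vf G a) \<gamma>"
      by (rule contract_add[OF okP gam mult_vfD(2)[OF X(1)] mult_vfD(2)[OF bar_mult_vf[OF a]]])
    then have "delta0 G (g + v_fun G \<gamma> a) = contract p \<gamma>" by (simp add: delta0_add delta0_v[OF a] g(2) x')
    then have "((x, p, \<alpha>), g + v_fun G \<gamma> a) \<in> FS" using X g Cinf_add[OF okX g(1) v_Cinf[OF a]] by (simp add: FS_iff)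
    moreover have "S = nf ((x, p, \<alpha>), g + v_fun G \<gamma> a)"
      using cG_nf[OF a, of x p \<alpha> "g + v_fun G \<gamma> a"] by (simp add: st(1) s t x')
    ultimately show "S \<in> nf ` FS" by blast
  next
    fix S assume "S \<in> nf ` FS"
    then obtain x p \<alpha> g where S: "S = nf ((x, p, \<alpha>), g)" and e: "((x, p, \<alpha>), g) \<in> FS" by (auto simp: image_iff)
    have "S = cG ((0, (x, p, \<alpha>)), (x, p, g))"
      using cG_nf[OF algd_zero, of x p \<alpha> g] by (simp add: S anchor_zero bar_zero v_zero)
    moreover have "(0, (x, p, \<alpha>)) \<in> vcar (space Gu)" "(x, p, g) \<in> vcar (space GB)" "rho Gu (0, (x, p, \<alpha>)) = sig GB (x, p, g)"
      using e algd_zero by (simp_all add: FS_iff mor_butterfly_def G_butterfly_def subspace_rvs_def XG_def XGgamma_def forget_mor_def anchor_zero bar_zero)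
    ultimately show "S \<in> cG ` {(x, y). x \<in> vcar (space Gu) \<and> y \<in> vcar (space GB) \<and> rho Gu x = sig GB y}" by blast
  qed
  finally show ?thesis .
qed

lemma nf_add:
  assumes u: "u \<in> nf e" and v: "v \<in> nf e'"
  shows "cG (fst u + fst v, snd u + snd v) = nf (e + e')"
proof -
  obtain x p \<alpha> k where e: "e = ((x, p, \<alpha>), k)" by (metis surj_pair)
  obtain z r \<beta> l where e': "e' = ((z, r, \<beta>), l)" by (metis surj_pair)
  obtain a where a: "a \<in> algd G" "u = ((a, (x, p, \<alpha>)), (x + anchor G a, p + bar_vf G a, k - v_fun G \<gamma> a))"
    using u unfolding e nf_iff by blast
  obtain b where b: "b \<in> algd G" "v = ((b, (z, r, \<beta>)), (z + anchor G b, r + bar_vf G b, l - v_fun G \<gamma> b))"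
    using v unfolding e' nf_iff by blast
  show ?thesis
    using cG_nf[OF algd_add[OF a(1) b(1)], of "x + z" "p + r" "\<alpha> + \<beta>" "k + l"]
    by (simp add: a(2) b(2) e e' anchor_add bar_add[OF a(1) b(1)] v_add[OF a(1) b(1)] add_ac add_diff_add diff_add_eq)
qed

lemma nf_scale:
  assumes u: "u \<in> nf e"
  shows "cG (c *\<^sub>R fst u, c *\<^sub>R snd u) = nf (c *\<^sub>R e)"
proof -
  obtain x p \<alpha> k where e: "e = ((x, p, \<alpha>), k)" by (metis surj_pair)
  obtain a where a: "a \<in> algd G" "u = ((a, (x, p, \<alpha>)), (x + anchor G a, p + bar_vf G a, k - v_fun G \<gamma> a))"
    using u unfolding e nf_iff by blast
  show ?thesis
    using cG_nf[OF algd_scale[OF a(1), of c], of "c *\<^sub>R x" "c *\<^sub>R p" "c *\<^sub>R \<alpha>" "c *\<^sub>R k"]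
    by (simp add: a(2) e anchor_scale bar_scale[OF a(1)] v_scale[OF a(1)] scaleR_add_right scaleR_diff_right)
qed

lemma nf_brk:
  assumes e: "e \<in> FS" "e' \<in> FS" and u: "u \<in> nf e" and v: "v \<in> nf e'"
  shows "cG (brk Gu (fst u) (fst v), brk GB (snd u) (snd v)) = nf (br e e')"
proof -
  obtain x p \<alpha> g where E: "e = ((x, p, \<alpha>), g)" by (metis surj_pair)
  obtain z r \<beta> h where E': "e' = ((z, r, \<beta>), h)" by (metis surj_pair)
  have X: "(x, p) \<in> mult_vf G" and g: "g \<in> Cinf Xm" "delta0 G g = contract p \<gamma>" using e(1) by (simp_all add: E FS_iff)
  have Z: "(z, r) \<in> mult_vf G" and h: "h \<in> Cinf Xm" "delta0 G h = contract r \<gamma>" using e(2) by (simp_all add: E' FS_iff)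
  obtain a where a: "a \<in> algd G" and ua: "u = ((a, (x, p, \<alpha>)), (x + anchor G a, p + bar_vf G a, g - v_fun G \<gamma> a))"
    using u unfolding E nf_iff by blast
  obtain b where b: "b \<in> algd G" and vb: "v = ((b, (z, r, \<beta>)), (z + anchor G b, r + bar_vf G b, h - v_fun G \<gamma> b))"
    using v unfolding E' nf_iff by blast
  note XD = mult_vfD[OF X] and ZD = mult_vfD[OF Z] and AD = mult_vfD[OF bar_mult_vf[OF a]] and BD = mult_vfD[OF bar_mult_vf[OF b]]
  have va: "- v_fun G \<gamma> a \<in> Cinf Xm" "delta0 G (- v_fun G \<gamma> a) = contract (bar_vf G a) \<gamma>"
    using Cinf_minus[OF okX v_Cinf[OF a]] delta0_v[OF a] by (simp_all add: delta0_minus)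
  define c where "c = mvf_act G p b - mvf_act G r a + mvf_act G (bar_vf G a) b"
  have c1: "mvf_act G p b \<in> algd G" "mvf_act G r a \<in> algd G" "mvf_act G (bar_vf G a) b \<in> algd G"
    by (rule mvf_act_props(1)[OF X b], rule mvf_act_props(1)[OF Z a], rule mvf_act_props(1)[OF bar_mult_vf[OF a] b])
  have c2: "mvf_act G p b - mvf_act G r a \<in> algd G" by (rule algd_diff[OF c1(1,2)])
  have c: "c \<in> algd G" unfolding c_def by (rule algd_add[OF c2 c1(3)])
  have ca: "anchor G c = lie_vf x (anchor G b) - lie_vf z (anchor G a) + lie_vf (anchor G a) (anchor G b)"
    unfolding c_def anchor_add anchor_diff mvf_act_props(4)[OF X b] mvf_act_props(4)[OF Z a] mvf_act_props(4)[OF bar_mult_vf[OF a] b] ..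
  have cb: "bar_vf G c = lie_vf p (bar_vf G b) - lie_vf r (bar_vf G a) + lie_vf (bar_vf G a) (bar_vf G b)"
    unfolding c_def bar_add[OF c2 c1(3)] bar_diff[OF c1(1,2)] bar_act[OF X b] bar_act[OF Z a] bar_act[OF bar_mult_vf[OF a] b] ..
  have cv: "v_fun G \<gamma> c = (vf_fun x (v_fun G \<gamma> b) + vf_fun (anchor G b) g + contract (anchor G b) (contract x B))
     - (vf_fun z (v_fun G \<gamma> a) + vf_fun (anchor G a) h + contract (anchor G a) (contract z B))
     + (vf_fun (anchor G a) (v_fun G \<gamma> b) + vf_fun (anchor G b) (- v_fun G \<gamma> a) + contract (anchor G b) (contract (anchor G a) B))"
    unfolding c_def v_add[OF c2 c1(3)] v_diff[OF c1(1,2)] act_v[OF X g b] act_v[OF Z h a] act_v[OF bar_mult_vf[OF a] va b] ..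
  have vm: "vf_fun (anchor G b) (- v_fun G \<gamma> a) = - vf_fun (anchor G b) (v_fun G \<gamma> a)"
    using vf_fun_diff[OF okX BD(1) Cinf_zero[OF okX] v_Cinf[OF a]] vf_fun_zero[OF okX BD(1)] by simp
  have l1: "lie_vf (x + anchor G a) (z + anchor G b) = lie_vf x z + anchor G c"
    unfolding ca lie_vf_add_left[OF okX XD(1) AD(1) vfields_add[OF okX ZD(1) BD(1)]]
      lie_vf_add_right[OF okX XD(1) ZD(1) BD(1)] lie_vf_add_right[OF okX AD(1) ZD(1) BD(1)]
    using lie_vf_antisym[of "anchor G a" z] by (simp add: algebra_simps)
  have l2: "lie_vf (p + bar_vf G a) (r + bar_vf G b) = lie_vf p r + bar_vf G c"
    unfolding cb lie_vf_add_left[OF okP XD(2) AD(2) vfields_add[OF okP ZD(2) BD(2)]]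
      lie_vf_add_right[OF okP XD(2) ZD(2) BD(2)] lie_vf_add_right[OF okP AD(2) ZD(2) BD(2)]
    using lie_vf_antisym[of "bar_vf G a" r] by (simp add: algebra_simps)
  have f1: "vf_fun (x + anchor G a) (h - v_fun G \<gamma> b) = vf_fun x h - vf_fun x (v_fun G \<gamma> b) + vf_fun (anchor G a) h - vf_fun (anchor G a) (v_fun G \<gamma> b)"
    by (simp add: vf_fun_add_left vf_fun_diff[OF okX XD(1) h(1) v_Cinf[OF b]] vf_fun_diff[OF okX AD(1) h(1) v_Cinf[OF b]])
  have f2: "vf_fun (z + anchor G b) (g - v_fun G \<gamma> a) = vf_fun z g - vf_fun z (v_fun G \<gamma> a) + vf_fun (anchor G b) g - vf_fun (anchor G b) (v_fun G \<gamma> a)"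
    by (simp add: vf_fun_add_left vf_fun_diff[OF okX ZD(1) g(1) v_Cinf[OF a]] vf_fun_diff[OF okX BD(1) g(1) v_Cinf[OF a]])
  have f3: "contract (z + anchor G b) (contract (x + anchor G a) B) = contract z (contract x B) + contract (anchor G b) (contract x B)
      - contract (anchor G a) (contract z B) + contract (anchor G b) (contract (anchor G a) B)"
    unfolding contract2_add'[OF okX Bf vfields_add[OF okX ZD(1) BD(1)] XD(1) AD(1)]
      contract2_add[OF okX Bf XD(1) ZD(1) BD(1)] contract2_add[OF okX Bf AD(1) ZD(1) BD(1)]
    using contract2_swap[OF Bf, of z "anchor G a"] by (simp add: algebra_simps)
  have l3: "vf_fun (x + anchor G a) (h - v_fun G \<gamma> b) - vf_fun (z + anchor G b) (g - v_fun G \<gamma> a) - contract (z + anchor G b) (contract (x + anchor G a) B)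
     = (vf_fun x h - vf_fun z g - contract z (contract x B)) - v_fun G \<gamma> c"
    unfolding cv vm f1 f2 f3 by (simp add: algebra_simps)
  have b1: "brk Gu (fst u) (fst v) = (c, (lie_vf x z, lie_vf p r, lie1 Xm x \<beta> - lie1 Xm z \<alpha>))"
    by (simp add: ua vb mor_butterfly_def XG_def XGgamma_def forget_mor_def c_def)
  have b2: "brk GB (snd u) (snd v) = (lie_vf x z + anchor G c, lie_vf p r + bar_vf G c, (vf_fun x h - vf_fun z g - contract z (contract x B)) - v_fun G \<gamma> c)"
    unfolding l1[symmetric] l2[symmetric] l3[symmetric] by (simp add: ua vb G_butterfly_def)
  show ?thesis unfolding b1 b2 cG_nf[OF c] by (simp add: E E' br_def)
qed

abbreviation "FB \<equiv> F_butterfly G \<gamma> B"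

lemma FB_simps: "vcar (space FB) = FS" "vadd (space FB) = (+)" "vscale (space FB) = (*\<^sub>R)" "vzero (space FB) = 0"
  "sig FB = fst" "lam FB f = ((0, 0, 0), pull0 Xm pr f)"
  by (simp_all add: F_butterfly_def subspace_rvs_def FS_def XGgamma_def)

lemma FS_shift: "((x, p, \<alpha>), g) \<in> FS \<Longrightarrow> f \<in> Cinf Mm \<Longrightarrow> ((x, p, \<alpha>), g + pull0 Xm pr f) \<in> FS"
  using Cinf_add[OF okX _ Cmap_pull[OF Cpr]] by (simp add: FS_iff delta0_add delta0_pull)

lemma rho_F:
  assumes e: "((x, p, \<alpha>), g) \<in> FS"
  obtains \<epsilon> where "rho FB ((x, p, \<alpha>), g) = (proj_vf G x, - \<epsilon>)" "\<epsilon> \<in> forms1 Mm" "pull1 Xm Mm pr \<epsilon> = \<alpha> - contract x B - d0 Xm g"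
proof -
  have "\<exists>!\<epsilon>. \<epsilon> \<in> forms1 Mm \<and> pull1 Xm Mm pr \<epsilon> = \<alpha> - contract x B - d0 Xm g"
    using e eta[of x p \<alpha> g] by (simp add: FS_iff)
  note ex = theI'[OF this]
  define \<epsilon> where "\<epsilon> = (THE \<epsilon>. \<epsilon> \<in> forms1 Mm \<and> pull1 Xm Mm pr \<epsilon> = \<alpha> - contract x B - d0 Xm g)"
  have "rho FB ((x, p, \<alpha>), g) = (proj_vf G x, - \<epsilon>)" by (simp add: F_butterfly_def \<epsilon>_def)
  then show ?thesis by (rule that) (use ex[folded \<epsilon>_def] in blast)+
qed

lemma rho_F_mem:
  assumes e: "e \<in> FS" shows "rho FB e \<in> vfields Mm \<times> forms1 Mm"
proof -
  obtain x p \<alpha> g where E: "e = ((x, p, \<alpha>), g)" by (metis surj_pair)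
  obtain \<epsilon> where "rho FB e = (proj_vf G x, - \<epsilon>)" "\<epsilon> \<in> forms1 Mm" using rho_F[OF e[unfolded E]] E by metis
  then show ?thesis using forms1_uminus[OF okM] proj_vf(1) e E by (auto simp: FS_iff)
qed

lemma pull1_pr_d0:
  assumes f: "f \<in> Cinf Mm"
  shows "pull1 Xm Mm pr (d0 Mm f) = d0 Xm (pull0 Xm pr f)"
proof (intro ext)
  fix y v show "pull1 Xm Mm pr (d0 Mm f) y v = d0 Xm (pull0 Xm pr f) y v"
    using Cmap_pts[OF Cpr, of y] push_tangent[OF Cpr okM, of y v] by (auto simp: pull1_def d0_def push_app[OF f])
qed

lemma rho_shift:
  assumes e: "((x, p, \<alpha>), g) \<in> FS" and f: "f \<in> Cinf Mm"
  shows "rho FB ((x, p, \<alpha>), g + pull0 Xm pr f) = rho FB ((x, p, \<alpha>), g) + (0, d0 Mm f)"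
proof -
  obtain \<epsilon> where r: "rho FB ((x, p, \<alpha>), g) = (proj_vf G x, - \<epsilon>)" "\<epsilon> \<in> forms1 Mm" "pull1 Xm Mm pr \<epsilon> = \<alpha> - contract x B - d0 Xm g"
    by (rule rho_F[OF e])
  obtain \<epsilon>' where r': "rho FB ((x, p, \<alpha>), g + pull0 Xm pr f) = (proj_vf G x, - \<epsilon>')" "\<epsilon>' \<in> forms1 Mm"
      "pull1 Xm Mm pr \<epsilon>' = \<alpha> - contract x B - d0 Xm (g + pull0 Xm pr f)"
    by (rule rho_F[OF FS_shift[OF e f]])
  have "\<exists>!\<epsilon>. \<epsilon> \<in> forms1 Mm \<and> pull1 Xm Mm pr \<epsilon> = \<alpha> - contract x B - d0 Xm (g + pull0 Xm pr f)"
    using FS_shift[OF e f] eta[of x p \<alpha> "g + pull0 Xm pr f"] by (simp add: FS_iff)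
  moreover have "\<epsilon> - d0 Mm f \<in> forms1 Mm" by (rule forms1_diff[OF okM r(2) d0_forms1[OF okM f]])
  moreover have "pull1 Xm Mm pr (\<epsilon> - d0 Mm f) = \<alpha> - contract x B - d0 Xm (g + pull0 Xm pr f)"
  proof -
    have "pull1 Xm Mm pr (\<epsilon> - d0 Mm f) = pull1 Xm Mm pr \<epsilon> - pull1 Xm Mm pr (d0 Mm f)"
      by (intro ext) (simp add: pull1_def)
    moreover have "g \<in> Cinf Xm" using e by (simp add: FS_iff)
    ultimately show ?thesis
      using d0_add[OF okX _ Cmap_pull[OF Cpr f], of g] by (simp add: r(3) pull1_pr_d0[OF f] algebra_simps)
  qed
  ultimately have "\<epsilon>' = \<epsilon> - d0 Mm f" using r'(2,3) by blast
  then show ?thesis by (simp add: r r')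
qed

lemma pull0_vf_fun:
  assumes x: "(x, p) \<in> mult_vf G" and w: "w \<in> Cinf Mm"
  shows "pull0 Xm pr (vf_fun (proj_vf G x) w) = vf_fun x (pull0 Xm pr w)"
proof (rule ext)
  fix y
  have at: "pull0 Xm pr F y = (if y \<in> pts Xm then F (pr y) else 0)" for F :: "'m \<Rightarrow> real" by (simp add: pull0_def)
  show "pull0 Xm pr (vf_fun (proj_vf G x) w) y = vf_fun x (pull0 Xm pr w) y"
    unfolding at[of "vf_fun (proj_vf G x) w"]
    by (cases "y \<in> pts Xm")
       (simp_all add: vf_fun_def proj_vf(2)[OF x] push_app[OF w] vf_off[OF okX mult_vfD(1)[OF x]])
qed

lemma pull0_contract:
  assumes x: "(x, p) \<in> mult_vf G" and e: "pull1 Xm Mm pr \<epsilon> = \<eta>" and n: "\<eta> \<in> forms1 Xm"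
  shows "pull0 Xm pr (contract (proj_vf G x) \<epsilon>) = contract x \<eta>"
proof (rule ext)
  fix y show "pull0 Xm pr (contract (proj_vf G x) \<epsilon>) y = contract x \<eta> y"
  proof (cases "y \<in> pts Xm")
    case True
    then show ?thesis using vfD[OF okX mult_vfD(1)[OF x] True]
      by (simp add: e[symmetric] pull0_def contract_def pull1_def proj_vf(2)[OF x])
  next
    case False
    then show ?thesis by (simp add: pull0_def contract_def forms1D(1)[OF n])
  qed
qed

context
  fixes H :: "'m form3"
begin

abbreviation "pB \<equiv> mor_butterfly (LC Mm H) (AM Mm H) psi_mor"
abbreviation "cF \<equiv> comp_coset (LC Mm H) pB FB"

definition CF where
  "CF = {(e, (w, r)). e \<in> FS \<and> w \<in> Cinf Mm \<and> r = rho FB e}"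

definition tot where
  "tot s = (fst (fst s), snd (fst s) + pull0 Xm pr (fst (snd s)))"

lemma cF_def: "cF ((X, g), (w, r)) = {((X, g + pull0 Xm pr f), (w - f, r + (0, d0 Mm f))) | f. f \<in> Cinf Mm}"
  by (simp add: comp_coset_def FB_simps mor_butterfly_def subspace_rvs_def LC_def Let_def psi_mor_def zero_prod_def[symmetric])

lemma cF_tot: "t \<in> cF s \<Longrightarrow> tot t = tot s"
proof -
  assume t: "t \<in> cF s"
  obtain X g w r where s: "s = ((X, g), (w, r))" by (metis surj_pair)
  obtain f where "t = ((X, g + pull0 Xm pr f), (w - f, r + (0, d0 Mm f)))" using t unfolding s cF_def by blast
  then show ?thesis using pull0_add[of Xm pr f "w - f"] by (simp add: tot_def s add.assoc)
qed

lemma cF_nonempty: "cF s \<noteq> {}"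
proof -
  obtain X g w r where s: "s = ((X, g), (w, r))" by (metis surj_pair)
  show ?thesis unfolding s cF_def using Cinf_zero[OF okM] by blast
qed

lemma cF_closed:
  assumes s: "s \<in> CF" and t: "t \<in> cF s" shows "t \<in> CF"
proof -
  obtain x p \<alpha> g w r where S: "s = (((x, p, \<alpha>), g), (w, r))" by (metis surj_pair)
  have e: "((x, p, \<alpha>), g) \<in> FS" and w: "w \<in> Cinf Mm" and r: "r = rho FB ((x, p, \<alpha>), g)" using s by (auto simp: S CF_def)
  obtain f where f: "f \<in> Cinf Mm" and t: "t = (((x, p, \<alpha>), g + pull0 Xm pr f), (w - f, r + (0, d0 Mm f)))"
    using t unfolding S cF_def by blast
  show ?thesis using FS_shift[OF e f] rho_shift[OF e f] Cinf_diff[OF okM w f] by (simp add: t r CF_def)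
qed

lemma cF_canon:
  assumes s: "s \<in> CF" shows "tot s \<in> FS" "cF s = cF (tot s, (0, rho FB (tot s)))"
proof -
  obtain x p \<alpha> g w r where S: "s = (((x, p, \<alpha>), g), (w, r))" by (metis surj_pair)
  have e: "((x, p, \<alpha>), g) \<in> FS" and w: "w \<in> Cinf Mm" and r: "r = rho FB ((x, p, \<alpha>), g)" using s by (auto simp: S CF_def)
  have c: "tot s = ((x, p, \<alpha>), g + pull0 Xm pr w)" by (simp add: tot_def S)
  show "tot s \<in> FS" unfolding c by (rule FS_shift[OF e w])
  have sh: "((x, p, \<alpha>), g + pull0 Xm pr w + pull0 Xm pr f, (0 - f, r + (0, d0 Mm w) + (0, d0 Mm f)))
      = ((x, p, \<alpha>), g + pull0 Xm pr (w + f), (w - (w + f), r + (0, d0 Mm (w + f))))" if "f \<in> Cinf Mm" for f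
    using d0_add[OF okM w that] pull0_add[of Xm pr w f] by (simp add: add_ac)
  have 2: "cF (tot s, (0, rho FB (tot s))) = {(((x, p, \<alpha>), g + pull0 Xm pr (w + f)), (w - (w + f), r + (0, d0 Mm (w + f)))) | f. f \<in> Cinf Mm}"
    unfolding c rho_shift[OF e w] cF_def r[symmetric] using sh by (auto simp: Set.set_eq_iff)
  have 1: "cF s = {(((x, p, \<alpha>), g + pull0 Xm pr f), (w - f, r + (0, d0 Mm f))) | f. f \<in> Cinf Mm}" unfolding S cF_def ..
  show "cF s = cF (tot s, (0, rho FB (tot s)))"
    unfolding 1 2
  proof (intro Set.set_eqI iffI)
    fix t assume "t \<in> {(((x, p, \<alpha>), g + pull0 Xm pr f), (w - f, r + (0, d0 Mm f))) | f. f \<in> Cinf Mm}"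
    then obtain f where f: "f \<in> Cinf Mm" "t = (((x, p, \<alpha>), g + pull0 Xm pr f), (w - f, r + (0, d0 Mm f)))" by blast
    then show "t \<in> {(((x, p, \<alpha>), g + pull0 Xm pr (w + f)), (w - (w + f), r + (0, d0 Mm (w + f)))) | f. f \<in> Cinf Mm}"
      using Cinf_diff[OF okM f(1) w] by (intro CollectI exI[of _ "f - w"]) simp
  next
    fix t assume "t \<in> {(((x, p, \<alpha>), g + pull0 Xm pr (w + f)), (w - (w + f), r + (0, d0 Mm (w + f)))) | f. f \<in> Cinf Mm}"
    then show "t \<in> {(((x, p, \<alpha>), g + pull0 Xm pr f), (w - f, r + (0, d0 Mm f))) | f. f \<in> Cinf Mm}"
      using Cinf_add[OF okM w] by blast
  qed
qed

lemma vcar_F: "vcar (space (comp_butterfly (LC Mm H) pB FB)) = cF ` CF"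
proof -
  have "{(x, y). x \<in> vcar (space FB) \<and> y \<in> vcar (space pB) \<and> rho FB x = sig pB y} = CF"
  proof -
    have "s \<in> {(x, y). x \<in> vcar (space FB) \<and> y \<in> vcar (space pB) \<and> rho FB x = sig pB y} \<longleftrightarrow> s \<in> CF" for s
    proof -
      obtain e w r where s: "s = (e, (w, r))" by (metis surj_pair)
      show ?thesis
        using rho_F_mem[of e]
        by (auto simp: s CF_def FB_simps(1) mor_butterfly_def subspace_rvs_def LC_def AM_def Let_def)
    qed
    then show ?thesis by (rule Set.set_eqI)
  qed
  then show ?thesis by (simp add: comp_butterfly_def Let_def)
qed

lemma tot_brk:
  assumes s: "s \<in> CF" and t: "t \<in> CF"
  shows "tot (brk FB (fst s) (fst t), brk pB (snd s) (snd t)) = br (tot s) (tot t)"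
proof -
  obtain x p \<alpha> g w R where S: "s = (((x, p, \<alpha>), g), (w, R))" by (metis surj_pair)
  obtain z r \<beta> h w' R' where T: "t = (((z, r, \<beta>), h), (w', R'))" by (metis surj_pair)
  have e: "((x, p, \<alpha>), g) \<in> FS" and w: "w \<in> Cinf Mm" and R: "R = rho FB ((x, p, \<alpha>), g)" using s by (auto simp: S CF_def)
  have e': "((z, r, \<beta>), h) \<in> FS" and w': "w' \<in> Cinf Mm" and R': "R' = rho FB ((z, r, \<beta>), h)" using t by (auto simp: T CF_def)
  have X: "(x, p) \<in> mult_vf G" "\<alpha> \<in> forms1 Xm" "g \<in> Cinf Xm" and Z: "(z, r) \<in> mult_vf G" "\<beta> \<in> forms1 Xm" "h \<in> Cinf Xm"
    using e e' by (simp_all add: FS_iff)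
  note XD = mult_vfD(1)[OF X(1)] and ZD = mult_vfD(1)[OF Z(1)]
  obtain \<epsilon> where E: "R = (proj_vf G x, - \<epsilon>)" "\<epsilon> \<in> forms1 Mm" "pull1 Xm Mm pr \<epsilon> = \<alpha> - contract x B - d0 Xm g"
    by (rule rho_F[OF e]) (simp add: R)
  obtain \<epsilon>' where E': "R' = (proj_vf G z, - \<epsilon>')" "\<epsilon>' \<in> forms1 Mm" "pull1 Xm Mm pr \<epsilon>' = \<beta> - contract z B - d0 Xm h"
    by (rule rho_F[OF e']) (simp add: R')
  define u where "u = proj_vf G x"
  define v where "v = proj_vf G z"
  have eta1: "\<alpha> - contract x B - d0 Xm g \<in> forms1 Xm"
    by (intro forms1_diff[OF okX] X(2) contract_forms2[OF okX XD Bf] d0_forms1[OF okX X(3)])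
  have eta2: "\<beta> - contract z B - d0 Xm h \<in> forms1 Xm"
    by (intro forms1_diff[OF okX] Z(2) contract_forms2[OF okX ZD Bf] d0_forms1[OF okX Z(3)])
  have k1: "pull0 Xm pr (contract u \<epsilon>') = contract x \<beta> - contract x (contract z B) - contract x (d0 Xm h)"
    unfolding u_def pull0_contract[OF X(1) E'(3) eta2] by (rule ext) (simp add: contract_def)
  have k2: "pull0 Xm pr (contract v \<epsilon>) = contract z \<alpha> - contract z (contract x B) - contract z (d0 Xm g)"
    unfolding v_def pull0_contract[OF Z(1) E(3) eta1] by (rule ext) (simp add: contract_def)
  have dc: "contract x (d0 Xm f) = vf_fun x f" if "x \<in> vfields Xm" for x and f
  proof (rule ext)
    fix y show "contract x (d0 Xm f) y = vf_fun x f y"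
      by (cases "y \<in> pts Xm") (simp_all add: contract_def d0_def vf_fun_def vfD[OF okX that] vf_off[OF okX that])
  qed
  have ca: "contract x (\<beta> + d0 Xm h) = contract x \<beta> + vf_fun x h" "contract z (\<alpha> + d0 Xm g) = contract z \<alpha> + vf_fun z g"
    by (simp_all add: dc[OF XD, symmetric] dc[OF ZD, symmetric]) (auto simp: contract_def)
  have B: "contract x (contract z B) = - contract z (contract x B)" by (rule contract2_swap[OF Bf])
  have pw: "pull0 Xm pr (vf_fun u w' - vf_fun v w + (1/2) *\<^sub>R (contract v \<epsilon> - contract u \<epsilon>'))
     = pull0 Xm pr (vf_fun u w') - pull0 Xm pr (vf_fun v w) + (1/2) *\<^sub>R (pull0 Xm pr (contract v \<epsilon>) - pull0 Xm pr (contract u \<epsilon>'))"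
    by (rule ext) (simp add: pull0_def)
  have b1: "brk FB (fst s) (fst t) = ((lie_vf x z, lie_vf p r, lie1 Xm x \<beta> - lie1 Xm z \<alpha>), (1/2) *\<^sub>R (contract x (\<beta> + d0 Xm h) - contract z (\<alpha> + d0 Xm g)))"
    by (simp add: S T F_butterfly_def XGgamma_def)
  have cm: "contract u (- \<epsilon>') = - contract u \<epsilon>'" "contract v (- \<epsilon>) = - contract v \<epsilon>" by (auto simp: contract_def)
  have vf0: "vf_fun 0 w' = 0" by (rule ext) (simp add: vf_fun_def)
  have b2: "fst (brk pB (snd s) (snd t)) = vf_fun u w' - vf_fun v w + (1/2) *\<^sub>R (contract v \<epsilon> - contract u \<epsilon>')"
    by (simp add: S T mor_butterfly_def AM_def psi_mor_def E(1) E'(1) u_def[symmetric] v_def[symmetric] cm vf0)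
  have "(1/2) *\<^sub>R (contract x (\<beta> + d0 Xm h) - contract z (\<alpha> + d0 Xm g)) + pull0 Xm pr (fst (brk pB (snd s) (snd t)))
      = vf_fun x (h + pull0 Xm pr w') - vf_fun z (g + pull0 Xm pr w) - contract z (contract x B)"
    unfolding b2 pw k1 k2 ca B dc[OF XD] dc[OF ZD] vf_fun_add[OF okX XD Z(3) Cmap_pull[OF Cpr w']]
      vf_fun_add[OF okX ZD X(3) Cmap_pull[OF Cpr w]]
    unfolding u_def v_def pull0_vf_fun[OF X(1) w'] pull0_vf_fun[OF Z(1) w]
    by (rule ext) (simp add: field_simps)
  then show ?thesis by (simp add: tot_def b1) (simp add: S T br_def)
qed

definition \<Phi> where "\<Phi> S = (\<Union>s\<in>S. nf (tot s))"

lemma \<Phi>_eq: "S \<noteq> {} \<Longrightarrow> (\<And>s. s \<in> S \<Longrightarrow> tot s = e) \<Longrightarrow> \<Phi> S = nf e"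
  unfolding \<Phi>_def by (simp cong: SUP_cong)

lemma \<Phi>_cF: "\<Phi> (cF s) = nf (tot s)"
  by (rule \<Phi>_eq[OF cF_nonempty cF_tot])

lemma \<Phi>_UN:
  assumes ne: "S \<noteq> {}" and e: "\<And>u. u \<in> S \<Longrightarrow> tot (h u) = e"
  shows "\<Phi> (\<Union>u\<in>S. cF (h u)) = nf e"
proof (rule \<Phi>_eq)
  show "(\<Union>u\<in>S. cF (h u)) \<noteq> {}" using ne cF_nonempty by blast
  fix s assume "s \<in> (\<Union>u\<in>S. cF (h u))"
  then obtain u where "u \<in> S" "s \<in> cF (h u)" by blast
  then show "tot s = e" using cF_tot e by metis
qed

lemma \<Phi>_UN2:
  assumes ne: "S \<noteq> {}" "T \<noteq> {}" and e: "\<And>u v. u \<in> S \<Longrightarrow> v \<in> T \<Longrightarrow> tot (h u v) = e"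
  shows "\<Phi> (\<Union>u\<in>S. \<Union>v\<in>T. cF (h u v)) = nf e"
proof (rule \<Phi>_eq)
  obtain u0 v0 where "u0 \<in> S" "v0 \<in> T" using ne by blast
  moreover obtain s0 where "s0 \<in> cF (h u0 v0)" using cF_nonempty by blast
  ultimately have "s0 \<in> (\<Union>u\<in>S. \<Union>v\<in>T. cF (h u v))" by (intro UN_I)
  then show "(\<Union>u\<in>S. \<Union>v\<in>T. cF (h u v)) \<noteq> {}" by (metis empty_iff)
  fix s assume "s \<in> (\<Union>u\<in>S. \<Union>v\<in>T. cF (h u v))"
  then show "tot s = e"
  proof (elim UN_E)
    fix u v assume u: "u \<in> S" "v \<in> T" and s: "s \<in> cF (h u v)"
    show "tot s = e" using cF_tot[OF s] e[OF u] by simp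
  qed
qed

lemma UN_const2: "S \<noteq> {} \<Longrightarrow> T \<noteq> {} \<Longrightarrow> (\<And>u v. u \<in> S \<Longrightarrow> v \<in> T \<Longrightarrow> f u v = C) \<Longrightarrow> (\<Union>u\<in>S. \<Union>v\<in>T. f u v) = C"
  by (simp cong: SUP_cong)

lemma tot_lin: "tot (s + t) = tot s + tot t" "tot (c *\<^sub>R s) = c *\<^sub>R tot s"
  using pull0_add[of Xm pr] pull0_scale[of Xm pr]
  by (simp_all add: tot_def prod_eq_iff add_ac scaleR_add_right)

abbreviation "E1 \<equiv> comp_butterfly (LC Mm H) pB FB"
abbreviation "E2 \<equiv> comp_butterfly (XG G) GB Gu"

lemma E1_simps:
  "vadd (space E1) C D = (\<Union>u\<in>C. \<Union>v\<in>D. cF (u + v))"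
  "vscale (space E1) c C = (\<Union>u\<in>C. cF (c *\<^sub>R u))"
  "brk E1 C D = (\<Union>u\<in>C. \<Union>v\<in>D. cF (brk FB (fst u) (fst v), brk pB (snd u) (snd v)))"
  "kap E1 a = cF (kap FB a, 0)" "lam E1 w = cF (0, lam pB w)"
  "sig E1 C = the_elem ((\<lambda>u. fst (fst u)) ` C)" "rho E1 C = the_elem ((\<lambda>u. rho pB (snd u)) ` C)"
  by (simp_all add: comp_butterfly_def Let_def case_prod_beta FB_simps plus_prod_def scaleR_prod_def)
     (simp_all add: mor_butterfly_def subspace_rvs_def plus_prod_def scaleR_prod_def)

lemma E2_simps:
  "vadd (space E2) C D = (\<Union>u\<in>C. \<Union>v\<in>D. cG (fst u + fst v, snd u + snd v))"
  "vscale (space E2) c C = (\<Union>u\<in>C. cG (c *\<^sub>R fst u, c *\<^sub>R snd u))"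
  "brk E2 C D = (\<Union>u\<in>C. \<Union>v\<in>D. cG (brk Gu (fst u) (fst v), brk GB (snd u) (snd v)))"
  "kap E2 a = cG (kap Gu a, 0)" "lam E2 w = cG (0, lam GB w)"
  "sig E2 C = the_elem ((\<lambda>u. snd (fst u)) ` C)" "rho E2 C = the_elem ((\<lambda>u. proj_vf G (fst (snd u))) ` C)"
  by (simp_all add: comp_butterfly_def Let_def case_prod_beta mor_butterfly_def G_butterfly_def subspace_rvs_def)

lemma \<Phi>_iso: "butterfly_iso (XGgamma G \<gamma> B) (AM Mm H) E1 E2 \<Phi>"
  unfolding butterfly_iso_def linear_iso_def vcar_F vcar_G
proof (intro conjI ballI allI)
  show "bij_betw \<Phi> (cF ` CF) (nf ` FS)"
  proof (rule bij_betwI')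
    fix C D assume "C \<in> cF ` CF" "D \<in> cF ` CF"
    then obtain s t where st: "s \<in> CF" "C = cF s" "t \<in> CF" "D = cF t" by blast
    show "\<Phi> C = \<Phi> D \<longleftrightarrow> C = D"
    proof
      assume "\<Phi> C = \<Phi> D"
      then have "tot s = tot t" using nf_inj by (simp add: st \<Phi>_cF)
      then show "C = D" using cF_canon(2)[OF st(1)] cF_canon(2)[OF st(3)] by (simp add: st)
    qed simp
  next
    fix C assume "C \<in> cF ` CF"
    then show "\<Phi> C \<in> nf ` FS" using cF_canon(1) by (auto simp: \<Phi>_cF)
  next
    fix D assume "D \<in> nf ` FS"
    then obtain e where e: "e \<in> FS" "D = nf e" by blast
    have "(e, (0, rho FB e)) \<in> CF" using e(1) Cinf_zero[OF okM] by (simp add: CF_def)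
    moreover have "tot (e, (0, rho FB e)) = e"
      by (simp add: tot_def prod_eq_iff) (simp add: pull0_def fun_eq_iff)
    ultimately show "\<exists>C\<in>cF ` CF. D = \<Phi> C" using \<Phi>_cF e(2) by (metis imageI)
  qed
next
  fix C D assume "C \<in> cF ` CF" "D \<in> cF ` CF"
  then obtain s t where st: "s \<in> CF" "C = cF s" "t \<in> CF" "D = cF t" by blast
  have "\<Phi> (vadd (space E1) C D) = nf (tot s + tot t)"
    unfolding E1_simps st by (rule \<Phi>_UN2[OF cF_nonempty cF_nonempty]) (metis tot_lin(1) cF_tot)
  moreover have "vadd (space E2) (\<Phi> C) (\<Phi> D) = nf (tot s + tot t)"
    unfolding E2_simps st \<Phi>_cF by (rule UN_const2[OF nf_nonempty nf_nonempty]) (rule nf_add)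
  ultimately show "\<Phi> (vadd (space E1) C D) = vadd (space E2) (\<Phi> C) (\<Phi> D)" by simp
  have "\<Phi> (brk E1 C D) = nf (br (tot s) (tot t))"
    unfolding E1_simps st
    by (rule \<Phi>_UN2[OF cF_nonempty cF_nonempty]) (metis tot_brk cF_tot cF_closed st(1,3))
  moreover have "brk E2 (\<Phi> C) (\<Phi> D) = nf (br (tot s) (tot t))"
    unfolding E2_simps st \<Phi>_cF
    by (rule UN_const2[OF nf_nonempty nf_nonempty]) (rule nf_brk[OF cF_canon(1)[OF st(1)] cF_canon(1)[OF st(3)]])
  ultimately show "\<Phi> (brk E1 C D) = brk E2 (\<Phi> C) (\<Phi> D)" by simp
next
  fix c C assume "C \<in> cF ` CF"
  then obtain s where s: "s \<in> CF" "C = cF s" by blast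
  have "\<Phi> (vscale (space E1) c C) = nf (c *\<^sub>R tot s)"
    unfolding E1_simps s by (rule \<Phi>_UN[OF cF_nonempty]) (metis tot_lin(2) cF_tot)
  moreover have "vscale (space E2) c (\<Phi> C) = nf (c *\<^sub>R tot s)"
    unfolding E2_simps s \<Phi>_cF using nf_scale[of _ "tot s" c] nf_nonempty[of "tot s"] by (simp cong: SUP_cong)
  ultimately show "\<Phi> (vscale (space E1) c C) = vscale (space E2) c (\<Phi> C)" by simp
next
  fix a assume "a \<in> deg1 (XGgamma G \<gamma> B)"
  then have a: "a \<in> algd G" by (simp add: XGgamma_def)
  have ma: "(-1) *\<^sub>R a \<in> algd G" by (rule algd_scale[OF a])
  have p0: "pull0 Xm pr 0 = 0" by (rule ext) (simp add: pull0_def)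
  have "\<Phi> (kap E1 a) = nf ((anchor G a, bar_vf G a, contract (anchor G a) B - d0 Xm (v_fun G \<gamma> a)), - v_fun G \<gamma> a)"
    unfolding E1_simps \<Phi>_cF by (simp add: tot_def F_butterfly_def XGgamma_def p0)
  also have "\<dots> = kap E2 a"
    using cG_nf[OF ma, of "anchor G a" "bar_vf G a" "contract (anchor G a) B - d0 Xm (v_fun G \<gamma> a)" "- v_fun G \<gamma> a"]
    unfolding E2_simps anchor_scale bar_scale[OF a] v_scale[OF a]
    by (simp add: mor_butterfly_def XGgamma_def forget_mor_def zero_prod_def)
  finally show "\<Phi> (kap E1 a) = kap E2 a" .
next
  fix w assume "w \<in> deg1 (AM Mm H)"
  have "\<Phi> (lam E1 w) = nf ((0, 0, 0), pull0 Xm pr w)"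
    unfolding E1_simps \<Phi>_cF by (simp add: tot_def mor_butterfly_def zero_prod_def)
  also have "\<dots> = lam E2 w"
    using cG_nf[OF algd_zero, of 0 0 0 "pull0 Xm pr w"] unfolding E2_simps
    by (simp add: anchor_zero bar_zero v_zero G_butterfly_def zero_prod_def)
  finally show "\<Phi> (lam E1 w) = lam E2 w" .
next
  fix C assume "C \<in> cF ` CF"
  then obtain s where s: "s \<in> CF" "C = cF s" by blast
  obtain x p \<alpha> g w r where S: "s = (((x, p, \<alpha>), g), (w, r))" by (metis surj_pair)
  have e: "((x, p, \<alpha>), g) \<in> FS" and r: "r = rho FB ((x, p, \<alpha>), g)" using s(1) by (auto simp: S CF_def)
  have P: "\<Phi> C = nf ((x, p, \<alpha>), g + pull0 Xm pr w)" unfolding s(2) \<Phi>_cF by (simp add: S tot_def)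
  have "sig E1 C = (x, p, \<alpha>)" unfolding E1_simps s(2)
    by (rule the_elem_image_const[OF cF_nonempty]) (auto simp: S cF_def)
  moreover have "sig E2 (\<Phi> C) = (x, p, \<alpha>)" unfolding E2_simps P
    by (rule the_elem_image_const[OF nf_nonempty]) (auto simp: nf_iff)
  ultimately show "sig E2 (\<Phi> C) = sig E1 C" by simp
  obtain \<epsilon> where "r = (proj_vf G x, - \<epsilon>)" by (rule rho_F[OF e]) (simp add: r)
  moreover have "rho pB (w', (u, \<mu>)) = u" for w' u \<mu> by (simp add: mor_butterfly_def AM_def psi_mor_def)
  ultimately have "rho E1 C = proj_vf G x" unfolding E1_simps s(2)
    by (intro the_elem_image_const[OF cF_nonempty]) (auto simp: S cF_def)
  moreover have "rho E2 (\<Phi> C) = proj_vf G x" unfolding E2_simps P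
    by (rule the_elem_image_const[OF nf_nonempty]) (auto simp: nf_iff proj_vf_anchor)
  ultimately show "rho E2 (\<Phi> C) = rho E1 C" by simp
qed

end

end

theorem proposition3p4:
  fixes G :: "('m, 'x, 'p) gerbe"
    and \<gamma> :: "'p form1" and B :: "'x form2" and H :: "'m form3"
  assumes "bundle_gerbe G"
    and "gerbe_connection G \<gamma>"
    and "curving G \<gamma> B"
    and "three_curvature G B H"
  shows "\<exists>\<Phi>. butterfly_iso (XGgamma G \<gamma> B) (AM (gM G) H)
    (comp_butterfly (LC (gM G) H)
       (mor_butterfly (LC (gM G) H) (AM (gM G) H) psi_mor) (F_butterfly G \<gamma> B))
    (comp_butterfly (XG G)
       (G_butterfly G \<gamma> B) (mor_butterfly (XGgamma G \<gamma> B) (XG G) forget_mor)) \<Phi>"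
proof -
  interpret gerbe_conn G \<gamma> B by unfold_locales (rule assms(1-3))+
  show ?thesis using \<Phi>_iso by blast
qed

end
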